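(* Suppose that the Coxeter group $W=W(X)$ has Property F and Property S. Let $x,y\in W$ and write $$C'_xC'_y=\sum_{z\in W}g(x,y,z)\,C'_z$$ in the Hecke algebra $\mathcal H(X)$. If $z\in W_c$, then $g(x,y,z)\in\mathbb Z^{\ge0}[\delta]\subset\mathbb Z^{\ge0}[v,v^{-1}]$, where $\delta=v+v^{-1}$.
   Context: **Hecke algebra.** $X$ is an arbitrary Coxeter graph and $W=W(X)$ the Coxeter group with finite set $S$ of distinguished generating involutions, $W=\langle S\mid (st)^{m(s,t)}=1 \text{ for } m(s,t)<\infty\rangle$, $m(s,s)=1$; $\ell$ is the length function and $\le$ the Bruhat order. Put $\mathcal A=\mathbb Z[v,v^{-1}]$, $\mathcal A^-=\mathbb Z[v^{-1}]$, $q=v^2$. $\mathcal H=\mathcal H(X)$ is the $\mathcal A$-algebra with basis $\{T_w:w\in W\}$ such that, for $s\in S$, $T_sT_w=T_{sw}$ if $\ell(sw)>\ell(w)$ and $T_sT_w=qT_{sw}+(q-1)T_w$ if $\ell(sw)<\ell(w)$. Put $\widetilde T_w=v^{-\ell(w)}T_w$. The bar involution is the ring automorphism of $\mathcal H$ with $\overline{\sum a_w\widetilde T_w}=\sum\overline{a_w}\,\widetilde T_{w^{-1}}^{-1}$, where $\bar{\ }$ on $\mathcal A$ exchanges $v$ and $v^{-1}$. **Kazhdan--Lusztig basis.** $C'_w$ is the unique bar-invariant element of $\mathcal H$ of the form $\widetilde T_w+\sum_{y<w}a_y\widetilde T_y$ with $a_y\in v^{-1}\mathcal A^-$; $\{C'_w:w\in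 W\}$ is an $\mathcal A$-basis of $\mathcal H$. **Fully commutative elements.** An element $w\in W$ is complex if $w=x_1w_{ss'}x_2$ with $\ell(w)=\ell(x_1)+\ell(w_{ss'})+\ell(x_2)$, where $w_{ss'}$ is the longest element of a finite parabolic subgroup $\langle s,s'\rangle$ with $s,s'\in S$ noncommuting; $W_c$ is the set of elements that are not complex. The left and right descent sets are $\mathcal L(w)=\{s\in S:\ell(sw)<\ell(w)\}$ and $\mathcal R(w)=\{s\in S:\ell(ws)<\ell(w)\}$. **Star reducibility.** Let $I=\{s,t\}\subseteq S$ be noncommuting generators with $m=m(s,t)$ ($m=\infty$ allowed). Let $W_I=\langle s,t\rangle$ and $W^I=\{w\in W:\mathcal L(w)\cap I=\emptyset\}$; each $w\in W$ is uniquely $w=w_Iw^I$ with $w_I\in W_I$, $w^I\in W^I$, and $\ell(w)=\ell(w_I)+\ell(w^I)$. The left $\{s,t\}$-strings are the sequences of $m-1$ elements $sw^I,tsw^I,stsw^I,\dots$ and $tw^I,stw^I,tstw^I,\dots$. If $x,y$ belong to the same left $\{s,t\}$-string and $\ell(x)=\ell(y)-1$, then $y$ is left star reducible to $x$. Right strings and right star reducibility are defined symmetrically. $y$ is star reducible to $x$ if there is a (possibly trivial) sequence $x=w_0,w_1,\dots,w_k=y$ such that each $w_{i+1}$ is left or right star reducible to $w_i$ with respect to some pair of noncommuting generators. **Property F.** Every element of $W_c$ is star reducible to a product of (distinct) commuting generators from $S$. **Property S.** Every element of $W\setminus W_c$ is star reducible to an element $w$ for which $\mathcal L(w)$ or $\mathcal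 R(w)$ (or both) contains a pair of noncommuting generators. *)

theory Defs
  imports
    "HOL-Algebra.Generated_Groups"
    "HOL-Library.Extended_Nat"
    "HOL-Library.Poly_Mapping"
begin

section \<open>Laurent polynomials\<close>

text \<open>
  The ring \<open>\<int>[v, v\<^sup>-\<^sup>1]\<close> is the group ring of the infinite cyclic group: the coefficient of
  \<open>v\<^sup>k\<close> in \<open>p\<close> is \<open>Poly_Mapping.lookup p k\<close>, for \<open>k\<close> an integer.
\<close>

type_synonym laurent = "int \<Rightarrow>\<^sub>0 int"

definition vpow :: "int \<Rightarrow> laurent" where
  "vpow k = Poly_Mapping.single k 1"

definition lbar :: "laurent \<Rightarrow> laurent" where
  "lbar p = Poly_Mapping.map_key uminus p"

text \<open>The ideal \<open>v\<^sup>-\<^sup>1 \<int>[v\<^sup>-\<^sup>1]\<close> of \<open>\<int>[v\<^sup>-\<^sup>1]\<close>.\<close>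

definition laurent_strict_neg :: "laurent set" where
  "laurent_strict_neg = {vpow (-1) * p | p. Poly_Mapping.keys p \<subseteq> {..0}}"

definition laurent_delta :: laurent where
  "laurent_delta = vpow 1 + vpow (-1)"

definition nonneg_delta :: "laurent set" where
  "nonneg_delta = {(\<Sum>i\<le>n. of_nat (c i) * laurent_delta ^ i) | n (c :: nat \<Rightarrow> nat). True}"

definition nonneg_laurent :: "laurent set" where
  "nonneg_laurent = {p. \<forall>k. 0 \<le> Poly_Mapping.lookup p k}"


section \<open>Coxeter systems\<close>

text \<open>
  The congruence on words generated by the relations \<open>(st)\<^sup>k = 1\<close> for \<open>m s t = k < \<infinity>\<close>.
  Since \<open>m s s = 1\<close> makes every letter its own inverse, words without formal inverses
  suffice to present the group.
\<close>

inductive cox_equiv :: "'w set \<Rightarrow> ('w \<Rightarrow> 'w \<Rightarrow> enat) \<Rightarrow> 'w list \<Rightarrow> 'w list \<Rightarrow> bool"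
  for S m where
  refl: "us \<in> lists S \<Longrightarrow> cox_equiv S m us us"
| sym: "cox_equiv S m us ws \<Longrightarrow> cox_equiv S m ws us"
| trans: "cox_equiv S m us ws \<Longrightarrow> cox_equiv S m ws xs \<Longrightarrow> cox_equiv S m us xs"
| rel: "\<lbrakk>s \<in> S; t \<in> S; m s t = enat k; us \<in> lists S; ws \<in> lists S\<rbrakk>
    \<Longrightarrow> cox_equiv S m (us @ concat (replicate k [s, t]) @ ws) (us @ ws)"

definition word_prod :: "('w, 'b) monoid_scheme \<Rightarrow> 'w list \<Rightarrow> 'w" where
  "word_prod W ws = foldr (\<lambda>x y. x \<otimes>\<^bsub>W\<^esub> y) ws \<one>\<^bsub>W\<^esub>"

text \<open>
  \<open>W\<close> is generated by the finite set \<open>S\<close>, and two words in \<open>S\<close> agree in \<open>W\<close> exactly when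
  the relations force them to: \<open>W = \<langle>S | (st)\<^sup>m\<^sup>(\<^sup>s\<^sup>,\<^sup>t\<^sup>) = 1 for m(s,t) < \<infinity>\<rangle>\<close>.
\<close>

locale coxeter_system = group W for W :: "('w, 'b) monoid_scheme" (structure) +
  fixes S :: "'w set" and m :: "'w \<Rightarrow> 'w \<Rightarrow> enat"
  assumes finite_gens: "finite S"
    and gens_closed: "S \<subseteq> carrier W"
    and m_diag: "s \<in> S \<Longrightarrow> m s s = 1"
    and m_sym: "\<lbrakk>s \<in> S; t \<in> S\<rbrakk> \<Longrightarrow> m s t = m t s"
    and m_off_diag: "\<lbrakk>s \<in> S; t \<in> S; s \<noteq> t\<rbrakk> \<Longrightarrow> 2 \<le> m s t"
    and generated: "generate W S = carrier W"
    and presented: "\<lbrakk>us \<in> lists S; ws \<in> lists S\<rbrakk>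
      \<Longrightarrow> word_prod W us = word_prod W ws \<longleftrightarrow> cox_equiv S m us ws"
begin

definition len :: "'w \<Rightarrow> nat" where
  "len w = (LEAST n. \<exists>ws \<in> lists S. length ws = n \<and> word_prod W ws = w)"

definition reflections :: "'w set" where
  "reflections = {x \<otimes> s \<otimes> inv x | x s. x \<in> carrier W \<and> s \<in> S}"

definition bruhat_step :: "'w \<Rightarrow> 'w \<Rightarrow> bool" where
  "bruhat_step x y \<longleftrightarrow> x \<in> carrier W \<and> (\<exists>r \<in> reflections. y = r \<otimes> x) \<and> len x < len y"

definition bruhat_less :: "'w \<Rightarrow> 'w \<Rightarrow> bool" where
  "bruhat_less = bruhat_step\<^sup>+\<^sup>+"

definition left_descents :: "'w \<Rightarrow> 'w set" where
  "left_descents w = {s \<in> S. len (s \<otimes> w) < len w}"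

definition right_descents :: "'w \<Rightarrow> 'w set" where
  "right_descents w = {s \<in> S. len (w \<otimes> s) < len w}"

definition noncommuting :: "'w \<Rightarrow> 'w \<Rightarrow> bool" where
  "noncommuting s t \<longleftrightarrow> s \<in> S \<and> t \<in> S \<and> s \<otimes> t \<noteq> t \<otimes> s"

definition is_longest :: "'w set \<Rightarrow> 'w \<Rightarrow> bool" where
  "is_longest H x \<longleftrightarrow> x \<in> H \<and> (\<forall>u \<in> H. len u \<le> len x)"

definition is_complex :: "'w \<Rightarrow> bool" where
  "is_complex w \<longleftrightarrow> (\<exists>s t x1 x2 w0.
     noncommuting s t \<and> finite (generate W {s, t}) \<and> is_longest (generate W {s, t}) w0 \<and>
     x1 \<in> carrier W \<and> x2 \<in> carrier W \<and>
     w = x1 \<otimes> w0 \<otimes> x2 \<and> len w = len x1 + len w0 + len x2)"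

definition fully_commutative :: "'w set" where
  "fully_commutative = {w \<in> carrier W. \<not> is_complex w}"

text \<open>
  \<open>alt_left s t k\<close> is the alternating product \<open>\<dots>sts\<close> of \<open>k\<close> factors with last factor \<open>s\<close>;
  \<open>alt_right s t k\<close> is \<open>sts\<dots>\<close> with first factor \<open>s\<close>.
\<close>

fun alt_left :: "'w \<Rightarrow> 'w \<Rightarrow> nat \<Rightarrow> 'w" where
  "alt_left s t 0 = \<one>"
| "alt_left s t (Suc k) = (if even k then s else t) \<otimes> alt_left s t k"

fun alt_right :: "'w \<Rightarrow> 'w \<Rightarrow> nat \<Rightarrow> 'w" where
  "alt_right s t 0 = \<one>"
| "alt_right s t (Suc k) = alt_right s t k \<otimes> (if even k then s else t)"

text \<open>
  The string through \<open>s \<otimes> u\<close>, where \<open>u\<close> has no descent in \<open>{s, t}\<close>; the other string over \<open>u\<close>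
  is obtained by exchanging \<open>s\<close> and \<open>t\<close>.
\<close>

definition left_string :: "'w \<Rightarrow> 'w \<Rightarrow> 'w \<Rightarrow> 'w set" where
  "left_string s t u = {alt_left s t k \<otimes> u | k. 1 \<le> k \<and> enat k < m s t}"

definition right_string :: "'w \<Rightarrow> 'w \<Rightarrow> 'w \<Rightarrow> 'w set" where
  "right_string s t u = {u \<otimes> alt_right s t k | k. 1 \<le> k \<and> enat k < m s t}"

definition left_star_reducible :: "'w \<Rightarrow> 'w \<Rightarrow> bool" where
  "left_star_reducible y x \<longleftrightarrow> (\<exists>s t u. noncommuting s t \<and>
     u \<in> carrier W \<and> left_descents u \<inter> {s, t} = {} \<and>
     x \<in> left_string s t u \<and> y \<in> left_string s t u \<and> len y = len x + 1)"

definition right_star_reducible :: "'w \<Rightarrow> 'w \<Rightarrow> bool" where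
  "right_star_reducible y x \<longleftrightarrow> (\<exists>s t u. noncommuting s t \<and>
     u \<in> carrier W \<and> right_descents u \<inter> {s, t} = {} \<and>
     x \<in> right_string s t u \<and> y \<in> right_string s t u \<and> len y = len x + 1)"

definition star_reducible :: "'w \<Rightarrow> 'w \<Rightarrow> bool" where
  "star_reducible = (\<lambda>y x. left_star_reducible y x \<or> right_star_reducible y x)\<^sup>*\<^sup>*"

definition commuting_product :: "'w \<Rightarrow> bool" where
  "commuting_product w \<longleftrightarrow> (\<exists>ws \<in> lists S. distinct ws \<and>
     (\<forall>s \<in> set ws. \<forall>t \<in> set ws. s \<otimes> t = t \<otimes> s) \<and> w = word_prod W ws)"

definition property_F :: bool where
  "property_F \<longleftrightarrow> (\<forall>w \<in> fully_commutative. \<exists>x. star_reducible w x \<and> commuting_product x)"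

definition property_S :: bool where
  "property_S \<longleftrightarrow> (\<forall>w \<in> carrier W - fully_commutative. \<exists>x. star_reducible w x \<and>
     (\<exists>s t. noncommuting s t \<and> ({s, t} \<subseteq> left_descents x \<or> {s, t} \<subseteq> right_descents x)))"

end


section \<open>The Hecke algebra and the Kazhdan--Lusztig basis\<close>

text \<open>
  The conditions below determine the algebra up to isomorphism.  That the basis element indexed
  by the identity is the unit has to be said only because of the case \<open>S = {}\<close>; otherwise it
  follows from the multiplication rules.
\<close>

locale hecke_algebra = coxeter_system W S m + module scale
  for W :: "('w, 'b) monoid_scheme" (structure) and S m
    and scale :: "laurent \<Rightarrow> 'h::ring_1 \<Rightarrow> 'h" (infixr \<open>*s\<close> 75) +
  fixes T :: "'w \<Rightarrow> 'h"
  assumes scale_mult_left: "(a *s x) * y = a *s (x * y)"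
    and scale_mult_right: "x * (a *s y) = a *s (x * y)"
    and T_inj: "inj_on T (carrier W)"
    and T_independent: "independent (T ` carrier W)"
    and T_span: "span (T ` carrier W) = UNIV"
    and T_one: "T \<one> = 1"
    and T_up: "\<lbrakk>s \<in> S; w \<in> carrier W; len (s \<otimes> w) > len w\<rbrakk>
      \<Longrightarrow> T s * T w = T (s \<otimes> w)"
    and T_down: "\<lbrakk>s \<in> S; w \<in> carrier W; len (s \<otimes> w) < len w\<rbrakk>
      \<Longrightarrow> T s * T w = vpow 2 *s T (s \<otimes> w) + (vpow 2 - 1) *s T w"
begin

definition Tn :: "'w \<Rightarrow> 'h" where
  "Tn w = vpow (- int (len w)) *s T w"

definition Tn_coeff :: "'h \<Rightarrow> 'w \<Rightarrow> laurent" where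
  "Tn_coeff h w = representation (Tn ` carrier W) h (Tn w)"

definition hinv :: "'h \<Rightarrow> 'h" where
  "hinv h = (THE u. u * h = 1 \<and> h * u = 1)"

definition hbar :: "'h \<Rightarrow> 'h" where
  "hbar h = (\<Sum>w | w \<in> carrier W \<and> Tn_coeff h w \<noteq> 0.
     lbar (Tn_coeff h w) *s hinv (Tn (inv w)))"

text \<open>Bruhat intervals are finite, so the sum below is an honest finite sum.\<close>

definition is_KL :: "'w \<Rightarrow> 'h \<Rightarrow> bool" where
  "is_KL w c \<longleftrightarrow> hbar c = c \<and>
     (\<exists>a. (\<forall>y. bruhat_less y w \<longrightarrow> a y \<in> laurent_strict_neg) \<and>
          c = Tn w + (\<Sum>y | bruhat_less y w. a y *s Tn y))"

definition KL :: "'w \<Rightarrow> 'h" where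
  "KL w = (THE c. is_KL w c)"

end

end

theory Submission
  imports Defs Complex_Main
begin

text \<open>
  Let \<open>J\<close> be the ideal of the Hecke algebra generated by the sums \<open>E\<close> over the finite dihedral
  subgroups \<open>\<langle>a, b\<rangle>\<close> with \<open>a, b\<close> noncommuting. If \<open>w = x w\<^sub>a\<^sub>b y\<close> is reduced, then \<open>T\<^sub>x E T\<^sub>y\<close> is,
  modulo the part of \<open>J\<close> in smaller length, independent of the factorization: this is a diamond
  argument on left descents, using that both products are congruent to \<open>C'\<^sub>w\<close> when \<open>w\<close> has two
  noncommuting descents. So leading terms of elements of \<open>J\<close> are complex, and the \<open>C'\<^sub>z\<close> with \<open>z\<close>
  fully commutative are independent modulo \<open>J\<close>. Along a string, multiplication by a generator
  is the adjacency matrix of a path modulo \<open>J\<close>; with Property S this puts \<open>C'\<^sub>w\<close> into \<open>J\<close> for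
  all complex \<open>w\<close>, whence \<open>J\<close> is exactly their span.

  The coefficients \<open>\<mu>\<close> and \<open>g\<close>, arranged along two strings, form a matrix commuting with the
  adjacency matrix of a path. Such a matrix is nonnegative if its first column is, so
  Property F reduces the positivity of \<open>\<mu>\<close>, and then of \<open>g\<close>, to products of commuting generators.
\<close>

section \<open>The order of a product of two generators\<close>

text \<open>The relations bound the order of \<open>s t\<close> only from above; the numbers game
  supplies an action in which this order is visibly \<open>m s t\<close>, and lengths in dihedral
  subgroups depend on it. The element \<open>E\<close> is the \<open>C'\<close> element of the
  longest element of its subgroup. The ideal is filtered by the nominal length of the products
  \<open>T_x E T_y\<close>, not by the lengths that occur in their sums: terms may cancel, and a
  bound on the support does not by itself give an expression by short products. Hence the diamond
  argument, and the separate check that a nonreduced product drops one step in the filtration. In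
  the matrices the entries beyond the two ends of a path must vanish. For products they do so modulo
  the ideal; for the coefficients \<mu> this fails if the two strings lie over the same element with
  opposite starting letters, and subtracting 1 along one diagonal repairs it. Star reductions on the
  right of the left factor need the right factor on a string; multiplying by a generator puts it
  there at the cost of a factor \<delta>, cancelled afterwards among the polynomials in
  \<delta>.\<close>

text \<open>
  The numbers game: firing \<open>s\<close> negates the value at \<open>s\<close> and adds the weighted value to the
  other nodes.  This is the dual of the geometric representation.
\<close>

definition bond :: "('w \<Rightarrow> 'w \<Rightarrow> enat) \<Rightarrow> 'w \<Rightarrow> 'w \<Rightarrow> real" where
  "bond m s r = (case m s r of enat k \<Rightarrow> 2 * cos (pi / real k) | \<infinity> \<Rightarrow> 2)"

definition fire :: "('w \<Rightarrow> 'w \<Rightarrow> enat) \<Rightarrow> 'w \<Rightarrow> ('w \<Rightarrow> real) \<Rightarrow> 'w \<Rightarrow> real" where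
  "fire m s p r = p r + bond m s r * p s"

definition fires :: "('w \<Rightarrow> 'w \<Rightarrow> enat) \<Rightarrow> 'w list \<Rightarrow> ('w \<Rightarrow> real) \<Rightarrow> 'w \<Rightarrow> real" where
  "fires m ws = fold (fire m) ws"

text \<open>The value carried by the node fired at step \<open>n\<close> when \<open>s\<close> and
  \<open>t\<close> are fired alternately from the values \<open>x\<close> at \<open>s\<close> and
  \<open>y\<close> at \<open>t\<close>. For \<open>c = 2 * cos \<theta>\<close> this is a Chebyshev
  recursion; \<open>c = 2\<close> belongs to the infinite bond.\<close>

fun fseq :: "real \<Rightarrow> real \<Rightarrow> real \<Rightarrow> nat \<Rightarrow> real" where
  "fseq c x y 0 = x"
| "fseq c x y (Suc 0) = y + c * x"
| "fseq c x y (Suc (Suc n)) = c * fseq c x y (Suc n) - fseq c x y n"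

text \<open>Telescoping with the recursion. The right-hand sides are the changes at \<open>s\<close>
  and at \<open>t\<close> after \<open>k\<close> rounds, which is what closes the induction for
  \<open>fires_alternating\<close>.\<close>

lemma fseq_sums:
  "c * (\<Sum>i<k. fseq c x y (2 * i + 1)) - 2 * (\<Sum>i<k. fseq c x y (2 * i)) = fseq c x y (2 * k) - x"
  "c * (\<Sum>i<k. fseq c x y (2 * i)) - 2 * (\<Sum>i<k. fseq c x y (2 * i + 1))
    = fseq c x y (2 * k + 1) - c * fseq c x y (2 * k) - y"
  by (induction k) (auto simp: algebra_simps)

text \<open>Firing adds to each node the fired value times a bond, so the position after
  \<open>k\<close> rounds is linear in the two sums of fired values. Evaluated at \<open>s\<close>
  and \<open>t\<close> it returns the next values to be fired.\<close>

lemma fires_alternating: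
  assumes "bond m s s = -2" "bond m t t = -2" "bond m s t = c" "bond m t s = c"
  shows "fires m (concat (replicate k [s, t])) p r
    = p r + bond m s r * (\<Sum>i<k. fseq c (p s) (p t) (2 * i))
        + bond m t r * (\<Sum>i<k. fseq c (p s) (p t) (2 * i + 1))"
proof -
  show ?thesis
  proof (induction k arbitrary: r)
    case 0
    then show ?case by (simp add: fires_def)
  next
    case (Suc k)
    let ?w = "concat (replicate k [s, t])"
    have "concat (replicate (Suc k) [s, t]) = ?w @ [s, t]"
      by (induction k) auto
    then have step: "fires m (concat (replicate (Suc k) [s, t])) p r
        = fire m t (fire m s (fires m ?w p)) r"
      by (simp add: fires_def)
    have s: "fires m ?w p s = fseq c (p s) (p t) (2 * k)"
      unfolding Suc.IH assms using fseq_sums[of c "p s" "p t" k] by (simp add: algebra_simps)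
    have t: "fires m ?w p t = fseq c (p s) (p t) (2 * k + 1) - c * fseq c (p s) (p t) (2 * k)"
      unfolding Suc.IH assms using fseq_sums[of c "p s" "p t" k] by (simp add: algebra_simps)
    show ?case
      unfolding step fire_def s t using assms Suc.IH[of r]
      by (simp add: algebra_simps)
  qed
qed

text \<open>The sines of the multiples of \<theta> satisfy the same recursion, by the addition
  formulas. The factor \<open>sin \<theta>\<close> stays on the left so that no division
  occurs.\<close>

lemma fseq_sin: "fseq (2 * cos \<theta>) x y n * sin \<theta> = x * sin (real (n + 1) * \<theta>) + y * sin (real n * \<theta>)"
proof (induction n rule: induct_nat_012)
  case 0
  then show ?case by simp
next
  case 1
  have "sin (2 * \<theta>) = 2 * sin \<theta> * cos \<theta>" by (rule sin_double)
  then show ?case by (simp add: algebra_simps)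
next
  case (ge2 n)
  have e: "sin ((a + 1) * \<theta>) + sin ((a - 1) * \<theta>) = 2 * cos \<theta> * sin (a * \<theta>)" for a
    by (simp add: algebra_simps sin_add sin_diff)
  have e1: "sin (\<theta> * (real n + 3)) = 2 * cos \<theta> * sin (\<theta> * (real n + 2)) - sin (\<theta> * (real n + 1))"
    using e[of "real n + 2"] by (simp add: mult.commute algebra_simps)
  have e2: "sin (\<theta> * (real n + 2)) = 2 * cos \<theta> * sin (\<theta> * (real n + 1)) - sin (\<theta> * real n)"
    using e[of "real n + 1"] by (simp add: mult.commute algebra_simps)
  have "fseq (2 * cos \<theta>) x y (Suc (Suc n)) * sin \<theta>
     = 2 * cos \<theta> * (fseq (2 * cos \<theta>) x y (Suc n) * sin \<theta>) - fseq (2 * cos \<theta>) x y n * sin \<theta>"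
    by (simp add: algebra_simps)
  also have "\<dots> = x * (2 * cos \<theta> * sin (\<theta> * (real n + 2)) - sin (\<theta> * (real n + 1)))
      + y * (2 * cos \<theta> * sin (\<theta> * (real n + 1)) - sin (\<theta> * real n))"
    unfolding ge2 by (simp add: algebra_simps)
  finally show ?case
    unfolding e1[symmetric] e2[symmetric] by (simp add: algebra_simps)
qed

lemma fseq_two: "fseq 2 x y n = x * real (n + 1) + y * real n"
  by (induction n rule: induct_nat_012) (auto simp: algebra_simps)

lemma pi_div_bounds:
  assumes "2 \<le> (k::nat)"
  shows "sin (pi / real k) > 0" "2 * cos (pi / real k) \<noteq> 2" "2 * cos (pi / real k) \<noteq> -2"
proof -
  have b: "0 < pi / real k" "pi / real k < pi"
    using assms by (auto simp: field_simps)
  then show s: "sin (pi / real k) > 0" by (rule sin_gt_zero)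
  have "(sin (pi / real k))\<^sup>2 + (cos (pi / real k))\<^sup>2 = 1" by simp
  moreover have "(sin (pi / real k))\<^sup>2 > 0" using s by simp
  ultimately have "(cos (pi / real k))\<^sup>2 < 1" by linarith
  then show "2 * cos (pi / real k) \<noteq> 2" "2 * cos (pi / real k) \<noteq> -2"
    by (auto simp: power2_eq_square)
qed

lemma fseq_periodic:
  assumes k: "2 \<le> k"
  shows "fseq (2 * cos (pi / real k)) x y (n + 2 * k) = fseq (2 * cos (pi / real k)) x y n"
proof -
  let ?\<theta> = "pi / real k"
  have per: "sin (real (j + 2 * k) * ?\<theta>) = sin (real j * ?\<theta>)" for j
  proof -
    have "real (j + 2 * k) * ?\<theta> = real j * ?\<theta> + 2 * pi"
      using k by (simp add: field_simps)
    then show ?thesis by simp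
  qed
  have "fseq (2 * cos ?\<theta>) x y (n + 2 * k) * sin ?\<theta> = fseq (2 * cos ?\<theta>) x y n * sin ?\<theta>"
    unfolding fseq_sin using per[of n] per[of "n + 1"] by (simp only: add.commute add.left_commute add.assoc)
  then show ?thesis using pi_div_bounds[OF k] by auto
qed

text \<open>The sums run over a full period, so shifting the index yields
  \<open>2 * P = c * Q\<close> and \<open>2 * Q = c * P\<close>; as \<open>c\<close> is neither 2
  nor -2, both vanish. A full period thus changes nothing at any node.\<close>

lemma fseq_sums_zero:
  assumes k: "2 \<le> k" and c: "c = 2 * cos (pi / real k)"
  shows "(\<Sum>i<k. fseq c x y (2 * i)) = 0" "(\<Sum>i<k. fseq c x y (2 * i + 1)) = 0"
proof -
  let ?f = "fseq c x y"
  define P where "P = (\<Sum>i<k. ?f (2 * i))"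
  define Q where "Q = (\<Sum>i<k. ?f (2 * i + 1))"
  have rec: "?f (n + 2) = c * ?f (n + 1) - ?f n" for n by simp
  have per: "?f (2 * k) = ?f 0" "?f (2 * k + 1) = ?f 1"
    using fseq_periodic[OF k, of x y 0] fseq_periodic[OF k, of x y 1] unfolding c
    by (simp_all add: add.commute)
  have shift: "(\<Sum>i<k. g (Suc i)) = (\<Sum>i<k. g i) + g k - g 0" for g :: "nat \<Rightarrow> real"
    using sum.lessThan_Suc_shift[of g k] by simp
  have P': "(\<Sum>i<k. ?f (2 * i + 2)) = P"
    using shift[of "\<lambda>i. ?f (2 * i)"] per unfolding P_def by simp
  have Q': "(\<Sum>i<k. ?f (2 * i + 3)) = Q"
    using shift[of "\<lambda>i. ?f (2 * i + 1)"] per unfolding Q_def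
    by (simp add: numeral_3_eq_3)
  have "P = c * Q - P"
    unfolding P_def Q_def sum_distrib_left sum_subtractf[symmetric]
    using P' rec[of "2 * _"] unfolding P_def by simp
  moreover have "Q = c * P - Q"
  proof -
    have "?f (2 * i + 3) = c * ?f (2 * i + 2) - ?f (2 * i + 1)" for i
      using rec[of "2 * i + 1"] by (simp add: numeral_3_eq_3)
    then have "(\<Sum>i<k. ?f (2 * i + 3)) = (\<Sum>i<k. c * ?f (2 * i + 2) - ?f (2 * i + 1))"
      by (rule sum.cong[OF HOL.refl])
    also have "\<dots> = c * (\<Sum>i<k. ?f (2 * i + 2)) - Q"
      unfolding Q_def sum_subtractf sum_distrib_left ..
    finally show ?thesis unfolding P' Q' .
  qed
  ultimately have pq: "2 * P = c * Q" "2 * Q = c * P" by auto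
  have "4 * P = 2 * (c * Q)" using pq(1) by linarith
  also have "\<dots> = c * (2 * Q)" by simp
  also have "\<dots> = c * (c * P)" by (simp only: pq(2))
  finally have "4 * P = c * (c * P)" .
  moreover have "(2 - c) * (2 + c) * P = 4 * P - c * (c * P)" by (simp add: algebra_simps)
  ultimately have "(2 - c) * (2 + c) * P = 0" by simp
  then have "P = 0" using pi_div_bounds[OF k] c by (metis add_eq_0_iff eq_iff_diff_eq_0 mult_eq_0_iff minus_equation_iff)
  then show "P = 0" "Q = 0" using pq(2) unfolding P_def Q_def by auto
qed

text \<open>The return of two consecutive terms fixes sine and cosine of
  \<open>2 j \<theta>\<close>, which is then a multiple of 2\<pi>; this requires \<open>k\<close> to
  divide \<open>j\<close>.\<close>

lemma fseq_order:
  assumes k: "2 \<le> k" and j: "0 < j" "j < k" and c: "c = 2 * cos (pi / real k)"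
  shows "\<not> (fseq c 1 0 (2 * j) = fseq c 1 0 0 \<and> fseq c 1 0 (2 * j + 1) = fseq c 1 0 1)"
proof
  let ?\<theta> = "pi / real k"
  have s: "sin ?\<theta> > 0" by (rule pi_div_bounds[OF k])
  assume h: "fseq c 1 0 (2 * j) = fseq c 1 0 0 \<and> fseq c 1 0 (2 * j + 1) = fseq c 1 0 1"
  have a1: "sin (real (2 * j + 1) * ?\<theta>) = sin ?\<theta>"
    using fseq_sin[of ?\<theta> 1 0 "2 * j"] h unfolding c by simp
  have "sin (real (2 * j + 2) * ?\<theta>) = sin (2 * ?\<theta>)"
    using fseq_sin[of ?\<theta> 1 0 "2 * j + 1"] fseq_sin[of ?\<theta> 1 0 1] h unfolding c
    by (simp add: algebra_simps)
  moreover have "sin (real (2 * j) * ?\<theta>) = 2 * cos ?\<theta> * sin (real (2 * j + 1) * ?\<theta>) - sin (real (2 * j + 2) * ?\<theta>)"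
  proof -
    have "sin ((a + 1) * ?\<theta>) + sin ((a - 1) * ?\<theta>) = 2 * cos ?\<theta> * sin (a * ?\<theta>)" for a
      by (simp add: algebra_simps sin_add sin_diff add_divide_distrib diff_divide_distrib)
    from this[of "real (2 * j) + 1"] show ?thesis by (simp add: algebra_simps)
  qed
  ultimately have a0: "sin (real (2 * j) * ?\<theta>) = 0"
    using a1 sin_double[of ?\<theta>] by simp
  have "sin (real (2 * j + 1) * ?\<theta>) = cos (real (2 * j) * ?\<theta>) * sin ?\<theta>"
    using a0 by (simp add: algebra_simps sin_add)
  then have c1: "cos (real (2 * j) * ?\<theta>) = 1" using a1 s by simp
  then obtain n :: int where n: "real (2 * j) * ?\<theta> = of_int n * 2 * pi"
    using cos_one_2pi_int by auto
  then have "real (2 * j) * pi = of_int n * 2 * pi * real k" using k by (simp add: field_simps)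
  then have "real j = of_int n * real k" by simp
  then have e: "int j = n * int k" by (metis of_int_eq_iff of_int_mult of_int_of_nat_eq)
  then have n: "0 < n * int k" using j by simp
  have "n > 0"
  proof (rule ccontr)
    assume "\<not> n > 0"
    then have "n * int k \<le> 0" by (simp add: mult_nonpos_nonneg)
    with n show False by simp
  qed
  then have "1 * int k \<le> n * int k" by (intro mult_right_mono) auto
  with e have "int k \<le> int j" by simp
  with j show False by simp
qed


section \<open>Words, reflections and length\<close>

text \<open>
  Parity of the number of occurrences of \<open>r\<close> among the reflections
  \<open>s\<^sub>1 \<dots> s\<^sub>i \<dots> s\<^sub>1\<close> of the word \<open>s\<^sub>1 \<dots> s\<^sub>n\<close>. It depends only on the product of the
  word, and a reflection \<open>r\<close> shortens that product from the left exactly when the number is odd.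
\<close>

fun occurs_odd :: "('w, 'b) monoid_scheme \<Rightarrow> 'w list \<Rightarrow> 'w \<Rightarrow> bool" where
  "occurs_odd W [] r = False"
| "occurs_odd W (s # ws) r = ((r = s) \<noteq> occurs_odd W ws (s \<otimes>\<^bsub>W\<^esub> r \<otimes>\<^bsub>W\<^esub> s))"

context coxeter_system
begin

lemma wp_Nil [simp]: "word_prod W [] = \<one>"
  and wp_Cons [simp]: "word_prod W (s # ws) = s \<otimes> word_prod W ws"
  by (simp_all add: word_prod_def)

lemma gen_closed [simp]: "s \<in> S \<Longrightarrow> s \<in> carrier W"
  using gens_closed by auto

lemma wp_closed [simp]: "ws \<in> lists S \<Longrightarrow> word_prod W ws \<in> carrier W"
  by (induction ws) auto

lemma wp_append: "us \<in> lists S \<Longrightarrow> ws \<in> lists S \<Longrightarrow> word_prod W (us @ ws) = word_prod W us \<otimes> word_prod W ws"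
  by (induction us) (auto simp: m_assoc)

lemma gen_square [simp]: assumes "s \<in> S" shows "s \<otimes> s = \<one>"
proof -
  have "cox_equiv S m ([] @ concat (replicate 1 [s, s]) @ []) ([] @ [])"
    by (rule cox_equiv.rel) (use assms m_diag in \<open>auto simp: one_enat_def\<close>)
  then have "word_prod W [s, s] = word_prod W []"
    using assms by (subst presented) auto
  then show ?thesis using assms by simp
qed

lemma gen_inv [simp]: "s \<in> S \<Longrightarrow> inv s = s"
  by (rule inv_equality) auto

lemma gen_cancel [simp]: "s \<in> S \<Longrightarrow> x \<in> carrier W \<Longrightarrow> s \<otimes> (s \<otimes> x) = x"
  by (simp add: m_assoc[symmetric])

lemma gen_cancel_right [simp]: "s \<in> S \<Longrightarrow> x \<in> carrier W \<Longrightarrow> x \<otimes> s \<otimes> s = x"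
  by (simp add: m_assoc)

lemma inv_cancel [simp]:
  assumes "x \<in> carrier W" "y \<in> carrier W"
  shows "inv x \<otimes> (x \<otimes> y) = y" "x \<otimes> (inv x \<otimes> y) = y"
  using assms by (simp_all add: m_assoc[symmetric])

lemma wp_rev: "ws \<in> lists S \<Longrightarrow> word_prod W (rev ws) = inv (word_prod W ws)"
proof (induction ws)
  case (Cons a ws)
  then have "rev ws \<in> lists S" "[a] \<in> lists S" by auto
  then show ?case using Cons wp_append[of "rev ws" "[a]"] by (auto simp: inv_mult_group)
qed simp

lemma word_exists:
  assumes "w \<in> carrier W" obtains ws where "ws \<in> lists S" "word_prod W ws = w"
proof -
  have "w \<in> generate W S" using assms generated by simp
  then have "\<exists>ws \<in> lists S. word_prod W ws = w"
  proof induction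
    case one then show ?case by (intro bexI[of _ "[]"]) auto
  next
    case (incl h) then show ?case by (intro bexI[of _ "[h]"]) auto
  next
    case (inv h) then show ?case by (intro bexI[of _ "[h]"]) auto
  next
    case (eng h1 h2)
    then obtain a b where "a \<in> lists S" "word_prod W a = h1" "b \<in> lists S" "word_prod W b = h2" by auto
    then show ?case by (intro bexI[of _ "a @ b"]) (auto simp: wp_append)
  qed
  then show thesis using that by auto
qed

lemma alternating_lists: "s \<in> S \<Longrightarrow> t \<in> S \<Longrightarrow> concat (replicate k [s, t]) \<in> lists S"
  by (induction k) auto

lemma wp_alternating: "s \<in> S \<Longrightarrow> t \<in> S \<Longrightarrow> word_prod W (concat (replicate k [s, t])) = (s \<otimes> t) [^] k"
proof (induction k)
  case (Suc k)
  then show ?case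
    using nat_pow_Suc2[of "s \<otimes> t" k] by (simp add: m_assoc del: nat_pow_Suc)
qed simp

lemma m_power: assumes "s \<in> S" "t \<in> S" "m s t = enat k" shows "(s \<otimes> t) [^] k = \<one>"
proof -
  have "cox_equiv S m ([] @ concat (replicate k [s, t]) @ []) ([] @ [])"
    by (rule cox_equiv.rel) (use assms in auto)
  then have "word_prod W (concat (replicate k [s, t])) = word_prod W []"
    using assms alternating_lists by (subst presented) auto
  then show ?thesis using assms by (simp add: wp_alternating)
qed

section \<open>The numbers game as an action of the group\<close>

lemma fires_append: "fires m (us @ ws) p = fires m ws (fires m us p)"
  by (simp add: fires_def)

lemma bond_diag: "s \<in> S \<Longrightarrow> bond m s s = -2"
  by (simp add: bond_def m_diag one_enat_def)

lemma fires_relation: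
  assumes "s \<in> S" "t \<in> S" "m s t = enat k"
  shows "fires m (concat (replicate k [s, t])) p = p"
proof (cases "s = t")
  case True
  then have "k = 1" using assms m_diag by (simp add: one_enat_def)
  then show ?thesis using True assms bond_diag by (auto simp: fires_def fire_def fun_eq_iff)
next
  case False
  have k: "2 \<le> k" using m_off_diag[OF assms(1,2) False] assms(3) by (simp add: numeral_eq_enat)
  have c: "bond m s t = 2 * cos (pi / real k)" "bond m t s = 2 * cos (pi / real k)"
    using assms m_sym[of s t] by (auto simp: bond_def)
  show ?thesis
    using fseq_sums_zero[OF k HOL.refl] assms
    by (auto simp: fun_eq_iff fires_alternating[OF bond_diag bond_diag c])
qed

lemma fires_equiv: "cox_equiv S m us ws \<Longrightarrow> fires m us p = fires m ws p"
proof (induction arbitrary: p rule: cox_equiv.induct)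
  case (rel s t k us ws)
  then show ?case by (simp add: fires_append fires_relation)
qed auto

text \<open>A trivial smaller power would fix every position of the game. The position supported at
  \<open>s\<close> is not fixed: for an infinite bond the fired values grow linearly, and for a
  finite one \<open>fseq_order\<close> applies.\<close>

lemma order_exact:
  assumes s: "s \<in> S" "t \<in> S" and ne: "s \<noteq> t" and j: "0 < j" "enat j < m s t"
  shows "(s \<otimes> t) [^] j \<noteq> \<one>"
proof
  assume "(s \<otimes> t) [^] j = \<one>"
  then have "word_prod W (concat (replicate j [s, t])) = word_prod W []"
    using s by (simp add: wp_alternating)
  then have "cox_equiv S m (concat (replicate j [s, t])) []"
    using presented[of "concat (replicate j [s, t])" "[]"] s alternating_lists by auto
  then have fixed: "fires m (concat (replicate j [s, t])) p = p" for p
    by (auto dest: fires_equiv[of _ _ p] simp: fires_def)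
  define p where "p = (\<lambda>r. if r = s then 1 else 0 :: real)"
  define c where "c = bond m s t"
  have c: "bond m s t = c" "bond m t s = c" using m_sym[OF s] by (auto simp: bond_def c_def)
  let ?P = "\<Sum>i<j. fseq c 1 0 (2 * i)" and ?Q = "\<Sum>i<j. fseq c 1 0 (2 * i + 1)"
  \<comment> \<open>Nothing has changed at \<open>s\<close> and at \<open>t\<close>, so both
    weighted sums of fired values are 0; \<open>fseq_sums\<close> converts this into the return of
    two consecutive terms.\<close>
  have ev: "- 2 * ?P + c * ?Q = 0" "c * ?P - 2 * ?Q = 0"
  proof -
    have "p s = p s + bond m s s * (\<Sum>i<j. fseq c (p s) (p t) (2 * i))
        + bond m t s * (\<Sum>i<j. fseq c (p s) (p t) (2 * i + 1))"
      "p t = p t + bond m s t * (\<Sum>i<j. fseq c (p s) (p t) (2 * i))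
        + bond m t t * (\<Sum>i<j. fseq c (p s) (p t) (2 * i + 1))"
      using fires_alternating[OF bond_diag[OF s(1)] bond_diag[OF s(2)] c, of j p]
      unfolding fixed by blast+
    moreover have "p s = 1" "p t = 0" using ne by (simp_all add: p_def)
    ultimately show "- 2 * ?P + c * ?Q = 0" "c * ?P - 2 * ?Q = 0"
      unfolding c bond_diag[OF s(1)] bond_diag[OF s(2)] by simp_all
  qed
  have f1: "fseq c 1 0 (2 * j) = 1"
    using fseq_sums[where k = j and x = 1 and y = 0 and c = c] ev by linarith
  have "fseq c 1 0 (2 * j + 1) - c * fseq c 1 0 (2 * j) = 0"
    using fseq_sums[where k = j and x = 1 and y = 0 and c = c] ev by linarith
  with f1 have f: "fseq c 1 0 (2 * j) = 1" "fseq c 1 0 (2 * j + 1) = c"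
    by (simp_all only: mult_1_right diff_eq_eq add_0)
  show False
  proof (cases "m s t")
    case infinity
    then have "c = 2" by (simp add: c_def bond_def)
    then show False using f(1) j by (simp add: fseq_two)
  next
    case (enat k)
    then have k: "2 \<le> k" "j < k" "c = 2 * cos (pi / real k)"
      using m_off_diag[OF s ne] j by (auto simp: c_def bond_def numeral_eq_enat)
    then show False using fseq_order[OF k(1) j(1) k(2) k(3)] f by simp
  qed
qed

end

context coxeter_system
begin

section \<open>The parity cocycle of reflections and its invariance under the relations\<close>

lemma occurs_odd_append:
  assumes "us \<in> lists S" "ws \<in> lists S" "r \<in> carrier W"
  shows "occurs_odd W (us @ ws) r
    = (occurs_odd W us r \<noteq> occurs_odd W ws (inv (word_prod W us) \<otimes> r \<otimes> word_prod W us))"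
  using assms
proof (induction us arbitrary: r)
  case (Cons s us)
  then have c: "s \<in> S" "us \<in> lists S" by auto
  have "inv (word_prod W us) \<otimes> (s \<otimes> r \<otimes> s) \<otimes> word_prod W us
    = inv (word_prod W (s # us)) \<otimes> r \<otimes> word_prod W (s # us)"
    using c wp_closed[OF c(2)] Cons.prems by (simp add: inv_mult_group m_assoc)
  then show ?case using Cons by auto
qed auto

lemma pow_conj:
  assumes "s \<in> S" "t \<in> S"
  shows "s \<otimes> ((t \<otimes> s) [^] (i::nat)) = (s \<otimes> t) [^] i \<otimes> s"
proof (induction i)
  case (Suc i)
  have "s \<otimes> (t \<otimes> s) [^] Suc i = (s \<otimes> (t \<otimes> s) [^] i) \<otimes> (t \<otimes> s)"
    using assms by (simp add: m_assoc)
  also have "\<dots> = (s \<otimes> t) [^] Suc i \<otimes> s"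
    unfolding Suc.IH using assms by (simp add: m_assoc)
  finally show ?case .
qed (use assms in simp)

fun alt_word :: "'w \<Rightarrow> 'w \<Rightarrow> nat \<Rightarrow> 'w list" where
  "alt_word s t 0 = []"
| "alt_word s t (Suc k) = s # alt_word t s k"

lemma alt_word_lists [simp]: "s \<in> S \<Longrightarrow> t \<in> S \<Longrightarrow> alt_word s t k \<in> lists S"
  by (induction k arbitrary: s t) auto

lemma alt_word_length [simp]: "length (alt_word s t k) = k"
  by (induction k arbitrary: s t) auto

lemma alt_word_double: "alt_word s t (2 * k) = concat (replicate k [s, t])"
  by (induction k) auto

lemma refl_conj_eq:
  assumes "s \<in> S" "t \<in> S" "r \<in> carrier W"
  shows "s \<otimes> r \<otimes> s = (t \<otimes> s) [^] (i::nat) \<otimes> t \<longleftrightarrow> r = (s \<otimes> t) [^] Suc i \<otimes> s"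
proof -
  have "(s \<otimes> t) [^] Suc i \<otimes> s = s \<otimes> ((t \<otimes> s) [^] i \<otimes> t) \<otimes> s"
    using assms pow_conj[of s t i] by (simp add: m_assoc[symmetric])
  moreover have "s \<otimes> (s \<otimes> r \<otimes> s) \<otimes> s = r" using assms by (simp add: m_assoc)
  moreover have "s \<otimes> (s \<otimes> x \<otimes> s) \<otimes> s = x" if "x \<in> carrier W" for x
    using that assms by (simp add: m_assoc)
  ultimately show ?thesis using assms by (metis gen_closed m_closed nat_pow_closed)
qed

text \<open>The letter in position \<open>i\<close> of the alternating word, counted from 0,
  contributes the reflection \<open>(s t)^i s\<close>.\<close>

lemma occurs_odd_alt:
  assumes "s \<in> S" "t \<in> S" "r \<in> carrier W"
  shows "occurs_odd W (alt_word s t k) r = odd (card {i. i < k \<and> r = (s \<otimes> t) [^] i \<otimes> s})"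
  using assms
proof (induction k arbitrary: s t r)
  case (Suc k)
  let ?A = "{i. i < k \<and> s \<otimes> r \<otimes> s = (t \<otimes> s) [^] i \<otimes> t}"
  have eq: "{i. i < Suc k \<and> r = (s \<otimes> t) [^] i \<otimes> s} = {i. i = 0 \<and> r = s} \<union> Suc ` ?A"
  proof -
    have "i < Suc k \<and> r = (s \<otimes> t) [^] i \<otimes> s \<longleftrightarrow> i = 0 \<and> r = s \<or> i \<in> Suc ` ?A" for i
    proof (cases i)
      case 0
      then show ?thesis using Suc.prems by auto
    next
      case (Suc j)
      then show ?thesis using refl_conj_eq[OF Suc.prems, of j] by (auto simp del: nat_pow_Suc)
    qed
    then show ?thesis by blast
  qed
  have "card {i. i < Suc k \<and> r = (s \<otimes> t) [^] i \<otimes> s} = card {i. i = (0::nat) \<and> r = s} + card ?A"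
    unfolding eq by (subst card_Un_disjoint) (auto simp: card_image)
  moreover have "card {i. i = (0::nat) \<and> r = s} = (if r = s then 1 else 0)" by auto
  moreover have "occurs_odd W (alt_word t s k) (s \<otimes> r \<otimes> s) = odd (card ?A)"
    using Suc by auto
  ultimately show ?case by auto
qed simp

text \<open>Since \<open>(s t)^k = 1\<close>, the \<open>2 * k\<close> reflections of the relator
  are \<open>k\<close> reflections listed twice. Hence relators do not affect parities.\<close>

lemma occurs_odd_relation:
  assumes "s \<in> S" "t \<in> S" "m s t = enat k" "r \<in> carrier W"
  shows "\<not> occurs_odd W (concat (replicate k [s, t])) r"
proof -
  let ?P = "\<lambda>i. r = (s \<otimes> t) [^] i \<otimes> s"
  have per: "?P (k + i) = ?P i" for i
    using assms m_power[OF assms(1-3)] by (simp add: nat_pow_mult[symmetric])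
  have "{i. i < 2 * k \<and> ?P i} = {i. i < k \<and> ?P i} \<union> (+) k ` {i. i < k \<and> ?P i}"
  proof -
    have "i < 2 * k \<and> ?P i \<longleftrightarrow> i \<in> {i. i < k \<and> ?P i} \<union> (+) k ` {i. i < k \<and> ?P i}" for i
    proof (cases "i < k")
      case False
      then obtain j where "i = k + j" using le_Suc_ex not_less by blast
      then show ?thesis using per[of j] by auto
    qed auto
    then show ?thesis by blast
  qed
  then have "card {i. i < 2 * k \<and> ?P i} = card {i. i < k \<and> ?P i} + card ((+) k ` {i. i < k \<and> ?P i})"
    by (simp add: card_Un_disjoint disjoint_iff image_iff)
  then have "even (card {i. i < 2 * k \<and> ?P i})"
    by (simp add: card_image)
  then show ?thesis
    using occurs_odd_alt[OF assms(1,2,4), of "2 * k"] unfolding alt_word_double by blast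
qed

lemma equiv_lists: "cox_equiv S m us ws \<Longrightarrow> us \<in> lists S \<and> ws \<in> lists S"
  by (induction rule: cox_equiv.induct) (auto simp: alternating_lists[simplified])

lemma occurs_odd_equiv: "cox_equiv S m us ws \<Longrightarrow> r \<in> carrier W \<Longrightarrow> occurs_odd W us r = occurs_odd W ws r"
proof (induction arbitrary: r rule: cox_equiv.induct)
  case (rel s t k us ws)
  let ?c = "concat (replicate k [s, t])"
  have c: "?c \<in> lists S" "word_prod W ?c = \<one>"
    using rel alternating_lists m_power by (auto simp: wp_alternating)
  let ?r = "inv (word_prod W us) \<otimes> r \<otimes> word_prod W us"
  have r: "?r \<in> carrier W" using rel by simp
  have "occurs_odd W (us @ ?c @ ws) r = (occurs_odd W us r \<noteq> occurs_odd W (?c @ ws) ?r)"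
    using rel c by (subst occurs_odd_append) auto
  also have "occurs_odd W (?c @ ws) ?r = (occurs_odd W ?c ?r \<noteq> occurs_odd W ws (inv (word_prod W ?c) \<otimes> ?r \<otimes> word_prod W ?c))"
    using rel c r by (intro occurs_odd_append) auto
  also have "inv (word_prod W ?c) \<otimes> ?r \<otimes> word_prod W ?c = ?r" using r c(2) by simp
  also have "occurs_odd W ?c ?r = False" using occurs_odd_relation rel r by blast
  finally show ?case using rel by (simp add: occurs_odd_append)
qed auto

lemma parity_equiv: "cox_equiv S m us ws \<Longrightarrow> even (length us) = even (length ws)"
proof (induction rule: cox_equiv.induct)
  case (rel s t k us ws)
  have "length (concat (replicate k [s, t])) = 2 * k" by (induction k) auto
  then show ?case by simp
qed auto

section \<open>Length, inversions and descents\<close>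

definition word_of :: "'w \<Rightarrow> 'w list" where
  "word_of w = (SOME ws. ws \<in> lists S \<and> word_prod W ws = w \<and> length ws = len w)"

lemma word_of: 
  assumes "w \<in> carrier W"
  shows "word_of w \<in> lists S" "word_prod W (word_of w) = w" "length (word_of w) = len w"
proof -
  obtain ws where "ws \<in> lists S" "word_prod W ws = w" using word_exists assms by blast
  then have "\<exists>n. \<exists>ws \<in> lists S. length ws = n \<and> word_prod W ws = w" by auto
  from LeastI_ex[OF this] have "\<exists>ws. ws \<in> lists S \<and> word_prod W ws = w \<and> length ws = len w"
    unfolding len_def by blast
  from someI_ex[OF this] show "word_of w \<in> lists S" "word_prod W (word_of w) = w" "length (word_of w) = len w"
    unfolding word_of_def by blast+
qed

lemma len_le: "ws \<in> lists S \<Longrightarrow> word_prod W ws = w \<Longrightarrow> len w \<le> length ws"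
  unfolding len_def by (rule Least_le) auto

lemma len_parity: "ws \<in> lists S \<Longrightarrow> even (len (word_prod W ws)) = even (length ws)"
  using word_of[of "word_prod W ws"] presented[of "word_of (word_prod W ws)" ws]
    parity_equiv[of "word_of (word_prod W ws)" ws] wp_closed[of ws] by simp

text \<open>Defined through one chosen reduced word and for every group element \<open>r\<close>; by
  \<open>inverts_word\<close> any word of \<open>w\<close> gives the same answer.\<close>

definition inverts :: "'w \<Rightarrow> 'w \<Rightarrow> bool" where
  "inverts w r = occurs_odd W (word_of w) r"

lemma inverts_word:
  assumes "ws \<in> lists S" "r \<in> carrier W" shows "inverts (word_prod W ws) r = occurs_odd W ws r"
  using word_of[of "word_prod W ws"] presented[of "word_of (word_prod W ws)" ws] occurs_odd_equiv assms
  unfolding inverts_def by auto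

lemma inverts_mult:
  assumes "x \<in> carrier W" "y \<in> carrier W" "r \<in> carrier W"
  shows "inverts (x \<otimes> y) r = (inverts x r \<noteq> inverts y (inv x \<otimes> r \<otimes> x))"
proof -
  have "word_of x @ word_of y \<in> lists S" "word_prod W (word_of x @ word_of y) = x \<otimes> y"
    using assms word_of by (auto simp: wp_append)
  then have "inverts (x \<otimes> y) r = occurs_odd W (word_of x @ word_of y) r"
    using inverts_word assms by metis
  then show ?thesis using assms word_of occurs_odd_append by (simp add: inverts_def)
qed

lemma inverts_one: "r \<in> carrier W \<Longrightarrow> \<not> inverts \<one> r"
  using inverts_word[of "[]"] by simp

lemma inverts_gen: "s \<in> S \<Longrightarrow> r \<in> carrier W \<Longrightarrow> inverts s r \<longleftrightarrow> r = s"
  using inverts_word[of "[s]"] by simp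

lemma len_one [simp]: "len \<one> = 0"
  using len_le[of "[]" \<one>] by simp

lemma len_eq_0: "w \<in> carrier W \<Longrightarrow> len w = 0 \<longleftrightarrow> w = \<one>"
  using word_of[of w] by auto

lemma len_mult_le: "x \<in> carrier W \<Longrightarrow> y \<in> carrier W \<Longrightarrow> len (x \<otimes> y) \<le> len x + len y"
  using len_le[of "word_of x @ word_of y" "x \<otimes> y"] word_of by (auto simp: wp_append)

lemma len_inv [simp]: assumes "x \<in> carrier W" shows "len (inv x) = len x"
proof -
  have le: "len (inv y) \<le> len y" if "y \<in> carrier W" for y
  proof -
    have "rev (word_of y) \<in> lists S" using word_of(1)[OF that] by auto
    then show ?thesis
      using len_le[of "rev (word_of y)" "inv y"] wp_rev[of "word_of y"] word_of[OF that] by simp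
  qed
  show ?thesis using le[of x] le[of "inv x"] assms by simp
qed

lemma len_gen [simp]: "s \<in> S \<Longrightarrow> len s = 1"
  using len_le[of "[s]" s] len_parity[of "[s]"] by (cases "len s") auto

lemma len_gen_mult:
  assumes "s \<in> S" "w \<in> carrier W"
  shows "len (s \<otimes> w) = len w + 1 \<or> len w = len (s \<otimes> w) + 1"
proof -
  have "even (len (s \<otimes> w)) \<noteq> even (len w)"
    using len_parity[of "s # word_of w"] assms word_of[of w] by auto
  moreover have "len (s \<otimes> w) \<le> len w + 1" using len_mult_le[of s w] assms by simp
  moreover have "len w \<le> len (s \<otimes> w) + 1" using len_mult_le[of s "s \<otimes> w"] assms by simp
  ultimately show ?thesis by presburger
qed

lemma len_mult_gen:
  assumes "s \<in> S" "w \<in> carrier W"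
  shows "len (w \<otimes> s) = len w + 1 \<or> len w = len (w \<otimes> s) + 1"
  using len_gen_mult[of s "inv w"] assms len_inv[of "w \<otimes> s"] by (simp add: inv_mult_group)

text \<open>If \<open>r\<close> occurs among the reflections of the word, multiplication by
  \<open>r\<close> deletes the letter that produces it.\<close>

lemma deletion:
  assumes "ws \<in> lists S" "r \<in> carrier W" "occurs_odd W ws r"
  shows "\<exists>us \<in> lists S. length us < length ws \<and> r \<otimes> word_prod W ws = word_prod W us"
  using assms
proof (induction ws arbitrary: r)
  case (Cons s ws)
  then have c: "s \<in> S" "ws \<in> lists S" by auto
  show ?case
  proof (cases "r = s")
    case True
    then show ?thesis using c wp_closed[OF c(2)] by (intro bexI[of _ ws]) simp_all
  next
    case False
    then obtain us where us: "us \<in> lists S" "length us < length ws"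
      "s \<otimes> r \<otimes> s \<otimes> word_prod W ws = word_prod W us"
      using Cons.IH[of "s \<otimes> r \<otimes> s"] Cons.prems c(1) by auto
    have "r \<otimes> word_prod W (s # ws) = s \<otimes> (s \<otimes> r \<otimes> s \<otimes> word_prod W ws)"
      using c wp_closed[OF c(2)] Cons.prems by (simp add: m_assoc)
    then show ?thesis using us c by (intro bexI[of _ "s # us"]) auto
  qed
qed simp

lemma inverts_len_less:
  assumes "w \<in> carrier W" "r \<in> carrier W" "inverts w r" shows "len (r \<otimes> w) < len w"
  using deletion[of "word_of w" r] word_of[of w] assms len_le unfolding inverts_def
  by (metis le_less_trans)

text \<open>In the cocycle rule the contributions of \<open>x\<close> and of \<open>inv x\<close>
  are equal and cancel; what remains is the contribution of \<open>s\<close>, which inverts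
  itself.\<close>

lemma inverts_reflection_self:
  assumes "x \<in> carrier W" "s \<in> S"
  shows "inverts (x \<otimes> s \<otimes> inv x) (x \<otimes> s \<otimes> inv x)"
proof -
  let ?r = "x \<otimes> s \<otimes> inv x"
  have r: "?r \<in> carrier W" using assms by simp
  have 1: "inv x \<otimes> ?r \<otimes> x = s" using assms by (simp add: m_assoc)
  have "inverts (x \<otimes> inv x) ?r = (inverts x ?r \<noteq> inverts (inv x) s)"
    using inverts_mult[of x "inv x" ?r] r 1 assms by simp
  then have 2: "inverts x ?r = inverts (inv x) s" using inverts_one r assms by simp
  have 3: "inverts (s \<otimes> inv x) s = (\<not> inverts (inv x) s)"
    using inverts_mult[of s "inv x" s] assms inverts_gen by simp
  have "inverts (x \<otimes> (s \<otimes> inv x)) ?r = (inverts x ?r \<noteq> inverts (s \<otimes> inv x) s)"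
    using inverts_mult[of x "s \<otimes> inv x" ?r] r 1 assms by simp
  then show ?thesis using 2 3 assms by (simp add: m_assoc)
qed

lemma reflection_closed: "r \<in> reflections \<Longrightarrow> r \<in> carrier W"
  by (auto simp: reflections_def)

lemma reflection_square: assumes "r \<in> reflections" shows "r \<otimes> r = \<one>"
proof -
  obtain x s where r: "r = x \<otimes> s \<otimes> inv x" "x \<in> carrier W" "s \<in> S" using assms by (auto simp: reflections_def)
  then show ?thesis by (simp add: m_assoc)
qed

text \<open>For the converse: if \<open>r\<close> does not invert \<open>w\<close>, it inverts
  \<open>r \<otimes> w\<close>, because it inverts itself; then
  \<open>w = r \<otimes> (r \<otimes> w)\<close> is the shorter of the two.\<close>

lemma inverts_iff:
  assumes r: "r \<in> reflections" and w: "w \<in> carrier W"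
  shows "inverts w r \<longleftrightarrow> len (r \<otimes> w) < len w"
proof
  show "len (r \<otimes> w) < len w" if "inverts w r"
    using inverts_len_less that reflection_closed[OF r] w by blast
  assume less: "len (r \<otimes> w) < len w"
  show "inverts w r"
  proof (rule ccontr)
    assume n: "\<not> inverts w r"
    have rc: "r \<in> carrier W" "r \<otimes> r = \<one>" using r reflection_closed reflection_square by auto
    then have "inv r = r" using inv_equality by blast
    then have rrr: "inv r \<otimes> r \<otimes> r = r" using rc by simp
    have "inverts r r" using r inverts_reflection_self by (auto simp: reflections_def)
    then have "inverts (r \<otimes> w) r" using inverts_mult[of r w r] n rc w rrr by simp
    then have "len (r \<otimes> (r \<otimes> w)) < len (r \<otimes> w)" using inverts_len_less rc w by blast
    moreover have "r \<otimes> (r \<otimes> w) = w" using rc w by (simp add: m_assoc[symmetric])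
    ultimately show False using less by simp
  qed
qed

lemma gen_reflection: "s \<in> S \<Longrightarrow> s \<in> reflections"
  unfolding reflections_def by (intro CollectI exI[of _ \<one>] exI[of _ s]) simp

lemma left_descent_iff:
  assumes "w \<in> carrier W"
  shows "s \<in> left_descents w \<longleftrightarrow> s \<in> S \<and> inverts w s"
  using inverts_iff[OF gen_reflection assms] by (auto simp: left_descents_def)

lemma left_descent_len: "s \<in> left_descents w \<Longrightarrow> w \<in> carrier W \<Longrightarrow> len w = len (s \<otimes> w) + 1"
  using len_gen_mult[of s w] by (auto simp: left_descents_def)

lemma not_left_descent_len: "s \<notin> left_descents w \<Longrightarrow> s \<in> S \<Longrightarrow> w \<in> carrier W \<Longrightarrow> len (s \<otimes> w) = len w + 1"
  using len_gen_mult[of s w] by (auto simp: left_descents_def)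

lemma left_descent_mult:
  "w \<in> carrier W \<Longrightarrow> s \<in> S \<Longrightarrow> s \<in> left_descents (s \<otimes> w) \<longleftrightarrow> s \<notin> left_descents w"
  using left_descent_len[of s w] not_left_descent_len[of s w] by (auto simp: left_descents_def)

lemma left_descentD: "s \<in> left_descents w \<Longrightarrow> s \<in> S"
  by (simp add: left_descents_def)

lemma right_descents_inv: "w \<in> carrier W \<Longrightarrow> right_descents w = left_descents (inv w)"
proof -
  assume w: "w \<in> carrier W"
  have "len (s \<otimes> inv w) = len (w \<otimes> s)" if "s \<in> S" for s
    using len_inv[of "w \<otimes> s"] w that by (simp add: inv_mult_group)
  then show ?thesis using w by (auto simp: right_descents_def left_descents_def)
qed

lemma finite_len_le: "finite {w \<in> carrier W. len w \<le> n}"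
proof -
  have "{w \<in> carrier W. len w \<le> n} \<subseteq> word_prod W ` {ws. set ws \<subseteq> S \<and> length ws \<le> n}"
  proof
    fix w assume "w \<in> {w \<in> carrier W. len w \<le> n}"
    then show "w \<in> word_prod W ` {ws. set ws \<subseteq> S \<and> length ws \<le> n}"
      using word_of[of w] by (intro image_eqI[of _ _ "word_of w"]) auto
  qed
  then show ?thesis using finite_lists_length_le[OF finite_gens] finite_surj by blast
qed

section \<open>Bruhat order and the lifting property\<close>

lemma bruhat_less_closed: "bruhat_less x y \<Longrightarrow> x \<in> carrier W \<and> y \<in> carrier W \<and> len x < len y"
  unfolding bruhat_less_def
proof (induction rule: tranclp_induct)
  case (base y)
  then show ?case using reflection_closed by (auto simp: bruhat_step_def)
next
  case (step y z)
  then show ?case using reflection_closed by (auto simp: bruhat_step_def)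
qed

lemma finite_bruhat: "finite {y. bruhat_less y w}"
  by (rule finite_subset[OF _ finite_len_le[of "len w"]]) (auto dest: bruhat_less_closed)

text \<open>Conjugating the reflection by \<open>s\<close> carries the step along, and the cocycle
  rule keeps its direction unless the reflection is \<open>s\<close> itself, in which case
  \<open>s \<otimes> y = w\<close>.\<close>

lemma bruhat_step_gen:
  assumes "bruhat_step y w" "s \<in> S"
  shows "bruhat_step (s \<otimes> y) (s \<otimes> w) \<or> s \<otimes> y = w"
proof -
  obtain r where r: "y \<in> carrier W" "r \<in> reflections" "w = r \<otimes> y" "len y < len w"
    using assms by (auto simp: bruhat_step_def)
  have rc: "r \<in> carrier W" "r \<otimes> r = \<one>" using r reflection_closed reflection_square by auto
  have wc: "w \<in> carrier W" using r rc by simp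
  have ry: "r \<otimes> w = y" using r rc by (simp add: m_assoc[symmetric])
  show ?thesis
  proof (cases "r = s")
    case True then show ?thesis using r by simp
  next
    case False
    let ?r = "s \<otimes> r \<otimes> s"
    obtain x p where x: "r = x \<otimes> p \<otimes> inv x" "x \<in> carrier W" "p \<in> S"
      using r by (auto simp: reflections_def)
    have "?r = (s \<otimes> x) \<otimes> p \<otimes> inv (s \<otimes> x)" using x assms by (simp add: inv_mult_group m_assoc)
    then have rr: "?r \<in> reflections" unfolding reflections_def using x assms
      by (intro CollectI exI[of _ "s \<otimes> x"] exI[of _ p]) auto
    have c: "s \<otimes> ?r \<otimes> s = r" using assms rc by (simp add: m_assoc)
    have "?r \<noteq> s"
    proof
      assume "?r = s"
      then have "s \<otimes> ?r \<otimes> s = s" using assms by simp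
      with c False show False by simp
    qed
    moreover have "inverts w r" using inverts_iff[OF r(2) wc] ry r by simp
    ultimately have "inverts (s \<otimes> w) ?r"
      using inverts_mult[of s w ?r] assms wc rc c inverts_gen by simp
    then have "len (?r \<otimes> (s \<otimes> w)) < len (s \<otimes> w)" using inverts_len_less assms wc rc by simp
    moreover have e: "?r \<otimes> (s \<otimes> w) = s \<otimes> y" using assms rc wc ry by (simp add: m_assoc)
    moreover have "s \<otimes> w = ?r \<otimes> (s \<otimes> y)"
      unfolding e[symmetric] using reflection_square[OF rr] reflection_closed[OF rr] assms wc
        m_assoc[of ?r ?r "s \<otimes> w"] by simp
    ultimately have "bruhat_step (s \<otimes> y) (s \<otimes> w)"
      unfolding bruhat_step_def using assms r rr by auto
    then show ?thesis ..
  qed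
qed

lemma bruhat_less_gen:
  assumes "bruhat_less y w" "s \<in> S"
  shows "bruhat_less (s \<otimes> y) w \<or> bruhat_less (s \<otimes> y) (s \<otimes> w) \<or> s \<otimes> y = w"
  using assms(1) unfolding bruhat_less_def
proof (induction rule: converse_tranclp_induct)
  case (base y)
  then show ?case using bruhat_step_gen[OF base assms(2)] by auto
next
  case (step y z)
  then show ?case using bruhat_step_gen[OF step(1) assms(2)]
    by (metis (no_types) tranclp.r_into_trancl tranclp_trans)
qed

lemma bruhat_step_up:
  assumes "w \<in> carrier W" "s \<in> S" "s \<notin> left_descents w" shows "bruhat_less w (s \<otimes> w)"
  unfolding bruhat_less_def bruhat_step_def
  using assms gen_reflection not_left_descent_len[of s w] by (intro tranclp.r_into_trancl) auto

text \<open>Left multiplication by \<open>C s\<close> either moves a basis element by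
  \<open>s\<close> or leaves it in place; these are the two bounds that keep the support of
  \<open>C s * KL w\<close> weakly below \<open>s \<otimes> w\<close>.\<close>

lemma bruhat_lift:
  assumes "bruhat_less y w \<or> y = w" "w \<in> carrier W" "s \<in> S" "s \<notin> left_descents w"
  shows "bruhat_less (s \<otimes> y) (s \<otimes> w) \<or> s \<otimes> y = s \<otimes> w" "bruhat_less y (s \<otimes> w)"
proof -
  have up: "bruhat_less w (s \<otimes> w)" using bruhat_step_up assms by simp
  show "bruhat_less y (s \<otimes> w)"
    using assms up unfolding bruhat_less_def by (auto intro: tranclp_trans)
  show "bruhat_less (s \<otimes> y) (s \<otimes> w) \<or> s \<otimes> y = s \<otimes> w"
    using assms(1) bruhat_less_gen[of y w s] assms(3) up unfolding bruhat_less_def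
    by (metis tranclp_trans)
qed

end

section \<open>Dihedral cosets\<close>

context coxeter_system
begin

definition alt :: "'w \<Rightarrow> 'w \<Rightarrow> nat \<Rightarrow> 'w" where
  "alt p q k = word_prod W (alt_word p q k)"

lemma alt_0 [simp]: "alt p q 0 = \<one>"
  and alt_Suc: "alt p q (Suc k) = p \<otimes> alt q p k"
  by (simp_all add: alt_def)

lemma alt_closed [simp]: "p \<in> S \<Longrightarrow> q \<in> S \<Longrightarrow> alt p q k \<in> carrier W"
  by (simp add: alt_def)

lemma gen_mult_alt: "p \<in> S \<Longrightarrow> q \<in> S \<Longrightarrow> p \<otimes> alt p q (Suc k) = alt q p k"
  by (simp add: alt_Suc)

lemma alt_left_eq: "alt_left s t k = (if odd k then alt s t k else alt t s k)"
  by (induction k) (auto simp: alt_Suc)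

lemma alt_left_closed [simp]: "s \<in> S \<Longrightarrow> t \<in> S \<Longrightarrow> alt_left s t k \<in> carrier W"
  by (simp add: alt_left_eq)

lemma alt_left_Suc_right: "s \<in> S \<Longrightarrow> t \<in> S \<Longrightarrow> alt_left s t (Suc k) = alt_left t s k \<otimes> s"
proof (induction k)
  case (Suc k)
  have "alt_left s t (Suc (Suc k)) = (if even (Suc k) then s else t) \<otimes> alt_left s t (Suc k)" by simp
  also have "\<dots> = (if even k then t else s) \<otimes> alt_left t s k \<otimes> s"
    unfolding Suc.IH[OF Suc.prems] using Suc.prems by (auto simp: m_assoc)
  finally show ?case by simp
qed simp

lemma inv_alt: "s \<in> S \<Longrightarrow> t \<in> S \<Longrightarrow> inv (alt s t k) = alt_left s t k"
proof (induction k arbitrary: s t)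
  case (Suc k)
  then show ?case unfolding alt_left_Suc_right[OF Suc.prems] by (simp add: alt_Suc inv_mult_group)
qed simp

lemma alt_right_eq: "s \<in> S \<Longrightarrow> t \<in> S \<Longrightarrow> inv (alt_right s t k) = alt_left s t k"
proof -
  assume s: "s \<in> S" "t \<in> S"
  have "alt_right s t k \<in> carrier W \<and> inv (alt_right s t k) = alt_left s t k"
    using s by (induction k) (auto simp: inv_mult_group)
  then show ?thesis ..
qed

lemma alt_word_add: "alt_word s t (i + j) = alt_word s t i @ (if even i then alt_word s t j else alt_word t s j)"
  by (induction i arbitrary: s t) auto

lemma alt_add: "s \<in> S \<Longrightarrow> t \<in> S \<Longrightarrow> alt s t (i + j) = alt s t i \<otimes> (if even i then alt s t j else alt t s j)"
  unfolding alt_def alt_word_add by (auto simp: wp_append)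

text \<open>The alternating word with \<open>2 * k\<close> letters is trivial, so its halves are
  mutually inverse, and inverting the second half produces the word with the other first
  letter.\<close>

lemma alt_longest:
  assumes "s \<in> S" "t \<in> S" "m s t = enat k" shows "alt s t k = alt t s k"
proof -
  let ?y = "if even k then alt s t k else alt t s k"
  have "alt s t (2 * k) = \<one>"
    using assms m_power unfolding alt_def alt_word_double by (simp add: wp_alternating)
  then have "alt s t k \<otimes> ?y = \<one>" using alt_add[OF assms(1,2), of k k] by (simp add: mult_2)
  then have "alt s t k = inv ?y" using assms by (intro inv_equality[symmetric]) auto
  then show ?thesis using assms by (auto simp: inv_alt alt_left_eq split: if_splits)
qed

definition dihedral :: "'w \<Rightarrow> 'w \<Rightarrow> 'w set" where
  "dihedral s t = {alt p q k | p q k. {p, q} = {s, t} \<and> enat k \<le> m s t}"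

lemma dihedral_gen_mult:
  assumes "s \<in> S" "t \<in> S" "s \<noteq> t" "p \<in> {s, t}" "x \<in> dihedral s t" shows "p \<otimes> x \<in> dihedral s t"
proof -
  obtain a b k where x: "x = alt a b k" "{a, b} = {s, t}" "enat k \<le> m s t"
    using assms by (auto simp: dihedral_def)
  have ab: "a \<in> S" "b \<in> S" "m a b = m s t" "m b a = m s t" "a \<noteq> b"
    using x assms m_sym[of s t] by (auto simp: doubleton_eq_iff)
  have down: "a \<otimes> alt a b k \<in> dihedral s t" if "k = Suc j" for j
  proof -
    have "a \<otimes> alt a b k = alt b a j" using gen_mult_alt[OF ab(1,2)] that by simp
    moreover have "enat j \<le> m s t" using x(3) that order_trans[of "enat j" "enat k"] by simp
    moreover have "{b, a} = {s, t}" using x(2) by (simp add: insert_commute)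
    ultimately show ?thesis unfolding dihedral_def by blast
  qed
  show ?thesis
  proof (cases "p = a \<and> k \<noteq> 0")
    case True
    then show ?thesis using down x by (cases k) auto
  next
    case False
    obtain c where c: "{p, c} = {s, t}" "x = alt c p k"
    proof (cases "k = 0")
      case True
      have "{p, if p = s then t else s} = {s, t}" using assms(4) by auto
      then show ?thesis using that[of "if p = s then t else s"] x(1) True by simp
    next
      case False
      then have "p \<noteq> a" using \<open>\<not> (p = a \<and> k \<noteq> 0)\<close> by blast
      then have "p = b" using x(2) assms(4) by blast
      then show ?thesis using that[of a] x by (simp add: insert_commute)
    qed
    have pc: "p \<in> S" "c \<in> S" "m p c = m s t" "m c p = m s t" 
      using c assms m_sym[of s t] by (auto simp: doubleton_eq_iff)
    show ?thesis
    proof (cases "enat k = m s t")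
      case True
      then obtain j where j: "k = Suc j" using m_off_diag[of s t] assms by (cases k) (auto simp: zero_enat_def[symmetric])
      have "x = alt p c k" using c alt_longest[of c p k] pc True by simp
      then have "p \<otimes> x = alt c p j" using pc by (simp add: alt_Suc j)
      moreover have "enat j \<le> m s t" using x(3) j order_trans[of "enat j" "enat k"] by simp
      moreover have "{c, p} = {s, t}" using c(1) by (simp add: insert_commute)
      ultimately show ?thesis unfolding dihedral_def by blast
    next
      case False
      then have "enat (Suc k) \<le> m s t" using x by (auto simp: Suc_ile_eq)
      moreover have "p \<otimes> x = alt p c (Suc k)" using c by (simp add: alt_Suc)
      ultimately show ?thesis unfolding dihedral_def using c by blast
    qed
  qed
qed

lemma alt_mem_generate: "p \<in> {s, t} \<Longrightarrow> q \<in> {s, t} \<Longrightarrow> alt p q k \<in> generate W {s, t}"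
  by (induction k arbitrary: p q) (auto simp: alt_Suc intro: generate.intros)

lemma one_mem_dihedral: "\<one> \<in> dihedral s t"
  unfolding dihedral_def by (rule CollectI, rule exI[of _ s], rule exI[of _ t], rule exI[of _ 0])
    (auto simp: zero_enat_def[symmetric])

lemma generate_eq_dihedral:
  assumes "s \<in> S" "t \<in> S" "s \<noteq> t" shows "generate W {s, t} = dihedral s t"
proof (intro Set.equalityI subsetI)
  fix x assume "x \<in> generate W {s, t}"
  then show "x \<in> dihedral s t"
  proof induction
    case one then show ?case by (rule one_mem_dihedral)
  next
    case (incl h)
    then show ?case using dihedral_gen_mult[OF assms incl one_mem_dihedral] assms by auto
  next
    case (inv h)
    then show ?case using dihedral_gen_mult[OF assms inv one_mem_dihedral] assms by auto
  next
    case (eng h1 h2)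
    obtain p q k where h1: "h1 = alt p q k" "{p, q} = {s, t}" using eng by (auto simp: dihedral_def)
    have h2c: "h2 \<in> carrier W" using eng(2) generate_in_carrier[of "{s,t}"] assms by auto
    have "p \<in> {s, t} \<Longrightarrow> q \<in> {s, t} \<Longrightarrow> alt p q k \<otimes> h2 \<in> dihedral s t" for p q
    proof (induction k arbitrary: p q)
      case 0 then show ?case using eng h2c by simp
    next
      case (Suc k)
      have "alt p q (Suc k) \<otimes> h2 = p \<otimes> (alt q p k \<otimes> h2)"
        using Suc.prems assms h2c by (auto simp: alt_Suc m_assoc)
      then show ?case using dihedral_gen_mult[OF assms Suc.prems(1) Suc.IH[OF Suc.prems(2,1)]] by simp
    qed
    then show ?case using h1 by auto
  qed
next
  fix x assume "x \<in> dihedral s t"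
  then show "x \<in> generate W {s, t}" using alt_mem_generate[of _ s t] by (auto simp: dihedral_def doubleton_eq_iff)
qed

lemma dihedral_closed: "s \<in> S \<Longrightarrow> t \<in> S \<Longrightarrow> x \<in> dihedral s t \<Longrightarrow> x \<in> carrier W"
  by (auto simp: dihedral_def doubleton_eq_iff)

section \<open>Minimal coset representatives and lengths in cosets\<close>

lemma coset_minimum:
  assumes st: "s \<in> S" "t \<in> S" "s \<noteq> t" and w: "w \<in> carrier W"
  obtains a where "a \<in> dihedral s t" "\<And>r. r \<in> dihedral s t \<Longrightarrow> \<not> inverts (a \<otimes> w) r"
proof -
  obtain a where a: "a \<in> dihedral s t" "\<And>b. b \<in> dihedral s t \<Longrightarrow> len (a \<otimes> w) \<le> len (b \<otimes> w)"
    using ex_has_least_nat[of "\<lambda>a. a \<in> dihedral s t" \<one> "\<lambda>a. len (a \<otimes> w)"] one_mem_dihedral by auto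
  have "\<not> inverts (a \<otimes> w) r" if r: "r \<in> dihedral s t" for r
  proof
    assume "inverts (a \<otimes> w) r"
    moreover have c: "a \<in> carrier W" "r \<in> carrier W" using a r dihedral_closed st by auto
    ultimately have "len (r \<otimes> (a \<otimes> w)) < len (a \<otimes> w)" using inverts_len_less w by simp
    moreover have "r \<otimes> a \<in> dihedral s t"
      using a r generate_eq_dihedral[OF st] generate.eng by metis
    ultimately show False using a(2)[of "r \<otimes> a"] c w by (simp add: m_assoc)
  qed
  then show thesis using that a by blast
qed

text \<open>An occurrence of \<open>p\<close> would make a power of \<open>q \<otimes> p\<close>
  with positive exponent below \<open>m p q\<close> trivial. This is where the exact order turns
  into a statement about lengths.\<close>

lemma alt_not_inverts:
  assumes "p \<in> S" "q \<in> S" "p \<noteq> q" "enat (Suc k) \<le> m p q"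
  shows "\<not> inverts (alt q p k) p"
proof -
  have "p \<noteq> (q \<otimes> p) [^] i \<otimes> q" if i: "i < k" for i
  proof
    assume "p = (q \<otimes> p) [^] i \<otimes> q"
    then have "p \<otimes> p = (q \<otimes> p) [^] i \<otimes> q \<otimes> p" by simp
    then have "(q \<otimes> p) [^] Suc i = \<one>" using assms by (simp add: m_assoc)
    moreover have "enat (Suc i) < m q p"
      using i assms(4) m_sym[OF assms(1,2)]
      by (metis Suc_less_eq Suc_ile_eq enat_ord_simps(2) order_less_le_trans less_imp_le order_le_less_trans)
    ultimately show False using order_exact[OF assms(2,1) assms(3)[symmetric], of "Suc i"] by blast
  qed
  then have "{i. i < k \<and> p = (q \<otimes> p) [^] i \<otimes> q} = {}" by blast
  then have "card {i. i < k \<and> p = (q \<otimes> p) [^] i \<otimes> q} = 0" by (simp only: card.empty)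
  then have "\<not> occurs_odd W (alt_word q p k) p" using occurs_odd_alt[OF assms(2,1) gen_closed[OF assms(1)], of k] by presburger
  then show ?thesis unfolding alt_def using inverts_word assms by simp
qed

text \<open>By the cocycle rule, if the next letter inverted the product, it would invert the
  alternating factor, excluded below length \<open>m p q\<close>, or a conjugate of it in the
  dihedral subgroup would invert \<open>u\<close>, excluded by assumption.\<close>

lemma alt_len_aux:
  assumes "p \<in> S" "q \<in> S" "p \<noteq> q" "u \<in> carrier W" "enat k \<le> m p q"
    and r: "\<And>r. r \<in> dihedral p q \<Longrightarrow> \<not> inverts u r"
  shows "len (alt p q k \<otimes> u) = k + len u"
  using assms
proof (induction k arbitrary: p q)
  case (Suc k)
  have k: "enat k \<le> m q p" using Suc.prems m_sym[of p q] by (simp add: Suc_ile_eq order.strict_implies_order)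
  have d: "dihedral q p = dihedral p q"
    unfolding dihedral_def using Suc.prems m_sym[of p q] by (auto simp: insert_commute)
  have IH: "len (alt q p k \<otimes> u) = k + len u" using Suc.IH[of q p] Suc.prems k d by auto
  have c: "alt q p k \<in> carrier W" using Suc.prems by simp
  have "alt q p k \<in> generate W {p, q}" by (rule alt_mem_generate) auto
  then have "inv (alt q p k) \<in> generate W {p, q}"
    using generate_m_inv_closed[of "{p,q}" "alt q p k"] Suc.prems by auto
  then have "inv (alt q p k) \<otimes> p \<otimes> alt q p k \<in> dihedral p q"
    using \<open>alt q p k \<in> generate W {p, q}\<close> generate_eq_dihedral[OF Suc.prems(1-3)]
      generate.eng generate.incl[of p "{p,q}" W] by (metis insertI1)
  then have "\<not> inverts u (inv (alt q p k) \<otimes> p \<otimes> alt q p k)" using Suc.prems by blast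
  then have "\<not> inverts (alt q p k \<otimes> u) p"
    using inverts_mult[of "alt q p k" u p] alt_not_inverts[of p q k] Suc.prems c by simp
  then have "len (p \<otimes> (alt q p k \<otimes> u)) = len (alt q p k \<otimes> u) + 1"
    using left_descent_iff[of "alt q p k \<otimes> u" p] not_left_descent_len[of p "alt q p k \<otimes> u"] Suc.prems c by auto
  then show ?case using IH Suc.prems c by (simp add: alt_Suc m_assoc)
qed simp

lemma dihedral_sym: "s \<in> S \<Longrightarrow> t \<in> S \<Longrightarrow> dihedral t s = dihedral s t"
  unfolding dihedral_def using m_sym[of s t] by (auto simp: insert_commute)

text \<open>Write \<open>u\<close> as an alternating word times the minimum of its coset: a nonempty
  word would make its first letter a descent. So \<open>u\<close> is that minimum.\<close>

lemma no_descent_no_inverts: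
  assumes st: "s \<in> S" "t \<in> S" "s \<noteq> t" and u: "u \<in> carrier W" "left_descents u \<inter> {s, t} = {}"
    and r: "r \<in> dihedral s t"
  shows "\<not> inverts u r"
proof -
  obtain a where a: "a \<in> dihedral s t" "\<And>r. r \<in> dihedral s t \<Longrightarrow> \<not> inverts (a \<otimes> u) r"
    using coset_minimum[OF st u(1)] by blast
  have ac: "a \<in> carrier W" using a dihedral_closed st by blast
  have "inv a \<in> dihedral s t"
    using a generate_eq_dihedral[OF st] generate_m_inv_closed[of "{s,t}" a] st by auto
  then obtain p q k where pq: "inv a = alt p q k" "{p, q} = {s, t}" "enat k \<le> m s t"
    by (auto simp: dihedral_def)
  have pq': "p \<in> S" "q \<in> S" "p \<noteq> q" "m p q = m s t" "m q p = m s t" "dihedral p q = dihedral s t" "dihedral q p = dihedral s t" "p \<in> {s, t}"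
    using pq st m_sym[of s t] dihedral_sym[of s t] by (auto simp: doubleton_eq_iff)
  have ue: "u = alt p q k \<otimes> (a \<otimes> u)" unfolding pq(1)[symmetric] using ac u by simp
  have len: "len (alt p q k \<otimes> (a \<otimes> u)) = k + len (a \<otimes> u)"
    if "{p, q} = {s, t}" "enat k \<le> m s t" for p q k
    using alt_len_aux[of p q "a \<otimes> u" k] that a st ac u m_sym[of s t] dihedral_sym[of s t]
    by (auto simp: doubleton_eq_iff)
  have "k = 0"
  proof (rule ccontr)
    assume "k \<noteq> 0"
    then obtain j where j: "k = Suc j" by (cases k) auto
    have "p \<otimes> u = alt q p j \<otimes> (a \<otimes> u)"
      by (subst ue) (use pq' ac u in \<open>simp add: j alt_Suc m_assoc\<close>)
    moreover have "enat j \<le> m s t" using pq j by (simp add: Suc_ile_eq order.strict_implies_order)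
    ultimately have "len (p \<otimes> u) = j + len (a \<otimes> u)" using len[of q p j] pq by (auto simp: insert_commute)
    moreover have "len u = Suc j + len (a \<otimes> u)" using len[OF pq(2,3)] ue j by metis
    ultimately have "p \<in> left_descents u" using pq' by (auto simp: left_descents_def)
    then show False using u pq' by auto
  qed
  then have "u = a \<otimes> u" using ue ac u by simp
  then show ?thesis using a r by metis
qed

lemma alt_len:
  assumes "p \<in> S" "q \<in> S" "p \<noteq> q" "u \<in> carrier W" "left_descents u \<inter> {p, q} = {}" "enat k \<le> m p q"
  shows "len (alt p q k \<otimes> u) = k + len u"
  using alt_len_aux no_descent_no_inverts assms by blast

lemma coset_decomposition:
  assumes st: "s \<in> S" "t \<in> S" "s \<noteq> t" and w: "w \<in> carrier W"
  obtains p q k u where "{p, q} = {s, t}" "enat k \<le> m s t" "u \<in> carrier W"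
    "left_descents u \<inter> {s, t} = {}" "w = alt p q k \<otimes> u"
proof -
  obtain a where a: "a \<in> dihedral s t" "\<And>r. r \<in> dihedral s t \<Longrightarrow> \<not> inverts (a \<otimes> w) r"
    using coset_minimum[OF st w] by blast
  have ac: "a \<in> carrier W" using a dihedral_closed st by blast
  have "inv a \<in> dihedral s t"
    using a generate_eq_dihedral[OF st] generate_m_inv_closed[of "{s,t}" a] st by auto
  then obtain p q k where pq: "inv a = alt p q k" "{p, q} = {s, t}" "enat k \<le> m s t"
    by (auto simp: dihedral_def)
  have "s \<in> dihedral s t" "t \<in> dihedral s t"
    using generate_eq_dihedral[OF st] generate.incl[of _ "{s,t}" W] by blast+
  then have "left_descents (a \<otimes> w) \<inter> {s, t} = {}"
    using a(2) left_descent_iff[of "a \<otimes> w"] ac w by auto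
  moreover have "w = alt p q k \<otimes> (a \<otimes> w)" unfolding pq(1)[symmetric] using ac w by simp
  ultimately show thesis using that pq ac w by (metis m_closed)
qed

lemma alt_descent:
  assumes "p \<in> S" "q \<in> S" "p \<noteq> q" "u \<in> carrier W" "left_descents u \<inter> {p, q} = {}" "enat (Suc k) \<le> m p q"
  shows "p \<in> left_descents (alt p q (Suc k) \<otimes> u)"
proof -
  have "enat k \<le> m q p" using assms m_sym[of p q] by (simp add: Suc_ile_eq order.strict_implies_order)
  then have "len (alt q p k \<otimes> u) = k + len u" using alt_len[of q p u k] assms by (auto simp: insert_commute)
  moreover have "p \<otimes> (alt p q (Suc k) \<otimes> u) = alt q p k \<otimes> u" using assms by (simp add: alt_Suc m_assoc)
  ultimately show ?thesis using alt_len[OF assms] assms by (simp add: left_descents_def)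
qed

lemma alt_not_descent:
  assumes "p \<in> S" "q \<in> S" "p \<noteq> q" "u \<in> carrier W" "left_descents u \<inter> {p, q} = {}" "enat k < m p q"
  shows "q \<notin> left_descents (alt p q k \<otimes> u)"
proof -
  have "enat (Suc k) \<le> m q p" using assms m_sym[of p q] by (simp add: Suc_ile_eq)
  then have "len (alt q p (Suc k) \<otimes> u) = Suc k + len u" using alt_len[of q p u "Suc k"] assms by (auto simp: insert_commute)
  moreover have "q \<otimes> (alt p q k \<otimes> u) = alt q p (Suc k) \<otimes> u" using assms by (simp add: alt_Suc m_assoc)
  moreover have "len (alt p q k \<otimes> u) = k + len u"
    using alt_len[of p q u k] assms by (simp add: order.strict_implies_order)
  ultimately show ?thesis using assms by (simp add: left_descents_def)
qed

text \<open>In the coset decomposition an alternating word shorter than the bond has at most its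
  first letter as a descent. Two descents therefore force the full length, and in particular a
  finite bond.\<close>

lemma two_descents:
  assumes "s \<noteq> t" "s \<in> left_descents w" "t \<in> left_descents w" "w \<in> carrier W"
  obtains k u where "m s t = enat k" "2 \<le> k" "u \<in> carrier W" "left_descents u \<inter> {s, t} = {}"
    "w = alt s t k \<otimes> u" "len w = k + len u"
proof -
  have st: "s \<in> S" "t \<in> S" using assms left_descentD by auto
  obtain p q k u where pq: "{p, q} = {s, t}" "enat k \<le> m s t" "u \<in> carrier W"
    "left_descents u \<inter> {s, t} = {}" "w = alt p q k \<otimes> u"
    using coset_decomposition[OF st assms(1,4)] by blast
  have pq': "p \<in> S" "q \<in> S" "p \<noteq> q" "m p q = m s t" "q \<in> {s, t}" "left_descents u \<inter> {p, q} = {}"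
    using pq st assms m_sym[of s t] by (auto simp: doubleton_eq_iff)
  have "\<not> enat k < m p q"
  proof
    assume "enat k < m p q"
    from alt_not_descent[OF pq'(1-3) pq(3) pq'(6) this] have "q \<notin> left_descents w" using pq(5) by simp
    then show False using assms pq'(5) by blast
  qed
  then have k: "m s t = enat k" using pq pq' by simp
  have "alt p q k = alt s t k" using alt_longest[OF st k] pq by (auto simp: doubleton_eq_iff)
  then show thesis using that[of k u] k pq pq' alt_len[of p q u k] m_off_diag[OF st assms(1)]
    by (simp add: numeral_eq_enat)
qed

lemma descent_two:
  assumes "a \<noteq> t" "a \<in> left_descents x" "t \<in> left_descents x" "x \<in> carrier W"
  shows "a \<in> left_descents (t \<otimes> x)"
proof -
  obtain k u where k: "m a t = enat k" "2 \<le> k" "u \<in> carrier W" "left_descents u \<inter> {a, t} = {}"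
    "x = alt a t k \<otimes> u" using two_descents[OF assms] by blast
  have st: "a \<in> S" "t \<in> S" using assms left_descentD by auto
  obtain j where j: "k = Suc (Suc j)" using k(2) by (metis add_2_eq_Suc le_Suc_ex)
  have "x = alt t a k \<otimes> u" using k alt_longest[OF st k(1)] by simp
  then have "t \<otimes> x = alt a t (Suc j) \<otimes> u" using k st by (simp add: j alt_Suc m_assoc)
  then show ?thesis using alt_descent[of a t u j] k st assms j by simp
qed

lemma descent_commuting:
  assumes "r \<in> S" "s \<in> S" "r \<otimes> s = s \<otimes> r" "r \<noteq> s" "w \<in> carrier W"
  shows "s \<in> left_descents (r \<otimes> w) \<longleftrightarrow> s \<in> left_descents w"
proof -
  have "r \<otimes> s \<otimes> r = s" using assms by (simp add: m_assoc)
  then show ?thesis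
    using inverts_mult[of r w s] assms inverts_gen[of r s] left_descent_iff[of "r \<otimes> w" s] left_descent_iff[of w s]
    by auto
qed

lemma noncommutingD: "noncommuting s t \<Longrightarrow> s \<in> S \<and> t \<in> S \<and> s \<noteq> t \<and> noncommuting t s"
  by (auto simp: noncommuting_def)

lemma noncommuting_bond:
  assumes "noncommuting s t" shows "enat 3 \<le> m s t"
proof (rule ccontr)
  have st: "s \<in> S" "t \<in> S" "s \<noteq> t" using noncommutingD[OF assms] by auto
  assume "\<not> enat 3 \<le> m s t"
  moreover have "enat 2 \<le> m s t" using m_off_diag[OF st] by (simp add: numeral_eq_enat)
  ultimately have "m s t = enat 2"
    by (cases "m s t") auto
  then have "alt s t 2 = alt t s 2" using alt_longest st by blast
  then have "s \<otimes> t = t \<otimes> s" using st by (simp add: numeral_2_eq_2 alt_Suc)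
  then show False using assms by (simp add: noncommuting_def)
qed

text \<open>Noncommuting generators have bond at least 3, so after two letters are removed from the
  full alternating word at least one more, namely \<open>t\<close>, stands in front.\<close>

lemma descent_three:
  assumes "noncommuting a t" "a \<in> left_descents x" "t \<in> left_descents x" "x \<in> carrier W"
  shows "t \<in> left_descents (a \<otimes> (t \<otimes> x))"
proof -
  have st: "a \<in> S" "t \<in> S" "a \<noteq> t" using noncommutingD[OF assms(1)] by auto
  obtain k u where k: "m a t = enat k" "2 \<le> k" "u \<in> carrier W" "left_descents u \<inter> {a, t} = {}"
    "x = alt a t k \<otimes> u" using two_descents[OF st(3) assms(2-4)] by blast
  have "3 \<le> k" using noncommuting_bond[OF assms(1)] k by simp
  then obtain j where j: "k = Suc (Suc (Suc j))" by (metis add.commute add_2_eq_Suc' le_Suc_ex numeral_3_eq_3 plus_1_eq_Suc add_Suc_right One_nat_def Suc_1)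
  have "x = alt t a k \<otimes> u" using k alt_longest[of a t k] st by simp
  then have "a \<otimes> (t \<otimes> x) = alt t a (Suc j) \<otimes> u" using k st by (simp add: j alt_Suc m_assoc)
  moreover have "enat (Suc j) \<le> m t a" using k j m_sym[of a t] st by simp
  ultimately show ?thesis using alt_descent[of t a u j] k st by (auto simp: insert_commute)
qed

lemma ex_left_descent:
  assumes "w \<in> carrier W" "w \<noteq> \<one>" obtains r where "r \<in> left_descents w"
proof -
  obtain r ws where e: "word_of w = r # ws" using word_of(2)[OF assms(1)] assms(2) by (cases "word_of w") auto
  then have c: "r \<in> S" "ws \<in> lists S" using word_of(1)[OF assms(1)] by auto
  have "r \<otimes> w = word_prod W ws"
    using word_of(2)[OF assms(1)] e c wp_closed[OF c(2)] by (metis gen_cancel wp_Cons)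
  then have "len (r \<otimes> w) < len w"
    using len_le[OF c(2)] word_of(3)[OF assms(1)] e by (metis le_imp_less_Suc length_Cons)
  then show thesis using that c by (auto simp: left_descents_def)
qed

section \<open>Fully commutative elements\<close>

lemma left_descents_one [simp]: "left_descents \<one> = {}"
  by (auto simp: left_descents_def)

lemma alt_len_one: "p \<in> S \<Longrightarrow> q \<in> S \<Longrightarrow> p \<noteq> q \<Longrightarrow> enat k \<le> m p q \<Longrightarrow> len (alt p q k) = k"
  using alt_len[of p q \<one> k] by simp

lemma longest_dihedral:
  assumes st: "s \<in> S" "t \<in> S" "s \<noteq> t" 
  shows "finite (generate W {s, t}) \<and> is_longest (generate W {s, t}) w0 \<longleftrightarrow> (\<exists>k. m s t = enat k \<and> w0 = alt s t k)"
proof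
  assume l: "finite (generate W {s, t}) \<and> is_longest (generate W {s, t}) w0"
  have fin: "m s t \<noteq> \<infinity>"
  proof
    assume i: "m s t = \<infinity>"
    have "inj (alt s t)" by (rule injI) (metis alt_len_one[OF st] i enat_ord_code(3))
    then have "infinite (range (alt s t))" using finite_imageD infinite_UNIV_nat by blast
    moreover have "range (alt s t) \<subseteq> generate W {s, t}" using alt_mem_generate by auto
    ultimately show False using l finite_subset by blast
  qed
  then obtain k where k: "m s t = enat k" by auto
  obtain p q j where w: "w0 = alt p q j" "{p, q} = {s, t}" "enat j \<le> m s t"
    using l generate_eq_dihedral[OF st] by (auto simp: is_longest_def dihedral_def)
  have "alt s t k \<in> generate W {s, t}" by (rule alt_mem_generate) auto
  then have "len (alt s t k) \<le> len w0" using l by (auto simp: is_longest_def)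
  moreover have "len (alt s t k) = k" using alt_len_one st k by simp
  moreover have "len w0 = j" using alt_len_one[of p q j] w st m_sym[of s t] by (auto simp: doubleton_eq_iff)
  ultimately have "j = k" using w k by simp
  then have "w0 = alt s t k" using w alt_longest[OF st(1,2) k] by (auto simp: doubleton_eq_iff)
  then show "\<exists>k. m s t = enat k \<and> w0 = alt s t k" using k by blast
next
  assume "\<exists>k. m s t = enat k \<and> w0 = alt s t k"
  then obtain k where k: "m s t = enat k" "w0 = alt s t k" by blast
  have le: "len x \<le> k \<and> x \<in> carrier W" if x: "x \<in> dihedral s t" for x
  proof -
    obtain p q j where w: "x = alt p q j" "{p, q} = {s, t}" "enat j \<le> m s t"
      using x by (auto simp: dihedral_def)
    then have "len x = j" using alt_len_one[of p q j] w st m_sym[of s t] by (auto simp: doubleton_eq_iff)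
    then show ?thesis using w k dihedral_closed st x by auto
  qed
  then have "dihedral s t \<subseteq> {x \<in> carrier W. len x \<le> k}" by blast
  then have "finite (dihedral s t)" using finite_len_le finite_subset by blast
  moreover have "len w0 = k" using alt_len_one st k by simp
  ultimately show "finite (generate W {s, t}) \<and> is_longest (generate W {s, t}) w0"
    using generate_eq_dihedral[OF st] le k alt_mem_generate[of s s t t k] by (auto simp: is_longest_def)
qed

text \<open>The longest element of a finite rank two subgroup is the alternating word whose length
  is the bond; in this form complexity can be handled letter by letter.\<close>

lemma complex_iff:
  "is_complex w \<longleftrightarrow> (\<exists>s t k x1 x2. noncommuting s t \<and> m s t = enat k \<and> x1 \<in> carrier W \<and> x2 \<in> carrier W \<and>
     w = x1 \<otimes> alt s t k \<otimes> x2 \<and> len w = len x1 + k + len x2)"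
proof -
  have "is_complex w \<longleftrightarrow> (\<exists>s t x1 x2 w0. noncommuting s t \<and> (\<exists>k. m s t = enat k \<and> w0 = alt s t k) \<and>
     x1 \<in> carrier W \<and> x2 \<in> carrier W \<and> w = x1 \<otimes> w0 \<otimes> x2 \<and> len w = len x1 + len w0 + len x2)"
    unfolding is_complex_def using longest_dihedral noncommutingD by (smt (verit, best))
  also have "\<dots> \<longleftrightarrow> (\<exists>s t k x1 x2. noncommuting s t \<and> m s t = enat k \<and> x1 \<in> carrier W \<and> x2 \<in> carrier W \<and>
     w = x1 \<otimes> alt s t k \<otimes> x2 \<and> len w = len x1 + len (alt s t k) + len x2)" by blast
  also have "\<dots> \<longleftrightarrow> (\<exists>s t k x1 x2. noncommuting s t \<and> m s t = enat k \<and> x1 \<in> carrier W \<and> x2 \<in> carrier W \<and>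
     w = x1 \<otimes> alt s t k \<otimes> x2 \<and> len w = len x1 + k + len x2)"
    using alt_len_one noncommutingD by (metis order_refl)
  finally show ?thesis .
qed

lemma complex_inv: assumes "is_complex w" "w \<in> carrier W" shows "is_complex (inv w)"
proof -
  obtain s t k x1 x2 where c: "noncommuting s t" "m s t = enat k" "x1 \<in> carrier W" "x2 \<in> carrier W"
     "w = x1 \<otimes> alt s t k \<otimes> x2" "len w = len x1 + k + len x2"
    using assms complex_iff by blast
  have st: "s \<in> S" "t \<in> S" using noncommutingD c by auto
  have "inv (alt s t k) = alt s t k" using alt_longest[OF st c(2)] st by (simp add: inv_alt alt_left_eq)
  then have "inv w = inv x2 \<otimes> alt s t k \<otimes> inv x1" using c st by (simp add: inv_mult_group m_assoc)
  moreover have "len (inv w) = len (inv x2) + k + len (inv x1)" using c assms by simp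
  ultimately show ?thesis unfolding complex_iff using c inv_closed by blast
qed

lemma complex_mult:
  assumes "is_complex w" "w \<in> carrier W" "x \<in> carrier W" "len (x \<otimes> w) = len x + len w"
  shows "is_complex (x \<otimes> w)"
proof -
  obtain s t k x1 x2 where c: "noncommuting s t" "m s t = enat k" "x1 \<in> carrier W" "x2 \<in> carrier W"
     "w = x1 \<otimes> alt s t k \<otimes> x2" "len w = len x1 + k + len x2"
    using assms complex_iff by blast
  have st: "s \<in> S" "t \<in> S" "s \<noteq> t" using noncommutingD c by auto
  have e: "x \<otimes> w = (x \<otimes> x1) \<otimes> alt s t k \<otimes> x2" using c st assms by (simp add: m_assoc)
  have "len (x \<otimes> w) \<le> len (x \<otimes> x1) + k + len x2"
    unfolding e using len_mult_le[of "(x \<otimes> x1) \<otimes> alt s t k" x2] len_mult_le[of "x \<otimes> x1" "alt s t k"]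
      alt_len_one[of s t k] c st assms by simp
  moreover have "len (x \<otimes> x1) \<le> len x + len x1" using len_mult_le assms c by simp
  ultimately have "len (x \<otimes> w) = len (x \<otimes> x1) + k + len x2" using assms c by simp
  then show ?thesis unfolding complex_iff using e c assms m_closed by blast
qed

lemma complex_up:
  "is_complex w \<Longrightarrow> w \<in> carrier W \<Longrightarrow> s \<in> S \<Longrightarrow> s \<notin> left_descents w \<Longrightarrow> is_complex (s \<otimes> w)"
  using complex_mult[of w s] not_left_descent_len[of s w] by simp

lemma complex_of_descent:
  assumes "is_complex (r \<otimes> w)" "r \<in> left_descents w" "w \<in> carrier W" shows "is_complex w"
proof -
  have r: "r \<in> S" using assms left_descentD by blast
  then show ?thesis using complex_up[of "r \<otimes> w" r] assms left_descent_mult[of w r] by auto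
qed

lemma two_descents_complex:
  assumes "noncommuting s t" "s \<in> left_descents w" "t \<in> left_descents w" "w \<in> carrier W"
  shows "is_complex w"
proof -
  have st: "s \<in> S" "t \<in> S" "s \<noteq> t" using noncommutingD assms by auto
  obtain k u where k: "m s t = enat k" "2 \<le> k" "u \<in> carrier W" "left_descents u \<inter> {s, t} = {}"
    "w = alt s t k \<otimes> u" "len w = k + len u" using two_descents[OF st(3) assms(2-4)] by blast
  have "w = \<one> \<otimes> alt s t k \<otimes> u" using k st by simp
  then show ?thesis unfolding complex_iff using assms(1) k by (metis add_0 len_one one_closed)
qed

text \<open>Take a reduced factorization of \<open>t \<otimes> u\<close> around a long braid. If
  nothing precedes the braid, both its letters are descents and one of them is \<open>t\<close>.
  Otherwise its first letter either does not commute with \<open>t\<close>, or can be stripped while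
  complexity persists. The second alternative shortens \<open>u\<close> and drives inductions on
  length.\<close>

lemma becomes_complex:
  assumes u: "u \<in> carrier W" "\<not> is_complex u" and t: "t \<in> S" "t \<notin> left_descents u" and cx: "is_complex (t \<otimes> u)"
  shows "(\<exists>b. noncommuting t b \<and> t \<in> left_descents (t \<otimes> u) \<and> b \<in> left_descents (t \<otimes> u)) \<or>
    (\<exists>p \<in> left_descents u. p \<otimes> t = t \<otimes> p \<and> p \<noteq> t \<and> is_complex (t \<otimes> (p \<otimes> u)))"
proof -
  obtain a b k x1 x2 where c: "noncommuting a b" "m a b = enat k" "x1 \<in> carrier W" "x2 \<in> carrier W"
     "t \<otimes> u = x1 \<otimes> alt a b k \<otimes> x2" "len (t \<otimes> u) = len x1 + k + len x2"
    using cx complex_iff by blast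
  have ab: "a \<in> S" "b \<in> S" "a \<noteq> b" using noncommutingD c by auto
  have tu: "t \<otimes> u \<in> carrier W" "t \<in> left_descents (t \<otimes> u)" using t u left_descent_mult[of u t] by auto
  have tt: "t \<otimes> (t \<otimes> u) = u" using t u by simp
  show ?thesis
  proof (cases "x1 = \<one>")
    case True
    have desc: "p \<in> left_descents (t \<otimes> u)" if "{p, q} = {a, b}" for p q
    proof -
      have pq: "p \<in> S" "q \<in> S" "p \<noteq> q" "m p q = enat k" "m q p = enat k" using that ab c m_sym[of a b] by (auto simp: doubleton_eq_iff)
      have "3 \<le> k" using noncommuting_bond[OF c(1)] c(2) by simp
      then obtain j where j: "k = Suc j" by (cases k) auto
      have "t \<otimes> u = alt p q k \<otimes> x2" using True c ab alt_longest[OF ab(1,2) c(2)] that by (auto simp: doubleton_eq_iff)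
      then have "p \<otimes> (t \<otimes> u) = alt q p j \<otimes> x2" using pq c by (simp add: j alt_Suc m_assoc)
      then have "len (p \<otimes> (t \<otimes> u)) \<le> j + len x2"
        using len_mult_le[of "alt q p j" x2] alt_len_one[of q p j] pq c j by simp
      then show ?thesis using c(6) True j pq by (simp add: left_descents_def)
    qed
    have da: "a \<in> left_descents (t \<otimes> u)" "b \<in> left_descents (t \<otimes> u)" using desc[of a b] desc[of b a] by auto
    \<comment> \<open>If \<open>t\<close> were neither letter, both would survive its removal as
      descents and make \<open>u\<close> complex.\<close>
    have "t = a \<or> t = b"
    proof (rule ccontr)
      assume "\<not> (t = a \<or> t = b)"
      then have "a \<in> left_descents u" "b \<in> left_descents u"
        using descent_two[of a t "t \<otimes> u"] descent_two[of b t "t \<otimes> u"] da tu tt by auto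
      then show False using two_descents_complex[OF c(1)] u by blast
    qed
    then show ?thesis using da c(1) noncommutingD by metis
  next
    case False
    then obtain r where r: "r \<in> left_descents x1" using ex_left_descent c by blast
    have rS: "r \<in> S" using r left_descentD by blast
    have l: "len x1 = len (r \<otimes> x1) + 1" using left_descent_len r c by blast
    have e: "r \<otimes> (t \<otimes> u) = (r \<otimes> x1) \<otimes> alt a b k \<otimes> x2" using c rS ab by (simp add: m_assoc)
    have "len (r \<otimes> (t \<otimes> u)) \<le> len (r \<otimes> x1) + k + len x2"
      unfolding e using len_mult_le[of "(r \<otimes> x1) \<otimes> alt a b k" x2] len_mult_le[of "r \<otimes> x1" "alt a b k"]
        alt_len_one[of a b k] c ab rS by simp
    then have rd: "r \<in> left_descents (t \<otimes> u)" using c(6) l rS by (simp add: left_descents_def)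
    then have "len (r \<otimes> (t \<otimes> u)) = len (r \<otimes> x1) + k + len x2"
      using left_descent_len[OF rd tu(1)] c(6) l by simp
    then have cr: "is_complex (r \<otimes> (t \<otimes> u))" unfolding complex_iff using e c rS m_closed gen_closed by blast
    show ?thesis
    proof (cases "noncommuting t r")
      case True then show ?thesis using rd tu by blast
    next
      case False
      have "r \<noteq> t" using cr tt u by auto
      have cm: "r \<otimes> t = t \<otimes> r" using False t rS by (auto simp: noncommuting_def)
      have "r \<in> left_descents u" using descent_commuting[of t r u] cm t rS \<open>r \<noteq> t\<close> rd u by auto
      moreover have "r \<otimes> (t \<otimes> u) = t \<otimes> (r \<otimes> u)" using cm t rS u by (simp add: m_assoc[symmetric])
      ultimately show ?thesis using cr cm \<open>r \<noteq> t\<close> by metis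
    qed
  qed
qed

lemma commute_swap:
  "p \<otimes> t = t \<otimes> p \<Longrightarrow> p \<in> S \<Longrightarrow> t \<in> S \<Longrightarrow> u \<in> carrier W \<Longrightarrow> p \<otimes> (t \<otimes> u) = t \<otimes> (p \<otimes> u)"
  by (simp add: m_assoc[symmetric])

lemma descents_commute:
  "\<not> is_complex w \<Longrightarrow> w \<in> carrier W \<Longrightarrow> s \<in> left_descents w \<Longrightarrow> t \<in> left_descents w \<Longrightarrow> s \<otimes> t = t \<otimes> s"
  using two_descents_complex[of s t w] left_descentD by (auto simp: noncommuting_def)

text \<open>A step up inside a string creates no long braid. If \<open>t\<close> and
  \<open>b\<close> were the letters of one in front of \<open>t \<otimes> w\<close>, then
  \<open>b\<close> differs from \<open>s\<close>, which is no descent there; so \<open>s\<close> and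
  \<open>t\<close> are both descents of \<open>b \<otimes> w\<close>, and \<open>w\<close> is
  already complex. A commuting letter in front is stripped by induction.\<close>

lemma star_not_complex:
  assumes "w \<in> carrier W" "\<not> is_complex w" "noncommuting s t" "s \<in> left_descents w" "t \<notin> left_descents w"
    "s \<notin> left_descents (t \<otimes> w)"
  shows "\<not> is_complex (t \<otimes> w)"
  using assms
proof (induction "len w" arbitrary: w rule: less_induct)
  case less
  have st: "s \<in> S" "t \<in> S" "s \<noteq> t" using noncommutingD less.prems by auto
  have w: "w \<in> carrier W" "t \<otimes> (t \<otimes> w) = w" "t \<otimes> w \<in> carrier W" using less.prems st by auto
  show ?case
  proof
    assume "is_complex (t \<otimes> w)"
    from becomes_complex[OF less.prems(1,2) st(2) less.prems(5) this] show False
    proof (elim disjE exE bexE conjE)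
      fix b assume b: "noncommuting t b" "t \<in> left_descents (t \<otimes> w)" "b \<in> left_descents (t \<otimes> w)"
      have bS: "b \<in> S" "b \<noteq> t" using noncommutingD b by auto
      have bw: "b \<in> left_descents w" using descent_two[of b t "t \<otimes> w"] b bS w by simp
      have "b \<noteq> s" using b less.prems by auto
      then have "s \<in> left_descents (b \<otimes> w)"
        using descent_commuting[of b s w] descents_commute[OF less.prems(2,1) bw less.prems(4)] bS st less.prems w by auto
      moreover have "t \<in> left_descents (b \<otimes> w)"
        using descent_three[of b t "t \<otimes> w"] b w noncommutingD by auto
      ultimately have "is_complex (b \<otimes> w)" using two_descents_complex less.prems bS by simp
      then show False using complex_of_descent bw less.prems by blast
    next
      fix r assume r: "r \<in> left_descents w" "r \<otimes> t = t \<otimes> r" "r \<noteq> t" "is_complex (t \<otimes> (r \<otimes> w))"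
      have rS: "r \<in> S" using r left_descentD by blast
      have rs: "r \<otimes> s = s \<otimes> r" using descents_commute[OF less.prems(2,1) r(1) less.prems(4)] .
      have "r \<noteq> s" using r less.prems(3) by (auto simp: noncommuting_def)
      have "\<not> is_complex (t \<otimes> (r \<otimes> w))"
      proof (rule less.hyps)
        show "len (r \<otimes> w) < len w" using r by (simp add: left_descents_def)
        show "r \<otimes> w \<in> carrier W" using rS w by simp
        show "\<not> is_complex (r \<otimes> w)" using complex_of_descent r less.prems by blast
        show "s \<in> left_descents (r \<otimes> w)" using descent_commuting[of r s w] rs \<open>r \<noteq> s\<close> rS st w less.prems by auto
        show "t \<notin> left_descents (r \<otimes> w)" using descent_commuting[of r t w] r rS st w less.prems by auto
        show "s \<notin> left_descents (t \<otimes> (r \<otimes> w))"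
          using descent_commuting[of r s "t \<otimes> w"] rs \<open>r \<noteq> s\<close> rS st w less.prems commute_swap[of r t w] r by auto
      qed (use less.prems in auto)
      then show False using r by blast
    qed
  qed
qed

text \<open>When \<open>s\<close> completes a long braid with \<open>d\<close>, a descent
  \<open>p\<close> of \<open>u\<close> not commuting with \<open>s\<close> has to be that
  \<open>d\<close>: otherwise \<open>p\<close> and \<open>s\<close> are both descents of
  \<open>d \<otimes> u\<close>, which makes \<open>u\<close> complex. The lemma excludes stray
  descents in the comparison of two commuting generators.\<close>

lemma becomes_complex_descent:
  assumes "u \<in> carrier W" "\<not> is_complex u" "s \<notin> left_descents u" "is_complex (s \<otimes> u)"
    "p \<in> left_descents u" "noncommuting p s"
  shows "p \<in> left_descents (s \<otimes> u)"
  using assms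
proof (induction "len u" arbitrary: u rule: less_induct)
  case less
  have st: "s \<in> S" "p \<in> S" "s \<noteq> p" using noncommutingD less.prems by auto
  have u: "u \<in> carrier W" "s \<otimes> (s \<otimes> u) = u" "s \<otimes> u \<in> carrier W" using less.prems st by auto
  from becomes_complex[OF less.prems(1,2) st(1) less.prems(3,4)] show ?case
  proof (elim disjE exE bexE conjE)
    fix d assume d: "noncommuting s d" "s \<in> left_descents (s \<otimes> u)" "d \<in> left_descents (s \<otimes> u)"
    have dS: "d \<in> S" "d \<noteq> s" using noncommutingD d by auto
    have du: "d \<in> left_descents u" using descent_two[of d s "s \<otimes> u"] d dS u by simp
    have "p = d"
    proof (rule ccontr)
      assume "p \<noteq> d"
      then have "p \<in> left_descents (d \<otimes> u)"
        using descent_commuting[of d p u] descents_commute[OF less.prems(2,1) du less.prems(5)] dS st less.prems u by auto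
      moreover have "s \<in> left_descents (d \<otimes> u)"
        using descent_three[of d s "s \<otimes> u"] d u noncommutingD by auto
      ultimately have "is_complex (d \<otimes> u)" using two_descents_complex less.prems dS by simp
      then show False using complex_of_descent du less.prems by blast
    qed
    then show ?thesis using d by simp
  next
    fix q assume q: "q \<in> left_descents u" "q \<otimes> s = s \<otimes> q" "q \<noteq> s" "is_complex (s \<otimes> (q \<otimes> u))"
    have qS: "q \<in> S" using q left_descentD by blast
    have qp: "q \<otimes> p = p \<otimes> q" using descents_commute[OF less.prems(2,1) q(1) less.prems(5)] .
    have "q \<noteq> p" using q less.prems(6) by (auto simp: noncommuting_def)
    have "p \<in> left_descents (s \<otimes> (q \<otimes> u))"
    proof (rule less.hyps)
      show "len (q \<otimes> u) < len u" using q by (simp add: left_descents_def)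
      show "q \<otimes> u \<in> carrier W" using qS u by simp
      show "\<not> is_complex (q \<otimes> u)" using complex_of_descent q less.prems by blast
      show "p \<in> left_descents (q \<otimes> u)" using descent_commuting[of q p u] qp \<open>q \<noteq> p\<close> qS st u less.prems by auto
      show "s \<notin> left_descents (q \<otimes> u)" using descent_commuting[of q s u] q qS st u less.prems by auto
    qed (use less.prems q in auto)
    then show ?thesis
      using descent_commuting[of q p "s \<otimes> u"] qp \<open>q \<noteq> p\<close> qS st u commute_swap[of q s u] q by auto
  qed
qed

text \<open>If \<open>p\<close> completed a long braid in front of \<open>s \<otimes> u\<close>, its
  other letter \<open>b\<close> would differ from \<open>s\<close>, because \<open>b\<close> does
  not commute with \<open>p\<close>; then \<open>b\<close> and \<open>p\<close> are already descents
  of \<open>p \<otimes> u\<close>. Further commuting letters are stripped by induction.\<close>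

lemma commuting_extension_not_complex:
  assumes "u \<in> carrier W" "p \<in> S" "s \<in> S" "p \<otimes> s = s \<otimes> p" "p \<noteq> s"
    "\<not> is_complex (p \<otimes> u)" "\<not> is_complex (s \<otimes> u)" "p \<notin> left_descents u" "s \<notin> left_descents u"
  shows "\<not> is_complex (p \<otimes> (s \<otimes> u))"
  using assms
proof (induction "len u" arbitrary: u rule: less_induct)
  case less
  note ps = less.prems(2-5)
  have u: "u \<in> carrier W" "s \<otimes> u \<in> carrier W" "p \<otimes> u \<in> carrier W" "p \<otimes> (s \<otimes> u) \<in> carrier W" "p \<otimes> (p \<otimes> (s \<otimes> u)) = s \<otimes> u"
    using less.prems by auto
  have sw: "p \<otimes> (s \<otimes> u) = s \<otimes> (p \<otimes> u)" using commute_swap ps u by blast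
  have psu: "p \<notin> left_descents (s \<otimes> u)" "s \<notin> left_descents (p \<otimes> u)"
    using descent_commuting[of s p u] descent_commuting[of p s u] less.prems by auto
  show ?case
  proof
    assume "is_complex (p \<otimes> (s \<otimes> u))"
    from becomes_complex[OF u(2) less.prems(7) ps(1) psu(1) this] show False
    proof (elim disjE exE bexE conjE)
      fix b assume b: "noncommuting p b" "p \<in> left_descents (p \<otimes> (s \<otimes> u))" "b \<in> left_descents (p \<otimes> (s \<otimes> u))"
      have "b \<noteq> s" using b ps by (auto simp: noncommuting_def)
      moreover have "s \<in> left_descents (s \<otimes> (p \<otimes> u))" using left_descent_mult[of "p \<otimes> u" s] psu ps u by simp
      ultimately have "b \<in> left_descents (s \<otimes> (s \<otimes> (p \<otimes> u)))"
        using descent_two[of b s "s \<otimes> (p \<otimes> u)"] b sw u by simp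
      then have "b \<in> left_descents (p \<otimes> u)" using ps u by simp
      moreover have "p \<in> left_descents (p \<otimes> u)" using left_descent_mult[of u p] less.prems by simp
      ultimately show False using two_descents_complex[OF b(1)] less.prems u by blast
    next
      fix q assume q: "q \<in> left_descents (s \<otimes> u)" "q \<otimes> p = p \<otimes> q" "q \<noteq> p" "is_complex (p \<otimes> (q \<otimes> (s \<otimes> u)))"
      have qS: "q \<in> S" using q left_descentD by blast
      have "q \<noteq> s" using q less.prems by auto
      have "s \<in> left_descents (s \<otimes> u)" using left_descent_mult[of u s] less.prems by simp
      then have qs: "q \<otimes> s = s \<otimes> q" using descents_commute[OF less.prems(7) u(2) q(1)] by blast
      have qu: "q \<in> left_descents u" using descent_commuting[of s q u] qs \<open>q \<noteq> s\<close> q qS ps u by auto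
      have "\<not> is_complex (p \<otimes> (s \<otimes> (q \<otimes> u)))"
      proof (rule less.hyps)
        show "len (q \<otimes> u) < len u" using qu by (simp add: left_descents_def)
        show "q \<otimes> u \<in> carrier W" using qS u by simp
        have "q \<in> left_descents (p \<otimes> u)" using descent_commuting[of p q u] q qu qS ps u by auto
        then show "\<not> is_complex (p \<otimes> (q \<otimes> u))"
          using complex_of_descent[of q "p \<otimes> u"] less.prems u commute_swap[of q p u] q qS by auto
        show "\<not> is_complex (s \<otimes> (q \<otimes> u))"
          using complex_of_descent[of q "s \<otimes> u"] less.prems u commute_swap[of q s u] q qs qS by auto
        show "p \<notin> left_descents (q \<otimes> u)" "s \<notin> left_descents (q \<otimes> u)"
          using descent_commuting[of q p u] descent_commuting[of q s u] q qs \<open>q \<noteq> s\<close> qS ps u less.prems by auto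
      qed (use ps in auto)
      moreover have "q \<otimes> (s \<otimes> u) = s \<otimes> (q \<otimes> u)" using commute_swap[of q s u] qs qS ps u by simp
      ultimately show False using q by simp
    qed
  qed
qed

end

section \<open>Strings and star operations\<close>

context coxeter_system
begin

lemma mem_fully_commutative: "w \<in> fully_commutative \<longleftrightarrow> w \<in> carrier W \<and> \<not> is_complex w"
  by (simp add: fully_commutative_def)

text \<open>First letter of the \<open>j\<close>-th element of the string whose words end in
  \<open>s\<close>. By period two the value at 0 is \<open>t\<close>, although the base carries no
  letter.\<close>

definition letter :: "'w \<Rightarrow> 'w \<Rightarrow> nat \<Rightarrow> 'w" where
  "letter s t j = (if odd j then s else t)"

definition is_base :: "'w \<Rightarrow> 'w \<Rightarrow> 'w \<Rightarrow> bool" where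
  "is_base s t u \<longleftrightarrow> noncommuting s t \<and> u \<in> carrier W \<and> left_descents u \<inter> {s, t} = {}"

text \<open>Index 0 is the base and index \<open>m s t\<close>, if finite, the element above the
  string; the string proper consists of the indices strictly between.\<close>

definition str :: "'w \<Rightarrow> 'w \<Rightarrow> 'w \<Rightarrow> nat \<Rightarrow> 'w" where
  "str s t u j = alt_left s t j \<otimes> u"

lemma str_eq_alt: "str s t u j = alt (letter s t j) (letter s t (Suc j)) j \<otimes> u"
  by (auto simp: str_def alt_left_eq letter_def)

lemma letter_bond:
  assumes "is_base s t u"
  shows "letter s t j \<in> S" "letter s t j \<noteq> letter s t (Suc j)"
    "m (letter s t j) (letter s t (Suc j)) = m s t" "noncommuting (letter s t j) (letter s t (Suc j))"
    "left_descents u \<inter> {letter s t j, letter s t (Suc j)} = {}" "letter s t (Suc (Suc j)) = letter s t j"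
  using assms noncommutingD[of s t] m_sym[of s t] by (auto simp: letter_def is_base_def)

lemma str_closed: "is_base s t u \<Longrightarrow> str s t u j \<in> carrier W"
  using noncommutingD[of s t] by (auto simp: str_def is_base_def)

lemma str_Suc: "is_base s t u \<Longrightarrow> str s t u (Suc j) = letter s t (Suc j) \<otimes> str s t u j"
  using noncommutingD[of s t] by (auto simp: str_def is_base_def letter_def m_assoc)

lemma str_0: "is_base s t u \<Longrightarrow> str s t u 0 = u"
  by (simp add: str_def is_base_def)

lemma str_down: "is_base s t u \<Longrightarrow> letter s t (Suc j) \<otimes> str s t u (Suc j) = str s t u j"
  unfolding str_Suc using letter_bond(1) str_closed by simp

lemma str_len: "is_base s t u \<Longrightarrow> enat j \<le> m s t \<Longrightarrow> len (str s t u j) = j + len u"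
  unfolding str_eq_alt using alt_len letter_bond by (metis is_base_def)

lemma str_descent:
  "is_base s t u \<Longrightarrow> 1 \<le> j \<Longrightarrow> enat j \<le> m s t \<Longrightarrow> letter s t j \<in> left_descents (str s t u j)"
  unfolding str_eq_alt using alt_descent[of "letter s t j" "letter s t (Suc j)" u "j - 1"] letter_bond
  by (metis is_base_def Suc_diff_1 less_eq_Suc_le One_nat_def)

lemma str_not_descent:
  "is_base s t u \<Longrightarrow> enat j < m s t \<Longrightarrow> letter s t (Suc j) \<notin> left_descents (str s t u j)"
  unfolding str_eq_alt using alt_not_descent letter_bond by (metis is_base_def)

lemma str_top:
  assumes "is_base s t u" "enat j = m s t"
  shows "letter s t (Suc j) \<in> left_descents (str s t u j)" "letter s t j \<in> left_descents (str s t u j)"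
proof -
  have "enat 3 \<le> m s t" using assms noncommuting_bond by (simp add: is_base_def)
  then have "enat 3 \<le> enat j" using assms(2) by simp
  then have j: "3 \<le> j" by simp
  let ?p = "letter s t j" and ?q = "letter s t (Suc j)"
  note b = letter_bond[OF assms(1), of j] letter_bond[OF assms(1), of "Suc j"]
  show "?p \<in> left_descents (str s t u j)" using str_descent assms j by simp
  have "str s t u j = alt ?q ?p j \<otimes> u" unfolding str_eq_alt using alt_longest[of ?p ?q j] b assms by simp
  moreover have "?q \<in> left_descents (alt ?q ?p (Suc (j - 1)) \<otimes> u)"
    using b assms j by (intro alt_descent) (auto simp: is_base_def insert_commute)
  ultimately show "?q \<in> left_descents (str s t u j)" using j by simp
qed

text \<open>The coset decomposition names the first letter of the alternating word, a string is
  named by the last one; hence \<open>s\<close> and \<open>t\<close> are assigned by the parity of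
  the length.\<close>

lemma descent_string:
  assumes "noncommuting p q" "w \<in> carrier W" "p \<in> left_descents w" "q \<notin> left_descents w"
  obtains s t u j where "is_base s t u" "{s, t} = {p, q}" "1 \<le> j" "enat j < m s t" "w = str s t u j" "letter s t j = p"
    "letter s t (Suc j) = q"
proof -
  have pq: "p \<in> S" "q \<in> S" "p \<noteq> q" "noncommuting q p" using noncommutingD assms by auto
  obtain a b k u where ab: "{a, b} = {p, q}" "enat k \<le> m p q" "u \<in> carrier W"
    "left_descents u \<inter> {p, q} = {}" "w = alt a b k \<otimes> u"
    using coset_decomposition[OF pq(1-3) assms(2)] by blast
  define s where "s = (if odd k then a else b)"
  define t where "t = (if odd k then b else a)"
  have st: "{s, t} = {p, q}" using ab by (auto simp: s_def t_def)
  then have base: "is_base s t u" using assms(1) pq ab by (auto simp: is_base_def doubleton_eq_iff)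
  have mm: "m s t = m p q" using st m_sym pq by (auto simp: doubleton_eq_iff)
  have w: "w = str s t u k" unfolding str_eq_alt ab(5) by (auto simp: letter_def s_def t_def)
  have k: "1 \<le> k" using assms(3) ab(4) w str_0[OF base] by (cases k) auto
  have kl: "enat k < m s t"
  proof (rule ccontr)
    assume "\<not> enat k < m s t"
    then have "enat k = m s t" using ab mm by simp
    from str_top[OF base this] have "q \<in> left_descents w" using st w by (auto simp: letter_def doubleton_eq_iff split: if_splits)
    then show False using assms by simp
  qed
  have "letter s t k \<noteq> q" using str_descent[OF base k less_imp_le[OF kl]] w assms(4) by auto
  then have "letter s t k = p" "letter s t (Suc k) = q" using st by (auto simp: letter_def doubleton_eq_iff split: if_splits)
  then show thesis using that base st k kl w by blast
qed

text \<open>Going down removes a descent, which cannot make an element complex; going up is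
  \<open>star_not_complex\<close>, whose last condition holds because the step stays below the
  top.\<close>

lemma string_fully_commutative:
  assumes b: "is_base s t u" and i: "1 \<le> i" "enat i < m s t" and j: "1 \<le> j" "enat j < m s t"
    and n: "\<not> is_complex (str s t u i)"
  shows "\<not> is_complex (str s t u j)"
proof -
  have down: "\<not> is_complex (str s t u k)" if "k \<le> i" for k
    using that
  proof (induction rule: inc_induct)
    case (step k)
    have "enat (Suc k) < m s t" using step i by (metis Suc_leI enat_ord_simps(1) le_less_trans)
    then have "letter s t (Suc k) \<in> left_descents (str s t u (Suc k))" using str_descent[OF b] by simp
    then show ?case using complex_of_descent[of "letter s t (Suc k)" "str s t u (Suc k)"] str_down[OF b, of k] step str_closed[OF b] by auto
  qed (rule n)
  have up: "enat k < m s t \<Longrightarrow> \<not> is_complex (str s t u k)" if "i \<le> k" for k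
    using that
  proof (induction rule: dec_induct)
    case (step k)
    have k: "enat k < m s t" "1 \<le> k" "enat (Suc k) < m s t"
      using step i order.strict_trans[of "enat k" "enat (Suc k)"] by auto
    show ?case unfolding str_Suc[OF b]
    proof (rule star_not_complex[OF str_closed[OF b] _ letter_bond(4)[OF b, of k]])
      show "\<not> is_complex (str s t u k)" using step k by blast
      show "letter s t k \<in> left_descents (str s t u k)" using str_descent[OF b k(2)] k by simp
      show "letter s t (Suc k) \<notin> left_descents (str s t u k)" using str_not_descent[OF b k(1)] .
      show "letter s t k \<notin> left_descents (letter s t (Suc k) \<otimes> str s t u k)"
        using str_not_descent[OF b k(3)] letter_bond(6)[OF b] str_Suc[OF b] by simp
    qed
  qed (use n in blast)
  show ?thesis using down[of j] up[of j] j by (cases "j \<le> i") auto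
qed

lemma left_star_reducible_string:
  assumes "left_star_reducible y x"
  obtains s t u j where "is_base s t u" "1 \<le> j" "enat (Suc j) < m s t" "x = str s t u j" "y = str s t u (Suc j)"
proof -
  obtain s t u i j where h: "noncommuting s t" "u \<in> carrier W" "left_descents u \<inter> {s, t} = {}"
     "x = alt_left s t i \<otimes> u" "y = alt_left s t j \<otimes> u" "1 \<le> i" "enat i < m s t" "1 \<le> j" "enat j < m s t" "len y = len x + 1"
    using assms unfolding left_star_reducible_def left_string_def by blast
  have b: "is_base s t u" using h by (simp add: is_base_def)
  have xy: "x = str s t u i" "y = str s t u j" using h by (simp_all add: str_def)
  have "len x = i + len u" "len y = j + len u" using str_len[OF b] xy h by auto
  then have "j = Suc i" using h by simp
  then show thesis using that b xy h by blast
qed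

lemma right_star_reducible_inv:
  assumes "right_star_reducible y x" shows "left_star_reducible (inv y) (inv x)" "x \<in> carrier W" "y \<in> carrier W"
proof -
  obtain s t u i j where h: "noncommuting s t" "u \<in> carrier W" "right_descents u \<inter> {s, t} = {}"
     "x = u \<otimes> alt_right s t i" "y = u \<otimes> alt_right s t j" "1 \<le> i" "enat i < m s t" "1 \<le> j" "enat j < m s t" "len y = len x + 1"
    using assms unfolding right_star_reducible_def right_string_def by blast
  have st: "s \<in> S" "t \<in> S" using noncommutingD h by auto
  have c: "alt_right s t k \<in> carrier W" for k by (induction k) (use st in auto)
  show xy: "x \<in> carrier W" "y \<in> carrier W" using h c by auto
  have "inv x = alt_left s t i \<otimes> inv u" "inv y = alt_left s t j \<otimes> inv u"
    using h c alt_right_eq[OF st] by (auto simp: inv_mult_group)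
  moreover have "left_descents (inv u) \<inter> {s, t} = {}" using right_descents_inv h by simp
  moreover have "len (inv y) = len (inv x) + 1" using xy h by simp
  ultimately show "left_star_reducible (inv y) (inv x)"
    unfolding left_star_reducible_def left_string_def using h by blast
qed

lemma left_star_complex:
  assumes "left_star_reducible y x" shows "x \<in> carrier W" "y \<in> carrier W" "is_complex x \<Longrightarrow> is_complex y"
proof -
  obtain s t u j where h: "is_base s t u" "1 \<le> j" "enat (Suc j) < m s t" "x = str s t u j" "y = str s t u (Suc j)"
    using left_star_reducible_string[OF assms] by blast
  show "x \<in> carrier W" "y \<in> carrier W" using h str_closed by auto
  show "is_complex y" if "is_complex x"
    using string_fully_commutative[OF h(1), of "Suc j" j] h that order.strict_trans[of "enat j" "enat (Suc j)"] by auto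
qed

lemma star_complex:
  assumes "star_reducible y x" "is_complex x" "x \<in> carrier W" shows "is_complex y \<and> y \<in> carrier W"
  using assms(1) unfolding star_reducible_def
proof (induction rule: converse_rtranclp_induct)
  case base
  then show ?case using assms by simp
next
  case (step y z)
  from step(1) show ?case
  proof
    assume "left_star_reducible y z"
    then show ?thesis using left_star_complex step by blast
  next
    assume r: "right_star_reducible y z"
    have "is_complex (inv y)" using left_star_complex(3)[OF right_star_reducible_inv(1)[OF r]] complex_inv step by blast
    then have "is_complex (inv (inv y))" using complex_inv right_star_reducible_inv[OF r] by blast
    then show ?thesis using right_star_reducible_inv[OF r] by simp
  qed
qed

lemma complex_inv_iff: "w \<in> carrier W \<Longrightarrow> is_complex (inv w) \<longleftrightarrow> is_complex w"
  using complex_inv[of w] complex_inv[of "inv w"] by auto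

lemma mem_right_descents_inv: "w \<in> carrier W \<Longrightarrow> s \<in> right_descents (inv w) \<longleftrightarrow> s \<in> left_descents w"
  using right_descents_inv[of "inv w"] by simp

section \<open>Products of distinct commuting generators\<close>

lemma occurs_odd_commuting:
  assumes "ws \<in> lists S" "distinct ws" "\<forall>s \<in> set ws. \<forall>t \<in> set ws. s \<otimes> t = t \<otimes> s" "r \<in> carrier W"
  shows "occurs_odd W ws r \<longleftrightarrow> r \<in> set ws"
  using assms
proof (induction ws arbitrary: r rule: list.induct)
  case (Cons s ws)
  have c: "s \<in> S" "\<forall>t \<in> set ws. t \<in> S \<and> s \<otimes> t = t \<otimes> s" and ws: "ws \<in> lists S"
    using Cons.prems(1) Cons.prems(3)[THEN bspec, of s] by (simp_all add: in_lists_conv_set)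
  have comm: "\<forall>s \<in> set ws. \<forall>t \<in> set ws. s \<otimes> t = t \<otimes> s"
    using Cons.prems(3) by (meson list.set_intros(2))
  have nd: "distinct ws" "s \<notin> set ws" using Cons.prems(2) by simp_all
  have "s \<otimes> r \<otimes> s \<in> set ws \<longleftrightarrow> r \<in> set ws"
  proof
    assume "r \<in> set ws"
    then have "s \<otimes> r = r \<otimes> s" "r \<in> S" using c by blast+
    then have "s \<otimes> r \<otimes> s = r" using c(1) by (metis gen_cancel_right gen_closed)
    then show "s \<otimes> r \<otimes> s \<in> set ws" using \<open>r \<in> set ws\<close> by simp
  next
    assume h: "s \<otimes> r \<otimes> s \<in> set ws"
    let ?t = "s \<otimes> r \<otimes> s"
    have t: "?t \<in> S" "s \<otimes> ?t = ?t \<otimes> s" using h c by blast+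
    have "r = s \<otimes> ?t \<otimes> s" using c(1) Cons.prems(4) by (simp add: m_assoc)
    also have "\<dots> = ?t" using t(2) t(1) c by (metis gen_cancel_right gen_closed)
    finally show "r \<in> set ws" using h by simp
  qed
  moreover have "occurs_odd W ws (s \<otimes> r \<otimes> s) \<longleftrightarrow> s \<otimes> r \<otimes> s \<in> set ws"
    using Cons.IH[OF ws nd(1) comm] Cons.prems(4) c(1) by simp
  ultimately show ?case using nd(2) by auto
qed simp

lemma commuting_descents:
  assumes "ws \<in> lists S" "distinct ws" "\<forall>s \<in> set ws. \<forall>t \<in> set ws. s \<otimes> t = t \<otimes> s"
  shows "left_descents (word_prod W ws) = set ws"
proof -
  have "s \<in> left_descents (word_prod W ws) \<longleftrightarrow> s \<in> S \<and> s \<in> set ws" for s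
    using left_descent_iff[of "word_prod W ws" s] inverts_word[OF assms(1), of s]
      occurs_odd_commuting[OF assms, of s] assms(1) wp_closed[OF assms(1)] by (metis gen_closed)
  moreover have "set ws \<subseteq> S" using assms(1) by auto
  ultimately show ?thesis by auto
qed

text \<open>The generators can be stripped from \<open>z\<close> one at a time, the others remaining
  descents because they commute. Containment of descents alone thus bounds the length from below,
  which makes \<mu> vanish where the inductions start.\<close>

lemma commuting_subset_len:
  assumes "ws \<in> lists S" "distinct ws" "\<forall>s \<in> set ws. \<forall>t \<in> set ws. s \<otimes> t = t \<otimes> s"
    "z \<in> carrier W" "set ws \<subseteq> left_descents z"
  shows "length ws \<le> len z"
  using assms
proof (induction ws arbitrary: z rule: list.induct)
  case (Cons s ws)
  have c: "s \<in> S" "s \<in> left_descents z" and ws: "ws \<in> lists S"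
    using Cons.prems(1,5) by (simp_all add: in_lists_conv_set)
  have comm: "\<forall>s \<in> set ws. \<forall>t \<in> set ws. s \<otimes> t = t \<otimes> s"
    using Cons.prems(3) by (meson list.set_intros(2))
  have nd: "distinct ws" "s \<notin> set ws" using Cons.prems(2) by simp_all
  have "set ws \<subseteq> left_descents (s \<otimes> z)"
  proof
    fix t assume t: "t \<in> set ws"
    then have "t \<in> S" "s \<noteq> t" "t \<in> left_descents z" using nd ws Cons.prems(5) by auto
    moreover have "s \<otimes> t = t \<otimes> s" using Cons.prems(3) t by (meson list.set_intros)
    ultimately show "t \<in> left_descents (s \<otimes> z)" using descent_commuting[OF c(1)] Cons.prems(4) by blast
  qed
  then have "length ws \<le> len (s \<otimes> z)" using Cons.IH[OF ws nd(1) comm] Cons.prems(4) c by simp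
  then show ?case using left_descent_len[OF c(2) Cons.prems(4)] by simp
qed simp

lemma commuting_len:
  assumes "ws \<in> lists S" "distinct ws" "\<forall>s \<in> set ws. \<forall>t \<in> set ws. s \<otimes> t = t \<otimes> s"
  shows "len (word_prod W ws) = length ws"
  using commuting_subset_len[OF assms wp_closed[OF assms(1)]] commuting_descents[OF assms] len_le[OF assms(1)]
  by (simp add: order_antisym)

end

section \<open>Laurent polynomials\<close>

lemma lookup_vpow [simp]: "Poly_Mapping.lookup (vpow k) j = (if j = k then 1 else 0)"
  by (simp add: vpow_def lookup_single when_def)

lemma vpow_0: "vpow 0 = 1"
  by (simp add: vpow_def)

lemma vpow_add: "vpow (a + b) = vpow a * vpow b"
  by (simp add: vpow_def mult_single)

lemma vpow_cancel [simp]: "vpow a * vpow (- a) = 1" "vpow (- a) * vpow a = 1"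
  by (simp_all add: vpow_add[symmetric] vpow_0)

lemma vpow_nonzero [simp]: "vpow a \<noteq> 0"
  using vpow_cancel(1)[of a] by (metis mult_zero_left zero_neq_one)

lemma poly_mapping_sum_singles:
  fixes p :: laurent
  shows "p = (\<Sum>k \<in> Poly_Mapping.keys p. of_int (Poly_Mapping.lookup p k) * vpow k)"
proof (rule poly_mapping_eqI)
  fix j
  have "Poly_Mapping.lookup (of_int c * vpow k) j = (if j = k then c else 0)" for c k
  proof -
    have "of_int c * vpow k = Poly_Mapping.single k c"
      by (simp add: vpow_def single_of_int[symmetric] mult_single del: single_of_int)
    then show ?thesis by (simp add: lookup_single when_def)
  qed
  then show "Poly_Mapping.lookup p j = Poly_Mapping.lookup (\<Sum>k \<in> Poly_Mapping.keys p. of_int (Poly_Mapping.lookup p k) * vpow k) j"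
    by (simp add: lookup_sum in_keys_iff)
qed

lemma laurent_induct [case_names add vpow]:
  fixes p :: laurent
  assumes add: "\<And>p q. P p \<Longrightarrow> P q \<Longrightarrow> P (p + q)" and v: "\<And>c k. P (of_int c * vpow k)"
  shows "P p"
proof -
  have "P (\<Sum>k \<in> A. of_int (Poly_Mapping.lookup p k) * vpow k)" if "finite A" for A
    using that
  proof induction
    case empty
    show ?case using v[of 0 0] by simp
  qed (auto intro: add v)
  from this[of "Poly_Mapping.keys p"] show ?thesis by (simp flip: poly_mapping_sum_singles)
qed

lemma lookup_of_int_mult: "Poly_Mapping.lookup (of_int c * p) j = c * Poly_Mapping.lookup (p :: laurent) j"
proof (induction c rule: int_induct[where k = 0])
  case base show ?case by simp
next
  case (step1 i) then show ?case by (simp add: algebra_simps lookup_add)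
next
  case (step2 i) then show ?case by (simp add: algebra_simps lookup_minus)
qed

lemma lookup_vpow_mult [simp]: "Poly_Mapping.lookup (vpow a * p) j = Poly_Mapping.lookup p (j - a)"
proof (induction p rule: laurent_induct)
  case (add p q)
  then show ?case by (simp add: distrib_left lookup_add)
next
  case (vpow c k)
  have "vpow a * (of_int c * vpow k) = of_int c * vpow (a + k)" by (simp add: vpow_add mult.left_commute)
  then show ?case by (simp only: lookup_of_int_mult lookup_vpow) auto
qed

lemma lookup_lbar [simp]: "Poly_Mapping.lookup (lbar p) k = Poly_Mapping.lookup p (- k)"
  unfolding lbar_def by (subst map_key.rep_eq) (auto intro: injI)

lemma lbar_add: "lbar (p + q) = lbar p + lbar q"
  by (rule poly_mapping_eqI) (simp add: lookup_add)

lemma lbar_0 [simp]: "lbar 0 = 0"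
  by (rule poly_mapping_eqI) simp

lemma lbar_eq_0 [simp]: "lbar p = 0 \<longleftrightarrow> p = 0"
  by (metis lbar_0 lookup_lbar minus_minus poly_mapping_eqI)

lemma lbar_vpow [simp]: "lbar (vpow k) = vpow (- k)"
  by (rule poly_mapping_eqI) auto

lemma lbar_1 [simp]: "lbar 1 = 1"
  using lbar_vpow[of 0] by (simp add: vpow_0)

lemma lbar_mult: "lbar (p * q) = lbar p * lbar q"
proof (induction p rule: laurent_induct)
  case (add p p')
  then show ?case by (simp add: distrib_right lbar_add)
next
  case (vpow c k)
  have "lbar (of_int c * r) = of_int c * lbar r" for r
    by (rule poly_mapping_eqI) (simp add: lookup_of_int_mult)
  moreover have "lbar (vpow k * q) = vpow (- k) * lbar q"
    by (rule poly_mapping_eqI) simp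
  ultimately show ?case by (simp add: mult.assoc)
qed

lemma strict_neg_iff: "p \<in> laurent_strict_neg \<longleftrightarrow> (\<forall>k \<ge> 0. Poly_Mapping.lookup p k = 0)"
proof
  assume "p \<in> laurent_strict_neg"
  then obtain q where q: "p = vpow (-1) * q" "Poly_Mapping.keys q \<subseteq> {..0}" by (auto simp: laurent_strict_neg_def)
  then have "Poly_Mapping.lookup q j = 0" if "j > 0" for j using that by (auto simp: in_keys_iff subset_iff)
  then show "\<forall>k \<ge> 0. Poly_Mapping.lookup p k = 0" using q by simp
next
  assume h: "\<forall>k \<ge> 0. Poly_Mapping.lookup p k = 0"
  have "p = vpow (-1) * (vpow 1 * p)" by (simp add: mult.assoc[symmetric] vpow_add[symmetric] vpow_0)
  moreover have "Poly_Mapping.keys (vpow 1 * p) \<subseteq> {..0}"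
  proof
    fix k assume "k \<in> Poly_Mapping.keys (vpow 1 * p)"
    then have "Poly_Mapping.lookup p (k - 1) \<noteq> 0" by (simp add: in_keys_iff)
    then have "\<not> k - 1 \<ge> 0" using h by blast
    then show "k \<in> {..0}" by simp
  qed
  ultimately show "p \<in> laurent_strict_neg" unfolding laurent_strict_neg_def by blast
qed

lemma strict_neg_0 [simp]: "0 \<in> laurent_strict_neg"
  and strict_neg_add: "p \<in> laurent_strict_neg \<Longrightarrow> q \<in> laurent_strict_neg \<Longrightarrow> p + q \<in> laurent_strict_neg"
  and strict_neg_diff: "p \<in> laurent_strict_neg \<Longrightarrow> q \<in> laurent_strict_neg \<Longrightarrow> p - q \<in> laurent_strict_neg"
  by (auto simp: strict_neg_iff lookup_add lookup_minus)

lemma strict_neg_sum: "(\<And>x. x \<in> A \<Longrightarrow> f x \<in> laurent_strict_neg) \<Longrightarrow> sum f A \<in> laurent_strict_neg"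
  by (induction A rule: infinite_finite_induct) (auto intro: strict_neg_add)

lemma strict_neg_of_int: "p \<in> laurent_strict_neg \<Longrightarrow> of_int c * p \<in> laurent_strict_neg"
  by (auto simp: strict_neg_iff lookup_of_int_mult)

text \<open>Bar invariance makes the support symmetric about 0, while all its exponents are
  negative. Every uniqueness statement about the Kazhdan--Lusztig basis rests on this.\<close>

lemma strict_neg_symmetric: "p \<in> laurent_strict_neg \<Longrightarrow> lbar p = p \<Longrightarrow> p = 0"
proof (rule poly_mapping_eqI)
  fix k assume p: "p \<in> laurent_strict_neg" "lbar p = p"
  have "Poly_Mapping.lookup p k = Poly_Mapping.lookup p (- k)" using p(2) lookup_lbar by metis
  then show "Poly_Mapping.lookup p k = Poly_Mapping.lookup 0 k" using p(1) strict_neg_iff by (cases "k \<ge> 0") auto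
qed

section \<open>Indexed bases of modules\<close>

text \<open>Coefficients are indexed by group elements instead of vectors. The locale is
  instantiated with both \<open>Tn\<close> and \<open>KL\<close>, so that the two coefficient
  functions share their rules.\<close>

locale indexed_basis = module scale
  for scale :: "'a::comm_ring_1 \<Rightarrow> 'h::ab_group_add \<Rightarrow> 'h" +
  fixes b :: "'i \<Rightarrow> 'h" and I :: "'i set"
  assumes basis_inj: "inj_on b I"
    and basis_independent: "independent (b ` I)"
    and basis_span: "span (b ` I) = UNIV"
begin

definition coef :: "'h \<Rightarrow> 'i \<Rightarrow> 'a" where
  "coef h i = representation (b ` I) h (b i)"

lemma coef_add: "coef (g + h) i = coef g i + coef h i"
  and coef_diff: "coef (g - h) i = coef g i - coef h i"
  and coef_scale: "coef (scale a h) i = a * coef h i"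
  and coef_zero [simp]: "coef 0 i = 0"
  using basis_independent basis_span
  by (simp_all add: coef_def representation_add representation_diff representation_scale representation_zero)

lemma coef_sum: "coef (sum f A) i = (\<Sum>x\<in>A. coef (f x) i)"
  by (induction A rule: infinite_finite_induct) (auto simp: coef_add)

lemma coef_basis: "i \<in> I \<Longrightarrow> j \<in> I \<Longrightarrow> coef (b i) j = (if j = i then 1 else 0)"
  using basis_inj by (auto simp: coef_def representation_basis[OF basis_independent] inj_on_eq_iff)

lemma finite_coef: "finite {i \<in> I. coef h i \<noteq> 0}"
proof (rule finite_imageD)
  show "finite (b ` {i \<in> I. coef h i \<noteq> 0})"
    by (rule finite_subset[OF _ finite_representation[of "b ` I" h]]) (auto simp: coef_def)
  show "inj_on b {i \<in> I. coef h i \<noteq> 0}"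
    using basis_inj by (rule inj_on_subset) auto
qed

lemma expand: "h = (\<Sum>i | i \<in> I \<and> coef h i \<noteq> 0. scale (coef h i) (b i))"
proof -
  have e: "{v. representation (b ` I) h v \<noteq> 0} = b ` {i. i \<in> I \<and> coef h i \<noteq> 0}"
    using representation_ne_zero[of "b ` I" h] by (auto simp: coef_def)
  have "h = (\<Sum>v | representation (b ` I) h v \<noteq> 0. scale (representation (b ` I) h v) v)"
    using sum_nonzero_representation_eq[OF basis_independent, of h] basis_span by simp
  also have "\<dots> = (\<Sum>i | i \<in> I \<and> coef h i \<noteq> 0. scale (coef h i) (b i))"
    unfolding e by (subst sum.reindex) (auto intro: inj_on_subset[OF basis_inj] simp: coef_def)
  finally show ?thesis .
qed

lemma coef_ext: "(\<And>i. i \<in> I \<Longrightarrow> coef g i = coef h i) \<Longrightarrow> g = h"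
proof -
  assume h: "\<And>i. i \<in> I \<Longrightarrow> coef g i = coef h i"
  have "coef (g - h) i = 0" if "i \<in> I" for i using h that by (simp add: coef_diff)
  then have "{i. i \<in> I \<and> coef (g - h) i \<noteq> 0} = {}" by blast
  then have "g - h = 0" using expand[of "g - h"] by simp
  then show ?thesis by simp
qed

lemma basis_induct [case_names add scale zero basis]:
  assumes "\<And>g h. P g \<Longrightarrow> P h \<Longrightarrow> P (g + h)" "\<And>a h. P h \<Longrightarrow> P (scale a h)" "P 0" "\<And>i. i \<in> I \<Longrightarrow> P (b i)"
  shows "P h"
proof -
  have "P (\<Sum>i\<in>A. scale (coef h i) (b i))" if "finite A" "A \<subseteq> I" for A
    using that by induction (auto intro: assms)
  from this[of "{i. i \<in> I \<and> coef h i \<noteq> 0}"] show ?thesis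
    using finite_coef[of h] expand[of h] by auto
qed

end

section \<open>The Hecke algebra\<close>

context hecke_algebra
begin

lemma smult_mult: "(a *s x) * (b *s y) = (a * b) *s (x * y)"
  by (simp add: scale_mult_left scale_mult_right mult.commute)

lemma Tn_inj: "inj_on Tn (carrier W)"
proof (rule inj_onI)
  fix x y assume h: "x \<in> carrier W" "y \<in> carrier W" "Tn x = Tn y"
  show "x = y"
  proof (rule ccontr)
    assume "x \<noteq> y"
    then have ne: "T x \<noteq> T y" using h T_inj by (auto simp: inj_on_eq_iff)
    define u where "u = (\<lambda>v. if v = T x then vpow (- int (len x)) else - vpow (- int (len y)))"
    have "(\<Sum>v\<in>{T x, T y}. u v *s v) = Tn x - Tn y" using ne by (simp add: u_def Tn_def)
    then have "(\<Sum>v\<in>{T x, T y}. u v *s v) = 0" using h by simp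
    from independentD[OF T_independent _ _ this, of "T x"] show False using h by (simp add: u_def)
  qed
qed

lemma T_eq_Tn: "T w = vpow (int (len w)) *s Tn w"
  by (simp add: Tn_def)

lemma Tn_independent: "independent (Tn ` carrier W)"
  unfolding independent_explicit_module
proof (intro allI impI)
  fix t u v assume t: "finite t" "t \<subseteq> Tn ` carrier W" "(\<Sum>v\<in>t. u v *s v) = 0" "v \<in> t"
  obtain A where A: "A \<subseteq> carrier W" "finite A" "t = Tn ` A"
    using finite_subset_image[OF t(1,2)] by blast
  have injA: "inj_on Tn A" "inj_on T A" using A Tn_inj T_inj inj_on_subset by blast+
  define f where "f = (\<lambda>x. u (Tn (the_inv_into A T x)) * vpow (- int (len (the_inv_into A T x))))"
  have f: "f (T w) = u (Tn w) * vpow (- int (len w))" if "w \<in> A" for w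
    using the_inv_into_f_f[OF injA(2) that] by (simp add: f_def)
  have "(\<Sum>v\<in>T ` A. f v *s v) = (\<Sum>w\<in>A. u (Tn w) *s Tn w)"
    by (subst sum.reindex[OF injA(2)]) (auto simp: f Tn_def intro: sum.cong)
  also have "\<dots> = 0" using t(3) unfolding A(3) by (subst (asm) sum.reindex[OF injA(1)]) auto
  finally have z: "(\<Sum>v\<in>T ` A. f v *s v) = 0" .
  obtain w where w: "w \<in> A" "v = Tn w" using t A by blast
  have "f (T w) = 0"
    by (rule independentD[OF T_independent _ _ z]) (use A w in auto)
  then show "u v = 0" using f[OF w(1)] w by simp
qed

lemma Tn_span: "span (Tn ` carrier W) = UNIV"
proof -
  have "T ` carrier W \<subseteq> span (Tn ` carrier W)"
  proof
    fix h assume "h \<in> T ` carrier W"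
    then obtain w where w: "w \<in> carrier W" "h = vpow (int (len w)) *s Tn w" using T_eq_Tn by blast
    then show "h \<in> span (Tn ` carrier W)" by (auto intro: span_scale span_base)
  qed
  then have "span (T ` carrier W) \<subseteq> span (Tn ` carrier W)" using span_minimal subspace_span by blast
  then show ?thesis using T_span by auto
qed

sublocale Tn: indexed_basis scale Tn "carrier W"
  by unfold_locales (use Tn_inj Tn_independent Tn_span in auto)

lemma Tn_coeff_eq: "Tn_coeff = Tn.coef"
  by (simp add: fun_eq_iff Tn_coeff_def Tn.coef_def)

abbreviation cf :: "'h \<Rightarrow> 'w \<Rightarrow> laurent" where "cf \<equiv> Tn.coef"

lemma Tn_one: "Tn \<one> = 1"
  by (simp add: Tn_def T_one vpow_0)

lemma Tn_up:
  assumes "s \<in> S" "w \<in> carrier W" "s \<notin> left_descents w" shows "Tn s * Tn w = Tn (s \<otimes> w)"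
proof -
  have l: "len (s \<otimes> w) = len w + 1" using not_left_descent_len assms by blast
  have "Tn s * Tn w = (vpow (-1) * vpow (- int (len w))) *s (T s * T w)"
    using assms by (simp add: Tn_def smult_mult)
  then show ?thesis using T_up[of s w] assms l by (simp add: Tn_def vpow_add[symmetric])
qed

lemma Tn_down:
  assumes "w \<in> carrier W" "s \<in> left_descents w"
  shows "Tn s * Tn w = Tn (s \<otimes> w) + (vpow 1 - vpow (-1)) *s Tn w"
proof -
  have s: "s \<in> S" using assms left_descentD by blast
  have l: "len w = len (s \<otimes> w) + 1" using left_descent_len assms by blast
  have e1: "vpow (-1) * (vpow (- int (len w)) * vpow 2) = vpow (- int (len (s \<otimes> w)))"
    using l by (simp add: vpow_add[symmetric])
  have e2: "vpow (-1) * (vpow (- int (len w)) * (vpow 2 - 1)) = (vpow 1 - vpow (-1)) * vpow (- int (len w))"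
    by (simp add: algebra_simps vpow_add[symmetric])
  have "Tn s * Tn w = (vpow (-1) * vpow (- int (len w))) *s (T s * T w)"
    using s by (simp add: Tn_def smult_mult)
  also have "\<dots> = (vpow (-1) * vpow (- int (len w))) *s (vpow 2 *s T (s \<otimes> w) + (vpow 2 - 1) *s T w)"
    using T_down[of s w] s assms l by simp
  also have "\<dots> = Tn (s \<otimes> w) + (vpow 1 - vpow (-1)) *s Tn w"
    unfolding Tn_def scale_right_distrib scale_scale mult.assoc e1 e2 by (simp add: mult.assoc)
  finally show ?thesis .
qed

text \<open>The Kazhdan--Lusztig element of a generator. The proofs multiply by it rather than by
  \<open>Tn s\<close>, because it is bar-invariant and its square is a multiple of itself.\<close>

definition C :: "'w \<Rightarrow> 'h" where
  "C s = Tn s + vpow (-1) *s 1"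

lemma C_mult: "C s * h = Tn s * h + vpow (-1) *s h"
  by (simp add: C_def distrib_right scale_mult_left)

lemma C_Tn_up: "s \<in> S \<Longrightarrow> w \<in> carrier W \<Longrightarrow> s \<notin> left_descents w \<Longrightarrow> C s * Tn w = Tn (s \<otimes> w) + vpow (-1) *s Tn w"
  by (simp add: C_mult Tn_up)

lemma C_Tn_down: "w \<in> carrier W \<Longrightarrow> s \<in> left_descents w \<Longrightarrow> C s * Tn w = Tn (s \<otimes> w) + vpow 1 *s Tn w"
  by (simp add: C_mult Tn_down scale_left_diff_distrib)

lemma cf_C:
  assumes "s \<in> S" "w \<in> carrier W"
  shows "cf (C s * h) w = cf h (s \<otimes> w) + (if s \<in> left_descents w then vpow 1 else vpow (-1)) * cf h w"
proof (induction h rule: Tn.basis_induct)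
  case (add g h)
  then show ?case by (simp add: distrib_left Tn.coef_add algebra_simps)
next
  case (scale a h)
  then show ?case by (simp add: scale_mult_right Tn.coef_scale algebra_simps)
next
  case zero
  then show ?case by simp
next
  case (basis x)
  have sw: "s \<otimes> w = x \<longleftrightarrow> w = s \<otimes> x" using assms basis by auto
  show ?case
    using C_Tn_up[of s x] C_Tn_down[of x s] assms basis sw
    by (cases "s \<in> left_descents x") (auto simp: Tn.coef_add Tn.coef_scale Tn.coef_basis)
qed

lemma C_square: "s \<in> S \<Longrightarrow> C s * C s = laurent_delta *s C s"
proof -
  assume s: "s \<in> S"
  then have d: "s \<in> left_descents s" by (simp add: left_descents_def)
  have "C s * C s = C s * Tn s + vpow (-1) *s C s"
    unfolding C_def[of s] by (simp add: distrib_left scale_mult_right)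
  also have "C s * Tn s = vpow 1 *s C s"
    using C_Tn_down[OF _ d] s Tn_one by (simp add: C_def scale_right_distrib vpow_add[symmetric] vpow_0)
  finally show ?thesis by (simp add: laurent_delta_def scale_left_distrib)
qed

lemma Tn_mult:
  "x \<in> carrier W \<Longrightarrow> y \<in> carrier W \<Longrightarrow> len (x \<otimes> y) = len x + len y \<Longrightarrow> Tn x * Tn y = Tn (x \<otimes> y)"
proof (induction "len x" arbitrary: x)
  case 0
  then have "x = \<one>" using len_eq_0 by simp
  then show ?case using 0 Tn_one by simp
next
  case (Suc n)
  then have "x \<noteq> \<one>" by auto
  then obtain s where s: "s \<in> left_descents x" using ex_left_descent Suc.prems by blast
  have sS: "s \<in> S" using s left_descentD by blast
  let ?x = "s \<otimes> x"
  have x: "?x \<in> carrier W" "s \<otimes> ?x = x" using sS Suc.prems by auto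
  have l: "len x = len ?x + 1" using left_descent_len s Suc.prems by blast
  have sx: "s \<notin> left_descents ?x" using left_descent_mult Suc.prems sS s by blast
  have xy: "s \<otimes> (?x \<otimes> y) = x \<otimes> y" using sS Suc.prems by (simp add: m_assoc)
  have "len (x \<otimes> y) \<le> len (?x \<otimes> y) + 1" using len_mult_le[of s "?x \<otimes> y"] xy x sS Suc.prems by simp
  then have l2: "len (?x \<otimes> y) = len ?x + len y" using len_mult_le[of ?x y] x l Suc.prems by simp
  have sxy: "s \<notin> left_descents (?x \<otimes> y)"
  proof
    assume "s \<in> left_descents (?x \<otimes> y)"
    then have "len (s \<otimes> (?x \<otimes> y)) < len (?x \<otimes> y)" by (simp add: left_descents_def)
    then show False using xy l l2 Suc.prems by simp
  qed
  have "Tn x * Tn y = Tn s * Tn ?x * Tn y" using Tn_up[OF sS x(1) sx] x by simp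
  also have "\<dots> = Tn s * Tn (?x \<otimes> y)" using Suc.hyps(1)[of ?x] Suc.hyps(2) l l2 x Suc.prems by (simp add: mult.assoc)
  also have "\<dots> = Tn (x \<otimes> y)" using Tn_up[of s "?x \<otimes> y"] sxy xy x sS Suc.prems by simp
  finally show ?case .
qed

lemma Tn_gen_split: "w \<in> carrier W \<Longrightarrow> s \<in> left_descents w \<Longrightarrow> Tn w = Tn s * Tn (s \<otimes> w)"
  using Tn_up[of s "s \<otimes> w"] left_descent_mult[of w s] left_descentD[of s w] by simp

lemma Tn_square: "s \<in> S \<Longrightarrow> Tn s * Tn s = 1 + (vpow 1 - vpow (-1)) *s Tn s"
  using Tn_down[of s s] Tn_one by (simp add: left_descents_def)

lemma Tn_right:
  assumes "s \<in> S" "w \<in> carrier W"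
  shows "Tn w * Tn s = (if s \<in> right_descents w then Tn (w \<otimes> s) + (vpow 1 - vpow (-1)) *s Tn w else Tn (w \<otimes> s))"
proof -
  have up: "Tn x * Tn s = Tn (x \<otimes> s)" if "x \<in> carrier W" "s \<notin> right_descents x" for x
    using Tn_mult[of x s] len_mult_gen[of s x] that assms by (auto simp: right_descents_def)
  show ?thesis
  proof (cases "s \<in> right_descents w")
    case True
    have "s \<notin> right_descents (w \<otimes> s)" using True assms by (auto simp: right_descents_def)
    then have w: "Tn w = Tn (w \<otimes> s) * Tn s" using up[of "w \<otimes> s"] assms by simp
    have "Tn w * Tn s = Tn (w \<otimes> s) * (Tn s * Tn s)" by (subst w) (simp add: mult.assoc)
    also have "\<dots> = Tn (w \<otimes> s) + (vpow 1 - vpow (-1)) *s Tn w"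
      unfolding Tn_square[OF assms(1)] w by (simp add: distrib_left scale_mult_right)
    finally show ?thesis using True by simp
  qed (use up assms in simp)
qed

section \<open>The anti-automorphism inverting the basis elements\<close>

text \<open>Exchanges left and right: it fixes every \<open>C s\<close> and carries
  \<open>KL w\<close> to \<open>KL (inv w)\<close>, so right-handed statements follow from
  left-handed ones.\<close>

definition iota :: "'h \<Rightarrow> 'h" where
  "iota h = (\<Sum>w | w \<in> carrier W \<and> cf h w \<noteq> 0. cf h w *s Tn (inv w))"

lemma cf_iota: assumes "w \<in> carrier W" shows "cf (iota h) w = cf h (inv w)"
proof -
  let ?A = "{x. x \<in> carrier W \<and> cf h x \<noteq> 0}"
  have fin: "finite ?A" using Tn.finite_coef[of h] by simp
  have "cf (iota h) w = (\<Sum>x\<in>?A. cf h x * cf (Tn (inv x)) w)"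
    by (simp add: iota_def Tn.coef_sum Tn.coef_scale)
  also have "\<dots> = (\<Sum>x\<in>?A. if x = inv w then cf h x else 0)"
    by (rule sum.cong) (use assms in \<open>auto simp: Tn.coef_basis\<close>)
  also have "\<dots> = cf h (inv w)" using fin assms by (simp add: sum.delta')
  finally show ?thesis .
qed

lemma iota_add: "iota (g + h) = iota g + iota h"
  and iota_scale: "iota (a *s h) = a *s iota h"
  and iota_0 [simp]: "iota 0 = 0"
  and iota_iota [simp]: "iota (iota h) = h"
  and iota_Tn: "w \<in> carrier W \<Longrightarrow> iota (Tn w) = Tn (inv w)"
  by (rule Tn.coef_ext; auto simp: cf_iota Tn.coef_add Tn.coef_scale Tn.coef_basis)+

lemma iota_diff: "iota (g - h) = iota g - iota h"
  by (rule Tn.coef_ext) (auto simp: cf_iota Tn.coef_diff)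

lemma iota_1 [simp]: "iota 1 = 1"
  using iota_Tn[of \<one>] Tn_one by simp

lemma iota_gen_mult: assumes "s \<in> S" shows "iota (Tn s * h) = iota h * Tn s"
proof (induction h rule: Tn.basis_induct)
  case (basis x)
  have "s \<in> left_descents x \<longleftrightarrow> s \<in> right_descents (inv x)" using mem_right_descents_inv basis by simp
  then show ?case
    using Tn_up[of s x] Tn_down[of x s] Tn_right[of s "inv x"] basis assms
    by (cases "s \<in> left_descents x") (auto simp: iota_Tn iota_add iota_scale inv_mult_group)
qed (auto simp: distrib_left distrib_right iota_add iota_scale scale_mult_left scale_mult_right)

lemma iota_Tn_mult: "w \<in> carrier W \<Longrightarrow> iota (Tn w * h) = iota h * Tn (inv w)"
proof (induction "len w" arbitrary: w h)
  case 0
  then show ?case using len_eq_0[of w] Tn_one by simp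
next
  case (Suc n)
  then have "w \<noteq> \<one>" by auto
  then obtain s where s: "s \<in> left_descents w" using ex_left_descent Suc.prems by blast
  have sS: "s \<in> S" using s left_descentD by blast
  have "Tn w = Tn s * Tn (s \<otimes> w)" using Tn_gen_split s Suc.prems by blast
  then have "iota (Tn w * h) = iota h * Tn (inv (s \<otimes> w)) * Tn s"
    using iota_gen_mult[OF sS] Suc left_descent_len[OF s] sS by (simp add: mult.assoc)
  moreover have "Tn (inv (s \<otimes> w)) * Tn s = Tn (inv w)"
    using Tn_mult[of "inv (s \<otimes> w)" s] sS Suc.prems left_descent_len[OF s] len_inv[of w] len_inv[of "s \<otimes> w"]
    by (simp add: inv_mult_group)
  ultimately show ?case by (simp add: mult.assoc)
qed

lemma iota_mult: "iota (g * h) = iota h * iota g"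
  by (induction g rule: Tn.basis_induct)
    (auto simp: distrib_left distrib_right iota_add iota_scale scale_mult_left scale_mult_right iota_Tn_mult iota_Tn)

lemma iota_C [simp]: "s \<in> S \<Longrightarrow> iota (C s) = C s"
  by (simp add: C_def iota_add iota_scale iota_Tn)

section \<open>The bar involution\<close>

lemma hinv_eq: "u * x = 1 \<Longrightarrow> x * u = 1 \<Longrightarrow> hinv x = u"
  unfolding hinv_def by (rule the_equality) (auto, metis mult.assoc mult_1_left mult_1_right)

lemma Tn_gen_inverse:
  assumes "s \<in> S"
  shows "Tn s * (Tn s - (vpow 1 - vpow (-1)) *s 1) = 1" "(Tn s - (vpow 1 - vpow (-1)) *s 1) * Tn s = 1"
  using Tn_square[OF assms] by (simp_all add: right_diff_distrib left_diff_distrib scale_mult_left scale_mult_right)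

definition Tb :: "'w \<Rightarrow> 'h" where
  "Tb w = hinv (Tn (inv w))"

lemma Tb_gen: "s \<in> S \<Longrightarrow> Tb s = Tn s - (vpow 1 - vpow (-1)) *s 1"
  unfolding Tb_def using hinv_eq Tn_gen_inverse by simp

lemma Tn_unit: "w \<in> carrier W \<Longrightarrow> \<exists>u. u * Tn w = 1 \<and> Tn w * u = 1"
proof (induction "len w" arbitrary: w)
  case 0
  then show ?case using len_eq_0[of w] Tn_one by (intro exI[of _ 1]) simp
next
  case (Suc n)
  then have "w \<noteq> \<one>" by auto
  then obtain s where s: "s \<in> left_descents w" using ex_left_descent Suc.prems by blast
  have sS: "s \<in> S" using s left_descentD by blast
  have w: "Tn w = Tn s * Tn (s \<otimes> w)" using Tn_gen_split s Suc.prems by blast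
  obtain u where u: "u * Tn (s \<otimes> w) = 1" "Tn (s \<otimes> w) * u = 1"
    using Suc.hyps(1)[of "s \<otimes> w"] Suc.hyps(2) Suc.prems left_descent_len[OF s] sS by auto
  let ?i = "Tn s - (vpow 1 - vpow (-1)) *s 1"
  have "u * ?i * Tn w = u * (?i * Tn s) * Tn (s \<otimes> w)" by (simp add: w mult.assoc)
  moreover have "Tn w * (u * ?i) = Tn s * (Tn (s \<otimes> w) * u) * ?i" by (simp add: w mult.assoc)
  ultimately show ?case using Tn_gen_inverse[OF sS] u by (intro exI[of _ "u * ?i"]) simp
qed

lemma Tb_inverse: "w \<in> carrier W \<Longrightarrow> Tb w * Tn (inv w) = 1 \<and> Tn (inv w) * Tb w = 1"
  using Tn_unit[of "inv w"] hinv_eq unfolding Tb_def by fastforce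

lemma Tb_eq: "w \<in> carrier W \<Longrightarrow> u * Tn (inv w) = 1 \<Longrightarrow> Tn (inv w) * u = 1 \<Longrightarrow> Tb w = u"
  unfolding Tb_def by (rule hinv_eq)

lemma Tb_one: "Tb \<one> = 1"
  by (rule Tb_eq) (simp_all add: Tn_one)

lemma Tb_up:
  assumes "s \<in> S" "w \<in> carrier W" "s \<notin> left_descents w" shows "Tb (s \<otimes> w) = Tb s * Tb w"
proof (rule Tb_eq)
  have "Tn (inv (s \<otimes> w)) = Tn (inv w) * Tn s"
    using Tn_mult[of "inv w" s] assms not_left_descent_len[of s w] len_inv[of "s \<otimes> w"]
    by (simp add: inv_mult_group)
  moreover have "Tb s * Tn s = 1" "Tn s * Tb s = 1" using Tb_inverse[of s] assms by auto
  moreover have "Tb w * Tn (inv w) = 1" "Tn (inv w) * Tb w = 1" using Tb_inverse[of w] assms by auto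
  ultimately show "Tb s * Tb w * Tn (inv (s \<otimes> w)) = 1" "Tn (inv (s \<otimes> w)) * (Tb s * Tb w) = 1"
    by (metis mult.assoc mult_1_left)+
qed (use assms in auto)

lemma hbar_eq:
  assumes "finite A" "A \<subseteq> carrier W" "\<And>w. w \<in> carrier W \<Longrightarrow> cf h w \<noteq> 0 \<Longrightarrow> w \<in> A"
  shows "hbar h = (\<Sum>w\<in>A. lbar (cf h w) *s Tb w)"
  unfolding hbar_def Tn_coeff_eq Tb_def[symmetric]
  by (rule sum.mono_neutral_left) (use assms in auto)

lemma hbar_add: "hbar (g + h) = hbar g + hbar h"
proof -
  let ?A = "{w \<in> carrier W. cf g w \<noteq> 0} \<union> {w \<in> carrier W. cf h w \<noteq> 0}"
  have f: "finite ?A" using Tn.finite_coef by blast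
  have "hbar (g + h) = (\<Sum>w\<in>?A. lbar (cf (g + h) w) *s Tb w)"
    by (rule hbar_eq) (use f in \<open>auto simp: Tn.coef_add\<close>)
  moreover have "hbar g = (\<Sum>w\<in>?A. lbar (cf g w) *s Tb w)" by (rule hbar_eq) (use f in auto)
  moreover have "hbar h = (\<Sum>w\<in>?A. lbar (cf h w) *s Tb w)" by (rule hbar_eq) (use f in auto)
  ultimately show ?thesis by (simp add: Tn.coef_add lbar_add scale_left_distrib sum.distrib)
qed

lemma hbar_scale: "hbar (a *s h) = lbar a *s hbar h"
proof -
  let ?A = "{w \<in> carrier W. cf h w \<noteq> 0}"
  have "hbar (a *s h) = (\<Sum>w\<in>?A. lbar (cf (a *s h) w) *s Tb w)"
    by (rule hbar_eq) (use Tn.finite_coef in \<open>auto simp: Tn.coef_scale\<close>)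
  moreover have "hbar h = (\<Sum>w\<in>?A. lbar (cf h w) *s Tb w)" by (rule hbar_eq) (use Tn.finite_coef in auto)
  ultimately show ?thesis by (simp add: Tn.coef_scale lbar_mult scale_sum_right)
qed

lemma hbar_Tn: "w \<in> carrier W \<Longrightarrow> hbar (Tn w) = Tb w"
  by (subst hbar_eq[of "{w}"]) (auto simp: Tn.coef_basis split: if_splits)

lemma hbar_0 [simp]: "hbar 0 = 0"
  by (subst hbar_eq[of "{}"]) auto

lemma hbar_uminus: "hbar (- h) = - hbar h"
  using hbar_add[of "- h" h] by (simp add: eq_neg_iff_add_eq_0)

lemma hbar_diff: "hbar (g - h) = hbar g - hbar h"
  using hbar_add[of g "- h"] by (simp add: hbar_uminus)

lemma hbar_sum: "hbar (sum f A) = (\<Sum>x\<in>A. hbar (f x))"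
  by (induction A rule: infinite_finite_induct) (auto simp: hbar_add)

text \<open>\<open>C s\<close> equals both \<open>Tn s + vpow (-1) *s 1\<close> and
  \<open>Tb s + vpow 1 *s 1\<close>, hence is its own bar image. In this form the multiplicativity
  of the bar involution enters the construction of the basis.\<close>

lemma hbar_C_mult: assumes "s \<in> S" shows "hbar (C s * h) = C s * hbar h"
proof (induction h rule: Tn.basis_induct)
  case (basis w)
  have Cs: "C s * g = Tb s * g + vpow 1 *s g" for g
    by (simp add: C_mult Tb_gen[OF assms] left_diff_distrib scale_mult_left scale_left_diff_distrib)
  show ?case
  proof (cases "s \<in> left_descents w")
    case True
    have w: "Tb w = Tb s * Tb (s \<otimes> w)"
      using Tb_up[of s "s \<otimes> w"] left_descent_mult[of w s] True assms basis by simp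
    have "C s * Tb w = (Tn s * Tb s) * Tb (s \<otimes> w) + vpow (-1) *s Tb w"
      by (simp add: C_mult w mult.assoc)
    also have "Tn s * Tb s = 1" using Tb_inverse[of s] assms by simp
    finally show ?thesis
      using C_Tn_down[OF basis True] basis assms by (simp add: hbar_add hbar_scale hbar_Tn)
  next
    case False
    then show ?thesis
      using C_Tn_up[OF assms basis False] basis assms Tb_up[OF assms basis False] Cs[of "Tb w"]
      by (simp add: hbar_add hbar_scale hbar_Tn)
  qed
qed (auto simp: distrib_left hbar_add hbar_scale scale_mult_right)

text \<open>Since \<open>Tb s\<close> is \<open>C s\<close> minus a scalar, peeling off one letter
  at a time gives unitriangularity with respect to length.\<close>

lemma cf_Tb:
  "w \<in> carrier W \<Longrightarrow> cf (Tb w) w = 1 \<and> (\<forall>y \<in> carrier W. cf (Tb w) y \<noteq> 0 \<longrightarrow> y = w \<or> len y < len w)"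
proof (induction "len w" arbitrary: w)
  case 0
  then have "w = \<one>" using len_eq_0 by simp
  then show ?case using Tb_one Tn_one Tn.coef_basis[of \<one>] by (auto split: if_splits)
next
  case (Suc n)
  then have "w \<noteq> \<one>" by auto
  then obtain s where s: "s \<in> left_descents w" using ex_left_descent Suc.prems by blast
  have sS: "s \<in> S" using s left_descentD by blast
  let ?x = "s \<otimes> w"
  have x: "?x \<in> carrier W" "s \<otimes> ?x = w" "s \<notin> left_descents ?x" "len w = len ?x + 1"
    using sS Suc.prems s left_descent_mult left_descent_len by auto
  have IH: "cf (Tb ?x) ?x = 1" "\<And>y. y \<in> carrier W \<Longrightarrow> cf (Tb ?x) y \<noteq> 0 \<Longrightarrow> y = ?x \<or> len y < len ?x"
    using Suc.hyps(1)[of ?x] Suc.hyps(2) x by auto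
  have "Tb w = Tb s * Tb ?x" using Tb_up[OF sS x(1,3)] x by simp
  also have "\<dots> = C s * Tb ?x - vpow 1 *s Tb ?x"
    by (simp add: C_mult Tb_gen[OF sS] left_diff_distrib scale_mult_left scale_left_diff_distrib)
  finally have e: "Tb w = C s * Tb ?x - vpow 1 *s Tb ?x" .
  have c: "cf (Tb w) y = cf (Tb ?x) (s \<otimes> y) + ((if s \<in> left_descents y then vpow 1 else vpow (-1)) - vpow 1) * cf (Tb ?x) y"
    if "y \<in> carrier W" for y
    unfolding e Tn.coef_diff Tn.coef_scale cf_C[OF sS that] by (simp add: algebra_simps)
  have "cf (Tb w) w = 1" using c[OF Suc.prems] s IH by simp
  moreover have "y = w \<or> len y < len w" if y: "y \<in> carrier W" "cf (Tb w) y \<noteq> 0" for y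
  proof -
    have "cf (Tb ?x) (s \<otimes> y) \<noteq> 0 \<or> cf (Tb ?x) y \<noteq> 0" using c[OF y(1)] y(2) by auto
    then show ?thesis
    proof
      assume "cf (Tb ?x) (s \<otimes> y) \<noteq> 0"
      then have "s \<otimes> y = ?x \<or> len (s \<otimes> y) < len ?x" using IH(2)[of "s \<otimes> y"] y sS by simp
      moreover have "s \<otimes> y = ?x \<Longrightarrow> y = w" using sS y Suc.prems by simp
      ultimately show ?thesis using len_gen_mult[OF sS y(1)] x by auto
    next
      assume "cf (Tb ?x) y \<noteq> 0"
      then show ?thesis using IH(2)[OF y(1)] x by auto
    qed
  qed
  ultimately show ?case by blast
qed

text \<open>At an element of maximal length in the support the bar involution merely conjugates the
  coefficient, by \<open>cf_Tb\<close>; a strictly negative coefficient equal to its conjugate is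
  0.\<close>

lemma bar_invariant_zero:
  assumes "hbar h = h" "\<And>y. y \<in> carrier W \<Longrightarrow> cf h y \<in> laurent_strict_neg" shows "h = 0"
proof (rule ccontr)
  assume "h \<noteq> 0"
  let ?A = "{y \<in> carrier W. cf h y \<noteq> 0}"
  have "?A \<noteq> {}" using \<open>h \<noteq> 0\<close> Tn.coef_ext[of h 0] by auto
  moreover have f: "finite ?A" by (rule Tn.finite_coef)
  ultimately have "Max (len ` ?A) \<in> len ` ?A" by (intro Max_in) auto
  then obtain y where y: "y \<in> ?A" "len y = Max (len ` ?A)" by auto
  have max: "len x \<le> len y" if "x \<in> ?A" for x using y(2) f that by auto
  have "cf (hbar h) y = (\<Sum>w\<in>?A. lbar (cf h w) * cf (Tb w) y)"
    by (subst hbar_eq[of ?A]) (use f in \<open>auto simp: Tn.coef_sum Tn.coef_scale\<close>)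
  also have "\<dots> = (\<Sum>w\<in>?A. if w = y then lbar (cf h y) else 0)"
  proof (rule sum.cong)
    fix w assume w: "w \<in> ?A"
    have "w \<noteq> y \<Longrightarrow> cf (Tb w) y = 0" using cf_Tb[of w] w y max[OF w] by force
    then show "lbar (cf h w) * cf (Tb w) y = (if w = y then lbar (cf h y) else 0)"
      using cf_Tb[of y] y by auto
  qed simp
  also have "\<dots> = lbar (cf h y)" using f y by simp
  finally have "lbar (cf h y) = cf h y" using assms(1) by simp
  then have "cf h y = 0" using strict_neg_symmetric assms(2) y by blast
  then show False using y by simp
qed

lemma hbar_iota: "hbar (iota h) = iota (hbar h)"
proof (induction h rule: Tn.basis_induct)
  case (basis w)
  have "Tb (inv w) = iota (Tb w)"
  proof (rule Tb_eq)
    have i: "iota (Tb w) * iota (Tn (inv w)) = iota (Tn (inv w) * Tb w)"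
      "iota (Tn (inv w)) * iota (Tb w) = iota (Tb w * Tn (inv w))" by (simp_all add: iota_mult)
    show "iota (Tb w) * Tn (inv (inv w)) = 1" "Tn (inv (inv w)) * iota (Tb w) = 1"
      using i Tb_inverse[of w] basis by (simp_all add: iota_Tn)
  qed (use basis in simp)
  then show ?case using basis by (simp add: iota_Tn hbar_Tn)
qed (auto simp: hbar_add hbar_scale iota_add iota_scale)

section \<open>The Kazhdan--Lusztig basis\<close>

text \<open>The defining conditions read off coefficient by coefficient, so that they can be checked
  without exhibiting a sum over the Bruhat interval.\<close>

definition KL_prop :: "'w \<Rightarrow> 'h \<Rightarrow> bool" where
  "KL_prop w c \<longleftrightarrow> hbar c = c \<and> cf c w = 1 \<and>
    (\<forall>y \<in> carrier W. y \<noteq> w \<longrightarrow> cf c y \<in> laurent_strict_neg \<and> (cf c y \<noteq> 0 \<longrightarrow> bruhat_less y w))"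

lemma is_KL_iff: assumes w: "w \<in> carrier W" shows "is_KL w c \<longleftrightarrow> KL_prop w c"
proof
  assume "is_KL w c"
  then obtain a where a: "hbar c = c" "\<And>y. bruhat_less y w \<Longrightarrow> a y \<in> laurent_strict_neg"
    "c = Tn w + (\<Sum>y | bruhat_less y w. a y *s Tn y)" by (auto simp: is_KL_def)
  have cfc: "cf c x = (if x = w then 1 else 0) + (if bruhat_less x w then a x else 0)" if x: "x \<in> carrier W" for x
  proof -
    have "cf (\<Sum>y | bruhat_less y w. a y *s Tn y) x = (\<Sum>y\<in>{y. bruhat_less y w}. if y = x then a x else 0)"
      unfolding Tn.coef_sum Tn.coef_scale
      by (rule sum.cong) (use x bruhat_less_closed in \<open>auto simp: Tn.coef_basis\<close>)
    then show ?thesis using a(3) w x finite_bruhat[of w] by (auto simp: Tn.coef_add Tn.coef_basis)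
  qed
  moreover have "\<not> bruhat_less w w" using bruhat_less_closed by blast
  ultimately show "KL_prop w c" using a w by (auto simp: KL_prop_def)
next
  assume k: "KL_prop w c"
  have n: "\<not> bruhat_less w w" using bruhat_less_closed by blast
  have "c = Tn w + (\<Sum>y | bruhat_less y w. cf c y *s Tn y)"
  proof (rule Tn.coef_ext)
    fix x assume x: "x \<in> carrier W"
    have "cf (\<Sum>y | bruhat_less y w. cf c y *s Tn y) x = (\<Sum>y\<in>{y. bruhat_less y w}. if y = x then cf c x else 0)"
      unfolding Tn.coef_sum Tn.coef_scale
      by (rule sum.cong) (use x bruhat_less_closed in \<open>auto simp: Tn.coef_basis\<close>)
    then show "cf c x = cf (Tn w + (\<Sum>y | bruhat_less y w. cf c y *s Tn y)) x"
      using k w x n finite_bruhat[of w] by (auto simp: Tn.coef_add Tn.coef_basis KL_prop_def)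
  qed
  moreover have "\<forall>y. bruhat_less y w \<longrightarrow> cf c y \<in> laurent_strict_neg"
    using k n bruhat_less_closed by (metis KL_prop_def)
  ultimately show "is_KL w c" using k unfolding is_KL_def KL_prop_def by blast
qed

lemma KL_prop_unique: "KL_prop w c \<Longrightarrow> KL_prop w c' \<Longrightarrow> c = c'"
proof -
  assume h: "KL_prop w c" "KL_prop w c'"
  have "c - c' = 0"
  proof (rule bar_invariant_zero)
    show "hbar (c - c') = c - c'" using h by (simp add: hbar_diff KL_prop_def)
    show "cf (c - c') y \<in> laurent_strict_neg" if "y \<in> carrier W" for y
      using h that by (cases "y = w") (auto simp: KL_prop_def Tn.coef_diff intro: strict_neg_diff)
  qed
  then show ?thesis by simp
qed

lemma KL_eqI: "w \<in> carrier W \<Longrightarrow> KL_prop w c \<Longrightarrow> KL w = c"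
  unfolding KL_def using is_KL_iff KL_prop_unique by (intro the_equality) auto

text \<open>The edge weight of the W-graph, in its one-sided form: for group elements it vanishes
  unless \<open>z\<close> is shorter than \<open>w\<close>.\<close>

definition mu :: "'w \<Rightarrow> 'w \<Rightarrow> int" where
  "mu z w = Poly_Mapping.lookup (cf (KL w) z) (-1)"

definition below :: "'w \<Rightarrow> 'w \<Rightarrow> 'w set" where
  "below s w = {z \<in> carrier W. s \<in> left_descents z \<and> mu z w \<noteq> 0}"

lemma KL_prop_len: "KL_prop w c \<Longrightarrow> y \<in> carrier W \<Longrightarrow> cf c y \<noteq> 0 \<Longrightarrow> y = w \<or> len y < len w"
  unfolding KL_prop_def using bruhat_less_closed by blast

lemma lbar_of_int: "lbar (of_int c) = of_int c"
  by (rule poly_mapping_eqI) (simp add: lookup_of_int when_def)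

lemma lookup_1: "Poly_Mapping.lookup (1::laurent) k = (if k = 0 then 1 else 0)"
  by (simp add: lookup_one when_def)

lemma mu_prop:
  assumes "KL_prop w (KL w)" "z \<in> carrier W" "mu z w \<noteq> 0" shows "bruhat_less z w"
proof -
  have "z \<noteq> w" using assms by (auto simp: mu_def KL_prop_def lookup_1)
  then show ?thesis using assms by (auto simp: mu_def KL_prop_def)
qed

lemma finite_below: "finite (below s w)"
  by (rule finite_subset[OF _ Tn.finite_coef[of "KL w"]]) (auto simp: below_def mu_def)

text \<open>At elements with descent \<open>s\<close>, multiplication by \<open>C s\<close>
  multiplies the old coefficient by \<open>v\<close>, so its part in degree -1 becomes a constant.
  Subtracting \<open>mu z w\<close> copies of \<open>KL z\<close> for these \<open>z\<close> removes
  exactly the constants and preserves bar invariance.\<close>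

lemma KL_step:
  assumes w: "w \<in> carrier W" "KL_prop w (KL w)" and s: "s \<in> S" "s \<notin> left_descents w"
    and z: "\<And>z. z \<in> below s w \<Longrightarrow> KL_prop z (KL z)"
  shows "KL_prop (s \<otimes> w) (C s * KL w - (\<Sum>z\<in>below s w. of_int (mu z w) *s KL z))"
proof -
  let ?Z = "below s w" and ?c = "KL w"
  let ?E = "C s * ?c - (\<Sum>z\<in>?Z. of_int (mu z w) *s KL z)"
  have hc: "hbar ?c = ?c" "cf ?c w = 1" "\<And>y. y \<in> carrier W \<Longrightarrow> y \<noteq> w \<Longrightarrow> cf ?c y \<in> laurent_strict_neg"
    "\<And>y. y \<in> carrier W \<Longrightarrow> cf ?c y \<noteq> 0 \<Longrightarrow> bruhat_less y w \<or> y = w"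
    using w by (auto simp: KL_prop_def)
  have Z: "z \<in> carrier W" "s \<in> left_descents z" "bruhat_less z w" "len z < len w" if "z \<in> ?Z" for z
    using that mu_prop[OF w(2)] bruhat_less_closed by (auto simp: below_def)
  have cfE: "cf ?E y = cf ?c (s \<otimes> y) + (if s \<in> left_descents y then vpow 1 else vpow (-1)) * cf ?c y
     - (\<Sum>z\<in>?Z. of_int (mu z w) * cf (KL z) y)" if "y \<in> carrier W" for y
    using that s by (simp add: Tn.coef_diff Tn.coef_sum Tn.coef_scale cf_C)
  have bar: "hbar ?E = ?E"
    using s hc(1) z by (simp add: hbar_diff hbar_C_mult hbar_sum hbar_scale lbar_of_int KL_prop_def)
  have sw: "s \<in> left_descents (s \<otimes> w)" "len (s \<otimes> w) = len w + 1" "s \<otimes> w \<in> carrier W" "s \<otimes> (s \<otimes> w) = w"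
    using s w left_descent_mult not_left_descent_len by auto
  have zero: "(\<Sum>z\<in>?Z. of_int (mu z w) * cf (KL z) (s \<otimes> w)) = 0"
  proof (rule sum.neutral, rule ballI)
    fix z' assume "z' \<in> ?Z"
    then have "cf (KL z') (s \<otimes> w) = 0" using KL_prop_len[OF z[of z'], of "s \<otimes> w"] Z[of z'] sw by force
    then show "of_int (mu z' w) * cf (KL z') (s \<otimes> w) = 0" by simp
  qed
  have "cf ?c (s \<otimes> w) = 0" using KL_prop_len[OF w(2), of "s \<otimes> w"] sw by force
  then have one: "cf ?E (s \<otimes> w) = 1" using cfE[OF sw(3)] sw zero hc by simp
  have neg: "cf ?E y \<in> laurent_strict_neg" if y: "y \<in> carrier W" "y \<noteq> s \<otimes> w" for y
  proof -
    have "s \<otimes> y \<noteq> w" using y s by auto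
    then have n1: "cf ?c (s \<otimes> y) \<in> laurent_strict_neg" using hc(3)[of "s \<otimes> y"] y s by simp
    show ?thesis
    proof (cases "s \<in> left_descents y")
      case False
      have "vpow (-1) * cf ?c y \<in> laurent_strict_neg"
        using hc(2) hc(3)[OF y(1)] by (cases "y = w") (auto simp: strict_neg_iff)
      moreover have "(\<Sum>z\<in>?Z. of_int (mu z w) * cf (KL z) y) \<in> laurent_strict_neg"
      proof (rule strict_neg_sum)
        fix z' assume z': "z' \<in> ?Z"
        have "y \<noteq> z'" using Z(2)[OF z'] False by auto
        then show "of_int (mu z' w) * cf (KL z') y \<in> laurent_strict_neg"
          using z[OF z'] y by (auto simp: KL_prop_def intro: strict_neg_of_int)
      qed
      ultimately show ?thesis using cfE[OF y(1)] n1 False by (auto intro: strict_neg_add strict_neg_diff)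
    next
      case True
      have yw: "y \<noteq> w" using True s by auto
      have a: "vpow 1 * cf ?c y - of_int (mu y w) \<in> laurent_strict_neg"
        using hc(3)[OF y(1) yw] by (auto simp: strict_neg_iff lookup_minus lookup_of_int mu_def when_def)
      have "(\<Sum>z\<in>?Z. of_int (mu z w) * cf (KL z) y) - of_int (mu y w) \<in> laurent_strict_neg"
      proof -
        have rest: "(\<Sum>z\<in>?Z - {y}. of_int (mu z w) * cf (KL z) y) \<in> laurent_strict_neg"
        proof (rule strict_neg_sum)
          fix z' assume z': "z' \<in> ?Z - {y}"
          then show "of_int (mu z' w) * cf (KL z') y \<in> laurent_strict_neg"
            using z[of z'] y by (auto simp: KL_prop_def intro: strict_neg_of_int)
        qed
        show ?thesis
        proof (cases "y \<in> ?Z")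
          case yes: True
          have "cf (KL y) y = 1" using z[OF yes] by (simp add: KL_prop_def)
          then show ?thesis using rest sum.remove[OF finite_below yes, of "\<lambda>z. of_int (mu z w) * cf (KL z) y"] by simp
        next
          case no: False
          then have "mu y w = 0" using True y by (simp add: below_def)
          then show ?thesis using rest no by simp
        qed
      qed
      from strict_neg_add[OF n1 strict_neg_diff[OF a this]] show ?thesis
        unfolding cfE[OF y(1)] using True by (simp add: algebra_simps)
    qed
  qed
  have br: "bruhat_less y (s \<otimes> w)" if y: "y \<in> carrier W" "y \<noteq> s \<otimes> w" "cf ?E y \<noteq> 0" for y
  proof -
    note lift = bruhat_lift[OF _ w(1) s]
    consider "cf ?c (s \<otimes> y) \<noteq> 0" | "cf ?c y \<noteq> 0" | z' where "z' \<in> ?Z" "cf (KL z') y \<noteq> 0"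
      using cfE[OF y(1)] y(3) sum.neutral[of ?Z "\<lambda>z. of_int (mu z w) * cf (KL z) y"] by force
    then show ?thesis
    proof cases
      case 1
      then have "bruhat_less (s \<otimes> y) w \<or> s \<otimes> y = w" using hc(4) y s by simp
      from lift(1)[OF this] show ?thesis using y s by simp
    next
      case 2
      then show ?thesis using lift(2) hc(4) y by blast
    next
      case 3
      have "bruhat_less y z' \<or> y = z'" using 3 z[OF 3(1)] y by (auto simp: KL_prop_def)
      then have "bruhat_less y w" using Z(3)[OF 3(1)] unfolding bruhat_less_def by auto
      then show ?thesis using lift(2) by blast
    qed
  qed
  show ?thesis unfolding KL_prop_def using bar one neg br by blast
qed

lemma KL_prop_one: "KL_prop \<one> 1"
  using hbar_Tn[of \<one>] Tb_one Tn_one Tn.coef_basis[of \<one>] by (auto simp: KL_prop_def split: if_splits)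

theorem KL_prop_KL: "w \<in> carrier W \<Longrightarrow> KL_prop w (KL w)"
proof (induction "len w" arbitrary: w rule: less_induct)
  case less
  show ?case
  proof (cases "w = \<one>")
    case True
    then show ?thesis using KL_prop_one KL_eqI by fastforce
  next
    case False
    then obtain s where s: "s \<in> left_descents w" using ex_left_descent less.prems by blast
    have sS: "s \<in> S" using s left_descentD by blast
    let ?x = "s \<otimes> w"
    have x: "?x \<in> carrier W" "s \<otimes> ?x = w" "s \<notin> left_descents ?x" "len w = len ?x + 1"
      using sS less.prems s left_descent_mult left_descent_len by auto
    have k: "KL_prop ?x (KL ?x)" using less.hyps[of ?x] x by simp
    have "KL_prop z (KL z)" if "z \<in> below s ?x" for z
    proof -
      have "bruhat_less z ?x" using mu_prop[OF k] that by (auto simp: below_def)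
      then show ?thesis using less.hyps[of z] bruhat_less_closed x by force
    qed
    from KL_step[OF x(1) k sS x(3) this] have "KL_prop w (C s * KL ?x - (\<Sum>z\<in>below s ?x. of_int (mu z ?x) *s KL z))"
      using x by simp
    then show ?thesis using KL_eqI less.prems by metis
  qed
qed

lemma KL_one: "KL \<one> = 1"
  using KL_eqI KL_prop_one by simp

lemma KL_up:
  assumes "w \<in> carrier W" "s \<in> S" "s \<notin> left_descents w"
  shows "C s * KL w = KL (s \<otimes> w) + (\<Sum>z\<in>below s w. of_int (mu z w) *s KL z)"
proof -
  have "KL_prop (s \<otimes> w) (C s * KL w - (\<Sum>z\<in>below s w. of_int (mu z w) *s KL z))"
    by (rule KL_step) (use assms KL_prop_KL in \<open>auto simp: below_def\<close>)
  then show ?thesis using KL_eqI[of "s \<otimes> w"] assms by (simp add: algebra_simps)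
qed

lemma below_len: "w \<in> carrier W \<Longrightarrow> z \<in> below s w \<Longrightarrow> z \<in> carrier W \<and> s \<in> left_descents z \<and> len z < len w"
  using mu_prop[OF KL_prop_KL, of w z] bruhat_less_closed by (auto simp: below_def)

text \<open>By \<open>KL_up\<close>, \<open>KL w\<close> is \<open>C s\<close> times an element
  minus a combination of shorter \<open>KL z\<close> with descent \<open>s\<close>; induction covers
  the latter, \<open>C_square\<close> the former.\<close>

lemma KL_down: "w \<in> carrier W \<Longrightarrow> s \<in> left_descents w \<Longrightarrow> C s * KL w = laurent_delta *s KL w"
proof (induction "len w" arbitrary: w rule: less_induct)
  case less
  have sS: "s \<in> S" using less.prems left_descentD by blast
  let ?x = "s \<otimes> w"
  have x: "?x \<in> carrier W" "s \<otimes> ?x = w" "s \<notin> left_descents ?x" "len w = len ?x + 1"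
    using sS less.prems left_descent_mult left_descent_len by auto
  have e: "KL w = C s * KL ?x - (\<Sum>z\<in>below s ?x. of_int (mu z ?x) *s KL z)"
    using KL_up[OF x(1) sS x(3)] x by simp
  have "C s * KL z = laurent_delta *s KL z" if "z \<in> below s ?x" for z
    using less.hyps[of z] below_len[OF x(1) that] x by simp
  then have "C s * (\<Sum>z\<in>below s ?x. of_int (mu z ?x) *s KL z) = laurent_delta *s (\<Sum>z\<in>below s ?x. of_int (mu z ?x) *s KL z)"
    unfolding sum_distrib_left scale_sum_right
    by (intro sum.cong) (auto simp: scale_mult_right mult.commute)
  moreover have "C s * (C s * KL ?x) = laurent_delta *s (C s * KL ?x)"
    using C_square[OF sS] by (simp add: mult.assoc[symmetric] scale_mult_left)
  ultimately show ?case by (subst (1 2) e) (simp add: right_diff_distrib scale_right_diff_distrib)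
qed

lemma KL_cf_self: "w \<in> carrier W \<Longrightarrow> cf (KL w) w = 1"
  and KL_cf_neg: "w \<in> carrier W \<Longrightarrow> y \<in> carrier W \<Longrightarrow> y \<noteq> w \<Longrightarrow> cf (KL w) y \<in> laurent_strict_neg"
  and KL_cf_len: "w \<in> carrier W \<Longrightarrow> y \<in> carrier W \<Longrightarrow> cf (KL w) y \<noteq> 0 \<Longrightarrow> y = w \<or> len y < len w"
  using KL_prop_KL[of w] KL_prop_len[of w "KL w" y] by (auto simp: KL_prop_def)

lemma mu_len: "w \<in> carrier W \<Longrightarrow> z \<in> carrier W \<Longrightarrow> mu z w \<noteq> 0 \<Longrightarrow> len z < len w"
  using mu_prop[OF KL_prop_KL] bruhat_less_closed by blast

text \<open>An eigenvector is determined by its coefficients at elements with descent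
  \<open>s\<close>; in particular all its longest terms have that descent.\<close>

lemma cf_eigen:
  assumes "C s * h = laurent_delta *s h" "s \<in> S" "y \<in> carrier W" "s \<notin> left_descents y"
  shows "cf h y = vpow (-1) * cf h (s \<otimes> y)"
proof -
  have "laurent_delta * cf h y = cf h (s \<otimes> y) + vpow (-1) * cf h y"
    using cf_C[OF assms(2,3), of h] assms(1,4) by (simp add: Tn.coef_scale)
  then have "vpow 1 * cf h y = cf h (s \<otimes> y)" by (simp add: laurent_delta_def algebra_simps)
  then have "vpow (-1) * (vpow 1 * cf h y) = vpow (-1) * cf h (s \<otimes> y)" by simp
  then show ?thesis by (simp add: mult.assoc[symmetric] vpow_add[symmetric] vpow_0)
qed

lemma KL_cf_ascent:
  "w \<in> carrier W \<Longrightarrow> s \<in> left_descents w \<Longrightarrow> y \<in> carrier W \<Longrightarrow> s \<notin> left_descents y \<Longrightarrow>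
    cf (KL w) y = vpow (-1) * cf (KL w) (s \<otimes> y)"
  using cf_eigen[OF KL_down] left_descentD by blast

text \<open>The coefficient at \<open>z\<close> is \<open>v^-1\<close> times the one at
  \<open>s \<otimes> z\<close>. The latter is 1 if \<open>s \<otimes> z = w\<close> and strictly
  negative otherwise, in which case nothing is left in degree -1.\<close>

lemma mu_ascent:
  assumes "w \<in> carrier W" "s \<in> left_descents w" "z \<in> carrier W" "s \<notin> left_descents z"
  shows "mu z w = (if s \<otimes> z = w then 1 else 0)"
proof -
  have "s \<in> S" using assms left_descentD by blast
  then have "s \<otimes> z \<in> carrier W" using assms by simp
  then show ?thesis
    using KL_cf_ascent[OF assms] KL_cf_self[OF assms(1)] KL_cf_neg[OF assms(1), of "s \<otimes> z"]
    by (auto simp: mu_def lookup_1 strict_neg_iff)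
qed

lemma iota_KL: assumes w: "w \<in> carrier W" shows "iota (KL w) = KL (inv w)"
proof -
  have "iota (KL w) - KL (inv w) = 0"
  proof (rule bar_invariant_zero)
    show "hbar (iota (KL w) - KL (inv w)) = iota (KL w) - KL (inv w)"
      using KL_prop_KL[of w] KL_prop_KL[of "inv w"] w by (simp add: hbar_diff hbar_iota KL_prop_def)
    fix y assume y: "y \<in> carrier W"
    show "cf (iota (KL w) - KL (inv w)) y \<in> laurent_strict_neg"
    proof (cases "y = inv w")
      case True
      then show ?thesis using w y KL_cf_self[of w] KL_cf_self[of "inv w"] by (simp add: Tn.coef_diff cf_iota)
    next
      case False
      then have "inv y \<noteq> w" using y by auto
      then show ?thesis using w y False KL_cf_neg[of w "inv y"] KL_cf_neg[of "inv w" y]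
        by (simp add: Tn.coef_diff cf_iota strict_neg_diff)
    qed
  qed
  then show ?thesis by simp
qed

lemma mu_inv: "w \<in> carrier W \<Longrightarrow> z \<in> carrier W \<Longrightarrow> mu (inv z) (inv w) = mu z w"
  using cf_iota[of "inv z" "KL w"] iota_KL[of w] by (simp add: mu_def)

section \<open>The Kazhdan--Lusztig elements as a basis\<close>

lemma KL_inj: "inj_on KL (carrier W)"
proof (rule inj_onI, rule ccontr)
  fix x y assume h: "x \<in> carrier W" "y \<in> carrier W" "KL x = KL y" "x \<noteq> y"
  then have "(1::laurent) \<in> laurent_strict_neg" using KL_cf_self[of x] KL_cf_neg[of y x] by simp
  then have "Poly_Mapping.lookup (1::laurent) 0 = 0" unfolding strict_neg_iff by blast
  then show False by simp
qed

lemma KL_independent: "independent (KL ` carrier W)"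
  unfolding independent_explicit_module
proof (intro allI impI, rule ccontr)
  fix t u v assume t: "finite t" "t \<subseteq> KL ` carrier W" "(\<Sum>v\<in>t. u v *s v) = 0" "v \<in> t" "u v \<noteq> 0"
  obtain A where A: "A \<subseteq> carrier W" "finite A" "t = KL ` A"
    using finite_subset_image[OF t(1,2)] by blast
  have injA: "inj_on KL A" using A KL_inj inj_on_subset by blast
  let ?B = "{w \<in> A. u (KL w) \<noteq> 0}"
  have "?B \<noteq> {}" "finite ?B" using t A by auto
  then have "Max (len ` ?B) \<in> len ` ?B" by (intro Max_in) auto
  then obtain y where y: "y \<in> ?B" "len y = Max (len ` ?B)" by auto
  have max: "len x \<le> len y" if "x \<in> ?B" for x using y(2) A that by auto
  have "0 = (\<Sum>w\<in>A. u (KL w) *s KL w)" using t(3) unfolding A(3) by (subst (asm) sum.reindex[OF injA]) auto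
  then have "0 = cf (\<Sum>w\<in>A. u (KL w) *s KL w) y" by (metis Tn.coef_zero)
  also have "\<dots> = (\<Sum>w\<in>A. u (KL w) * cf (KL w) y)" by (simp add: Tn.coef_sum Tn.coef_scale)
  also have "\<dots> = (\<Sum>w\<in>A. if w = y then u (KL y) else 0)"
  proof (rule sum.cong)
    fix w assume w: "w \<in> A"
    show "u (KL w) * cf (KL w) y = (if w = y then u (KL y) else 0)"
    proof (cases "w = y")
      case True then show ?thesis using KL_cf_self[of y] A w by auto
    next
      case False
      have "cf (KL w) y = 0" if "u (KL w) \<noteq> 0"
      proof (rule ccontr)
        assume "cf (KL w) y \<noteq> 0"
        then have "len y < len w" using KL_cf_len[of w y] False A(1) w y(1) by blast
        then show False using max[of w] w that by simp
      qed
      then show ?thesis using False by auto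
    qed
  qed simp
  also have "\<dots> = u (KL y)" using y A by simp
  finally show False using y by simp
qed

lemma KL_span: "span (KL ` carrier W) = UNIV"
proof -
  have "Tn w \<in> span (KL ` carrier W)" if "w \<in> carrier W" for w
    using that
  proof (induction "len w" arbitrary: w rule: less_induct)
    case less
    let ?A = "{y. y \<in> carrier W \<and> cf (KL w) y \<noteq> 0}"
    have f: "finite ?A" using Tn.finite_coef by simp
    have wA: "w \<in> ?A" using KL_cf_self less.prems by simp
    have e: "KL w = Tn w + (\<Sum>y\<in>?A - {w}. cf (KL w) y *s Tn y)"
      using Tn.expand[of "KL w"] sum.remove[OF f wA, of "\<lambda>y. cf (KL w) y *s Tn y"] KL_cf_self[OF less.prems] by simp
    have "(\<Sum>y\<in>?A - {w}. cf (KL w) y *s Tn y) \<in> span (KL ` carrier W)"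
      using less KL_cf_len by (intro span_sum span_scale) blast
    moreover have "KL w \<in> span (KL ` carrier W)" using less.prems by (intro span_base) auto
    ultimately have m1: "KL w - (\<Sum>y\<in>?A - {w}. cf (KL w) y *s Tn y) \<in> span (KL ` carrier W)"
      using span_diff by blast
    have m2: "KL w - (\<Sum>y\<in>?A - {w}. cf (KL w) y *s Tn y) = Tn w"
      by (rule diff_eq_eq[THEN iffD2, OF e])
    from m1[unfolded m2] show ?case .
  qed
  then have "Tn ` carrier W \<subseteq> span (KL ` carrier W)" by auto
  then have "span (Tn ` carrier W) \<subseteq> span (KL ` carrier W)" using span_minimal subspace_span by blast
  then show ?thesis using Tn_span by auto
qed

sublocale KL: indexed_basis scale KL "carrier W"
  by unfold_locales (use KL_inj KL_independent KL_span in auto)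

end

section \<open>Elements of bounded length\<close>

context hecke_algebra
begin

text \<open>The bound is strict: \<open>low 0\<close> characterizes zero and
  \<open>low (Suc n)\<close> allows lengths up to \<open>n\<close>, whence the \<open>Suc\<close> in
  the product rules.\<close>

definition low :: "nat \<Rightarrow> 'h \<Rightarrow> bool" where
  "low n h \<longleftrightarrow> (\<forall>w \<in> carrier W. cf h w \<noteq> 0 \<longrightarrow> len w < n)"

lemma low_0 [simp]: "low n 0"
  and low_add: "low n g \<Longrightarrow> low n h \<Longrightarrow> low n (g + h)"
  and low_diff: "low n g \<Longrightarrow> low n h \<Longrightarrow> low n (g - h)"
  and low_scale: "low n h \<Longrightarrow> low n (a *s h)"
  and low_mono: "low n h \<Longrightarrow> n \<le> k \<Longrightarrow> low k h"
  by (auto simp: low_def Tn.coef_add Tn.coef_diff Tn.coef_scale)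

lemma low_sum: "(\<And>x. x \<in> A \<Longrightarrow> low n (f x)) \<Longrightarrow> low n (sum f A)"
  by (induction A rule: infinite_finite_induct) (auto intro: low_add)

lemma low_Tn: "w \<in> carrier W \<Longrightarrow> len w < n \<Longrightarrow> low n (Tn w)"
  by (auto simp: low_def Tn.coef_basis split: if_splits)

lemma low_zero_eq: "low 0 h \<Longrightarrow> h = 0"
  by (rule Tn.coef_ext) (auto simp: low_def)

lemma low_expand:
  assumes "low n h" shows "h = (\<Sum>w | w \<in> carrier W \<and> len w < n. cf h w *s Tn w)"
proof -
  have f: "finite {w. w \<in> carrier W \<and> len w < n}"
    by (rule finite_subset[OF _ finite_len_le[of n]]) auto
  have "h = (\<Sum>w | w \<in> carrier W \<and> cf h w \<noteq> 0. cf h w *s Tn w)" by (rule Tn.expand)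
  also have "\<dots> = (\<Sum>w | w \<in> carrier W \<and> len w < n. cf h w *s Tn w)"
    by (rule sum.mono_neutral_left) (use assms f in \<open>auto simp: low_def\<close>)
  finally show ?thesis .
qed

lemma low_gen_mult: assumes "s \<in> S" "low n h" shows "low (Suc n) (Tn s * h)"
  unfolding low_def
proof (intro ballI impI)
  fix w assume w: "w \<in> carrier W" "cf (Tn s * h) w \<noteq> 0"
  have "Tn s * h = C s * h - vpow (-1) *s h" by (simp add: C_mult)
  then have "cf (Tn s * h) w = cf (C s * h) w - vpow (-1) * cf h w" by (simp add: Tn.coef_diff Tn.coef_scale)
  then have "cf h (s \<otimes> w) \<noteq> 0 \<or> cf h w \<noteq> 0" using w cf_C[OF assms(1) w(1), of h] by auto
  then show "len w < Suc n"
  proof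
    assume "cf h (s \<otimes> w) \<noteq> 0"
    then have "len (s \<otimes> w) < n" using assms w by (simp add: low_def)
    then show ?thesis using len_gen_mult[OF assms(1) w(1)] by auto
  next
    assume "cf h w \<noteq> 0"
    then have "len w < n" using assms w by (simp add: low_def)
    then show ?thesis by simp
  qed
qed

lemma low_Tn_mult: "x \<in> carrier W \<Longrightarrow> low n h \<Longrightarrow> low (len x + n) (Tn x * h)"
proof (induction "len x" arbitrary: x)
  case 0
  then show ?case using len_eq_0[of x] Tn_one by simp
next
  case (Suc k)
  then have "x \<noteq> \<one>" by auto
  then obtain s where s: "s \<in> left_descents x" using ex_left_descent Suc.prems by blast
  have sS: "s \<in> S" using s left_descentD by blast
  have l: "len x = len (s \<otimes> x) + 1" using left_descent_len s Suc.prems by blast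
  have "low (len (s \<otimes> x) + n) (Tn (s \<otimes> x) * h)" using Suc l sS by auto
  from low_gen_mult[OF sS this] show ?case
    using Tn_gen_split[OF Suc.prems(1) s] l by (simp add: mult.assoc)
qed

lemma low_mult: assumes "low (Suc i) g" "low j h" shows "low (i + j) (g * h)"
proof -
  have "g * h = (\<Sum>w | w \<in> carrier W \<and> len w < Suc i. cf g w *s (Tn w * h))"
    by (subst low_expand[OF assms(1)]) (simp add: sum_distrib_right scale_mult_left)
  moreover have "low (i + j) (Tn w * h)" if "w \<in> carrier W" "len w < Suc i" for w
    using low_Tn_mult[OF that(1) assms(2)] that(2) by (auto intro: low_mono)
  ultimately show ?thesis by (auto intro!: low_sum low_scale)
qed

lemma low_iota: "low n h \<Longrightarrow> low n (iota h)"
  by (auto simp: low_def cf_iota)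

lemma low_mult': assumes "low i g" "low (Suc j) h" shows "low (i + j) (g * h)"
proof -
  have "low (j + i) (iota h * iota g)" using low_mult low_iota assms by blast
  then have "low (j + i) (iota (iota h * iota g))" by (rule low_iota)
  then show ?thesis by (simp add: iota_mult add.commute)
qed

lemma low_C: "s \<in> S \<Longrightarrow> low 2 (C s)"
  by (auto simp: C_def simp flip: Tn_one intro!: low_add low_scale low_Tn)

lemma low_1: "low (Suc 0) 1"
  using low_Tn[of \<one> "Suc 0"] Tn_one by simp

section \<open>Sums over finite dihedral subgroups\<close>

text \<open>For a finite bond \<open>m\<close> this is \<open>v^-m\<close> times the plain sum of
  the \<open>T x\<close>, that is, the \<open>C'\<close> element of the longest element; its leading
  coefficient is 1.\<close>

definition Edih :: "'w \<Rightarrow> 'w \<Rightarrow> 'h" where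
  "Edih a b = (\<Sum>x\<in>dihedral a b. vpow (int (len x) - int (the_enat (m a b))) *s Tn x)"

lemma finite_dihedral:
  assumes "a \<in> S" "b \<in> S" "a \<noteq> b" "m a b = enat k" shows "finite (dihedral a b)"
  using longest_dihedral[OF assms(1-3), of "alt a b k"] assms generate_eq_dihedral[OF assms(1-3)] by auto

lemma dihedral_len:
  assumes "a \<in> S" "b \<in> S" "a \<noteq> b" "m a b = enat k" "x \<in> dihedral a b"
  shows "len x \<le> k" "len x = k \<Longrightarrow> x = alt a b k"
    "p \<in> {a, b} \<Longrightarrow> len x = k - 1 \<Longrightarrow> p \<notin> left_descents x \<Longrightarrow> x = p \<otimes> alt a b k"
proof -
  obtain c d j where x: "x = alt c d j" "{c, d} = {a, b}" "enat j \<le> m a b"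
    using assms(5) by (auto simp: dihedral_def)
  have cd: "c \<in> S" "d \<in> S" "c \<noteq> d" "m c d = enat k" "m d c = enat k"
    using x assms m_sym[of a b] by (auto simp: doubleton_eq_iff)
  have l: "len x = j" using alt_len_one[of c d j] cd x assms by simp
  show "len x \<le> k" using l x assms by simp
  have top: "alt c d k = alt a b k" using alt_longest[OF assms(1,2,4)] x by (auto simp: doubleton_eq_iff)
  show "x = alt a b k" if "len x = k" using that l x top by simp
  assume p: "p \<in> {a, b}" "len x = k - 1" "p \<notin> left_descents x"
  have "2 \<le> k" using m_off_diag[OF cd(1-3)] cd(4) by (simp add: numeral_eq_enat)
  then obtain i where i: "k = Suc (Suc i)" by (metis add_2_eq_Suc le_Suc_ex)
  have j: "j = Suc i" using p l i by simp
  have "c \<in> left_descents x" using alt_descent[of c d \<one> i] cd i x j by simp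
  then have "p = d" using p x by auto
  then have "x = p \<otimes> alt d c k" using x j i cd by (simp add: alt_Suc)
  also have "alt d c k = alt a b k" using alt_longest[OF cd(1,2,4)] top by simp
  finally show "x = p \<otimes> alt a b k" .
qed

lemma dihedral_gen_iff:
  assumes "a \<in> S" "b \<in> S" "a \<noteq> b" "p \<in> {a, b}" "y \<in> carrier W"
  shows "p \<otimes> y \<in> dihedral a b \<longleftrightarrow> y \<in> dihedral a b"
  using dihedral_gen_mult[OF assms(1-4), of y] dihedral_gen_mult[OF assms(1-4), of "p \<otimes> y"] assms by auto

lemma cf_dihedral_sum:
  assumes "finite A" "A \<subseteq> carrier W" "y \<in> carrier W"
  shows "cf (\<Sum>x\<in>A. f x *s Tn x) y = (if y \<in> A then f y else 0)"
proof -
  have "cf (\<Sum>x\<in>A. f x *s Tn x) y = (\<Sum>x\<in>A. if x = y then f y else 0)"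
    unfolding Tn.coef_sum Tn.coef_scale by (rule sum.cong) (use assms in \<open>auto simp: Tn.coef_basis\<close>)
  then show ?thesis using assms by simp
qed

context
  fixes a b :: 'w and k :: nat
  assumes ab: "a \<in> S" "b \<in> S" "a \<noteq> b" "m a b = enat k"
begin

lemma k_ge_2: "2 \<le> k"
  using m_off_diag[OF ab(1-3)] ab(4) by (simp add: numeral_eq_enat)

lemma top_closed: "alt a b k \<in> carrier W" "len (alt a b k) = k" "alt a b k \<in> dihedral a b"
  using alt_len_one[of a b k] ab by (auto simp: dihedral_def)

lemma dihedral_sub: "dihedral a b \<subseteq> carrier W"
  using dihedral_closed ab by blast

lemma cf_Edih: "y \<in> carrier W \<Longrightarrow> cf (Edih a b) y = (if y \<in> dihedral a b then vpow (int (len y) - int k) else 0)"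
  unfolding Edih_def using cf_dihedral_sum[OF finite_dihedral[OF ab] dihedral_sub] ab(4) by simp

lemma dihedral_inv: "y \<in> carrier W \<Longrightarrow> inv y \<in> dihedral a b \<longleftrightarrow> y \<in> dihedral a b"
  using generate_m_inv_closed[of "{a,b}" y] generate_m_inv_closed[of "{a,b}" "inv y"]
    generate_eq_dihedral[OF ab(1-3)] ab by auto

lemma iota_Edih: "iota (Edih a b) = Edih a b"
  by (rule Tn.coef_ext) (simp add: cf_iota cf_Edih dihedral_inv)

lemma low_Edih: "low k (Edih a b - Tn (alt a b k))" "low (Suc k) (Edih a b)"
proof -
  show 1: "low k (Edih a b - Tn (alt a b k))"
    unfolding low_def
  proof (intro ballI impI)
    fix y assume y: "y \<in> carrier W" "cf (Edih a b - Tn (alt a b k)) y \<noteq> 0"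
    have c: "cf (Edih a b - Tn (alt a b k)) y = (if y \<in> dihedral a b then vpow (int (len y) - int k) else 0) - (if y = alt a b k then 1 else 0)"
      using y top_closed by (simp add: Tn.coef_diff cf_Edih Tn.coef_basis)
    have "y \<in> dihedral a b \<and> y \<noteq> alt a b k"
    proof (cases "y = alt a b k")
      case True
      then show ?thesis using c y top_closed by (simp add: vpow_0)
    qed (use c y in \<open>auto split: if_splits\<close>)
    then show "len y < k" using dihedral_len(1,2)[OF ab, of y] by (metis le_neq_implies_less)
  qed
  have "low (Suc k) (Edih a b - Tn (alt a b k) + Tn (alt a b k))"
    using low_mono[OF 1] low_Tn[OF top_closed(1)] top_closed by (intro low_add) auto
  then show "low (Suc k) (Edih a b)" by simp
qed

text \<open>The subgroup splits into pairs \<open>x\<close>, \<open>p \<otimes> x\<close> with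
  \<open>p\<close> no descent of \<open>x\<close>, and each weighted pair is a scalar multiple of
  \<open>C p * Tn x\<close>. The leading term of the cofactor is the longest element with the letter
  \<open>p\<close> removed from the left.\<close>

lemma Edih_factor:
  assumes p: "p \<in> {a, b}"
  obtains D where "Edih a b = C p * D" "low (k - 1) (D - Tn (p \<otimes> alt a b k))" "low k D"
    "D = (\<Sum>x | x \<in> dihedral a b \<and> p \<notin> left_descents x. vpow (int (len x) + 1 - int k) *s Tn x)"
proof -
  have pS: "p \<in> S" using p ab by auto
  let ?A = "{x. x \<in> dihedral a b \<and> p \<notin> left_descents x}"
  define D where "D = (\<Sum>x\<in>?A. vpow (int (len x) + 1 - int k) *s Tn x)"
  have fin: "finite ?A" "?A \<subseteq> carrier W" using finite_dihedral[OF ab] dihedral_sub by auto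
  have cfD: "cf D y = (if y \<in> ?A then vpow (int (len y) + 1 - int k) else 0)" if "y \<in> carrier W" for y
    unfolding D_def using cf_dihedral_sum[OF fin that] by simp
  have "Edih a b = C p * D"
  proof (rule Tn.coef_ext)
    fix y assume y: "y \<in> carrier W"
    have py: "p \<otimes> y \<in> carrier W" "p \<otimes> y \<in> dihedral a b \<longleftrightarrow> y \<in> dihedral a b"
      "p \<in> left_descents (p \<otimes> y) \<longleftrightarrow> p \<notin> left_descents y"
      using y pS dihedral_gen_iff[OF ab(1-3) p y] left_descent_mult by auto
    have ev: "vpow (-1) * vpow (int (len y) + 1 - int k) = vpow (int (len y) - int k)"
      by (simp add: vpow_add[symmetric])
    show "cf (Edih a b) y = cf (C p * D) y"
    proof (cases "p \<in> left_descents y")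
      case True
      have "int (len (p \<otimes> y)) + 1 = int (len y)" using left_descent_len[OF True y] by simp
      then show ?thesis using True py y by (simp add: cf_Edih cf_C[OF pS y] cfD)
    next
      case False
      then show ?thesis using py y ev by (simp add: cf_Edih cf_C[OF pS y] cfD)
    qed
  qed
  moreover have t: "p \<otimes> alt a b k \<in> carrier W" "len (p \<otimes> alt a b k) = k - 1" "p \<otimes> alt a b k \<in> ?A" 
  proof -
    define q where "q = (if p = a then b else a)"
    have q: "q \<in> S" "p \<noteq> q" "m p q = enat k" using p ab m_sym[of a b] by (auto simp: q_def)
    have "alt a b k = alt p q k" using p alt_longest[OF ab(1,2,4)] by (auto simp: q_def)
    then have e: "alt a b k = alt p q (Suc (k - 1)) \<otimes> \<one>" using k_ge_2 pS q(1) by simp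
    have "p \<in> left_descents (alt p q (Suc (k - 1)) \<otimes> \<one>)"
      by (rule alt_descent) (use pS q k_ge_2 in auto)
    then have "p \<in> left_descents (alt a b k)" using e by simp
    then show "len (p \<otimes> alt a b k) = k - 1" "p \<otimes> alt a b k \<in> carrier W" "p \<otimes> alt a b k \<in> ?A" 
      using left_descent_len[of p "alt a b k"] top_closed pS dihedral_gen_iff[OF ab(1-3) p] left_descent_mult[of "alt a b k" p] by auto
  qed
  moreover have lowD: "low (k - 1) (D - Tn (p \<otimes> alt a b k))"
    unfolding low_def
  proof (intro ballI impI)
    fix y assume y: "y \<in> carrier W" "cf (D - Tn (p \<otimes> alt a b k)) y \<noteq> 0"
    have c: "cf (D - Tn (p \<otimes> alt a b k)) y = (if y \<in> ?A then vpow (int (len y) + 1 - int k) else 0) - (if y = p \<otimes> alt a b k then 1 else 0)"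
      using y t(1) by (simp add: Tn.coef_diff cfD Tn.coef_basis)
    have "y \<in> ?A \<and> y \<noteq> p \<otimes> alt a b k"
    proof (cases "y = p \<otimes> alt a b k")
      case True
      have "int (len y) + 1 - int k = 0" using True t k_ge_2 by simp
      then have "cf (D - Tn (p \<otimes> alt a b k)) y = 0" using c True t(3) by (simp add: vpow_0)
      then show ?thesis using y by simp
    qed (use c y in \<open>auto split: if_splits\<close>)
    moreover have "y \<noteq> alt a b k"
    proof
      assume "y = alt a b k"
      then have "p \<notin> left_descents (alt a b k)" using \<open>y \<in> ?A \<and> _\<close> by simp
      then show False using t(3) left_descent_mult[of "alt a b k" p] top_closed pS by auto
    qed
    ultimately have "len y \<noteq> k" "len y \<noteq> k - 1" "len y \<le> k"
      using dihedral_len[OF ab, of y] p by auto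
    then show "len y < k - 1" by simp
  qed
  moreover have "low k D"
  proof -
    have "low k (D - Tn (p \<otimes> alt a b k) + Tn (p \<otimes> alt a b k))"
      using low_mono[OF lowD] low_Tn[OF t(1)] t k_ge_2 by (intro low_add) auto
    then show ?thesis by simp
  qed
  ultimately show thesis using that[of D] D_def by blast
qed

lemma C_Edih: "p \<in> {a, b} \<Longrightarrow> C p * Edih a b = laurent_delta *s Edih a b"
proof -
  assume p: "p \<in> {a, b}"
  then have "p \<in> S" using ab by auto
  obtain D where D: "Edih a b = C p * D" using Edih_factor[OF p] by blast
  have "C p * Edih a b = (C p * C p) * D" unfolding D by (simp add: mult.assoc)
  then show ?thesis unfolding C_square[OF \<open>p \<in> S\<close>] D by (simp add: scale_mult_left)
qed

lemma Edih_C: "p \<in> {a, b} \<Longrightarrow> Edih a b * C p = laurent_delta *s Edih a b"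
proof -
  assume p: "p \<in> {a, b}"
  then have "p \<in> S" using ab by auto
  have "iota (C p * Edih a b) = laurent_delta *s Edih a b"
    unfolding C_Edih[OF p] by (simp add: iota_scale iota_Edih)
  then show ?thesis using \<open>p \<in> S\<close> by (simp add: iota_mult iota_Edih)
qed

lemma Edih_Tn: "p \<in> {a, b} \<Longrightarrow> Edih a b * Tn p = vpow 1 *s Edih a b"
proof -
  assume p: "p \<in> {a, b}"
  have "Edih a b * C p = Edih a b * Tn p + vpow (-1) *s Edih a b"
    by (simp add: C_def distrib_left scale_mult_right)
  then show ?thesis unfolding Edih_C[OF p] by (simp add: laurent_delta_def scale_left_distrib)
qed

lemma Edih_factor_right:
  assumes p: "p \<in> {a, b}"
  obtains D where "Edih a b = D * C p" "low (k - 1) (D - Tn (alt a b k \<otimes> p))" "low k D"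
proof -
  have pS: "p \<in> S" using p ab by auto
  obtain D where D: "Edih a b = C p * D" "low (k - 1) (D - Tn (p \<otimes> alt a b k))" "low k D"
    using Edih_factor[OF p] by blast
  have "inv (alt a b k) = alt a b k" using alt_longest[OF ab(1,2,4)] ab by (simp add: inv_alt alt_left_eq)
  then have "iota (Tn (p \<otimes> alt a b k)) = Tn (alt a b k \<otimes> p)"
    using ab pS by (simp add: iota_Tn inv_mult_group)
  moreover have "Edih a b = iota D * C p" using D(1) pS iota_Edih by (metis iota_C iota_mult)
  moreover have "low (k - 1) (iota (D - Tn (p \<otimes> alt a b k)))" "low k (iota D)" using low_iota D by auto
  ultimately show thesis using that by (simp add: iota_diff)
qed

end

text \<open>The rank two identity for \<open>C'\<close> of \<open>a b a\<close>, in a form that lets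
  two braids of bond 3 be compared by multiplying generators.\<close>

lemma Edih_three:
  assumes ab: "a \<in> S" "b \<in> S" "a \<noteq> b" "m a b = enat 3"
  shows "Edih a b = C a * C b * C a - C a"
proof -
  obtain D where D: "Edih a b = C a * D"
    "D = (\<Sum>x | x \<in> dihedral a b \<and> a \<notin> left_descents x. vpow (int (len x) + 1 - int 3) *s Tn x)"
    using Edih_factor[OF ab, of a] by blast
  have a3: "alt b a 1 = b" "alt b a 2 = b \<otimes> a" using ab by (simp_all add: numeral_2_eq_2 alt_Suc)
  have nd: "a \<notin> left_descents (alt b a j)" if "j < 3" for j
    using alt_not_descent[of b a \<one> j] ab that m_sym[of a b] by simp
  have mem: "alt b a j \<in> dihedral a b" if "j < 3" for j
    unfolding dihedral_def using that ab by (intro CollectI exI[of _ b] exI[of _ a] exI[of _ j]) auto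
  have len3: "len (alt b a j) = j" if "j < 3" for j using alt_len_one[of b a j] ab that m_sym[of a b] by simp
  have set: "{x. x \<in> dihedral a b \<and> a \<notin> left_descents x} = {\<one>, b, b \<otimes> a}" (is "?L = ?R")
  proof (intro Set.equalityI subsetI)
    fix x assume x: "x \<in> ?L"
    then obtain c d j where cd: "x = alt c d j" "{c, d} = {a, b}" "enat j \<le> m a b" by (auto simp: dihedral_def)
    show "x \<in> ?R"
    proof (cases j)
      case 0 then show ?thesis using cd by simp
    next
      case (Suc i)
      have cd': "c \<in> S" "d \<in> S" "c \<noteq> d" "m c d = enat 3" using cd ab m_sym[of a b] by (auto simp: doubleton_eq_iff)
      have "c \<in> left_descents x" using alt_descent[of c d \<one> i] cd cd' Suc ab by simp
      then have c: "c = b" "d = a" using x cd(2) by (auto simp: doubleton_eq_iff)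
      have "j \<noteq> 3" 
      proof
        assume "j = 3"
        then have "x = alt a b (Suc 2)" using cd(1) c alt_longest[OF ab(1,2,4)] by (simp add: numeral_3_eq_3)
        moreover have "a \<in> left_descents (alt a b (Suc 2) \<otimes> \<one>)" by (rule alt_descent) (use ab in auto)
        ultimately show False using x ab by simp
      qed
      then have "j = 1 \<or> j = 2" using cd(3) ab Suc by (auto simp: numeral_3_eq_3)
      then show ?thesis using cd(1) c a3 by auto
    qed
  next
    fix x assume "x \<in> ?R"
    then have "x = alt b a 0 \<or> x = alt b a 1 \<or> x = alt b a 2" using a3 by auto
    then show "x \<in> ?L" using mem[of 0] mem[of 1] mem[of 2] nd[of 0] nd[of 1] nd[of 2] by auto
  qed
  have d: "\<one> \<noteq> b" "\<one> \<noteq> b \<otimes> a" "b \<noteq> b \<otimes> a" 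
  proof -
    have l: "len b = 1" "len (b \<otimes> a) = 2" using len3[of 1] len3[of 2] a3 by auto
    show "\<one> \<noteq> b" "\<one> \<noteq> b \<otimes> a" "b \<noteq> b \<otimes> a"
      by (rule notI, drule arg_cong[where f = len], simp add: l)+
  qed
  have "D = vpow (-2) *s 1 + vpow (-1) *s Tn b + Tn (b \<otimes> a)"
    unfolding D(2) set using d len3[of 1] len3[of 2] a3 Tn_one by (simp add: vpow_0 add.assoc)
  moreover have "Tn (b \<otimes> a) = Tn b * Tn a" using Tn_mult[of b a] len3[of 2] a3 ab by simp
  ultimately have "D = C b * C a - vpow (-1) *s Tn a"
    by (simp add: C_def distrib_left distrib_right scale_mult_left scale_mult_right scale_right_distrib vpow_add[symmetric])
  moreover have "C a * Tn a = vpow 1 *s C a"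
  proof -
    have "C a * C a = C a * Tn a + vpow (-1) *s C a"
      unfolding C_def[of a] by (simp add: distrib_left scale_mult_right)
    then show ?thesis unfolding C_square[OF ab(1)] by (simp add: laurent_delta_def scale_left_distrib)
  qed
  ultimately show ?thesis
    unfolding D(1) by (simp add: right_diff_distrib scale_mult_right mult.assoc vpow_add[symmetric] vpow_0)
qed

section \<open>The filtered Temperley--Lieb ideal\<close>

definition braid_products :: "nat \<Rightarrow> 'h set" where
  "braid_products n = {Tn x * Edih a b * Tn y | x a b k y. x \<in> carrier W \<and> y \<in> carrier W \<and>
     noncommuting a b \<and> m a b = enat k \<and> len x + k + len y < n}"

text \<open>The filtration counts \<open>len x + k + len y\<close> whether or not the product is
  reduced. Lying in \<open>F n\<close> is therefore a priori stronger than lying in the ideal with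
  all terms shorter than \<open>n\<close>.\<close>

definition F :: "nat \<Rightarrow> 'h set" where
  "F n = span (braid_products n)"

lemma F_0: "0 \<in> F n" and F_add: "g \<in> F n \<Longrightarrow> h \<in> F n \<Longrightarrow> g + h \<in> F n"
  and F_diff: "g \<in> F n \<Longrightarrow> h \<in> F n \<Longrightarrow> g - h \<in> F n" and F_scale: "h \<in> F n \<Longrightarrow> c *s h \<in> F n"
  and F_sum: "(\<And>x. x \<in> A \<Longrightarrow> f x \<in> F n) \<Longrightarrow> sum f A \<in> F n"
  by (simp_all add: F_def span_zero span_add span_diff span_scale span_sum)

lemma F_mono: "n \<le> k \<Longrightarrow> h \<in> F n \<Longrightarrow> h \<in> F k"
proof -
  assume "n \<le> k" "h \<in> F n"
  moreover have "braid_products n \<subseteq> braid_products k" unfolding braid_products_def using \<open>n \<le> k\<close> by force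
  ultimately show ?thesis unfolding F_def using span_mono by blast
qed

lemma F_zero: "h \<in> F 0 \<Longrightarrow> h = 0"
  by (simp add: F_def braid_products_def)

lemma F_product:
  assumes "noncommuting a b" "m a b = enat k" "low (Suc i) g" "low (Suc j) h" "i + k + j < n"
  shows "g * Edih a b * h \<in> F n"
proof -
  have "g * Edih a b * h = (\<Sum>x | x \<in> carrier W \<and> len x < Suc i. \<Sum>y | y \<in> carrier W \<and> len y < Suc j.
      (cf g x * cf h y) *s (Tn x * Edih a b * Tn y))"
  proof -
    have "g * Edih a b * h = (\<Sum>x | x \<in> carrier W \<and> len x < Suc i. cf g x *s (Tn x * Edih a b * h))"
      by (subst low_expand[OF assms(3)]) (simp add: sum_distrib_right scale_mult_left)
    also have "\<dots> = (\<Sum>x | x \<in> carrier W \<and> len x < Suc i. \<Sum>y | y \<in> carrier W \<and> len y < Suc j.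
      (cf g x * cf h y) *s (Tn x * Edih a b * Tn y))"
    proof (rule sum.cong)
      fix x
      show "cf g x *s (Tn x * Edih a b * h) = (\<Sum>y | y \<in> carrier W \<and> len y < Suc j. (cf g x * cf h y) *s (Tn x * Edih a b * Tn y))"
        by (subst low_expand[OF assms(4)]) (simp add: sum_distrib_left scale_mult_right scale_sum_right)
    qed simp
    finally show ?thesis .
  qed
  also have "\<dots> \<in> F n"
  proof (intro F_sum F_scale)
    fix x y assume "x \<in> {x \<in> carrier W. len x < Suc i}" "y \<in> {x \<in> carrier W. len x < Suc j}"
    then have "Tn x * Edih a b * Tn y \<in> braid_products n"
      unfolding braid_products_def using assms by (intro CollectI exI[of _ x] exI[of _ a] exI[of _ b] exI[of _ k] exI[of _ y]) auto
    then show "Tn x * Edih a b * Tn y \<in> F n" unfolding F_def by (rule span_base)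
  qed
  finally show ?thesis .
qed

lemma F_induct [consumes 1, case_names zero product add scale]:
  assumes "f \<in> F n" "P 0"
    "\<And>x a b k y. x \<in> carrier W \<Longrightarrow> y \<in> carrier W \<Longrightarrow> noncommuting a b \<Longrightarrow> m a b = enat k \<Longrightarrow> len x + k + len y < n \<Longrightarrow>
      P (Tn x * Edih a b * Tn y)"
    "\<And>g h. P g \<Longrightarrow> P h \<Longrightarrow> P (g + h)" "\<And>c h. P h \<Longrightarrow> P (c *s h)"
  shows "P f"
  using assms(1) unfolding F_def
proof (induction rule: span_induct_alt)
  case base then show ?case by (rule assms(2))
next
  case (step c g h)
  have "P g" using step(1) assms(3) unfolding braid_products_def by blast
  then show ?case using assms(4,5) step by blast
qed

lemma F_mult_left: assumes "low (Suc i) g" "f \<in> F n" shows "g * f \<in> F (i + n)"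
  using assms(2)
proof (induction rule: F_induct)
  case (product x a b k y)
  have "low (Suc (i + len x)) (g * Tn x)" using low_mult[OF assms(1) low_Tn[of x "Suc (len x)"]] product by simp
  from F_product[OF product(3,4) this low_Tn[of y "Suc (len y)"]] show ?case
    using product by (simp add: mult.assoc)
qed (auto simp: distrib_left scale_mult_right intro: F_0 F_add F_scale)

lemma F_mult_right: assumes "low (Suc i) g" "f \<in> F n" shows "f * g \<in> F (n + i)"
  using assms(2)
proof (induction rule: F_induct)
  case (product x a b k y)
  have "low (Suc (len y + i)) (Tn y * g)" using low_mult[OF low_Tn[of y "Suc (len y)"] assms(1)] product by simp
  from F_product[OF product(3,4) low_Tn[of x "Suc (len x)"] this] show ?case
    using product by (simp add: mult.assoc)
qed (auto simp: distrib_right scale_mult_left intro: F_0 F_add F_scale)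

lemma F_gen_mult: "s \<in> S \<Longrightarrow> f \<in> F n \<Longrightarrow> Tn s * f \<in> F (Suc n)"
  using F_mult_left[of 1 "Tn s" f n] low_Tn[of s "Suc (Suc 0)"] by simp

lemma low_F: "f \<in> F n \<Longrightarrow> low n f"
proof (induction rule: F_induct)
  case (product x a b k y)
  have ab: "a \<in> S" "b \<in> S" "a \<noteq> b" using noncommutingD product by auto
  have "low (Suc (len x + k)) (Tn x * Edih a b)"
    using low_mult[OF low_Tn[of x "Suc (len x)"] low_Edih(2)[OF ab product(4)]] product by simp
  from low_mult[OF this low_Tn[of y "Suc (len y)"]] show ?case using product by (auto intro: low_mono)
qed (auto intro: low_add low_scale)

text \<open>Each reduced factorization of \<open>w\<close> around a long braid gives an element of
  the ideal with leading term \<open>Tn w\<close>. The goal of the next section is that the choice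
  does not matter modulo \<open>F (len w)\<close>.\<close>

definition rep :: "'w \<Rightarrow> 'h \<Rightarrow> bool" where
  "rep w h \<longleftrightarrow> (\<exists>x a b k y. x \<in> carrier W \<and> y \<in> carrier W \<and> noncommuting a b \<and> m a b = enat k \<and>
     w = x \<otimes> alt a b k \<otimes> y \<and> len w = len x + k + len y \<and> h = Tn x * Edih a b * Tn y)"

lemma rep_closed: "rep w h \<Longrightarrow> w \<in> carrier W"
  using noncommutingD by (auto simp: rep_def)

lemma rep_complex: "rep w h \<Longrightarrow> is_complex w"
  unfolding rep_def complex_iff by blast

lemma rep_exists: "is_complex w \<Longrightarrow> \<exists>h. rep w h"
  unfolding rep_def complex_iff by blast

lemma rep_F: "rep w h \<Longrightarrow> h \<in> F (Suc (len w))"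
proof -
  assume "rep w h"
  then obtain x a b k y where h: "x \<in> carrier W" "y \<in> carrier W" "noncommuting a b" "m a b = enat k"
     "len w = len x + k + len y" "h = Tn x * Edih a b * Tn y" unfolding rep_def by blast
  show ?thesis unfolding h(6)
    by (rule F_product[OF h(3,4) low_Tn low_Tn, of _ "len x" _ "len y"]) (use h in auto)
qed

lemma rep_top: "rep w h \<Longrightarrow> low (len w) (h - Tn w)"
proof -
  assume "rep w h"
  then obtain x a b k y where h: "x \<in> carrier W" "y \<in> carrier W" "noncommuting a b" "m a b = enat k"
     "w = x \<otimes> alt a b k \<otimes> y" "len w = len x + k + len y" "h = Tn x * Edih a b * Tn y" unfolding rep_def by blast
  have ab: "a \<in> S" "b \<in> S" "a \<noteq> b" using noncommutingD h by auto
  have c: "alt a b k \<in> carrier W" "len (alt a b k) = k" using alt_len_one[of a b k] ab h by auto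
  have l: "len (x \<otimes> alt a b k) = len x + k"
    using len_mult_le[of x "alt a b k"] len_mult_le[of "x \<otimes> alt a b k" y] h c by simp
  have "Tn w = Tn x * Tn (alt a b k) * Tn y"
    using Tn_mult[of x "alt a b k"] Tn_mult[of "x \<otimes> alt a b k" y] l h c by simp
  then have e: "h - Tn w = Tn x * (Edih a b - Tn (alt a b k)) * Tn y"
    using h by (simp add: right_diff_distrib left_diff_distrib)
  have "low (len x + k) (Tn x * (Edih a b - Tn (alt a b k)))"
    using low_mult[OF low_Tn[of x "Suc (len x)"] low_Edih(1)[OF ab h(4)]] h by simp
  from low_mult'[OF this low_Tn[of y "Suc (len y)"]] show ?thesis unfolding e using h by simp
qed

lemma rep_mult:
  assumes "rep w h" "z \<in> carrier W" "len (z \<otimes> w) = len z + len w" shows "rep (z \<otimes> w) (Tn z * h)"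
proof -
  obtain x a b k y where h: "x \<in> carrier W" "y \<in> carrier W" "noncommuting a b" "m a b = enat k"
     "w = x \<otimes> alt a b k \<otimes> y" "len w = len x + k + len y" "h = Tn x * Edih a b * Tn y"
    using assms unfolding rep_def by blast
  have ab: "a \<in> S" "b \<in> S" "a \<noteq> b" using noncommutingD h by auto
  have c: "alt a b k \<in> carrier W" "len (alt a b k) = k" using alt_len_one[of a b k] ab h by auto
  have e: "z \<otimes> w = (z \<otimes> x) \<otimes> alt a b k \<otimes> y" using h c assms by (simp add: m_assoc)
  have "len (z \<otimes> w) \<le> len (z \<otimes> x) + k + len y"
    unfolding e using len_mult_le[of "(z \<otimes> x) \<otimes> alt a b k" y] len_mult_le[of "z \<otimes> x" "alt a b k"] h c assms by simp
  then have l: "len (z \<otimes> x) = len z + len x" using len_mult_le[of z x] assms h by simp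
  have "z \<otimes> x \<in> carrier W" "len (z \<otimes> w) = len (z \<otimes> x) + k + len y" using l h assms by auto
  moreover have "Tn z * h = Tn (z \<otimes> x) * Edih a b * Tn y"
    unfolding Tn_mult[OF assms(2) h(1) l, symmetric] h(7) by (simp only: mult.assoc)
  ultimately show ?thesis unfolding rep_def using e h(2-4) by blast
qed

lemma rep_gen:
  assumes "rep (s \<otimes> w) h" "s \<in> left_descents w" "w \<in> carrier W" shows "rep w (Tn s * h)"
proof -
  have s: "s \<in> S" using assms left_descentD by blast
  then show ?thesis using rep_mult[OF assms(1), of s] left_descent_len[OF assms(2,3)] assms by simp
qed

lemma rep_cases:
  assumes "rep w h"
  obtains (braid) a b k y where "noncommuting a b" "m a b = enat k" "y \<in> carrier W" "w = alt a b k \<otimes> y" "len w = k + len y"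
      "h = Edih a b * Tn y" "a \<in> left_descents w" "b \<in> left_descents w"
  | (gen) s h' where "s \<in> left_descents w" "is_complex (s \<otimes> w)" "rep (s \<otimes> w) h'" "h = Tn s * h'"
proof -
  obtain x a b k y where h: "x \<in> carrier W" "y \<in> carrier W" "noncommuting a b" "m a b = enat k"
     "w = x \<otimes> alt a b k \<otimes> y" "len w = len x + k + len y" "h = Tn x * Edih a b * Tn y"
    using assms unfolding rep_def by blast
  have ab: "a \<in> S" "b \<in> S" "a \<noteq> b" using noncommutingD h by auto
  have c: "alt a b k \<in> carrier W" "len (alt a b k) = k" using alt_len_one[of a b k] ab h by auto
  have wc: "w \<in> carrier W" using h c by simp
  show thesis
  proof (cases "x = \<one>")
    case True
    have w: "w = alt a b k \<otimes> y" "len w = k + len y" using True h c by auto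
    have "3 \<le> k" using noncommuting_bond[OF h(3)] h(4) by simp
    then obtain j where j: "k = Suc j" by (cases k) auto
    have desc: "p \<in> left_descents w" if "{p, q} = {a, b}" for p q
    proof -
      have pq: "p \<in> S" "q \<in> S" "p \<noteq> q" "m p q = enat k" "m q p = enat k" using that ab h m_sym[of a b] by (auto simp: doubleton_eq_iff)
      have "w = alt p q k \<otimes> y" using w alt_longest[OF ab(1,2) h(4)] that by (auto simp: doubleton_eq_iff)
      then have "p \<otimes> w = alt q p j \<otimes> y" using pq h by (simp add: j alt_Suc m_assoc)
      then have "len (p \<otimes> w) \<le> j + len y"
        using len_mult_le[of "alt q p j" y] alt_len_one[of q p j] pq h j by simp
      then show ?thesis using w j pq by (simp add: left_descents_def)
    qed
    show thesis
      by (rule braid[OF h(3,4,2) w]) (use True h Tn_one desc[of a b] desc[of b a] in auto)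
  next
    case False
    then obtain r where r: "r \<in> left_descents x" using ex_left_descent h by blast
    have rS: "r \<in> S" using r left_descentD by blast
    have l: "len x = len (r \<otimes> x) + 1" using left_descent_len r h by blast
    have e: "r \<otimes> w = (r \<otimes> x) \<otimes> alt a b k \<otimes> y" using h rS c by (simp add: m_assoc)
    have "len (r \<otimes> w) \<le> len (r \<otimes> x) + k + len y"
      unfolding e using len_mult_le[of "(r \<otimes> x) \<otimes> alt a b k" y] len_mult_le[of "r \<otimes> x" "alt a b k"] h c rS by simp
    then have rd: "r \<in> left_descents w" using h(6) l rS by (simp add: left_descents_def)
    then have "len (r \<otimes> w) = len (r \<otimes> x) + k + len y" using left_descent_len[OF rd wc] h(6) l by simp
    then have "rep (r \<otimes> w) (Tn (r \<otimes> x) * Edih a b * Tn y)"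
      unfolding rep_def using e h rS by (metis gen_closed m_closed)
    moreover have "h = Tn r * (Tn (r \<otimes> x) * Edih a b * Tn y)"
      using h(7) Tn_gen_split[OF h(1) r] by (simp add: mult.assoc)
    ultimately show thesis using gen[OF rd] rep_complex by blast
  qed
qed

lemma rep_braid:
  assumes "noncommuting a b" "a \<in> left_descents w" "b \<in> left_descents w" "w \<in> carrier W"
  obtains k y where "m a b = enat k" "y \<in> carrier W" "w = alt a b k \<otimes> y" "len w = k + len y"
    "left_descents y \<inter> {a, b} = {}" "rep w (Edih a b * Tn y)"
proof -
  have ab: "a \<in> S" "b \<in> S" "a \<noteq> b" using noncommutingD assms by auto
  obtain k u where k: "m a b = enat k" "2 \<le> k" "u \<in> carrier W" "left_descents u \<inter> {a, b} = {}"
    "w = alt a b k \<otimes> u" "len w = k + len u" using two_descents[OF ab(3) assms(2-4)] by blast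
  have "rep w (Edih a b * Tn u)"
    unfolding rep_def using k assms(1) ab Tn_one
    by (intro exI[of _ \<one>] exI[of _ a] exI[of _ b] exI[of _ k] exI[of _ u]) auto
  then show thesis using that k by blast
qed

text \<open>The longest terms of a common eigenvector have both \<open>a\<close> and
  \<open>b\<close> as descents, so each is the leading term of some \<open>Edih a b * Tn y\<close>.
  These are eigenvectors themselves, and subtracting them leaves a shorter common eigenvector. In
  this way a bound on the support becomes a bound in the filtration.\<close>

lemma eigen_F:
  assumes ab: "noncommuting a b"
  shows "low n h \<Longrightarrow> C a * h = laurent_delta *s h \<Longrightarrow> C b * h = laurent_delta *s h \<Longrightarrow> h \<in> F n"
proof (induction n arbitrary: h)
  case 0
  then show ?case using low_zero_eq F_0 by blast
next
  case (Suc n)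
  have abS: "a \<in> S" "b \<in> S" "a \<noteq> b" using noncommutingD ab by auto
  let ?A = "{x \<in> carrier W. len x = n \<and> cf h x \<noteq> 0}"
  have fin: "finite ?A" by (rule finite_subset[OF _ Tn.finite_coef[of h]]) auto
  have desc: "p \<in> left_descents x" if "x \<in> ?A" "p \<in> {a, b}" for x p
  proof (rule ccontr)
    assume n: "p \<notin> left_descents x"
    have pS: "p \<in> S" "C p * h = laurent_delta *s h" using that abS Suc.prems by auto
    have "cf h (p \<otimes> x) \<noteq> 0" using cf_eigen[OF pS(2,1) _ n] that by auto
    then have "len (p \<otimes> x) < Suc n" using Suc.prems(1) pS that by (simp add: low_def)
    then show False using not_left_descent_len[OF n pS(1)] that by simp
  qed
  have "\<exists>y. rep x (Edih a b * Tn y)" if "x \<in> ?A" for x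
    using rep_braid[OF ab desc[OF that, of a] desc[OF that, of b]] that by blast
  then have "\<forall>x\<in>?A. \<exists>y. rep x (Edih a b * Tn y)" by blast
  from bchoice[OF this] obtain Y where Y: "\<And>x. x \<in> ?A \<Longrightarrow> rep x (Edih a b * Tn (Y x))" by blast
  \<comment> \<open>Finiteness of the bond is only known once there is a term of top length.\<close>
  obtain k where k: "?A \<noteq> {} \<Longrightarrow> m a b = enat k"
    using rep_braid[OF ab desc[of _ a] desc[of _ b]] by blast
  let ?g = "\<Sum>x\<in>?A. cf h x *s (Edih a b * Tn (Y x))"
  have gF: "?g \<in> F (Suc n)" using Y rep_F by (intro F_sum F_scale) force
  have "low n (h - ?g)"
  proof -
    have "low n (h - (\<Sum>x\<in>?A. cf h x *s Tn x))"
      unfolding low_def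
    proof (intro ballI impI)
      fix w assume w: "w \<in> carrier W" "cf (h - (\<Sum>x\<in>?A. cf h x *s Tn x)) w \<noteq> 0"
      have "cf (\<Sum>x\<in>?A. cf h x *s Tn x) w = (if w \<in> ?A then cf h w else 0)"
        by (rule cf_dihedral_sum[OF fin _ w(1)]) auto
      then have "cf h w \<noteq> 0" "w \<notin> ?A" using w by (auto simp: Tn.coef_diff split: if_splits)
      then show "len w < n" using Suc.prems(1) w by (auto simp: low_def less_Suc_eq)
    qed
    moreover have "low n (\<Sum>x\<in>?A. cf h x *s (Edih a b * Tn (Y x) - Tn x))"
      using rep_top[OF Y] by (intro low_sum low_scale) force
    ultimately have "low n (h - (\<Sum>x\<in>?A. cf h x *s Tn x) - (\<Sum>x\<in>?A. cf h x *s (Edih a b * Tn (Y x) - Tn x)))"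
      by (rule low_diff)
    then show ?thesis by (simp add: scale_right_diff_distrib sum_subtractf algebra_simps)
  qed
  moreover have eig: "C p * ?g = laurent_delta *s ?g" if p: "p \<in> {a, b}" for p
  proof (cases "?A = {}")
    case False
    then have e: "C p * (Edih a b * Tn y) = laurent_delta *s (Edih a b * Tn y)" for y
      using C_Edih[OF abS k p] by (simp add: mult.assoc[symmetric] scale_mult_left)
    show ?thesis unfolding sum_distrib_left scale_sum_right
      by (rule sum.cong) (auto simp: scale_mult_right e mult.commute)
  qed auto
  ultimately have "h - ?g \<in> F n"
    using Suc.prems by (intro Suc.IH) (auto simp: right_diff_distrib scale_right_diff_distrib)
  then have "h - ?g + ?g \<in> F (Suc n)" using gF F_add F_mono[of n "Suc n"] by force
  then show ?case by simp
qed

lemma KL_low: "w \<in> carrier W \<Longrightarrow> low (len w) (KL w - Tn w)"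
  using KL_cf_len[of w] KL_cf_self[of w] by (auto simp: low_def Tn.coef_diff Tn.coef_basis split: if_splits)

text \<open>Both elements have leading term \<open>Tn w\<close> and are eigenvectors for both
  letters, so the difference is a shorter common eigenvector. \<open>KL w\<close> becomes the
  reference point shared by all braids in front of \<open>w\<close>.\<close>

lemma rep_braid_KL:
  assumes "noncommuting a b" "m a b = enat k" "y \<in> carrier W" "w = alt a b k \<otimes> y" "len w = k + len y"
    "a \<in> left_descents w" "b \<in> left_descents w"
  shows "Edih a b * Tn y - KL w \<in> F (len w)"
proof (rule eigen_F[OF assms(1)])
  have ab: "a \<in> S" "b \<in> S" "a \<noteq> b" using noncommutingD assms by auto
  have wc: "w \<in> carrier W" using assms ab by simp
  have "rep w (Edih a b * Tn y)"
    unfolding rep_def using assms ab Tn_one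
    by (intro exI[of _ \<one>] exI[of _ a] exI[of _ b] exI[of _ k] exI[of _ y]) auto
  from low_diff[OF rep_top[OF this] KL_low[OF wc]] show "low (len w) (Edih a b * Tn y - KL w)" by simp
  have "C p * (Edih a b * Tn y - KL w) = laurent_delta *s (Edih a b * Tn y - KL w)" if "p \<in> {a, b}" for p
    using C_Edih[OF ab assms(2) that] KL_down[OF wc, of p] that assms
    by (auto simp: right_diff_distrib scale_right_diff_distrib mult.assoc[symmetric] scale_mult_left)
  then show "C a * (Edih a b * Tn y - KL w) = laurent_delta *s (Edih a b * Tn y - KL w)"
    "C b * (Edih a b * Tn y - KL w) = laurent_delta *s (Edih a b * Tn y - KL w)" by auto
qed

end

section \<open>Independence of the choice of a braid\<close>

context hecke_algebra
begin

definition rep_unique :: "nat \<Rightarrow> bool" where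
  "rep_unique n \<longleftrightarrow> (\<forall>w h h'. len w = n \<longrightarrow> rep w h \<longrightarrow> rep w h' \<longrightarrow> h - h' \<in> F n)"

lemma rep_uniqueD: "rep_unique (len w) \<Longrightarrow> rep w h \<Longrightarrow> rep w h' \<Longrightarrow> h - h' \<in> F (len w)"
  by (auto simp: rep_unique_def)

lemma Tn_commute:
  assumes "p \<in> S" "s \<in> S" "p \<otimes> s = s \<otimes> p" shows "Tn p * Tn s = Tn s * Tn p"
proof (cases "p = s")
  case False
  have "p \<notin> left_descents s" "s \<notin> left_descents p"
    using commuting_descents[of "[p]"] commuting_descents[of "[s]"] assms False by auto
  then show ?thesis using Tn_up[of p s] Tn_up[of s p] assms by simp
qed simp

lemma C_commute: "p \<in> S \<Longrightarrow> s \<in> S \<Longrightarrow> p \<otimes> s = s \<otimes> p \<Longrightarrow> Tn p * C s = C s * Tn p"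
  using Tn_commute[of p s] by (simp add: C_def distrib_left distrib_right scale_mult_left scale_mult_right)

lemma F_trans: "f - g \<in> F n \<Longrightarrow> g - h \<in> F n \<Longrightarrow> f - h \<in> F n"
  using F_add[of "f - g" n "g - h"] by simp

lemma F_sym: "f - g \<in> F n \<Longrightarrow> g - f \<in> F n"
  using F_scale[of "f - g" n "-1"] by simp

text \<open>By uniqueness any representative of \<open>w\<close> may be used. If
  \<open>s \<otimes> w\<close> is complex, \<open>Tn s * h'\<close> and \<open>C s * h'\<close>
  differ only by a multiple of \<open>h'\<close>, which is lower. Otherwise \<open>s\<close>
  completes a braid: if the braid stands in front, \<open>Edih_factor\<close> splits off
  \<open>C s\<close>; if a letter commuting with \<open>s\<close> does, that letter is pulled out
  and induction applies.\<close>

lemma rep_divisible: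
  assumes "\<And>j. j \<le> len w \<Longrightarrow> rep_unique j" "rep w h" "s \<in> left_descents w"
  shows "\<exists>e. low (len (s \<otimes> w)) e \<and> h - C s * (Tn (s \<otimes> w) + e) \<in> F (len w)"
  using assms
proof (induction "len w" arbitrary: w h rule: less_induct)
  case less
  have w: "w \<in> carrier W" using rep_closed less.prems by blast
  have s: "s \<in> S" using left_descentD less.prems by blast
  have l: "len w = len (s \<otimes> w) + 1" using left_descent_len less.prems w by blast
  let ?u = "s \<otimes> w"
  have u: "?u \<in> carrier W" "s \<otimes> ?u = w" "s \<notin> left_descents ?u" using s w less.prems left_descent_mult by auto
  have unique: "h' - h \<in> F (len w)" if "rep w h'" for h'
    using rep_uniqueD[of w h' h] less.prems that by blast
  have "\<exists>h0 e. rep w h0 \<and> low (len ?u) e \<and> h0 - C s * (Tn ?u + e) \<in> F (len w)"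
  proof (cases "is_complex ?u")
    case True
    then obtain h' where h': "rep ?u h'" using rep_exists by blast
    have "Tn s * h' - C s * (Tn ?u + (h' - Tn ?u)) = - (vpow (-1) *s h')"
      by (simp add: C_mult)
    moreover have "h' \<in> F (len w)" using rep_F[OF h'] l by simp
    ultimately have "Tn s * h' - C s * (Tn ?u + (h' - Tn ?u)) \<in> F (len w)"
      using F_scale[of "vpow (-1) *s h'" "len w" "-1"] F_scale[of h' "len w" "vpow (-1)"] by simp
    then show ?thesis using rep_gen[OF h' less.prems(3) w] rep_top[OF h'] by blast
  next
    case False
    have "is_complex (s \<otimes> ?u)" using rep_complex less.prems u by simp
    from becomes_complex[OF u(1) False s u(3) this] show ?thesis
    proof (elim disjE exE bexE conjE)
      fix b assume b: "noncommuting s b" "s \<in> left_descents (s \<otimes> ?u)" "b \<in> left_descents (s \<otimes> ?u)"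
      have sb: "s \<in> S" "b \<in> S" "s \<noteq> b" using noncommutingD b by auto
      have sbw: "s \<in> left_descents w" "b \<in> left_descents w" using b u by simp_all
      obtain k y where y: "m s b = enat k" "y \<in> carrier W" "w = alt s b k \<otimes> y" "len w = k + len y"
          "left_descents y \<inter> {s, b} = {}" "rep w (Edih s b * Tn y)"
        using rep_braid[OF b(1) sbw w] by blast
      obtain D where D: "Edih s b = C s * D" "low (k - 1) (D - Tn (s \<otimes> alt s b k))"
        using Edih_factor[OF sb y(1), of s] by blast
      have k2: "2 \<le> k" using k_ge_2[OF sb y(1)] .
      have su: "?u = (s \<otimes> alt s b k) \<otimes> y" using y sb by (simp add: m_assoc)
      have "s \<in> left_descents (alt s b (Suc (k - 1)) \<otimes> \<one>)"
        by (rule alt_descent) (use sb y k2 in auto)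
      then have "len (alt s b k) = len (s \<otimes> alt s b k) + 1" using left_descent_len[of s "alt s b k"] sb k2 by simp
      then have la: "len (s \<otimes> alt s b k) = k - 1" using alt_len_one[of s b k] sb y by simp
      then have "Tn (s \<otimes> alt s b k) * Tn y = Tn ?u"
        using Tn_mult[of "s \<otimes> alt s b k" y] su l y sb k2 by simp
      then have "Edih s b * Tn y - C s * (Tn ?u + (D - Tn (s \<otimes> alt s b k)) * Tn y) = 0"
        unfolding D(1) by (simp add: mult.assoc left_diff_distrib distrib_left right_diff_distrib)
      moreover have "low (len ?u) ((D - Tn (s \<otimes> alt s b k)) * Tn y)"
      proof -
        have "len ?u = k - 1 + len y" using l y(4) k2 by linarith
        then show ?thesis using low_mult'[OF D(2) low_Tn[OF y(2), of "Suc (len y)"]] by (simp only: lessI)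
      qed
      ultimately show ?thesis using y(6) F_0[of "len w"] by metis
    next
      fix p assume p: "p \<in> left_descents ?u" "p \<otimes> s = s \<otimes> p" "p \<noteq> s" "is_complex (s \<otimes> (p \<otimes> ?u))"
      have pS: "p \<in> S" using p left_descentD by blast
      have pw: "s \<otimes> (p \<otimes> ?u) = p \<otimes> w" using commute_swap[of p s ?u] p pS s u by simp
      have pd: "p \<in> left_descents w" using descent_commuting[of s p w] p pS s w by auto
      have sd: "s \<in> left_descents (p \<otimes> w)" using descent_commuting[of p s w] p pS s w less.prems by auto
      have lp: "len w = len (p \<otimes> w) + 1" "p \<otimes> w \<in> carrier W" using left_descent_len[OF pd w] pS w by auto
      obtain h' where h': "rep (p \<otimes> w) h'" using rep_exists p(4) pw by auto
      have spw: "s \<otimes> (p \<otimes> w) = p \<otimes> ?u" using commute_swap[of p s w] p pS s w by simp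
      obtain e where e: "low (len (s \<otimes> (p \<otimes> w))) e" "h' - C s * (Tn (s \<otimes> (p \<otimes> w)) + e) \<in> F (len (p \<otimes> w))"
        using less.hyps[of "p \<otimes> w" h'] h' lp less.prems(1) sd by force
      have Tp: "Tn p * Tn (p \<otimes> ?u) = Tn ?u" using Tn_gen_split[OF u(1) p(1)] by simp
      have "Tn p * (h' - C s * (Tn (s \<otimes> (p \<otimes> w)) + e)) \<in> F (len w)"
        using F_gen_mult[OF pS e(2)] lp by simp
      moreover have "Tn p * (C s * (Tn (p \<otimes> ?u) + e)) = C s * (Tn ?u + Tn p * e)"
        using C_commute[OF pS s p(2)] Tp by (simp add: mult.assoc[symmetric] distrib_left) (simp add: mult.assoc Tp)
      ultimately have "Tn p * h' - C s * (Tn ?u + Tn p * e) \<in> F (len w)"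
        unfolding spw by (simp add: right_diff_distrib)
      moreover have "low (len ?u) (Tn p * e)"
        using low_gen_mult[OF pS e(1)] left_descent_len[OF p(1) u(1)] unfolding spw by simp
      ultimately show ?thesis using rep_gen[OF h' pd w] by blast
    qed
  qed
  then obtain h0 e where "rep w h0" "low (len ?u) e" "h0 - C s * (Tn ?u + e) \<in> F (len w)" by blast
  then show ?case using F_trans[of h h0 "len w"] F_sym[OF unique] by blast
qed

lemma alt_left_last:
  "s \<in> S \<Longrightarrow> t \<in> S \<Longrightarrow> u \<in> carrier W \<Longrightarrow> alt_left s t (Suc j) \<otimes> u = alt_left t s j \<otimes> (s \<otimes> u)"
  unfolding alt_left_Suc_right by (simp add: m_assoc)

text \<open>Removing \<open>s\<close> breaks the braid of \<open>w\<close> in \<open>s, q\<close>,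
  yet \<open>s \<otimes> w\<close> is complex. Complexity is constant along a string, so its bottom
  element \<open>a \<otimes> y\<close> is complex and has a representative divisible by
  \<open>C a\<close> on the left. As \<open>C a\<close> also splits off \<open>Edih s q\<close> on
  the right, the cofactor times that representative can be compared with
  \<open>Edih s q * Tn y\<close>.\<close>

lemma rep_overlap:
  assumes prev: "\<And>j. j < len w \<Longrightarrow> rep_unique j" and ab: "noncommuting s q"
    and d: "s \<in> left_descents w" "q \<in> left_descents w" and w: "w \<in> carrier W" and h: "rep (s \<otimes> w) h"
  shows "Tn s * h - KL w \<in> F (len w)"
proof -
  have sq: "s \<in> S" "q \<in> S" "s \<noteq> q" using noncommutingD ab by auto
  obtain k y where y: "m s q = enat k" "y \<in> carrier W" "w = alt s q k \<otimes> y" "len w = k + len y"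
    "left_descents y \<inter> {s, q} = {}" "rep w (Edih s q * Tn y)"
    using rep_braid[OF ab d w] by blast
  have k3: "3 \<le> k" using noncommuting_bond[OF ab] y by simp
  then obtain i where i: "k = Suc (Suc i)" by (metis Suc_le_D numeral_3_eq_3 Suc_le_mono)
  \<comment> \<open>The last letter of the braid, adjacent to \<open>y\<close>; which generator it
    is depends on the parity of \<open>k\<close>.\<close>
  define a where "a = (if odd k then s else q)"
  define b where "b = (if odd k then q else s)"
  have ab': "{a, b} = {s, q}" by (auto simp: a_def b_def)
  have abS: "a \<in> S" "b \<in> S" using sq by (auto simp: a_def b_def)
  have base: "is_base a b y" using ab y noncommutingD by (auto simp: is_base_def a_def b_def)
  have mk: "m a b = enat k" using y m_sym[of s q] sq by (auto simp: a_def b_def)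
  have w': "w = str a b y k" unfolding str_eq_alt y(3) by (auto simp: letter_def a_def b_def)
  have lk: "letter a b k = s" by (auto simp: letter_def a_def b_def)
  have sw: "s \<otimes> w = str a b y (Suc i)" using str_down[OF base, of "Suc i"] lk i w' by simp
  have cx: "is_complex (str a b y 1)"
  proof (rule ccontr)
    assume "\<not> is_complex (str a b y 1)"
    then have "\<not> is_complex (str a b y (Suc i))"
      using string_fully_commutative[OF base, of 1 "Suc i"] i mk by (simp add: one_enat_def)
    then show False using rep_complex[OF h] sw by simp
  qed
  have s1: "str a b y 1 = a \<otimes> y" using str_Suc[OF base, of 0] str_0[OF base] by (simp add: letter_def)
  have l1: "len (a \<otimes> y) = Suc (len y)" using str_len[OF base, of 1] s1 mk i by (simp add: one_enat_def)
  obtain h1 where h1: "rep (a \<otimes> y) h1" using rep_exists cx s1 by auto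
  have ad: "a \<in> left_descents (a \<otimes> y)" using l1 abS y by (simp add: left_descents_def)
  have aay: "a \<otimes> (a \<otimes> y) = y" using abS y by simp
  have "\<exists>e. low (len (a \<otimes> (a \<otimes> y))) e \<and> h1 - C a * (Tn (a \<otimes> (a \<otimes> y)) + e) \<in> F (len (a \<otimes> y))"
    by (rule rep_divisible[OF prev h1 ad]) (use l1 y(4) i in linarith)
  then obtain e where e: "low (len y) e" "h1 - C a * (Tn y + e) \<in> F (Suc (len y))"
    unfolding aay l1 by blast
  define z where "z = alt_left b a i"
  define Z where "Z = alt_left b a (Suc i)"
  have zc: "z \<in> carrier W" "Z \<in> carrier W" using abS by (auto simp: z_def Z_def)
  have sw2: "s \<otimes> w = z \<otimes> (a \<otimes> y)" unfolding sw str_def z_def using alt_left_last abS y by blast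
  have w2: "w = Z \<otimes> (a \<otimes> y)" unfolding w' i str_def Z_def using alt_left_last abS y by blast
  have lz: "len z = i" "len Z = Suc i"
  proof -
    have ba: "is_base b a \<one>" using base noncommutingD[of a b] by (simp add: is_base_def)
    have "m b a = enat k" using mk m_sym[OF abS] by simp
    then show "len z = i" "len Z = Suc i"
      using str_len[OF ba, of i] str_len[OF ba, of "Suc i"] i zc unfolding z_def Z_def str_def by simp_all
  qed
  have lsw: "len (s \<otimes> w) = i + Suc (len y)" using left_descent_len[OF d(1) w] y i by simp
  have r: "rep (s \<otimes> w) (Tn z * h1)" unfolding sw2 by (rule rep_mult[OF h1 zc(1)]) (use lsw sw2 l1 lz in simp)
  have "h - Tn z * h1 \<in> F (len (s \<otimes> w))"
    using rep_uniqueD[OF prev h r] left_descent_len[OF d(1) w] by simp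
  then have "Tn s * (h - Tn z * h1) \<in> F (len w)" using F_gen_mult[OF sq(1)] left_descent_len[OF d(1) w] by fastforce
  moreover have "Tn s * Tn z = Tn Z"
  proof -
    have "Z = (if even i then b else a) \<otimes> z" by (simp add: z_def Z_def)
    moreover have "(if even i then b else a) = s" using i by (auto simp: a_def b_def)
    ultimately have "Z = s \<otimes> z" by simp
    then show ?thesis using Tn_mult[of s z] lz sq zc by simp
  qed
  ultimately have 1: "Tn s * h - Tn Z * h1 \<in> F (len w)" by (simp add: right_diff_distrib mult.assoc[symmetric])
  \<comment> \<open>The cofactor has leading term \<open>Tn Z\<close>, so \<open>Tn Z * h1\<close>
    may be replaced by \<open>D * h1\<close> modulo \<open>F (len w)\<close>.\<close>
  obtain D where D: "Edih s q = D * C a" "low (k - 1) (D - Tn (alt s q k \<otimes> a))" "low k D"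
    using Edih_factor_right[OF sq y(1), of a] ab' by blast
  have aZ: "alt s q k \<otimes> a = Z"
  proof -
    have "alt s q k = alt_left a b k" unfolding alt_left_eq a_def b_def by auto
    also have "\<dots> = Z \<otimes> a" unfolding i Z_def using alt_left_Suc_right abS by blast
    finally show ?thesis using zc abS by simp
  qed
  have h1F: "h1 \<in> F (Suc (Suc (len y)))" using rep_F[OF h1] l1 by simp
  have "low (Suc i) (D - Tn Z)" using D(2) aZ i by simp
  from F_mult_left[OF this h1F] have 2: "(D - Tn Z) * h1 \<in> F (len w)" using y i by simp
  have "low (Suc (Suc i)) D" using D(3) i by simp
  from F_mult_left[OF this e(2)] have 3: "D * (h1 - C a * (Tn y + e)) \<in> F (len w)" using y i by simp
  \<comment> \<open>All terms of \<open>e\<close> are shorter than \<open>y\<close>; for trivial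
    \<open>y\<close> this leaves only \<open>e = 0\<close>.\<close>
  have 4: "Edih s q * e \<in> F (len w)"
  proof (cases "len y")
    case 0
    then have "e = 0" using e(1) low_zero_eq by simp
    then show ?thesis using F_0 by simp
  next
    case (Suc j)
    have "1 * Edih s q * e \<in> F (len w)"
      by (rule F_product[OF ab y(1) low_1, of j]) (use e Suc y in auto)
    then show ?thesis by simp
  qed
  have eq: "Tn s * h - Edih s q * Tn y
    = (Tn s * h - Tn Z * h1) - (D - Tn Z) * h1 + D * (h1 - C a * (Tn y + e)) + Edih s q * e"
    unfolding D(1) by (simp add: algebra_simps)
  have 5: "Tn s * h - Edih s q * Tn y \<in> F (len w)"
    by (subst eq) (rule F_add[OF F_add[OF F_diff[OF 1 2] 3] 4])
  show ?thesis using F_trans[OF 5 rep_braid_KL[OF ab y(1-4) d]] .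
qed

lemma alt_commute:
  assumes "s \<in> S" "a \<in> S" "b \<in> S" "a \<otimes> s = s \<otimes> a" "b \<otimes> s = s \<otimes> b"
  shows "alt a b j \<otimes> s = s \<otimes> alt a b j"
  using assms
proof (induction j arbitrary: a b)
  case (Suc j)
  have "alt a b (Suc j) \<otimes> s = a \<otimes> (alt b a j \<otimes> s)" using Suc.prems by (simp add: alt_Suc m_assoc)
  also have "\<dots> = a \<otimes> (s \<otimes> alt b a j)" using Suc.IH[of b a] Suc.prems by simp
  also have "\<dots> = s \<otimes> alt a b (Suc j)" using Suc.prems by (simp add: alt_Suc m_assoc[symmetric])
  finally show ?case .
qed simp

lemma alt_commute_descent:
  assumes "s \<in> S" "a \<in> S" "b \<in> S" "a \<otimes> s = s \<otimes> a" "b \<otimes> s = s \<otimes> b" "s \<noteq> a" "s \<noteq> b" "y \<in> carrier W"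
  shows "s \<in> left_descents (alt a b j \<otimes> y) \<longleftrightarrow> s \<in> left_descents y"
  using assms
proof (induction j arbitrary: a b)
  case (Suc j)
  have "alt a b (Suc j) \<otimes> y = a \<otimes> (alt b a j \<otimes> y)" using Suc.prems by (simp add: alt_Suc m_assoc)
  then show ?case using descent_commuting[of a s "alt b a j \<otimes> y"] Suc.IH[of b a] Suc.prems by auto
qed simp

lemma Edih_commute:
  assumes "s \<in> S" "a \<in> S" "b \<in> S" "a \<noteq> b" "a \<otimes> s = s \<otimes> a" "b \<otimes> s = s \<otimes> b" "s \<noteq> a" "s \<noteq> b" "m a b = enat k"
  shows "Edih a b * Tn s = Tn s * Edih a b"
proof -
  have "Tn x * Tn s = Tn s * Tn x" if xd: "x \<in> dihedral a b" for x
  proof -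
    obtain c d j where x: "x = alt c d j" "{c, d} = {a, b}" using xd unfolding dihedral_def by blast
    have cd: "c \<in> S" "d \<in> S" "c \<otimes> s = s \<otimes> c" "d \<otimes> s = s \<otimes> d" "s \<noteq> c" "s \<noteq> d"
      using x assms by (auto simp: doubleton_eq_iff)
    have xc: "x \<in> carrier W" "x \<otimes> s = s \<otimes> x" using x cd assms alt_commute by auto
    have "s \<notin> left_descents x" using alt_commute_descent[of s c d \<one> j] cd assms x by simp
    then have "len (s \<otimes> x) = len x + 1" using not_left_descent_len assms xc by blast
    then show ?thesis using Tn_mult[of s x] Tn_mult[of x s] xc assms by simp
  qed
  then show ?thesis
    unfolding Edih_def sum_distrib_left sum_distrib_right
    by (intro sum.cong) (auto simp: scale_mult_left scale_mult_right)
qed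

text \<open>A descent commuting with both letters passes through the braid and is a descent of
  \<open>y\<close>; any other one falls under \<open>rep_overlap\<close>.\<close>

lemma rep_overlap_any:
  assumes prev: "\<And>j. j < len w \<Longrightarrow> rep_unique j" and ab: "noncommuting a b"
    and d: "a \<in> left_descents w" "b \<in> left_descents w" and w: "w \<in> carrier W"
    and s: "s \<in> left_descents w" and h: "rep (s \<otimes> w) h"
  shows "Tn s * h - KL w \<in> F (len w)"
proof -
  have abS: "a \<in> S" "b \<in> S" "a \<noteq> b" using noncommutingD ab by auto
  have sS: "s \<in> S" using s left_descentD by blast
  show ?thesis
  proof (cases "noncommuting s a \<or> noncommuting s b")
    case True
    then show ?thesis using rep_overlap[OF prev _ s _ w h] d by blast
  next
    case False
    then have c: "a \<otimes> s = s \<otimes> a" "b \<otimes> s = s \<otimes> b" using abS sS by (auto simp: noncommuting_def)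
    then have ne: "s \<noteq> a" "s \<noteq> b" using ab by (auto simp: noncommuting_def)
    obtain k y where y: "m a b = enat k" "y \<in> carrier W" "w = alt a b k \<otimes> y" "len w = k + len y"
      "left_descents y \<inter> {a, b} = {}" "rep w (Edih a b * Tn y)"
      using rep_braid[OF ab d w] by blast
    have sy: "s \<in> left_descents y" using alt_commute_descent[of s a b y k] s y sS abS c ne by simp
    have ly: "len y = len (s \<otimes> y) + 1" using left_descent_len sy y by blast
    have lw: "len w = len (s \<otimes> w) + 1" using left_descent_len s w by blast
    have sw: "s \<otimes> w = alt a b k \<otimes> (s \<otimes> y)"
      unfolding y(3) using alt_commute[of s a b k] sS abS c y by (simp add: m_assoc[symmetric])
    have "rep (s \<otimes> w) (Edih a b * Tn (s \<otimes> y))"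
      unfolding rep_def using ab y sw ly lw Tn_one abS sS
      by (intro exI[of _ \<one>] exI[of _ a] exI[of _ b] exI[of _ k] exI[of _ "s \<otimes> y"]) auto
    then have "h - Edih a b * Tn (s \<otimes> y) \<in> F (len (s \<otimes> w))" using rep_uniqueD[OF prev h] lw by simp
    then have "Tn s * (h - Edih a b * Tn (s \<otimes> y)) \<in> F (len w)" using F_gen_mult[OF sS] lw by fastforce
    moreover have "Tn s * (Edih a b * Tn (s \<otimes> y)) = Edih a b * Tn y"
    proof -
      have "Tn s * (Edih a b * Tn (s \<otimes> y)) = (Tn s * Edih a b) * Tn (s \<otimes> y)" by (rule mult.assoc[symmetric])
      also have "\<dots> = Edih a b * (Tn s * Tn (s \<otimes> y))"
        unfolding Edih_commute[OF sS abS c ne y(1), symmetric] by (rule mult.assoc)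
      finally show ?thesis unfolding Tn_gen_split[OF y(2) sy, symmetric] .
    qed
    ultimately have 1: "Tn s * h - Edih a b * Tn y \<in> F (len w)" by (simp add: right_diff_distrib)
    show ?thesis using F_trans[OF 1 rep_braid_KL[OF ab y(1-4) d]] .
  qed
qed

text \<open>The easy diamond: one representative of \<open>s \<otimes> (t \<otimes> w)\<close>,
  multiplied by \<open>Tn s * Tn t\<close>, serves both sides.\<close>

lemma rep_commuting_pair:
  assumes prev: "\<And>j. j < len w \<Longrightarrow> rep_unique j" and w: "w \<in> carrier W"
    and d: "s \<in> left_descents w" "t \<in> left_descents w" "s \<noteq> t" "s \<otimes> t = t \<otimes> s"
    and u: "is_complex (s \<otimes> (t \<otimes> w))" and h: "rep (s \<otimes> w) h1" "rep (t \<otimes> w) h2"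
  shows "Tn s * h1 - Tn t * h2 \<in> F (len w)"
proof -
  have st: "s \<in> S" "t \<in> S" using d left_descentD by auto
  have ts: "t \<otimes> (s \<otimes> w) = s \<otimes> (t \<otimes> w)" using commute_swap[of s t w] d st w by simp
  have td: "t \<in> left_descents (s \<otimes> w)" "s \<in> left_descents (t \<otimes> w)"
    using descent_commuting[of s t w] descent_commuting[of t s w] d st w by auto
  have l: "len w = len (s \<otimes> w) + 1" "len w = len (t \<otimes> w) + 1"
    by (rule left_descent_len[OF d(1) w], rule left_descent_len[OF d(2) w])
  obtain h where hu: "rep (s \<otimes> (t \<otimes> w)) h" using rep_exists u by blast
  have r: "rep (s \<otimes> w) (Tn t * h)" "rep (t \<otimes> w) (Tn s * h)"
    using rep_gen[of t "s \<otimes> w" h] rep_gen[of s "t \<otimes> w" h] ts hu td st w by auto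
  have "h1 - Tn t * h \<in> F (len (s \<otimes> w))" "h2 - Tn s * h \<in> F (len (t \<otimes> w))"
    using rep_uniqueD[OF prev h(1) r(1)] rep_uniqueD[OF prev h(2) r(2)] l by auto
  then have "Tn s * (h1 - Tn t * h) \<in> F (len w)" "Tn t * (h2 - Tn s * h) \<in> F (len w)"
    using F_gen_mult[OF st(1)] F_gen_mult[OF st(2)] l by (metis Suc_eq_plus1)+
  then have "Tn s * (h1 - Tn t * h) - Tn t * (h2 - Tn s * h) \<in> F (len w)" by (rule F_diff)
  moreover have "Tn s * (Tn t * h) = Tn t * (Tn s * h)"
    using Tn_commute[of s t] st d by (metis mult.assoc)
  ultimately show ?thesis by (simp add: right_diff_distrib)
qed

text \<open>
  Two braids overlapping in more than a common end letter occur only in \<open>s t b s t\<close> with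
  \<open>s, t\<close> commuting; there the two expressions are compared directly.
\<close>

lemma Edih_overlap:
  assumes "noncommuting t b" "noncommuting s b" "m t b = enat 3" "m s b = enat 3" "s \<otimes> t = t \<otimes> s"
  shows "C s * Edih t b * C s = C t * Edih s b * C t"
proof -
  have S: "s \<in> S" "t \<in> S" "b \<in> S" "t \<noteq> b" "s \<noteq> b" using assms noncommutingD by auto
  have "C s * C t = C t * C s"
    using C_commute[of s t] S assms(5) by (simp add: C_def distrib_left distrib_right scale_mult_left scale_mult_right scale_right_distrib Tn_commute add_ac)
  then have c: "C s * C t = C t * C s" "C s * (C t * x) = C t * (C s * x)" for x by (metis mult.assoc)+
  have sq: "C s * C s = laurent_delta *s C s" "C t * C t = laurent_delta *s C t" using C_square S by auto
  have sq': "C s * (C s * x) = laurent_delta *s (C s * x)" "C t * (C t * x) = laurent_delta *s (C t * x)" for x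
    using sq by (metis mult.assoc scale_mult_left)+
  show ?thesis
    unfolding Edih_three[OF S(2,3,4) assms(3)] Edih_three[OF S(1,3,5) assms(4)]
    by (simp add: left_diff_distrib right_diff_distrib mult.assoc c sq sq' scale_mult_right)
qed

text \<open>The braids in \<open>t, b\<close> and \<open>s, b\<close> both turn out to have bond 3,
  and \<open>w\<close> is the reduced product of \<open>s t b s t\<close> with some
  \<open>y'\<close>; the comparison then reduces to \<open>Edih_overlap\<close>.\<close>

lemma rep_A3:
  assumes prev: "\<And>j. j < len w \<Longrightarrow> rep_unique j" and w: "w \<in> carrier W"
    and d: "s \<in> left_descents w" "t \<in> left_descents w" "s \<noteq> t" "s \<otimes> t = t \<otimes> s"
    and u: "\<not> is_complex (s \<otimes> (t \<otimes> w))" and h: "rep (s \<otimes> w) h1" "rep (t \<otimes> w) h2"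
    and b: "noncommuting t b" "noncommuting s b" "b \<in> left_descents (s \<otimes> w)" "b \<in> left_descents (t \<otimes> w)"
  shows "Tn s * h1 - Tn t * h2 \<in> F (len w)"
proof -
  let ?u = "s \<otimes> (t \<otimes> w)"
  have st: "s \<in> S" "t \<in> S" "b \<in> S" "t \<noteq> b" "s \<noteq> b" using d left_descentD b noncommutingD by auto
  have ts: "t \<otimes> (s \<otimes> w) = ?u" using commute_swap[of s t w] d st w by simp
  have td: "t \<in> left_descents (s \<otimes> w)" "s \<in> left_descents (t \<otimes> w)"
    using descent_commuting[of s t w] descent_commuting[of t s w] d st w by auto
  have l: "len w = len (s \<otimes> w) + 1" "len w = len (t \<otimes> w) + 1"
    by (rule left_descent_len[OF d(1) w], rule left_descent_len[OF d(2) w])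
  have uc: "?u \<in> carrier W" using st w by simp
  have b': "noncommuting b t" "noncommuting b s" using b noncommutingD by auto
  have bu: "b \<in> left_descents ?u" using descent_two[of b t "s \<otimes> w"] st b td ts w by simp
  have tbu: "t \<in> left_descents (b \<otimes> ?u)" using descent_three[OF b'(1) b(3) td(1)] ts st w by simp
  have sbu: "s \<in> left_descents (b \<otimes> ?u)" using descent_three[OF b'(2) b(4) td(2)] st w by simp
  \<comment> \<open>A longer braid would leave \<open>b\<close> as a descent of
    \<open>p \<otimes> (b \<otimes> ?u)\<close>, next to the other one of \<open>s, t\<close>, which
    does not commute with \<open>b\<close>. Then \<open>?u\<close> would be complex.\<close>
  have three: "k = 3 \<and> b \<otimes> ?u = p \<otimes> y" if p: "p \<in> {s, t}" "m p b = enat k" "y \<in> carrier W"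
    "p \<otimes> ?u = alt p b k \<otimes> y" "left_descents y \<inter> {p, b} = {}" for p k y
  proof -
    have pS: "p \<in> S" "p \<noteq> b" "noncommuting p b" using p st b by auto
    define r where "r = (if p = s then t else s)"
    have r: "r \<in> S" "r \<noteq> p" "noncommuting r b" "p \<otimes> r = r \<otimes> p" "r \<in> left_descents (b \<otimes> ?u)" "p \<in> left_descents (b \<otimes> ?u)"
      using p st d b sbu tbu by (auto simp: r_def)
    have k3: "3 \<le> k" using noncommuting_bond[OF pS(3)] p by simp
    then obtain j where j: "k = Suc (Suc (Suc j))" by (metis Suc_le_D numeral_3_eq_3 Suc_le_mono)
    have mb: "m b p = enat k" using m_sym[of p b] p pS st by simp
    have "?u = p \<otimes> (p \<otimes> ?u)" using pS uc by simp
    then have ue: "?u = alt b p (Suc (Suc j)) \<otimes> y" unfolding p(4) j using pS st p by (simp add: alt_Suc m_assoc)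
    then have bue: "b \<otimes> ?u = alt p b (Suc j) \<otimes> y" using pS st p by (simp add: alt_Suc m_assoc)
    then have pbu: "p \<otimes> (b \<otimes> ?u) = alt b p j \<otimes> y" using pS st p by (simp add: alt_Suc m_assoc)
    have "j = 0"
    proof (rule ccontr)
      assume "j \<noteq> 0"
      then obtain i where i: "j = Suc i" by (cases j) auto
      have "b \<in> left_descents (p \<otimes> (b \<otimes> ?u))" unfolding pbu i
        by (rule alt_descent) (use pS st p mb j i in auto)
      moreover have "r \<in> left_descents (p \<otimes> (b \<otimes> ?u))"
        using descent_commuting[of p r "b \<otimes> ?u"] r pS st uc by simp
      ultimately have "is_complex (p \<otimes> (b \<otimes> ?u))" using two_descents_complex[OF r(3)] pS st uc by simp
      then show False using complex_of_descent[OF _ r(6)] complex_of_descent[OF _ bu uc] u st uc by simp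
    qed
    then show ?thesis using j bue p pS st by (simp add: alt_Suc)
  qed
  obtain k y where y: "m t b = enat k" "y \<in> carrier W" "s \<otimes> w = alt t b k \<otimes> y" "len (s \<otimes> w) = k + len y"
    "left_descents y \<inter> {t, b} = {}" "rep (s \<otimes> w) (Edih t b * Tn y)"
    using rep_braid[OF b(1) td(1) b(3)] st w by auto
  obtain k' z where z: "m s b = enat k'" "z \<in> carrier W" "t \<otimes> w = alt s b k' \<otimes> z" "len (t \<otimes> w) = k' + len z"
    "left_descents z \<inter> {s, b} = {}" "rep (t \<otimes> w) (Edih s b * Tn z)"
    using rep_braid[OF b(2) td(2) b(4)] st w by auto
  have tu: "t \<otimes> ?u = s \<otimes> w" "s \<otimes> ?u = t \<otimes> w" using ts st w by (metis gen_cancel gen_closed m_closed)+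
  have ky: "k = 3" "b \<otimes> ?u = t \<otimes> y" using three[of t k y] y tu by auto
  have kz: "k' = 3" "b \<otimes> ?u = s \<otimes> z" using three[of s k' z] z tu by auto
  have sy: "s \<in> left_descents y"
    using sbu ky(2) descent_commuting[of t s y] d st y by auto
  define y' where "y' = s \<otimes> y"
  have y': "y' \<in> carrier W" "len y = len y' + 1" "y = s \<otimes> y'" using st y left_descent_len[OF sy] by (auto simp: y'_def)
  have "s \<otimes> z = t \<otimes> (s \<otimes> y')" using ky kz y' by simp
  also have "\<dots> = s \<otimes> (t \<otimes> y')" using commute_swap[of s t y'] d st y' by simp
  finally have "s \<otimes> (s \<otimes> z) = s \<otimes> (s \<otimes> (t \<otimes> y'))" by simp
  then have zy: "z = t \<otimes> y'" using st z y' by simp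
  have lz: "len z = len y' + 1" using l y z ky kz y' by simp
  have Ty: "Tn y = Tn s * Tn y'" using Tn_gen_split[OF y(2) sy] by (simp add: y'_def)
  have Tz: "Tn z = Tn t * Tn y'" using Tn_mult[of t y'] zy lz y' st by simp
  \<comment> \<open>Passing from \<open>Tn p\<close> to \<open>C p\<close> on either side of the
    braid only produces terms with one factor fewer, hence of smaller nominal length.\<close>
  have one: "Tn p * Edih q b * Tn p * Tn y' - C p * Edih q b * C p * Tn y' \<in> F (len w)"
    if pq: "p \<in> S" "noncommuting q b" "m q b = enat 3" for p q
  proof -
    have T: "Tn p = C p - vpow (-1) *s 1" by (simp add: C_def)
    have "C p * Edih q b * Tn y' \<in> F (len w)"
      by (rule F_product[OF pq(2,3), of 1 _ "len y'"]) (use l y ky y' low_C[OF pq(1)] low_Tn in \<open>auto simp: numeral_2_eq_2\<close>)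
    moreover have "1 * Edih q b * (C p * Tn y') \<in> F (len w)"
      by (rule F_product[OF pq(2,3) low_1, of "Suc (len y')"])
        (use l y ky y' low_mult[of 1 "C p" "Suc (len y')" "Tn y'"] low_C[OF pq(1)] low_Tn in \<open>auto simp: numeral_2_eq_2\<close>)
    moreover have "1 * Edih q b * Tn y' \<in> F (len w)"
      by (rule F_product[OF pq(2,3) low_1, of "len y'"]) (use l y ky y' low_Tn in auto)
    ultimately have "(vpow (-1) * vpow (-1)) *s (1 * Edih q b * Tn y') - vpow (-1) *s (C p * Edih q b * Tn y')
        - vpow (-1) *s (1 * Edih q b * (C p * Tn y')) \<in> F (len w)" by (intro F_diff F_scale)
    moreover have "Tn p * Edih q b * Tn p * Tn y' - C p * Edih q b * C p * Tn y'
      = (vpow (-1) * vpow (-1)) *s (1 * Edih q b * Tn y') - vpow (-1) *s (C p * Edih q b * Tn y')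
        - vpow (-1) *s (1 * Edih q b * (C p * Tn y'))"
      unfolding T by (simp add: left_diff_distrib right_diff_distrib scale_mult_left scale_mult_right scale_right_diff_distrib mult.assoc)
    ultimately show ?thesis by simp
  qed
  have "h1 - Edih t b * Tn y \<in> F (len (s \<otimes> w))" "h2 - Edih s b * Tn z \<in> F (len (t \<otimes> w))"
    using rep_uniqueD[OF prev h(1) y(6)] rep_uniqueD[OF prev h(2) z(6)] l by auto
  then have 1: "Tn s * (h1 - Edih t b * Tn y) \<in> F (len w)" "Tn t * (h2 - Edih s b * Tn z) \<in> F (len w)"
    using F_gen_mult[OF st(1)] F_gen_mult[OF st(2)] l by (metis Suc_eq_plus1)+
  have 2: "Tn s * Edih t b * Tn s * Tn y' - C s * Edih t b * C s * Tn y' \<in> F (len w)"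
    "Tn t * Edih s b * Tn t * Tn y' - C t * Edih s b * C t * Tn y' \<in> F (len w)"
    using one[OF st(1) b(1)] one[OF st(2) b(2)] y z ky kz by auto
  have "C s * Edih t b * C s = C t * Edih s b * C t"
    using Edih_overlap[OF b(1,2)] y z ky kz d by simp
  then have "Tn s * h1 - Tn t * h2 = Tn s * (h1 - Edih t b * Tn y) - Tn t * (h2 - Edih s b * Tn z)
    + (Tn s * Edih t b * Tn s * Tn y' - C s * Edih t b * C s * Tn y')
    - (Tn t * Edih s b * Tn t * Tn y' - C t * Edih s b * C t * Tn y')"
    unfolding Ty Tz by (simp add: right_diff_distrib mult.assoc)
  then show ?thesis using F_diff[OF F_add[OF F_diff[OF 1] 2(1)] 2(2)] by simp
qed

text \<open>Suppose \<open>s \<otimes> (t \<otimes> w)\<close> is not complex, so that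
  \<open>t\<close> completes a braid. If it does so in front with a letter \<open>b\<close>, the
  same \<open>b\<close> occurs for \<open>s\<close>, which is the situation of
  \<open>rep_A3\<close>. If a letter \<open>p\<close> commuting with \<open>t\<close> stands in
  front, it is a third descent of \<open>w\<close>, and \<open>s\<close> and \<open>t\<close> are
  each compared with \<open>p\<close> by the easy diamond.\<close>

lemma rep_two_gens:
  assumes prev: "\<And>j. j < len w \<Longrightarrow> rep_unique j" and w: "w \<in> carrier W"
    and nc: "\<And>a b. a \<in> left_descents w \<Longrightarrow> b \<in> left_descents w \<Longrightarrow> \<not> noncommuting a b"
    and d: "s \<in> left_descents w" "t \<in> left_descents w" "s \<noteq> t"
    and h: "rep (s \<otimes> w) h1" "rep (t \<otimes> w) h2"
  shows "Tn s * h1 - Tn t * h2 \<in> F (len w)"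
proof -
  have st: "s \<in> S" "t \<in> S" using d left_descentD by auto
  have cm: "s \<otimes> t = t \<otimes> s" using nc[OF d(1,2)] st by (auto simp: noncommuting_def)
  let ?u = "s \<otimes> (t \<otimes> w)"
  have ts: "t \<otimes> (s \<otimes> w) = ?u" using commute_swap[of s t w] cm st w by simp
  have td: "t \<in> left_descents (s \<otimes> w)" "s \<in> left_descents (t \<otimes> w)"
    using descent_commuting[of s t w] descent_commuting[of t s w] d cm st w by auto
  have tu: "t \<otimes> ?u = s \<otimes> w" "s \<otimes> ?u = t \<otimes> w" using ts st w by (metis gen_cancel gen_closed m_closed)+
  have uc: "?u \<in> carrier W" using st w by simp
  have nd: "t \<notin> left_descents ?u" "s \<notin> left_descents ?u"
    using left_descent_mult[of "s \<otimes> w" t] left_descent_mult[of "t \<otimes> w" s] td ts st w by auto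
  show ?thesis
  proof (cases "is_complex ?u")
    case True
    then show ?thesis using rep_commuting_pair[OF prev w d cm _ h] by blast
  next
    case False
    have cx: "is_complex (t \<otimes> ?u)" "is_complex (s \<otimes> ?u)" using rep_complex h tu by auto
    from becomes_complex[OF uc False st(2) nd(1) cx(1)] show ?thesis
    proof (elim disjE exE bexE conjE)
      fix b assume b: "noncommuting t b" "t \<in> left_descents (t \<otimes> ?u)" "b \<in> left_descents (t \<otimes> ?u)"
      have bS: "b \<in> S" "b \<noteq> t" using noncommutingD b by auto
      have "b \<noteq> s" using b cm by (auto simp: noncommuting_def)
      have sb: "noncommuting s b"
      proof (rule ccontr)
        assume "\<not> noncommuting s b"
        then have "s \<otimes> b = b \<otimes> s" using st bS by (auto simp: noncommuting_def)
        then have "b \<in> left_descents w" using descent_commuting[of s b w] b tu \<open>b \<noteq> s\<close> st bS w by auto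
        then show False using nc[OF d(2)] b by blast
      qed
      have "b \<in> left_descents ?u" using descent_two[of b t "t \<otimes> ?u"] b bS st uc by simp
      then have "b \<in> left_descents (s \<otimes> ?u)"
        using becomes_complex_descent[OF uc False nd(2) cx(2)] sb noncommutingD by blast
      then show ?thesis using rep_A3[OF prev w d cm False h b(1) sb] b tu by auto
    next
      fix p assume p: "p \<in> left_descents ?u" "p \<otimes> t = t \<otimes> p" "p \<noteq> t" "is_complex (t \<otimes> (p \<otimes> ?u))"
      have pS: "p \<in> S" using p left_descentD by blast
      have "p \<noteq> s" using p nd by auto
      have ptu: "p \<in> left_descents (s \<otimes> w)" using descent_commuting[of t p ?u] p pS st uc tu by auto
      have ps: "p \<otimes> s = s \<otimes> p"
      proof (rule ccontr)
        assume "p \<otimes> s \<noteq> s \<otimes> p"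
        then have nps: "noncommuting p s" using pS st by (auto simp: noncommuting_def)
        have "p \<in> left_descents (s \<otimes> ?u)" using becomes_complex_descent[OF uc False nd(2) cx(2) p(1) nps] .
        then have "p \<in> left_descents w" using descent_commuting[of t p w] p pS st w tu by auto
        then show False using nc[OF _ d(1)] nps by blast
      qed
      have pw: "p \<in> left_descents w" using descent_commuting[of s p w] ps pS st w \<open>p \<noteq> s\<close> ptu by auto
      have spw: "s \<otimes> (p \<otimes> w) = t \<otimes> (p \<otimes> ?u)"
      proof -
        have "s \<otimes> (p \<otimes> w) = p \<otimes> (t \<otimes> ?u)" using commute_swap[of p s w] ps pS st w tu by simp
        then show ?thesis using commute_swap[of p t ?u] p pS st uc by simp
      qed
      have tpw: "t \<otimes> (p \<otimes> w) = s \<otimes> (p \<otimes> ?u)"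
      proof -
        have "t \<otimes> (p \<otimes> w) = p \<otimes> (s \<otimes> ?u)" using commute_swap[of p t w] p pS st w tu by simp
        then show ?thesis using commute_swap[of p s ?u] ps pS st uc by simp
      qed
      have sp: "is_complex (s \<otimes> (p \<otimes> w))" using p spw by simp
      \<comment> \<open>Otherwise neither \<open>?u\<close> nor
        \<open>s \<otimes> (p \<otimes> ?u)\<close> is complex, and
        \<open>commuting_extension_not_complex\<close> would keep \<open>s \<otimes> ?u\<close> from
        being complex.\<close>
      have tp: "is_complex (t \<otimes> (p \<otimes> w))"
      proof (rule ccontr)
        assume n: "\<not> is_complex (t \<otimes> (p \<otimes> w))"
        have "\<not> is_complex (p \<otimes> (s \<otimes> (p \<otimes> ?u)))"
          by (rule commuting_extension_not_complex)
            (use n tpw False nd p ps pS st uc \<open>p \<noteq> s\<close> left_descent_mult[of ?u p] descent_commuting[of p s ?u] in auto)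
        moreover have "p \<otimes> (s \<otimes> (p \<otimes> ?u)) = s \<otimes> ?u" using commute_swap[of p s "p \<otimes> ?u"] ps pS st uc by simp
        ultimately show False using cx by simp
      qed
      have "is_complex (p \<otimes> w)"
        using complex_of_descent[of s "p \<otimes> w"] sp descent_commuting[of p s w] d ps \<open>p \<noteq> s\<close> pS st w by auto
      then obtain h3 where h3: "rep (p \<otimes> w) h3" using rep_exists by blast
      have 1: "Tn s * h1 - Tn p * h3 \<in> F (len w)"
        using rep_commuting_pair[OF prev w d(1) pw _ _ sp h(1) h3] \<open>p \<noteq> s\<close> ps by auto
      have 2: "Tn t * h2 - Tn p * h3 \<in> F (len w)"
        using rep_commuting_pair[OF prev w d(2) pw _ _ tp h(2) h3] p by auto
      show ?thesis using F_trans[OF 1 F_sym[OF 2]] .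
    qed
  qed
qed

theorem rep_unique: "rep_unique n"
proof (induction n rule: less_induct)
  case (less n)
  show ?case unfolding rep_unique_def
  proof (intro allI impI)
    fix w h h' assume w: "len w = n" and h: "rep w h" "rep w h'"
    have prev: "\<And>j. j < len w \<Longrightarrow> rep_unique j" using less w by simp
    have wc: "w \<in> carrier W" using rep_closed h by blast
    show "h - h' \<in> F n"
    proof (cases "\<exists>a b. a \<in> left_descents w \<and> b \<in> left_descents w \<and> noncommuting a b")
      case True
      then obtain a b where ab: "a \<in> left_descents w" "b \<in> left_descents w" "noncommuting a b" by blast
      have "h - KL w \<in> F (len w)" if "rep w h" for h
        using that
      proof (cases rule: rep_cases)
        case (braid a b k y)
        then show ?thesis using rep_braid_KL by blast
      next
        case (gen s h')
        then show ?thesis using rep_overlap_any[OF prev ab(3,1,2) wc] by blast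
      qed
      from F_trans[OF this[OF h(1)] F_sym[OF this[OF h(2)]]] show ?thesis using w by simp
    next
      case False
      have g: "\<exists>s h'. s \<in> left_descents w \<and> rep (s \<otimes> w) h' \<and> h = Tn s * h'" if "rep w h" for h
        using that by (cases rule: rep_cases) (use False in blast)+
      obtain s h1 where s: "s \<in> left_descents w" "rep (s \<otimes> w) h1" "h = Tn s * h1" using g[OF h(1)] by blast
      obtain t h2 where t: "t \<in> left_descents w" "rep (t \<otimes> w) h2" "h' = Tn t * h2" using g[OF h(2)] by blast
      show ?thesis
      proof (cases "s = t")
        case True
        have sS: "s \<in> S" using s left_descentD by blast
        have l: "len w = len (s \<otimes> w) + 1" using left_descent_len s wc by blast
        have "h1 - h2 \<in> F (len (s \<otimes> w))" using rep_uniqueD[OF prev s(2), of h2] t l True by simp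
        then have "Tn s * (h1 - h2) \<in> F (len w)" using F_gen_mult[OF sS] l by (metis Suc_eq_plus1)
        then show ?thesis using s t True w by (simp add: right_diff_distrib)
      next
        case ne: False
        then show ?thesis using rep_two_gens[OF prev wc _ s(1) t(1) ne s(2) t(2)] False s t w by blast
      qed
    qed
  qed
qed

section \<open>Fully commutative elements are independent modulo the ideal\<close>

text \<open>A nonreduced product loses one step in the filtration at the letter where reducedness
  fails. To the right of the braid that letter is absorbed by \<open>Edih_Tn\<close>. To the left,
  the remaining product is divisible by \<open>C s\<close> modulo lower terms, and
  \<open>Tn s\<close> acts on \<open>C s\<close> as a scalar.\<close>

lemma product_reduced_or_shorter:
  assumes "x \<in> carrier W" "y \<in> carrier W" "noncommuting a b" "m a b = enat k"
  shows "len (x \<otimes> alt a b k \<otimes> y) = len x + k + len y \<or> Tn x * Edih a b * Tn y \<in> F (len x + k + len y)"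
  using assms
proof (induction "len x" arbitrary: x)
  case 0
  have ab: "a \<in> S" "b \<in> S" "a \<noteq> b" using noncommutingD 0 by auto
  have x: "x = \<one>" using 0 len_eq_0 by simp
  show ?case
  proof (cases "left_descents y \<inter> {a, b} = {}")
    case True
    then show ?thesis using alt_len[OF ab 0(3) True] 0 x ab by simp
  next
    case False
    then obtain p where p: "p \<in> {a, b}" "p \<in> left_descents y" by blast
    have pS: "p \<in> S" using p left_descentD by blast
    have "Edih a b * Tn y = Edih a b * Tn p * Tn (p \<otimes> y)"
      using Tn_gen_split[OF 0(3) p(2)] by (simp add: mult.assoc)
    also have "\<dots> = vpow 1 *s (1 * Edih a b * Tn (p \<otimes> y))"
      using Edih_Tn[OF ab 0(5) p(1)] by (simp add: scale_mult_left)
    also have "\<dots> \<in> F (k + len y)"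
      by (intro F_scale F_product[OF 0(4,5) low_1, of "len (p \<otimes> y)"])
        (use left_descent_len[OF p(2) 0(3)] low_Tn pS 0 in auto)
    finally show ?thesis using x Tn_one by simp
  qed
next
  case (Suc n)
  have ab: "a \<in> S" "b \<in> S" "a \<noteq> b" using noncommutingD Suc by auto
  have "x \<noteq> \<one>" using Suc by auto
  then obtain s where s: "s \<in> left_descents x" using ex_left_descent Suc.prems by blast
  have sS: "s \<in> S" using s left_descentD by blast
  let ?x = "s \<otimes> x"
  have x: "?x \<in> carrier W" "s \<otimes> ?x = x" "len x = len ?x + 1" using sS Suc.prems left_descent_len[OF s] by auto
  let ?w = "?x \<otimes> alt a b k \<otimes> y" and ?N = "len ?x + k + len y"
  let ?h = "Tn ?x * Edih a b * Tn y"
  have e: "Tn x * Edih a b * Tn y = Tn s * ?h" using Tn_gen_split[OF Suc.prems(1) s] by (simp add: mult.assoc)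
  have sw: "x \<otimes> alt a b k \<otimes> y = s \<otimes> ?w" using x(2) sS ab x(1) Suc.prems by (metis alt_closed gen_closed m_assoc m_closed)
  have wc: "?w \<in> carrier W" using x ab Suc.prems by simp
  have "len ?w = ?N \<or> ?h \<in> F ?N" using Suc.hyps(1)[of ?x] Suc.hyps(2) Suc.prems x by simp
  then show ?case
  proof
    assume "?h \<in> F ?N"
    then show ?thesis using F_gen_mult[OF sS] e x by auto
  next
    assume l: "len ?w = ?N"
    have r: "rep ?w ?h" unfolding rep_def using x Suc.prems l by blast
    show ?thesis
    proof (cases "s \<in> left_descents ?w")
      case False
      then show ?thesis using not_left_descent_len[OF False sS wc] l sw x by simp
    next
      case True
      obtain f where f: "?h - C s * (Tn (s \<otimes> ?w) + f) \<in> F ?N"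
        using rep_divisible[OF rep_unique r True] l by metis
      let ?g = "C s * (Tn (s \<otimes> ?w) + f)"
      have g: "Tn s * ?g = vpow 1 *s ?g"
      proof -
        have "C s * C s = Tn s * C s + vpow (-1) *s C s" by (simp add: C_mult)
        then have "Tn s * C s = vpow 1 *s C s" using C_square[OF sS] by (simp add: laurent_delta_def scale_left_distrib)
        then show ?thesis by (simp add: mult.assoc[symmetric] scale_mult_left)
      qed
      have "Tn s * ?h = Tn s * (?h - ?g) + vpow 1 *s ?h - vpow 1 *s (?h - ?g)"
        using g by (simp add: right_diff_distrib scale_right_diff_distrib)
      moreover have "Tn s * (?h - ?g) \<in> F (Suc ?N)" using F_gen_mult[OF sS f] .
      moreover have "?h \<in> F (Suc ?N)" using rep_F[OF r] l by simp
      moreover have "?h - ?g \<in> F (Suc ?N)" using F_mono[OF _ f] by simp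
      ultimately have "Tn s * ?h \<in> F (Suc ?N)" using F_add F_diff F_scale by presburger
      then show ?thesis using e x by simp
    qed
  qed
qed

text \<open>One representative is fixed for each complex \<open>w\<close> of length
  \<open>n\<close>. Reduced products of nominal length \<open>n\<close> agree with it modulo
  \<open>F n\<close> by uniqueness, nonreduced ones lie in \<open>F n\<close>; so an element of
  \<open>F (Suc n)\<close> is determined modulo \<open>F n\<close> by its coefficients at these
  \<open>w\<close>.\<close>

lemma F_leading:
  assumes "f \<in> F (Suc n)" "\<And>w. w \<in> carrier W \<Longrightarrow> is_complex w \<Longrightarrow> len w = n \<Longrightarrow> cf f w = 0"
  shows "f \<in> F n"
proof -
  let ?A = "{w \<in> carrier W. is_complex w \<and> len w = n}"
  have fin: "finite ?A" by (rule finite_subset[OF _ finite_len_le[of n]]) auto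
  define J where "J = (\<lambda>w. SOME h. rep w h)"
  have J: "rep w (J w)" if "w \<in> ?A" for w
  proof -
    have "\<exists>h. rep w h" using rep_exists that by blast
    then show ?thesis unfolding J_def by (rule someI_ex)
  qed
  have "f - (\<Sum>w\<in>?A. cf f w *s J w) \<in> F n"
    using assms(1)
  proof (induction rule: F_induct)
    case zero
    then show ?case by (simp add: F_0)
  next
    case (add g h)
    from F_add[OF this] show ?case by (simp add: Tn.coef_add scale_left_distrib sum.distrib algebra_simps)
  next
    case (scale c h)
    from F_scale[OF this, of c] show ?case
      by (simp add: Tn.coef_scale scale_right_diff_distrib scale_sum_right)
  next
    case (product x a b k y)
    let ?h = "Tn x * Edih a b * Tn y" and ?w = "x \<otimes> alt a b k \<otimes> y"
    have shorter: ?case if "?h \<in> F n"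
    proof -
      have "cf ?h w = 0" if "w \<in> ?A" for w using low_F[OF \<open>?h \<in> F n\<close>] that by (auto simp: low_def)
      then have "(\<Sum>w\<in>?A. cf ?h w *s J w) = 0" by (intro sum.neutral) simp
      then show ?thesis using that by simp
    qed
    show ?case
    proof (cases "len ?w = n \<and> len x + k + len y = n")
      case True
      have "len ?w = len x + k + len y" using True by simp
      then have r: "rep ?w ?h" unfolding rep_def using product(1-4) by blast
      have wA: "?w \<in> ?A" using rep_closed[OF r] rep_complex[OF r] True by simp
      have "cf ?h w = (if w = ?w then 1 else 0)" if "w \<in> ?A" for w
      proof -
        have "cf (?h - Tn ?w) w = 0" using rep_top[OF r] that True by (auto simp: low_def)
        then show ?thesis using that rep_closed[OF r] by (simp add: Tn.coef_diff Tn.coef_basis split: if_splits)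
      qed
      then have "(\<Sum>w\<in>?A. cf ?h w *s J w) = (\<Sum>w\<in>?A. if w = ?w then J ?w else 0)"
        by (intro sum.cong) auto
      also have "\<dots> = J ?w" using fin wA by simp
      finally have "(\<Sum>w\<in>?A. cf ?h w *s J w) = J ?w" .
      moreover have "?h - J ?w \<in> F n" using rep_uniqueD[OF rep_unique r J[OF wA]] True by simp
      ultimately show ?thesis by simp
    next
      case False
      have "?h \<in> F n"
      proof (cases "len x + k + len y = n")
        case True
        then show ?thesis using product_reduced_or_shorter[OF product(1-4)] False by auto
      next
        case False
        then show ?thesis using product
          by (intro F_product[OF product(3,4), of "len x" _ "len y"] low_Tn) auto
      qed
      then show ?thesis by (rule shorter)
    qed
  qed
  moreover have "(\<Sum>w\<in>?A. cf f w *s J w) = 0" using assms(2) by (intro sum.neutral) simp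
  ultimately show ?thesis by simp
qed

text \<open>\<open>KL\<close> is unitriangular over \<open>Tn\<close>, so in the top length the two
  expansions agree.\<close>

lemma KL_coef_top:
  assumes "low (Suc n) h"
  shows "w \<in> carrier W \<Longrightarrow> len w = n \<Longrightarrow> KL.coef h w = cf h w"
proof -
  assume w: "w \<in> carrier W" "len w = n"
  let ?B = "{z \<in> carrier W. KL.coef h z \<noteq> 0}"
  have fin: "finite ?B" by (rule KL.finite_coef)
  have e: "cf h y = (\<Sum>z\<in>?B. KL.coef h z * cf (KL z) y)" for y
    using arg_cong[OF KL.expand[of h], of "\<lambda>h. cf h y"] by (simp add: Tn.coef_sum Tn.coef_scale)
  have top: "cf h y = KL.coef h y" if y: "y \<in> carrier W" "\<And>z. z \<in> ?B \<Longrightarrow> len z \<le> len y" for y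
  proof -
    have "cf h y = (\<Sum>z\<in>?B. if z = y then KL.coef h y else 0)"
      unfolding e
    proof (rule sum.cong)
      fix z assume z: "z \<in> ?B"
      have "z \<noteq> y \<Longrightarrow> cf (KL z) y = 0" using KL_cf_len[of z y] y(2)[OF z] z y(1) by force
      then show "KL.coef h z * cf (KL z) y = (if z = y then KL.coef h y else 0)"
        using KL_cf_self[of y] y by auto
    qed simp
    then show ?thesis using fin y by auto
  qed
  have le: "len z \<le> n" if z: "z \<in> ?B" for z
  proof -
    have "Max (len ` ?B) \<in> len ` ?B" using fin z by (intro Max_in) auto
    then obtain y where y: "y \<in> ?B" "len y = Max (len ` ?B)" by auto
    have max: "\<And>x. x \<in> ?B \<Longrightarrow> len x \<le> len y" using y(2) fin by auto
    have "cf h y \<noteq> 0" using top[of y] max y by auto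
    then have "len y < Suc n" using assms y by (auto simp: low_def)
    then show ?thesis using max[OF z] by simp
  qed
  show ?thesis using top[of w] le w by simp
qed

text \<open>With no component at complex elements, \<open>f\<close> sinks through the filtration
  step by step, down to \<open>F 0\<close>, which is zero. For combinations of \<open>KL w\<close>
  with \<open>w\<close> fully commutative this is independence modulo the ideal.\<close>

theorem F_independent:
  assumes "f \<in> F n" "\<And>w. w \<in> carrier W \<Longrightarrow> is_complex w \<Longrightarrow> KL.coef f w = 0" shows "f = 0"
  using assms
proof (induction n)
  case 0
  then show ?case using F_zero by blast
next
  case (Suc n)
  have "f \<in> F n"
  proof (rule F_leading[OF Suc.prems(1)])
    fix w assume w: "w \<in> carrier W" "is_complex w" "len w = n"
    show "cf f w = 0"
      using KL_coef_top[OF low_F[OF Suc.prems(1)] w(1,3)] Suc.prems(2)[OF w(1,2)] by simp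
  qed
  then show ?case using Suc by blast
qed

end

section \<open>The Temperley--Lieb ideal and the Kazhdan--Lusztig basis\<close>

context hecke_algebra
begin

definition TL_ideal :: "'h set" where
  "TL_ideal = (\<Union>n. F n)"

lemma ideal_0 [simp]: "0 \<in> TL_ideal"
  using F_0 by (auto simp: TL_ideal_def)

lemma ideal_add: "g \<in> TL_ideal \<Longrightarrow> h \<in> TL_ideal \<Longrightarrow> g + h \<in> TL_ideal"
proof -
  assume "g \<in> TL_ideal" "h \<in> TL_ideal"
  then obtain i j where "g \<in> F i" "h \<in> F j" by (auto simp: TL_ideal_def)
  then have "g + h \<in> F (max i j)" using F_mono[of i "max i j"] F_mono[of j "max i j"] by (intro F_add) auto
  then show ?thesis by (auto simp: TL_ideal_def)
qed

lemma ideal_scale: "h \<in> TL_ideal \<Longrightarrow> c *s h \<in> TL_ideal"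
  using F_scale by (auto simp: TL_ideal_def)

lemma ideal_diff: "g \<in> TL_ideal \<Longrightarrow> h \<in> TL_ideal \<Longrightarrow> g - h \<in> TL_ideal"
  using ideal_add[of g "(-1) *s h"] ideal_scale[of h "-1"] by simp

lemma ideal_sum: "(\<And>x. x \<in> A \<Longrightarrow> f x \<in> TL_ideal) \<Longrightarrow> sum f A \<in> TL_ideal"
  by (induction A rule: infinite_finite_induct) (auto intro: ideal_add)

lemma ex_low: "\<exists>n. low (Suc n) h"
proof -
  let ?A = "{w \<in> carrier W. cf h w \<noteq> 0}"
  have "finite (len ` ?A)" using Tn.finite_coef by blast
  then have "\<exists>n. \<forall>k \<in> len ` ?A. k \<le> n" using finite_nat_set_iff_bounded_le by blast
  then obtain n where "\<And>w. w \<in> ?A \<Longrightarrow> len w \<le> n" by blast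
  then show ?thesis by (intro exI[of _ n]) (auto simp: low_def less_Suc_eq_le)
qed

lemma ideal_mult_left: "h \<in> TL_ideal \<Longrightarrow> g * h \<in> TL_ideal"
  and ideal_mult_right: "h \<in> TL_ideal \<Longrightarrow> h * g \<in> TL_ideal"
proof -
  obtain i where i: "low (Suc i) g" using ex_low by blast
  assume "h \<in> TL_ideal"
  then obtain n where n: "h \<in> F n" by (auto simp: TL_ideal_def)
  show "g * h \<in> TL_ideal" using F_mult_left[OF i n] by (auto simp: TL_ideal_def)
  show "h * g \<in> TL_ideal" using F_mult_right[OF i n] by (auto simp: TL_ideal_def)
qed

lemma ideal_cancel: "a \<in> TL_ideal \<Longrightarrow> a - (b + r) \<in> TL_ideal \<Longrightarrow> r \<in> TL_ideal \<Longrightarrow> b \<in> TL_ideal"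
  using ideal_diff[OF ideal_diff[of a "a - (b + r)"], of r] by simp

lemma str_len_less: "is_base s t u \<Longrightarrow> enat (Suc j) < m s t \<Longrightarrow> len (str s t u j) < len (str s t u (Suc j))"
  using str_len[of s t u j] str_len[of s t u "Suc j"] order.strict_trans[of "enat j" "enat (Suc j)" "m s t"]
  by (simp add: less_imp_le)

lemma ideal_iota: assumes "h \<in> TL_ideal" shows "iota h \<in> TL_ideal"
proof -
  obtain n where "h \<in> F n" using assms by (auto simp: TL_ideal_def)
  then show ?thesis
  proof (induction rule: F_induct)
    case (product x a b k y)
    have ab: "a \<in> S" "b \<in> S" "a \<noteq> b" using noncommutingD product by auto
    have "iota (Tn x * Edih a b * Tn y) = Tn (inv y) * Edih a b * Tn (inv x)"
      using product iota_Edih[OF ab product(4)] by (simp add: iota_mult iota_Tn mult.assoc)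
    moreover have "Tn (inv y) * Edih a b * Tn (inv x) \<in> F n"
      by (rule F_product[OF product(3,4) low_Tn low_Tn, of _ "len y" _ "len x"]) (use product in auto)
    ultimately show ?case by (auto simp: TL_ideal_def)
  qed (auto simp: iota_add iota_scale intro: ideal_add ideal_scale)
qed

text \<open>\<open>KL w\<close> is an eigenvector for both letters, so \<open>eigen_F\<close>
  applies with any bound on its support.\<close>

lemma descent_pair_in_ideal:
  assumes "noncommuting s t" "s \<in> left_descents w" "t \<in> left_descents w" "w \<in> carrier W"
  shows "KL w \<in> TL_ideal"
proof -
  obtain n where "low (Suc n) (KL w)" using ex_low by blast
  then have "KL w \<in> F (Suc n)"
    by (rule eigen_F[OF assms(1)]) (use KL_down assms in auto)
  then show ?thesis by (auto simp: TL_ideal_def)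
qed

text \<open>Apart from the upper neighbour, the terms of the product with both letters as descents
  lie in the ideal, and among those without \<open>?q\<close> as a descent \<open>mu_ascent\<close>
  leaves at most the lower neighbour, with coefficient 1.\<close>

lemma string_mult:
  assumes b: "is_base s t u" and j: "1 \<le> j" "enat j < m s t"
  shows "C (letter s t (Suc j)) * KL (str s t u j)
    - (KL (str s t u (Suc j)) + (if j = 1 then 0 else KL (str s t u (j - 1)))) \<in> TL_ideal"
proof -
  let ?w = "str s t u j" and ?p = "letter s t (Suc j)" and ?q = "letter s t j"
  have wc: "?w \<in> carrier W" by (rule str_closed[OF b])
  have pq: "?p \<in> S" "?q \<in> S" "noncommuting ?p ?q" using letter_bond[OF b] noncommutingD by blast+
  have pw: "?p \<notin> left_descents ?w" by (rule str_not_descent[OF b j(2)])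
  have qw: "?q \<in> left_descents ?w" using str_descent[OF b j(1)] j by simp
  have down: "?q \<otimes> ?w = str s t u (j - 1)" using str_down[OF b, of "j - 1"] j by simp
  let ?B = "below ?p ?w"
  have e: "C ?p * KL ?w = KL (str s t u (Suc j)) + (\<Sum>z\<in>?B. of_int (mu z ?w) *s KL z)"
    using KL_up[OF wc pq(1) pw] str_Suc[OF b] by simp
  let ?D = "{z \<in> ?B. ?q \<in> left_descents z}" and ?N = "{z \<in> ?B. ?q \<notin> left_descents z}"
  have D: "(\<Sum>z\<in>?D. of_int (mu z ?w) *s KL z) \<in> TL_ideal"
    by (intro ideal_sum ideal_scale) (use descent_pair_in_ideal[OF pq(3)] in \<open>auto simp: below_def\<close>)
  have N: "z = ?q \<otimes> ?w \<and> mu z ?w = 1" if "z \<in> ?N" for z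
  proof -
    have z: "z \<in> carrier W" "mu z ?w \<noteq> 0" "?q \<notin> left_descents z" using that by (auto simp: below_def)
    then have "?q \<otimes> z = ?w" "mu z ?w = 1" using mu_ascent[OF wc qw z(1,3)] by (auto split: if_splits)
    then show ?thesis using gen_cancel[OF pq(2) z(1)] by simp
  qed
  have "(\<Sum>z\<in>?N. of_int (mu z ?w) *s KL z) = (if j = 1 then 0 else KL (str s t u (j - 1)))"
  proof (cases "j = 1")
    case True
    \<comment> \<open>For \<open>j = 1\<close> the lower neighbour would be the base
      \<open>u\<close>, which has no descent in the pair and so cannot occur.\<close>
    have e0: "?N = {}"
    proof (rule ccontr)
      assume "?N \<noteq> {}"
      then obtain z where z: "z \<in> ?N" by blast
      then have "z = u" using N[OF z] down True str_0[OF b] by simp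
      then have "?p \<in> left_descents u" using z by (simp add: below_def)
      then show False using letter_bond(5)[OF b, of j] by blast
    qed
    show ?thesis unfolding e0 using True by simp
  next
    case False
    then obtain i where i: "j = Suc i" "1 \<le> i" using j by (cases j) auto
    let ?z = "?q \<otimes> ?w"
    have zc: "?z \<in> carrier W" using wc pq by simp
    have "enat i < m s t" using j i order.strict_trans[of "enat i" "enat j"] by simp
    then have "letter s t i \<in> left_descents (str s t u i)" using str_descent[OF b i(2)] by simp
    then have pz: "?p \<in> left_descents ?z" using down i letter_bond(6)[OF b, of i] by simp
    have qz: "?q \<notin> left_descents ?z" using left_descent_mult[OF wc pq(2)] qw by blast
    have "mu ?z ?w = 1" using mu_ascent[OF wc qw zc qz] wc pq by simp
    then have "?z \<in> ?N" using zc pz qz by (simp add: below_def)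
    then have e1: "?N = {?z}" using N by blast
    show ?thesis unfolding e1 using \<open>mu ?z ?w = 1\<close> down False by simp
  qed
  moreover have "(\<Sum>z\<in>?B. of_int (mu z ?w) *s KL z) = (\<Sum>z\<in>?D. of_int (mu z ?w) *s KL z) + (\<Sum>z\<in>?N. of_int (mu z ?w) *s KL z)"
    by (subst sum.union_disjoint[symmetric]) (auto simp: finite_below intro: sum.cong)
  ultimately show ?thesis using e D by simp
qed

text \<open>\<open>string_mult\<close> solved for the upper neighbour: the product lies in the ideal
  with \<open>KL x\<close>, and the lower neighbour, if present, is complex and shorter.\<close>

lemma left_star_in_ideal:
  assumes "left_star_reducible y x" "is_complex x" "KL x \<in> TL_ideal"
    and "\<And>z. z \<in> carrier W \<Longrightarrow> is_complex z \<Longrightarrow> len z < len y \<Longrightarrow> KL z \<in> TL_ideal"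
  shows "KL y \<in> TL_ideal"
proof -
  obtain s t u j where h: "is_base s t u" "1 \<le> j" "enat (Suc j) < m s t" "x = str s t u j" "y = str s t u (Suc j)"
    using left_star_reducible_string[OF assms(1)] by blast
  have j: "enat j < m s t" using h(3) order.strict_trans[of "enat j" "enat (Suc j)"] by simp
  let ?r = "if j = 1 then 0 else KL (str s t u (j - 1))"
  have "?r \<in> TL_ideal"
  proof (cases "j = 1")
    case False
    then have i: "1 \<le> j - 1" "enat (j - 1) < m s t"
      using h(2) j order.strict_trans[of "enat (j - 1)" "enat j"] by auto
    have "is_complex (str s t u (j - 1))"
      using string_fully_commutative[OF h(1) i h(2) j] assms(2) h(4) by blast
    moreover have "len (str s t u (j - 1)) < len y"
      using str_len[OF h(1), of "j - 1"] str_len[OF h(1), of "Suc j"] i h by simp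
    ultimately show ?thesis using assms(4) str_closed[OF h(1)] False by simp
  qed simp
  moreover have "C (letter s t (Suc j)) * KL x \<in> TL_ideal" using assms(3) ideal_mult_left by blast
  ultimately show ?thesis
    using ideal_cancel[of "C (letter s t (Suc j)) * KL x" "KL y" ?r] string_mult[OF h(1,2) j] unfolding h(4,5) by blast
qed

text \<open>Property S gives a chain of star reductions ending in an element with two noncommuting
  descents on one side. Complexity spreads from that end up the chain, so the first reduct of
  \<open>w\<close> is complex and shorter and induction applies to it; right reductions are
  transported by \<open>iota\<close>.\<close>

lemma complex_in_ideal:
  assumes S: "property_S"
  shows "w \<in> carrier W \<Longrightarrow> is_complex w \<Longrightarrow> KL w \<in> TL_ideal"
proof (induction "len w" arbitrary: w rule: less_induct)
  case less
  have inv: "KL (inv v) \<in> TL_ideal \<longleftrightarrow> KL v \<in> TL_ideal" if "v \<in> carrier W" for v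
    using ideal_iota[of "KL v"] ideal_iota[of "KL (inv v)"] iota_KL[OF that] by (metis iota_iota)
  have "w \<in> carrier W - fully_commutative" using less.prems by (simp add: mem_fully_commutative)
  then obtain x s t where x: "star_reducible w x" "noncommuting s t"
    "{s, t} \<subseteq> left_descents x \<or> {s, t} \<subseteq> right_descents x"
    using S unfolding property_S_def by blast
  have pair: "is_complex x \<and> KL x \<in> TL_ideal" if xc: "x \<in> carrier W"
    using x(3)
  proof
    assume "{s, t} \<subseteq> left_descents x"
    then show ?thesis using two_descents_complex[OF x(2)] descent_pair_in_ideal[OF x(2)] xc by auto
  next
    assume "{s, t} \<subseteq> right_descents x"
    then have "{s, t} \<subseteq> left_descents (inv x)" using right_descents_inv xc by simp
    then have "is_complex (inv x)" "KL (inv x) \<in> TL_ideal"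
      using two_descents_complex[OF x(2)] descent_pair_in_ideal[OF x(2)] xc by auto
    then show ?thesis using inv complex_inv_iff xc by simp
  qed
  from x(1) show ?case unfolding star_reducible_def
  proof (cases rule: converse_rtranclpE)
    case base
    then show ?thesis using pair less.prems by simp
  next
    case (step y)
    have yx: "star_reducible y x" using step(2) by (simp add: star_reducible_def)
    have yc: "y \<in> carrier W" using step(1) left_star_complex right_star_reducible_inv by blast
    have star_closed: "b \<in> carrier W" if "star_reducible a b" "a \<in> carrier W" for a b
      using that unfolding star_reducible_def
    proof (induction rule: rtranclp_induct)
      case (step b c)
      then show ?case using left_star_complex right_star_reducible_inv by blast
    qed
    have xc: "x \<in> carrier W" using star_closed[OF yx yc] .
    have cy: "is_complex y" using star_complex[OF yx] pair xc by blast
    from step(1) show ?thesis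
    proof
      assume l: "left_star_reducible w y"
      obtain s t u j where h: "is_base s t u" "1 \<le> j" "enat (Suc j) < m s t" "y = str s t u j" "w = str s t u (Suc j)"
        using left_star_reducible_string[OF l] by blast
      then have "len y < len w" using str_len_less[OF h(1,3)] by simp
      then show ?thesis using left_star_in_ideal[OF l cy] less.hyps yc cy by blast
    next
      assume r: "right_star_reducible w y"
      note l = right_star_reducible_inv(1)[OF r]
      obtain s t u j where h: "is_base s t u" "1 \<le> j" "enat (Suc j) < m s t" "inv y = str s t u j" "inv w = str s t u (Suc j)"
        using left_star_reducible_string[OF l] by blast
      then have "len (inv y) < len (inv w)" using str_len_less[OF h(1,3)] by simp
      then have "len y < len w" using yc less.prems by simp
      then have "KL (inv y) \<in> TL_ideal" using less.hyps yc cy inv by blast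
      moreover have "KL z \<in> TL_ideal" if "z \<in> carrier W" "is_complex z" "len z < len (inv w)" for z
        using less.hyps[of z] that less.prems by simp
      ultimately have "KL (inv w) \<in> TL_ideal"
        using left_star_in_ideal[OF l] complex_inv[OF cy yc] by blast
      then show ?thesis using inv less.prems by blast
    qed
  qed
qed

text \<open>
  Under Property S the ideal is spanned by the \<open>C'\<^sub>w\<close> with \<open>w\<close> complex: these lie in it, and the
  remaining \<open>C'\<^sub>w\<close> are independent modulo it.
\<close>

theorem ideal_iff:
  assumes S: "property_S"
  shows "h \<in> TL_ideal \<longleftrightarrow> (\<forall>z \<in> fully_commutative. KL.coef h z = 0)"
proof -
  let ?A = "{w \<in> carrier W. KL.coef h w \<noteq> 0}"
  let ?c = "\<Sum>w\<in>{w \<in> ?A. is_complex w}. KL.coef h w *s KL w"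
  let ?f = "\<Sum>w\<in>{w \<in> ?A. \<not> is_complex w}. KL.coef h w *s KL w"
  have fin: "finite ?A" by (rule KL.finite_coef)
  have h: "h = ?c + ?f"
  proof -
    have "h = (\<Sum>w\<in>?A. KL.coef h w *s KL w)" using KL.expand[of h] by simp
    also have "\<dots> = ?c + ?f"
      by (subst sum.union_disjoint[symmetric]) (auto intro: sum.cong finite_subset[OF _ fin])
    finally show ?thesis .
  qed
  have c: "?c \<in> TL_ideal"
    by (intro ideal_sum ideal_scale) (use complex_in_ideal[OF S] in auto)
  have cf0: "KL.coef ?f w = 0" if "w \<in> carrier W" "is_complex w" for w
    unfolding KL.coef_sum KL.coef_scale
    by (rule sum.neutral) (use that in \<open>auto simp: KL.coef_basis\<close>)
  show ?thesis
  proof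
    assume "h \<in> TL_ideal"
    have e: "h - ?c = ?f" by (rule diff_eq_eq[THEN iffD2, OF HOL.trans[OF h add.commute]])
    have "?f \<in> TL_ideal" using ideal_diff[OF \<open>h \<in> TL_ideal\<close> c] unfolding e .
    then obtain n where n: "?f \<in> F n" by (auto simp: TL_ideal_def)
    have f0: "?f = 0" using F_independent[OF n] cf0 by blast
    show "\<forall>z \<in> fully_commutative. KL.coef h z = 0"
    proof
      fix z assume z: "z \<in> fully_commutative"
      have "KL.coef ?c z = 0"
        unfolding KL.coef_sum KL.coef_scale
        by (rule sum.neutral) (use z in \<open>auto simp: KL.coef_basis mem_fully_commutative\<close>)
      moreover have "KL.coef h z = KL.coef ?c z + KL.coef ?f z"
        using arg_cong[OF h, of "\<lambda>x. KL.coef x z"] by (simp only: KL.coef_add)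
      ultimately show "KL.coef h z = 0" unfolding f0 by simp
    qed
  next
    assume z: "\<forall>z \<in> fully_commutative. KL.coef h z = 0"
    then have "{w \<in> ?A. \<not> is_complex w} = {}" by (auto simp: mem_fully_commutative)
    then have "?f = 0" by (simp only: sum.empty)
    then have "?c + ?f \<in> TL_ideal" using ideal_add[OF c] ideal_0 by (simp only:)
    then show "h \<in> TL_ideal" by (rule subst[OF h[symmetric], of "\<lambda>x. x \<in> TL_ideal"])
  qed
qed

end

section \<open>Matrices commuting with a path\<close>

text \<open>The relation says that the differences \<open>a i j - a (i - 1) (j - 1)\<close> are
  constant along antidiagonals, hence symmetric; the zero row and column then give the symmetry of
  \<open>a\<close>.\<close>

lemma path_matrix_symmetric:
  fixes a :: "nat \<Rightarrow> nat \<Rightarrow> 'a::ab_group_add" and M :: enat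
  assumes rel: "\<And>i j. 1 \<le> i \<Longrightarrow> 1 \<le> j \<Longrightarrow> enat i < M \<Longrightarrow> enat j < M \<Longrightarrow> a (i - 1) j + a (i + 1) j = a i (j - 1) + a i (j + 1)"
    and zero: "\<And>j. a 0 j = 0" "\<And>i. a i 0 = 0"
  shows "i \<le> j \<Longrightarrow> enat j < M \<Longrightarrow> a i j = a j i"
proof -
  define d where "d = (\<lambda>i j. a i j - a (i - 1) (j - 1))"
  have shift: "d i (i + k) = d (i + l) (i + k - l)" if "l \<le> k" "1 \<le> i" "enat (i + k) < M" for i k l
    using that(1)
  proof (induction l)
    case (Suc l)
    define j where "j = i + k - Suc l"
    have "enat (i + l) < M" "enat j < M" "1 \<le> j" "i + k - l = j + 1"
      using Suc that order.strict_trans1[of "enat (i + l)" "enat (i + k)" M] order.strict_trans1[of "enat j" "enat (i + k)" M]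
      by (auto simp: j_def)
    then have "d (i + l) (i + k - l) = d (i + Suc l) j"
      using rel[of "i + l" j] that by (simp add: d_def algebra_simps)
    then show ?case using Suc by (simp add: j_def)
  qed simp
  show "i \<le> j \<Longrightarrow> enat j < M \<Longrightarrow> a i j = a j i"
  proof (induction i arbitrary: j)
    case 0
    then show ?case using zero by simp
  next
    case (Suc i)
    obtain k where k: "j = Suc i + k" using Suc.prems le_Suc_ex by blast
    have "d (Suc i) j = d j (Suc i)" using shift[of k k "Suc i"] Suc.prems k by (simp add: add.commute)
    moreover have "a i (j - 1) = a (j - 1) i"
      using Suc.IH[of "j - 1"] Suc.prems order.strict_trans1[of "enat (j - 1)" "enat j" M] by auto
    ultimately show ?case by (simp add: d_def)
  qed
qed

text \<open>
  A matrix commuting with the adjacency matrix of a path is determined by its first column; being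
  a combination of Chebyshev polynomials in the adjacency matrix, it is nonnegative if that column is.
\<close>

lemma path_matrix_mem:
  fixes a :: "nat \<Rightarrow> nat \<Rightarrow> 'a::ab_group_add" and M :: enat
  assumes rel: "\<And>i j. 1 \<le> i \<Longrightarrow> 1 \<le> j \<Longrightarrow> enat i < M \<Longrightarrow> enat j < M \<Longrightarrow> a (i - 1) j + a (i + 1) j = a i (j - 1) + a i (j + 1)"
    and zero: "\<And>j. a 0 j = 0" "\<And>i. a i 0 = 0" "\<And>i j. enat i = M \<Longrightarrow> a i j = 0"
    and P: "0 \<in> P" "\<And>x y. x \<in> P \<Longrightarrow> y \<in> P \<Longrightarrow> x + y \<in> P"
    and col: "\<And>i. 1 \<le> i \<Longrightarrow> enat i < M \<Longrightarrow> a i 1 \<in> P"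
    and ij: "1 \<le> i" "1 \<le> j" "enat i < M" "enat j < M"
  shows "a i j \<in> P"
proof -
  \<comment> \<open>The relation, telescoped along a diagonal, writes an entry as one from the next
    row and previous column plus an entry of the first column, so only sums occur in the induction
    on columns.\<close>
  have diag: "a (i + l) (Suc l) - a (i + l + 1) l = a i 1" if "1 \<le> i" "enat (i + l) < M" for i l
    using that
  proof (induction l)
    case 0
    then show ?case using zero by simp
  next
    case (Suc l)
    have "enat (Suc l) < M" "enat (i + l) < M"
      using Suc.prems order.strict_trans1[of "enat (Suc l)" "enat (i + Suc l)" M] order.strict_trans1[of "enat (i + l)" "enat (i + Suc l)" M] by auto
    then show ?case
      using Suc rel[of "i + Suc l" "Suc l"] by (simp add: algebra_simps)
  qed
  have low: "j \<le> i \<Longrightarrow> 1 \<le> j \<Longrightarrow> enat i < M \<Longrightarrow> a i j \<in> P" for i j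
  proof (induction j arbitrary: i)
    case (Suc j)
    have e: "a i (Suc j) = a (i + 1) j + a (i - j) 1"
      using diag[of "i - j" j] Suc.prems by (simp add: algebra_simps)
    have "enat (i - j) < M" using Suc.prems order.strict_trans1[of "enat (i - j)" "enat i" M] by simp
    then have c: "a (i - j) 1 \<in> P" using col[of "i - j"] Suc.prems by simp
    have "a (i + 1) j \<in> P"
    proof (cases "j = 0")
      case True
      then show ?thesis using zero P by simp
    next
      case False
      show ?thesis
      proof (cases "enat (i + 1) < M")
        case True
        then show ?thesis using Suc False by auto
      next
        case False
        then have "enat (i + 1) = M" using Suc.prems by (cases M) auto
        then show ?thesis using zero P by simp
      qed
    qed
    then show ?case using c P(2) e by metis
  qed simp
  show ?thesis
  proof (cases "j \<le> i")
    case True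
    then show ?thesis using low ij by blast
  next
    case False
    then have "a i j = a j i"
      using path_matrix_symmetric[where M = M and a = a and i = i and j = j, OF rel zero(1,2)] ij by simp
    then show ?thesis using low[of i j] False ij by simp
  qed
qed

section \<open>Polynomials in \<open>\<delta>\<close> with nonnegative coefficients\<close>

lemma nonneg_deltaI: "(\<Sum>i\<le>n. of_nat (c i) * laurent_delta ^ i) \<in> nonneg_delta"
  unfolding nonneg_delta_def by (intro CollectI exI[of _ n] exI[of _ c]) simp

lemma nonneg_deltaE:
  assumes "p \<in> nonneg_delta" obtains n c where "p = (\<Sum>i\<le>n. of_nat (c i) * laurent_delta ^ i)"
  using assms unfolding nonneg_delta_def by blast

lemma nonneg_delta_0: "0 \<in> nonneg_delta"
  unfolding nonneg_delta_def by (intro CollectI exI[of _ 0] exI[of _ "\<lambda>_. 0"]) simp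

lemma nonneg_delta_1: "1 \<in> nonneg_delta"
  unfolding nonneg_delta_def by (intro CollectI exI[of _ 0] exI[of _ "\<lambda>_. 1"]) simp

lemma nonneg_delta_add:
  assumes "p \<in> nonneg_delta" "q \<in> nonneg_delta" shows "p + q \<in> nonneg_delta"
proof -
  obtain n c n' c' where pq: "p = (\<Sum>i\<le>n. of_nat (c i) * laurent_delta ^ i)" "q = (\<Sum>i\<le>n'. of_nat (c' i) * laurent_delta ^ i)"
    using assms unfolding nonneg_delta_def by blast
  have ext: "(\<Sum>i\<le>k. of_nat (f i) * laurent_delta ^ i) = (\<Sum>i\<le>max n n'. of_nat (if i \<le> k then f i else 0) * laurent_delta ^ i)"
    if "k \<le> max n n'" for k f
    by (rule sum.mono_neutral_cong_left) (use that in auto)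
  have "p + q = (\<Sum>i\<le>max n n'. of_nat ((if i \<le> n then c i else 0) + (if i \<le> n' then c' i else 0)) * laurent_delta ^ i)"
    unfolding pq ext[of n c, OF max.cobounded1] ext[of n' c', OF max.cobounded2] sum.distrib[symmetric]
    by (rule sum.cong) (auto simp: algebra_simps)
  then show ?thesis using nonneg_deltaI by (simp only:)
qed

lemma nonneg_delta_sum: "(\<And>x. x \<in> A \<Longrightarrow> f x \<in> nonneg_delta) \<Longrightarrow> sum f A \<in> nonneg_delta"
  by (induction A rule: infinite_finite_induct) (auto intro: nonneg_delta_0 nonneg_delta_add)

lemma nonneg_delta_of_nat_mult: "p \<in> nonneg_delta \<Longrightarrow> of_nat k * p \<in> nonneg_delta"
  by (induction k) (auto simp: algebra_simps intro: nonneg_delta_0 nonneg_delta_add)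

lemma nonneg_delta_of_int_mult: "p \<in> nonneg_delta \<Longrightarrow> 0 \<le> k \<Longrightarrow> of_int k * p \<in> nonneg_delta"
  using nonneg_delta_of_nat_mult[of p "nat k"] by simp

lemma nonneg_delta_delta_mult:
  assumes "p \<in> nonneg_delta" shows "laurent_delta * p \<in> nonneg_delta"
proof -
  obtain n c where p: "p = (\<Sum>i\<le>n. of_nat (c i) * laurent_delta ^ i)" using assms unfolding nonneg_delta_def by blast
  have "(\<Sum>i\<le>Suc n. of_nat (case i of 0 \<Rightarrow> 0 | Suc j \<Rightarrow> c j) * laurent_delta ^ i) = laurent_delta * p"
    unfolding sum.atMost_Suc_shift p by (simp add: sum_distrib_left algebra_simps)
  then show ?thesis using nonneg_deltaI[of "case_nat 0 c" "Suc n"] by (simp only:)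
qed

lemma lookup_delta_mult: "Poly_Mapping.lookup (laurent_delta * p) k = Poly_Mapping.lookup p (k - 1) + Poly_Mapping.lookup p (k + 1)"
  by (simp add: laurent_delta_def distrib_right lookup_add)

lemma delta_nonzero: "laurent_delta \<noteq> 0"
proof
  assume "laurent_delta = 0"
  then have "Poly_Mapping.lookup laurent_delta 1 = 0" by simp
  then show False by (simp add: laurent_delta_def lookup_add)
qed

text \<open>Moved outwards by one, the extreme exponents of \<open>p\<close> survive in the product
  and are distinct, so a nonzero \<open>p\<close> cannot give a constant.\<close>

lemma delta_mult_constant:
  assumes "laurent_delta * p = of_int c" shows "c = 0"
proof (rule ccontr)
  assume c: "c \<noteq> 0"
  have l: "Poly_Mapping.lookup p (k - 1) + Poly_Mapping.lookup p (k + 1) = (if k = 0 then c else 0)" for k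
    unfolding lookup_delta_mult[symmetric] assms by (simp add: lookup_of_int when_def)
  let ?K = "Poly_Mapping.keys p"
  have "p \<noteq> 0" using assms c by auto
  then have K: "finite ?K" "?K \<noteq> {}" by auto
  have "Max ?K \<in> ?K" "Min ?K \<in> ?K" using K by auto
  then have nz: "Poly_Mapping.lookup p (Max ?K) \<noteq> 0" "Poly_Mapping.lookup p (Min ?K) \<noteq> 0" by auto
  have out: "Poly_Mapping.lookup p k = 0" if "k > Max ?K \<or> k < Min ?K" for k
  proof -
    have "k \<notin> ?K"
    proof
      assume "k \<in> ?K"
      from Max_ge[OF K(1) this] Min_le[OF K(1) this] show False using that by linarith
    qed
    then show ?thesis by (simp add: in_keys_iff)
  qed
  have "Max ?K + 1 = 0" using l[of "Max ?K + 1"] out[of "Max ?K + 1 + 1"] nz by (auto split: if_splits)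
  moreover have "Min ?K - 1 = 0" using l[of "Min ?K - 1"] out[of "Min ?K - 1 - 1"] nz by (auto split: if_splits)
  moreover have "Min ?K \<le> Max ?K" using K by simp
  ultimately show False by simp
qed

text \<open>Dividing the polynomial in \<delta> formally leaves its constant term as a multiple of
  \<delta>, so that term is 0. Right star reductions first produce the coefficients multiplied by
  \<delta>.\<close>

lemma nonneg_delta_divide:
  assumes "laurent_delta * p \<in> nonneg_delta" shows "p \<in> nonneg_delta"
proof -
  obtain n c where e: "laurent_delta * p = (\<Sum>i\<le>n. of_nat (c i) * laurent_delta ^ i)" using assms unfolding nonneg_delta_def by blast
  define q where "q = (\<Sum>i<n. of_nat (c (Suc i)) * laurent_delta ^ i)"
  have "laurent_delta * p = of_nat (c 0) + laurent_delta * q"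
    unfolding e sum.atMost_shift q_def by (simp add: sum_distrib_left mult.left_commute)
  then have "laurent_delta * (p - q) = of_int (int (c 0))" by (simp add: algebra_simps)
  then have "laurent_delta * (p - q) = 0" using delta_mult_constant by fastforce
  then have "p = q" using delta_nonzero by simp
  moreover have "q \<in> nonneg_delta"
  proof (cases n)
    case 0
    then show ?thesis by (simp add: q_def nonneg_delta_0)
  next
    case (Suc k)
    then show ?thesis unfolding q_def nonneg_delta_def by (auto simp: lessThan_Suc_atMost)
  qed
  ultimately show ?thesis by simp
qed

text \<open>Polynomials in \<delta> are bar-invariant and \<open>v\<close> is not, which makes the
  inclusion strict.\<close>

lemma nonneg_delta_subset: "nonneg_delta \<subset> nonneg_laurent"
proof -
  let ?P = "\<lambda>p. (\<forall>k. 0 \<le> Poly_Mapping.lookup p k) \<and> lbar p = p"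
  have pow: "?P (laurent_delta ^ i)" for i
  proof (induction i)
    case 0
    then show ?case by (simp add: lookup_one when_def)
  next
    case (Suc i)
    have "lbar laurent_delta = laurent_delta" by (simp add: laurent_delta_def lbar_add add.commute)
    then show ?case using Suc by (simp add: lookup_delta_mult lbar_mult)
  qed
  have "?P p" if pn: "p \<in> nonneg_delta" for p
  proof -
    obtain n c where p: "p = (\<Sum>i\<le>n. of_nat (c i) * laurent_delta ^ i)" using nonneg_deltaE[OF pn] by blast
    have nat: "?P (of_nat k * r)" if "?P r" for k r
    proof (induction k)
      case (Suc k)
      then show ?case using that by (simp add: distrib_right lookup_add lbar_add)
    qed simp
    have "?P (\<Sum>i\<in>A. of_nat (c i) * laurent_delta ^ i)" if "finite A" for A
      using that
    proof induction
      case (insert x A)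
      then show ?case using nat[OF pow, of "c x" x] by (simp add: lookup_add lbar_add)
    qed simp
    then show ?thesis unfolding p by blast
  qed
  then have "nonneg_delta \<subseteq> nonneg_laurent" by (auto simp: nonneg_laurent_def)
  moreover have "vpow 1 \<in> nonneg_laurent" by (simp add: nonneg_laurent_def)
  moreover have "vpow 1 \<notin> nonneg_delta"
  proof
    assume "vpow 1 \<in> nonneg_delta"
    then have "lbar (vpow 1) = vpow 1" using \<open>\<And>p. p \<in> nonneg_delta \<Longrightarrow> ?P p\<close> by blast
    then have "Poly_Mapping.lookup (vpow (-1)) 1 = Poly_Mapping.lookup (vpow 1) 1" by simp
    then show False unfolding lookup_vpow by simp
  qed
  ultimately show ?thesis by blast
qed

section \<open>Positivity of the edge weights on fully commutative elements\<close>

context hecke_algebra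
begin

text \<open>The coefficient of \<open>v^-1\<close> in \<open>C q * KL w\<close> at \<open>y\<close>
  is computed twice: by the action on the standard basis, where the eigenvalue for \<open>p\<close>
  turns \<open>v\<close> times the coefficient at \<open>y\<close> into the one at
  \<open>p \<otimes> y\<close>, and by \<open>KL_up\<close>. In the resulting sum of products
  \<open>mu_ascent\<close> reduces one factor of each term to 0 or 1, which singles out
  \<open>p \<otimes> y\<close> and \<open>p \<otimes> w\<close>.\<close>

lemma mu_relation:
  assumes pq: "p \<in> S" "q \<in> S" and w: "w \<in> carrier W" "p \<in> left_descents w" "q \<notin> left_descents w"
    and y: "y \<in> carrier W" "q \<in> left_descents y" "p \<notin> left_descents y"
  shows "mu (q \<otimes> y) w + (if q \<in> left_descents (p \<otimes> y) then 0 else mu (p \<otimes> y) w)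
    = mu y (q \<otimes> w) + (if q \<in> left_descents (p \<otimes> w) then mu y (p \<otimes> w) else 0)"
proof -
  let ?B = "below q w"
  have ev: "cf (C q * KL w) y = cf (KL w) (q \<otimes> y) + cf (KL w) (p \<otimes> y)"
  proof -
    have "vpow 1 * cf (KL w) y = vpow 1 * (vpow (-1) * cf (KL w) (p \<otimes> y))"
      using KL_cf_ascent[OF w(1,2) y(1,3)] by simp
    also have "\<dots> = cf (KL w) (p \<otimes> y)" by (simp add: mult.assoc[symmetric] vpow_add[symmetric] vpow_0)
    finally show ?thesis using cf_C[OF pq(2) y(1), of "KL w"] y by simp
  qed
  have "cf (C q * KL w) y = cf (KL (q \<otimes> w)) y + (\<Sum>z\<in>?B. of_int (mu z w) * cf (KL z) y)"
    unfolding KL_up[OF w(1) pq(2) w(3)] by (simp add: Tn.coef_add Tn.coef_sum Tn.coef_scale)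
  with ev have "Poly_Mapping.lookup (cf (KL w) (q \<otimes> y) + cf (KL w) (p \<otimes> y)) (-1)
      = Poly_Mapping.lookup (cf (KL (q \<otimes> w)) y + (\<Sum>z\<in>?B. of_int (mu z w) * cf (KL z) y)) (-1)" by simp
  then have 1: "mu (q \<otimes> y) w + mu (p \<otimes> y) w = mu y (q \<otimes> w) + (\<Sum>z\<in>?B. mu z w * mu y z)"
    by (simp add: lookup_add lookup_sum lookup_of_int_mult mu_def)
  let ?D = "{z \<in> ?B. p \<in> left_descents z}" and ?N = "{z \<in> ?B. p \<notin> left_descents z}"
  have pyc: "p \<otimes> y \<in> carrier W" "p \<otimes> w \<in> carrier W" using pq y w by auto
  have pp: "p \<in> left_descents (p \<otimes> y)" "p \<notin> left_descents (p \<otimes> w)"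
    using left_descent_mult[OF y(1) pq(1)] left_descent_mult[OF w(1) pq(1)] y w by auto
  have "(\<Sum>z\<in>?D. mu z w * mu y z) = (\<Sum>z\<in>?D. if z = p \<otimes> y then mu (p \<otimes> y) w else 0)"
  proof (rule sum.cong)
    fix z assume "z \<in> ?D"
    then have "z \<in> carrier W" "p \<in> left_descents z" by (auto simp: below_def)
    from mu_ascent[OF this y(1,3)] show "mu z w * mu y z = (if z = p \<otimes> y then mu (p \<otimes> y) w else 0)" by auto
  qed simp
  also have "\<dots> = (if p \<otimes> y \<in> ?D then mu (p \<otimes> y) w else 0)"
    using finite_subset[OF _ finite_below[of q w], of ?D] by simp
  also have "\<dots> = (if q \<in> left_descents (p \<otimes> y) then mu (p \<otimes> y) w else 0)"
    using pp pyc by (auto simp: below_def)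
  finally have D: "(\<Sum>z\<in>?D. mu z w * mu y z) = (if q \<in> left_descents (p \<otimes> y) then mu (p \<otimes> y) w else 0)" .
  have N1: "z = p \<otimes> w \<and> mu z w = 1" if "z \<in> ?N" for z
  proof -
    have z: "z \<in> carrier W" "mu z w \<noteq> 0" "p \<notin> left_descents z" using that by (auto simp: below_def)
    then have "p \<otimes> z = w" "mu z w = 1" using mu_ascent[OF w(1,2) z(1,3)] by (auto split: if_splits)
    then show ?thesis using gen_cancel[OF pq(1) z(1)] by simp
  qed
  have N: "(\<Sum>z\<in>?N. mu z w * mu y z) = (if q \<in> left_descents (p \<otimes> w) then mu y (p \<otimes> w) else 0)"
  proof (cases "q \<in> left_descents (p \<otimes> w)")
    case True
    have "mu (p \<otimes> w) w = 1" using mu_ascent[OF w(1,2) pyc(2) pp(2)] pq w by simp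
    then have "p \<otimes> w \<in> ?N" using True pp pyc by (simp add: below_def)
    then have e: "?N = {p \<otimes> w}" using N1 by blast
    show ?thesis unfolding e using True \<open>mu (p \<otimes> w) w = 1\<close> by simp
  next
    case False
    then have "q \<notin> left_descents z" if "z \<in> ?N" for z using N1[OF that] by simp
    then have e: "?N = {}" by (auto simp: below_def)
    show ?thesis unfolding e using False by simp
  qed
  have "(\<Sum>z\<in>?B. mu z w * mu y z) = (\<Sum>z\<in>?D. mu z w * mu y z) + (\<Sum>z\<in>?N. mu z w * mu y z)"
    by (subst sum.union_disjoint[symmetric]) (auto intro: sum.cong finite_subset[OF _ finite_below[of q w]])
  then show ?thesis using 1 unfolding D N by (simp split: if_splits)
qed

lemma letter_other:
  assumes "is_base s t u" "{s', t'} = {s, t}"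
  shows "letter s' t' i = letter s t j \<or> letter s' t' i = letter s t (Suc j)"
  using assms by (auto simp: letter_def doubleton_eq_iff)

lemma letter_parity:
  assumes "is_base s t u" "{s', t'} = {s, t}"
  shows "letter s' t' i = letter s t j \<longleftrightarrow> (s' = s \<longleftrightarrow> (even i \<longleftrightarrow> even j))"
  using assms noncommutingD[of s t] by (auto simp: letter_def is_base_def doubleton_eq_iff)

text \<open>The matrix keeps the entries with equal first letters, the others being replaced by 0.
  When the letters differ, \<open>mu_relation\<close> is the path relation up to boundary terms;
  when they agree, all four neighbouring entries are 0.\<close>

lemma mu_string_nonneg:
  assumes b: "is_base s t u" "is_base s' t' u'" "{s', t'} = {s, t}"
    and col: "\<And>i. 1 \<le> i \<Longrightarrow> enat i < m s t \<Longrightarrow> 0 \<le> mu (str s' t' u' i) (str s t u 1)"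
    and ij: "1 \<le> i" "enat i < m s t" "1 \<le> j" "enat j < m s t" "letter s' t' i = letter s t j"
  shows "0 \<le> mu (str s' t' u' i) (str s t u j)"
proof -
  define Z where "Z = str s' t' u'"
  define Y where "Y = str s t u"
  have ne: "s \<noteq> t" "s \<in> S" "t \<in> S" using b noncommutingD[of s t] by (auto simp: is_base_def)
  have mm: "m s' t' = m s t" using b(3) m_sym ne by (auto simp: doubleton_eq_iff)
  \<comment> \<open>If the strings lie over the same element and start with different letters, the
    base of one is just below the first element of the other, and their tops coincide when the bond
    is finite. The boundary terms this produces are compensated by taking 1 off the entries with
    \<open>j = i + 1\<close>.\<close>
  define e where "e = (if s' = t \<and> u' = u then 1 else 0 :: int)"
  define a where "a = (\<lambda>i j. if 1 \<le> i \<and> 1 \<le> j \<and> enat i < m s t \<and> enat j < m s t \<and> letter s' t' i = letter s t j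
    then mu (Z i) (Y j) - (if j = i + 1 then e else 0) else 0)"
  have par: "letter s' t' i = letter s t j \<longleftrightarrow> (s' = s \<longleftrightarrow> (even i \<longleftrightarrow> even j))" for i j
    by (rule letter_parity[OF b(1,3)])
  have Zc: "Z i \<in> carrier W" "Y i \<in> carrier W" for i using str_closed b by (auto simp: Z_def Y_def)
  have rel: "a (i - 1) j + a (i + 1) j = a i (j - 1) + a i (j + 1)"
    if h: "1 \<le> i" "1 \<le> j" "enat i < m s t" "enat j < m s t" for i j
  proof (cases "letter s' t' i = letter s t j")
    case True
    then have "letter s' t' (i - 1) \<noteq> letter s t j" "letter s' t' (i + 1) \<noteq> letter s t j"
      "letter s' t' i \<noteq> letter s t (j - 1)" "letter s' t' i \<noteq> letter s t (j + 1)"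
      unfolding par using h by auto
    then show ?thesis by (simp add: a_def)
  next
    case False
    define p where "p = letter s t j"
    define q where "q = letter s t (Suc j)"
    have pq: "p \<in> S" "q \<in> S" "p \<noteq> q" using letter_bond[OF b(1)] by (auto simp: p_def q_def)
    have qi: "letter s' t' i = q" "letter s' t' (Suc i) = p"
      using False letter_other[OF b(1,3), of i j] letter_other[OF b(1,3), of "Suc i" j] letter_bond(2)[OF b(2), of i]
      by (auto simp: p_def q_def)
    have types: "letter s' t' (i - 1) = letter s t j" "letter s' t' (i + 1) = letter s t j"
      "letter s' t' i = letter s t (j - 1)" "letter s' t' i = letter s t (j + 1)"
      using False h unfolding par by auto
    have w: "p \<in> left_descents (Y j)" "q \<notin> left_descents (Y j)"
      using str_descent[OF b(1) h(2)] str_not_descent[OF b(1) h(4)] h by (auto simp: p_def q_def Y_def)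
    have y: "q \<in> left_descents (Z i)" "p \<notin> left_descents (Z i)"
      using str_descent[OF b(2) h(1)] str_not_descent[OF b(2), of i] h qi mm by (auto simp: Z_def)
    have nb: "q \<otimes> Z i = Z (i - 1)" "p \<otimes> Z i = Z (Suc i)" "q \<otimes> Y j = Y (Suc j)" "p \<otimes> Y j = Y (j - 1)"
      using str_down[OF b(2), of "i - 1"] str_Suc[OF b(2), of i] str_Suc[OF b(1), of j] str_down[OF b(1), of "j - 1"] h qi
      by (auto simp: Z_def Y_def p_def q_def)
    have R: "mu (Z (i - 1)) (Y j) + (if q \<in> left_descents (Z (Suc i)) then 0 else mu (Z (Suc i)) (Y j))
      = mu (Z i) (Y (Suc j)) + (if q \<in> left_descents (Y (j - 1)) then mu (Z i) (Y (j - 1)) else 0)"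
      using mu_relation[OF pq(1,2) Zc(2) w Zc(1) y] unfolding nb .
    have qZ: "q \<in> left_descents (Z (Suc i)) \<longleftrightarrow> \<not> enat (Suc i) < m s t"
    proof
      assume "q \<in> left_descents (Z (Suc i))"
      then show "\<not> enat (Suc i) < m s t"
        using str_not_descent[OF b(2), of "Suc i"] letter_bond(6)[OF b(2), of i] qi mm by (auto simp: Z_def)
    next
      assume "\<not> enat (Suc i) < m s t"
      then have "enat (Suc i) = m s' t'" using h(3) mm by (cases "m s t") auto
      then show "q \<in> left_descents (Z (Suc i))"
        using str_top(1)[OF b(2), of "Suc i"] letter_bond(6)[OF b(2), of i] qi by (auto simp: Z_def)
    qed
    have qY: "q \<in> left_descents (Y (j - 1)) \<longleftrightarrow> 2 \<le> j"
    proof (cases "j = 1")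
      case True
      then show ?thesis using str_0[OF b(1)] letter_bond(5)[OF b(1), of j] by (auto simp: Y_def q_def)
    next
      case False
      then obtain l where l: "j = Suc l" "1 \<le> l" using h by (cases j) auto
      have "enat l < m s t" using h l order.strict_trans[of "enat l" "enat j"] by simp
      then have "letter s t l \<in> left_descents (Y l)" using str_descent[OF b(1) l(2)] by (simp add: Y_def)
      then show ?thesis using l letter_bond(6)[OF b(1), of l] by (simp add: q_def)
    qed
    have lt: "enat (i - 1) < m s t" "enat (j - 1) < m s t"
      using h order.strict_trans1[of "enat (i - 1)" "enat i"] order.strict_trans1[of "enat (j - 1)" "enat j"] by auto
    have A1: "mu (Z (i - 1)) (Y j) = a (i - 1) j + (if j = i then e else 0)"
    proof (cases "i = 1")
      case True
      have u': "p \<notin> left_descents u'" "q \<notin> left_descents u'" "u' \<in> carrier W"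
        using letter_bond(5)[OF b(2), of i] qi b(2) by (auto simp: is_base_def)
      have "mu u' (Y j) = (if p \<otimes> u' = Y j then 1 else 0)" using mu_ascent[OF Zc(2) w(1) u'(3,1)] .
      moreover have "p \<otimes> u' = Y j \<longleftrightarrow> j = 1 \<and> s' = t \<and> u' = u"
      proof
        assume "p \<otimes> u' = Y j"
        then have "u' = Y (j - 1)" using nb(4) pq u' by (metis gen_cancel)
        then have "j = 1" using u' qY h by auto
        moreover have "u' = u" using \<open>u' = Y (j - 1)\<close> \<open>j = 1\<close> str_0[OF b(1)] by (simp add: Y_def)
        moreover have "s' = t" using False True \<open>j = 1\<close> b(3) by (auto simp: letter_def doubleton_eq_iff)
        ultimately show "j = 1 \<and> s' = t \<and> u' = u" by simp
      next
        assume j: "j = 1 \<and> s' = t \<and> u' = u"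
        then show "p \<otimes> u' = Y j" using str_Suc[OF b(1), of 0] str_0[OF b(1)] by (simp add: Y_def p_def)
      qed
      ultimately show ?thesis using True str_0[OF b(2)] by (auto simp: a_def e_def Z_def)
    next
      case False
      then show ?thesis using h lt types by (auto simp: a_def)
    qed
    have A2: "(if q \<in> left_descents (Z (Suc i)) then 0 else mu (Z (Suc i)) (Y j))
      = a (i + 1) j + (if j = i + 2 then e else 0)"
      unfolding qZ using h types order.strict_trans1[of "enat (Suc i)" "enat (Suc (Suc i))" "m s t"] by (auto simp: a_def)
    have A3: "(if q \<in> left_descents (Y (j - 1)) then mu (Z i) (Y (j - 1)) else 0)
      = a i (j - 1) + (if j = i + 2 then e else 0)"
      unfolding qY using h lt types by (auto simp: a_def)
    have A4: "mu (Z i) (Y (Suc j)) = a i (j + 1) + (if j = i then e else 0)"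
    proof (cases "enat (Suc j) < m s t")
      case True
      then show ?thesis using h types by (auto simp: a_def)
    next
      case False
      then have top: "enat (Suc j) = m s t" using h(4) by (cases "m s t") auto
      have "p \<in> left_descents (Y (Suc j))"
        using str_top(1)[OF b(1) top] letter_bond(6)[OF b(1), of j] by (simp add: Y_def p_def)
      then have mu: "mu (Z i) (Y (Suc j)) = (if Z (Suc i) = Y (Suc j) then 1 else 0)"
        using mu_ascent[OF Zc(2) _ Zc(1) y(2)] nb by simp
      have "Z (Suc i) = Y (Suc j) \<longleftrightarrow> j = i \<and> s' = t \<and> u' = u"
      proof
        assume z: "Z (Suc i) = Y (Suc j)"
        have "q \<in> left_descents (Y (Suc j))" using str_top(2)[OF b(1) top] by (simp add: Y_def q_def)
        then have "\<not> enat (Suc i) < m s t" using qZ z by simp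
        then have "enat (Suc i) = m s t" using h(3) by (cases "m s t") auto
        then have ij: "j = i" using top by (metis enat.inject nat.inject)
        then have st: "s' = t" "t' = s" using \<open>letter s' t' i \<noteq> letter s t j\<close> b(3) by (auto simp: letter_def doubleton_eq_iff split: if_splits)
        have "alt s t (Suc j) = alt t s (Suc j)" by (rule alt_longest[OF ne(2,3) top[symmetric]])
        then have "alt_left t s (Suc j) = alt_left s t (Suc j)" unfolding alt_left_eq by auto
        then have "alt_left s t (Suc j) \<otimes> u' = alt_left s t (Suc j) \<otimes> u"
          using z st ij unfolding Z_def Y_def str_def by simp
        moreover have "alt_left s t (Suc j) \<in> carrier W" "u \<in> carrier W" "u' \<in> carrier W"
          using b ne alt_left_closed by (auto simp: is_base_def simp del: alt_left.simps)
        ultimately have "u' = u" using inv_cancel(1) by metis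
        then show "j = i \<and> s' = t \<and> u' = u" using ij st by simp
      next
        assume z: "j = i \<and> s' = t \<and> u' = u"
        then have "t' = s" using b(3) ne by (auto simp: doubleton_eq_iff)
        moreover have "alt s t (Suc j) = alt t s (Suc j)" by (rule alt_longest[OF ne(2,3) top[symmetric]])
        then have "alt_left t s (Suc j) = alt_left s t (Suc j)" unfolding alt_left_eq by auto
        ultimately show "Z (Suc i) = Y (Suc j)" using z unfolding Z_def Y_def str_def by simp
      qed
      then show ?thesis using mu False by (auto simp: a_def e_def)
    qed
    show ?thesis using R unfolding A1 A2 A3 A4 by simp
  qed
  \<comment> \<open>The correction leaves the first column alone, and adding \<open>e\<close> back
    keeps the entries nonnegative.\<close>
  have "a i j \<in> {0..}"
  proof (rule path_matrix_mem[where M = "m s t"])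
    show "a i 1 \<in> {0..}" if "1 \<le> i" "enat i < m s t" for i
      using col[OF that] that by (auto simp: a_def Z_def Y_def)
  qed (use rel ij in \<open>auto simp: a_def\<close>)
  then show ?thesis using ij by (auto simp: a_def Z_def Y_def e_def split: if_splits)
qed

text \<open>A fully commutative \<open>z\<close> cannot have both letters as descents, so
  containment of descents puts it on a string for the same pair. The first column of the matrix
  involves the bottom element of the string of \<open>w\<close>, which is shorter than
  \<open>w\<close>.\<close>

lemma left_star_mu_nonneg:
  assumes star: "left_star_reducible w x" and w: "\<not> is_complex w" and z: "z \<in> carrier W" "\<not> is_complex z"
    and d: "left_descents w \<subseteq> left_descents z"
    and IH: "\<And>v z. v \<in> fully_commutative \<Longrightarrow> z \<in> fully_commutative \<Longrightarrow> len v < len w \<Longrightarrow> 0 \<le> mu z v"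
  shows "0 \<le> mu z w"
proof -
  obtain s t u j where h: "is_base s t u" "1 \<le> j" "enat (Suc j) < m s t" "x = str s t u j" "w = str s t u (Suc j)"
    using left_star_reducible_string[OF star] by blast
  let ?p = "letter s t (Suc j)" and ?q = "letter s t j"
  have pq: "noncommuting ?p ?q" using letter_bond(4)[OF h(1)] noncommutingD by blast
  have "?p \<in> left_descents z" using str_descent[OF h(1), of "Suc j"] h d by auto
  moreover then have "?q \<notin> left_descents z" using two_descents_complex[OF pq] z by blast
  ultimately obtain s' t' u' i where z': "is_base s' t' u'" "{s', t'} = {?p, ?q}" "1 \<le> i" "enat i < m s' t'" "z = str s' t' u' i"
    "letter s' t' i = ?p"
    using descent_string[OF pq z(1)] by metis
  have st: "{s', t'} = {s, t}" using z'(2) by (auto simp: letter_def)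
  have ne: "s \<noteq> t" "s \<in> S" "t \<in> S" using h noncommutingD[of s t] by (auto simp: is_base_def)
  have mm: "m s' t' = m s t" using st m_sym ne by (auto simp: doubleton_eq_iff)
  have one: "enat 1 < m s t" using h by (metis One_nat_def Suc_le_mono enat_ord_simps(1) le0 order_le_less_trans)
  show ?thesis unfolding z'(5) h(5)
  proof (rule mu_string_nonneg[OF h(1) z'(1) st])
    fix l assume l: "1 \<le> l" "enat l < m s t"
    have "\<not> is_complex (str s t u 1)"
      using string_fully_commutative[OF h(1), of "Suc j" 1] h w one by simp
    moreover have "\<not> is_complex (str s' t' u' l)"
      using string_fully_commutative[OF z'(1,3,4), of l] l mm z z' by simp
    moreover have "len (str s t u 1) < len w"
      using str_len[OF h(1), of 1] str_len[OF h(1), of "Suc j"] h one by simp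
    ultimately show "0 \<le> mu (str s' t' u' l) (str s t u 1)"
      using IH str_closed[OF h(1)] str_closed[OF z'(1)] by (simp add: mem_fully_commutative)
  qed (use z' h mm in auto)
qed

lemma fully_commutative_inv: "w \<in> fully_commutative \<Longrightarrow> inv w \<in> fully_commutative"
  using complex_inv_iff by (auto simp: mem_fully_commutative)

lemma property_F_cases:
  assumes "property_F" "w \<in> fully_commutative"
  obtains ws where "ws \<in> lists S" "distinct ws" "\<forall>s \<in> set ws. \<forall>t \<in> set ws. s \<otimes> t = t \<otimes> s" "w = word_prod W ws"
  | x where "left_star_reducible w x"
  | x where "left_star_reducible (inv w) (inv x)"
proof -
  obtain x where x: "star_reducible w x" "commuting_product x" using assms by (auto simp: property_F_def)
  from x(1) show thesis unfolding star_reducible_def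
  proof (cases rule: converse_rtranclpE)
    case base
    then show ?thesis using x(2) that(1) unfolding commuting_product_def by blast
  next
    case (step y)
    then show ?thesis using that(2,3) right_star_reducible_inv by blast
  qed
qed

text \<open>Where containment of descents fails on one side, \<open>mu_ascent\<close> gives 0 or 1.
  Where it holds, a product of commuting generators is no longer than \<open>z\<close>, so the
  weight is 0, and any other \<open>w\<close> admits a star reduction to which the matrix argument
  applies.\<close>

theorem mu_nonneg:
  assumes F: "property_F"
  shows "w \<in> fully_commutative \<Longrightarrow> z \<in> fully_commutative \<Longrightarrow> 0 \<le> mu z w"
proof (induction "len w" arbitrary: w z rule: less_induct)
  case less
  have wc: "w \<in> carrier W" "\<not> is_complex w" "z \<in> carrier W" "\<not> is_complex z"
    using less.prems by (auto simp: mem_fully_commutative)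
  have asc: "0 \<le> mu y v" if "v \<in> carrier W" "y \<in> carrier W" "\<not> left_descents v \<subseteq> left_descents y" for v y
    using that mu_ascent[of v _ y] by (auto split: if_splits) (metis zero_le_one order_refl)
  show ?case
  proof (cases "left_descents w \<subseteq> left_descents z \<and> left_descents (inv w) \<subseteq> left_descents (inv z)")
    case False
    then show ?thesis using asc[OF wc(1,3)] asc[of "inv w" "inv z"] mu_inv[OF wc(1,3)] wc by auto
  next
    case True
    from property_F_cases[OF F less.prems(1)] show ?thesis
    proof cases
      case (1 ws)
      have "len w \<le> len z"
        using commuting_subset_len[OF 1(1-3) wc(3)] commuting_descents[OF 1(1-3)] commuting_len[OF 1(1-3)] 1(4) True by simp
      then have "mu z w = 0" using mu_len[OF wc(1,3)] by fastforce
      then show ?thesis by simp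
    next
      case (2 x)
      then show ?thesis using left_star_mu_nonneg[OF 2 wc(2-4)] True less.hyps by blast
    next
      case (3 x)
      have "0 \<le> mu (inv z) (inv w)"
      proof (rule left_star_mu_nonneg[OF 3])
        show "0 \<le> mu y v" if "v \<in> fully_commutative" "y \<in> fully_commutative" "len v < len (inv w)" for v y
          using less.hyps that wc by simp
      qed (use True wc complex_inv_iff in auto)
      then show ?thesis using mu_inv[OF wc(1,3)] by simp
    qed
  qed
qed

end

section \<open>Positivity of the structure constants\<close>

locale star_reducible_hecke = hecke_algebra W S m scale T
  for W :: "('w, 'b) monoid_scheme" (structure) and S m
    and scale :: "laurent \<Rightarrow> 'h::ring_1 \<Rightarrow> 'h" (infixr \<open>*s\<close> 75) and T +
  assumes F: "property_F" and S: "property_S"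
begin

section \<open>Coefficients at fully commutative elements\<close>

lemma coef_ideal: "g - h \<in> TL_ideal \<Longrightarrow> z \<in> fully_commutative \<Longrightarrow> KL.coef g z = KL.coef h z"
  using ideal_iff[OF S, of "g - h"] by (simp add: KL.coef_diff)

lemma complex_ideal: "z \<in> carrier W \<Longrightarrow> is_complex z \<Longrightarrow> KL z \<in> TL_ideal"
  by (rule complex_in_ideal[OF S])

text \<open>The terms with complex \<open>x\<close> lie in the ideal, which has no component at
  fully commutative \<open>z\<close>. Hence positivity can be propagated through products while
  looking at fully commutative elements only.\<close>

lemma coef_mult_expand:
  assumes z: "z \<in> fully_commutative"
  shows "KL.coef (g * h) z = (\<Sum>x | x \<in> fully_commutative \<and> KL.coef h x \<noteq> 0. KL.coef h x * KL.coef (g * KL x) z)"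
proof -
  let ?A = "{x. x \<in> carrier W \<and> KL.coef h x \<noteq> 0}"
  have fin: "finite ?A" using KL.finite_coef[of h] by simp
  have "KL.coef (g * h) z = (\<Sum>x\<in>?A. KL.coef h x * KL.coef (g * KL x) z)"
    by (subst KL.expand[of h]) (simp add: sum_distrib_left scale_mult_right KL.coef_sum KL.coef_scale)
  also have "\<dots> = (\<Sum>x | x \<in> fully_commutative \<and> KL.coef h x \<noteq> 0. KL.coef h x * KL.coef (g * KL x) z)"
  proof (rule sum.mono_neutral_right[OF fin])
    show "\<forall>x \<in> ?A - {x. x \<in> fully_commutative \<and> KL.coef h x \<noteq> 0}. KL.coef h x * KL.coef (g * KL x) z = 0"
    proof
      fix x assume "x \<in> ?A - {x. x \<in> fully_commutative \<and> KL.coef h x \<noteq> 0}"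
      then have "g * KL x \<in> TL_ideal"
        by (intro ideal_mult_left complex_ideal) (auto simp: mem_fully_commutative)
      then show "KL.coef h x * KL.coef (g * KL x) z = 0" using ideal_iff[OF S] z by simp
    qed
  qed (auto simp: mem_fully_commutative)
  finally show ?thesis .
qed

lemma coef_KL_gen:
  assumes "p \<in> S" "x \<in> carrier W" "p \<notin> left_descents x" "z \<in> carrier W"
  shows "KL.coef (C p * KL x) z = (if z = p \<otimes> x then 1 else 0) + (if p \<in> left_descents z then of_int (mu z x) else 0)"
proof -
  have "KL.coef (\<Sum>y\<in>below p x. of_int (mu y x) *s KL y) z = (\<Sum>y\<in>below p x. if y = z then of_int (mu z x) else 0)"
    unfolding KL.coef_sum KL.coef_scale
    by (rule sum.cong) (use assms in \<open>auto simp: KL.coef_basis below_def\<close>)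
  also have "\<dots> = (if z \<in> below p x then of_int (mu z x) else 0)" using finite_below by simp
  also have "\<dots> = (if p \<in> left_descents z then of_int (mu z x) else 0)" using assms by (auto simp: below_def)
  finally show ?thesis
    unfolding KL_up[OF assms(2,1,3)] using assms by (simp add: KL.coef_add KL.coef_basis)
qed

lemma coef_KL_gen_mem:
  assumes "p \<in> S" "x \<in> fully_commutative" "z \<in> fully_commutative"
  shows "KL.coef (C p * KL x) z \<in> nonneg_delta"
proof -
  have c: "x \<in> carrier W" "z \<in> carrier W" using assms by (auto simp: mem_fully_commutative)
  show ?thesis
  proof (cases "p \<in> left_descents x")
    case True
    then show ?thesis
      using KL_down[OF c(1) True] c nonneg_delta_delta_mult[OF nonneg_delta_1]
      by (auto simp: KL.coef_scale KL.coef_basis nonneg_delta_0)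
  next
    case False
    have "of_int (mu z x) \<in> nonneg_delta"
      using nonneg_delta_of_int_mult[OF nonneg_delta_1 mu_nonneg[OF F assms(2,3)]] by simp
    then show ?thesis
      unfolding coef_KL_gen[OF assms(1) c(1) False c(2)]
      by (auto intro: nonneg_delta_add nonneg_delta_0 nonneg_delta_1)
  qed
qed

definition positive :: "'h \<Rightarrow> bool" where
  "positive h \<longleftrightarrow> (\<forall>z \<in> fully_commutative. KL.coef h z \<in> nonneg_delta)"

lemma nonneg_delta_mult:
  assumes "p \<in> nonneg_delta" "q \<in> nonneg_delta" shows "p * q \<in> nonneg_delta"
proof -
  obtain n c where p: "p = (\<Sum>i\<le>n. of_nat (c i) * laurent_delta ^ i)" using nonneg_deltaE[OF assms(1)] by blast
  have "laurent_delta ^ i * q \<in> nonneg_delta" for i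
  proof (induction i)
    case (Suc i)
    then show ?case using nonneg_delta_delta_mult[OF Suc] by (simp add: mult.assoc)
  qed (use assms in simp)
  then have "of_nat (c i) * (laurent_delta ^ i * q) \<in> nonneg_delta" for i by (rule nonneg_delta_of_nat_mult)
  then show ?thesis unfolding p sum_distrib_right by (intro nonneg_delta_sum) (simp add: mult.assoc)
qed

lemma positive_mult:
  assumes "positive h" "\<And>x. x \<in> fully_commutative \<Longrightarrow> KL.coef h x \<noteq> 0 \<Longrightarrow> positive (g * KL x)"
  shows "positive (g * h)"
  unfolding positive_def
proof
  fix z assume z: "z \<in> fully_commutative"
  show "KL.coef (g * h) z \<in> nonneg_delta"
  proof (subst coef_mult_expand[OF z], rule nonneg_delta_sum)
    fix x assume "x \<in> {x. x \<in> fully_commutative \<and> KL.coef h x \<noteq> 0}"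
    then have x: "x \<in> fully_commutative" "KL.coef h x \<noteq> 0" by auto
    show "KL.coef h x * KL.coef (g * KL x) z \<in> nonneg_delta"
      using nonneg_delta_mult assms(1) assms(2)[OF x] x(1) z by (simp add: positive_def)
  qed
qed

lemma positive_gen: "p \<in> S \<Longrightarrow> x \<in> fully_commutative \<Longrightarrow> positive (C p * KL x)"
  by (simp add: positive_def coef_KL_gen_mem)

lemma positive_KL: "x \<in> fully_commutative \<Longrightarrow> positive (KL x)"
  by (auto simp: positive_def KL.coef_basis mem_fully_commutative nonneg_delta_0 nonneg_delta_1)

text \<open>No correction terms arise: an element of \<open>below s ?w\<close> is shorter than
  \<open>?w\<close>, so it misses one of the descents of \<open>?w\<close>, and
  \<open>mu_ascent\<close> makes it a neighbour of \<open>?w\<close>; its descent \<open>s\<close>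
  would then be a descent of \<open>?w\<close>.\<close>

lemma KL_commuting_product:
  assumes "ws \<in> lists S" "distinct ws" "\<forall>s \<in> set ws. \<forall>t \<in> set ws. s \<otimes> t = t \<otimes> s"
  shows "KL (word_prod W ws) = foldr (\<lambda>s h. C s * h) ws 1"
  using assms
proof (induction ws rule: list.induct)
  case Nil
  then show ?case using KL_one by simp
next
  case (Cons s ws)
  have c: "s \<in> S" "ws \<in> lists S" "s \<notin> set ws" "distinct ws" using Cons.prems(1,2) by (auto simp: in_lists_conv_set)
  have comm: "\<forall>s \<in> set ws. \<forall>t \<in> set ws. s \<otimes> t = t \<otimes> s" using Cons.prems(3) by (meson list.set_intros(2))
  let ?w = "word_prod W ws"
  have wc: "?w \<in> carrier W" using c by simp
  have L: "left_descents ?w = set ws" by (rule commuting_descents[OF c(2,4) comm])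
  have "below s ?w = {}"
  proof (rule ccontr)
    assume "below s ?w \<noteq> {}"
    then obtain z where zb: "z \<in> below s ?w" by blast
    then have z: "z \<in> carrier W" "s \<in> left_descents z" "mu z ?w \<noteq> 0" "len z < len ?w"
      using below_len[OF wc zb] by (simp_all add: below_def)
    have "\<not> set ws \<subseteq> left_descents z"
    proof
      assume "set ws \<subseteq> left_descents z"
      from commuting_subset_len[OF c(2,4) comm z(1) this] show False
        using commuting_len[OF c(2,4) comm] z(4) by linarith
    qed
    then obtain r where r: "r \<in> set ws" "r \<notin> left_descents z" by blast
    have rS: "r \<in> S" "r \<noteq> s" using r c by (auto simp: in_lists_conv_set)
    have "r \<in> left_descents ?w" using r(1) L by simp
    from mu_ascent[OF wc this z(1) r(2)] z(3) have "r \<otimes> z = ?w" by (simp split: if_splits)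
    moreover have "r \<otimes> s = s \<otimes> r" using Cons.prems(3) r by (meson list.set_intros)
    ultimately have "s \<in> left_descents ?w" using descent_commuting[OF rS(1) c(1) _ rS(2) z(1)] z(2) by simp
    then show False using L c by simp
  qed
  then have "C s * KL ?w = KL (s \<otimes> ?w)" using KL_up[OF wc c(1)] L c by simp
  then show ?case using Cons.IH[OF c(2,4) comm] by simp
qed

lemma positive_commuting_product:
  assumes "ws \<in> lists S" "y \<in> fully_commutative"
  shows "positive (foldr (\<lambda>s h. C s * h) ws 1 * KL y)"
  using assms(1)
proof (induction ws rule: list.induct)
  case Nil
  then show ?case using positive_KL assms by simp
next
  case (Cons s ws)
  then have s: "s \<in> S" "positive (foldr (\<lambda>s h. C s * h) ws 1 * KL y)" by (auto simp: in_lists_conv_set)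
  have "positive (C s * (foldr (\<lambda>s h. C s * h) ws 1 * KL y))"
    by (rule positive_mult[OF s(2) positive_gen[OF s(1)]])
  then show ?case by (simp add: mult.assoc)
qed

text \<open>The image of \<open>C p\<close> involves only \<open>KL z\<close> with \<open>p\<close>
  as a descent, and the eigenvector lies in that image up to the factor
  \<open>laurent_delta\<close>, which can be cancelled.\<close>

lemma coef_eigen:
  assumes "C p * h = laurent_delta *s h" "p \<in> S" "z \<in> carrier W" "p \<notin> left_descents z"
  shows "KL.coef h z = 0"
proof -
  have "KL.coef (C p * KL x) z = 0" if x: "x \<in> carrier W" for x
  proof (cases "p \<in> left_descents x")
    case True
    then show ?thesis using KL_down[OF x True] x assms by (auto simp: KL.coef_scale KL.coef_basis)
  next
    case False
    have "z \<noteq> p \<otimes> x" using left_descent_mult[OF x assms(2)] False assms(4) by auto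
    then show ?thesis using coef_KL_gen[OF assms(2) x False assms(3)] assms(4) by simp
  qed
  then have "KL.coef (C p * h) z = 0"
    by (subst KL.expand[of h]) (simp add: sum_distrib_left scale_mult_right KL.coef_sum KL.coef_scale)
  then show ?thesis using assms(1) delta_nonzero by (simp add: KL.coef_scale)
qed

text \<open>A neighbour of a fully commutative element may be complex; the cutoff makes it count as
  0.\<close>

definition fc :: "'h \<Rightarrow> 'w \<Rightarrow> laurent" where
  "fc h z = (if z \<in> fully_commutative then KL.coef h z else 0)"

text \<open>Dual to \<open>string_mult\<close>: instead of expanding a product, one coefficient of
  it is read off. Fully commutative \<open>x\<close> occurring in \<open>h\<close> have descent
  \<open>c\<close> and not \<open>r\<close>, so \<open>mu_ascent\<close> leaves only the two
  neighbours of \<open>z\<close> as contributors.\<close>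

lemma coef_gen_string:
  assumes h: "C c * h = laurent_delta *s h" and cr: "noncommuting c r"
    and z: "z \<in> fully_commutative" "r \<in> left_descents z"
  shows "KL.coef (C r * h) z = fc h (r \<otimes> z) + fc h (c \<otimes> z)"
proof -
  have zc: "z \<in> carrier W" "\<not> is_complex z" using z by (auto simp: mem_fully_commutative)
  have S: "c \<in> S" "r \<in> S" "noncommuting r c" "c \<noteq> r" using noncommutingD cr by auto
  have cz: "c \<notin> left_descents z" using two_descents_complex[OF cr _ z(2)] zc by blast
  let ?B = "{x. x \<in> fully_commutative \<and> KL.coef h x \<noteq> 0}"
  have fin: "finite ?B" by (rule finite_subset[OF _ KL.finite_coef[of h]]) (auto simp: mem_fully_commutative)
  have rc: "r \<otimes> z \<in> carrier W" "c \<otimes> z \<in> carrier W" "r \<otimes> z \<noteq> c \<otimes> z"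
    using S zc by (auto simp: right_cancel)
  have summand: "KL.coef (C r * KL x) z = (if x = r \<otimes> z then 1 else 0) + (if x = c \<otimes> z then 1 else 0)" if x: "x \<in> ?B" for x
  proof -
    have xc: "x \<in> carrier W" "\<not> is_complex x" using x by (auto simp: mem_fully_commutative)
    have cx: "c \<in> left_descents x" using coef_eigen[OF h S(1) xc(1)] x by blast
    have rx: "r \<notin> left_descents x" using two_descents_complex[OF cr cx] xc by blast
    have "z = r \<otimes> x \<longleftrightarrow> x = r \<otimes> z" using S xc zc by auto
    moreover have "mu z x = (if x = c \<otimes> z then 1 else 0)" using mu_ascent[OF xc(1) cx zc(1) cz] by auto
    ultimately show ?thesis using coef_KL_gen[OF S(2) xc(1) rx zc(1)] z(2) by simp
  qed
  have "KL.coef (C r * h) z = (\<Sum>x\<in>?B. (if x = r \<otimes> z then KL.coef h (r \<otimes> z) else 0) + (if x = c \<otimes> z then KL.coef h (c \<otimes> z) else 0))"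
    by (subst coef_mult_expand[OF z(1)], rule sum.cong) (use summand in auto)
  also have "\<dots> = fc h (r \<otimes> z) + fc h (c \<otimes> z)"
    using fin by (auto simp: sum.distrib fc_def)
  finally show ?thesis .
qed

text \<open>The value 0 at the base and from the top on makes both ends of the path uniform; modulo
  the ideal the neighbour rule remains true there.\<close>

definition strKL :: "'w \<Rightarrow> 'w \<Rightarrow> 'w \<Rightarrow> nat \<Rightarrow> 'h" where
  "strKL s t u j = (if 1 \<le> j \<and> enat j < m s t then KL (str s t u j) else 0)"

lemma strKL_mult:
  assumes b: "is_base s t u" and j: "1 \<le> j" "enat j < m s t"
  shows "C (letter s t (Suc j)) * strKL s t u j - (strKL s t u (j + 1) + strKL s t u (j - 1)) \<in> TL_ideal"
    "C (letter s t j) * strKL s t u j = laurent_delta *s strKL s t u j"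
proof -
  show "C (letter s t j) * strKL s t u j = laurent_delta *s strKL s t u j"
    using KL_down[OF str_closed[OF b] str_descent[OF b j(1)]] j by (simp add: strKL_def)
  have lt: "enat (j - 1) < m s t" using j order.strict_trans1[of "enat (j - 1)" "enat j"] by simp
  have 1: "strKL s t u (j - 1) = (if j = 1 then 0 else KL (str s t u (j - 1)))"
    using j lt by (auto simp: strKL_def)
  have 2: "KL (str s t u (Suc j)) - strKL s t u (j + 1) \<in> TL_ideal"
  proof (cases "enat (Suc j) < m s t")
    case True
    then show ?thesis by (simp add: strKL_def)
  next
    case False
    then have top: "enat (Suc j) = m s t" using j by (cases "m s t") auto
    have "noncommuting (letter s t (Suc j)) (letter s t (Suc (Suc j)))" using letter_bond(4)[OF b] .
    then have "KL (str s t u (Suc j)) \<in> TL_ideal"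
      using descent_pair_in_ideal str_top[OF b top] str_closed[OF b] by blast
    then show ?thesis using False by (simp add: strKL_def)
  qed
  have "C (letter s t (Suc j)) * strKL s t u j - (KL (str s t u (Suc j)) + strKL s t u (j - 1)) \<in> TL_ideal"
    unfolding 1 using string_mult[OF b j] j by (simp add: strKL_def)
  from ideal_add[OF this 2] show "C (letter s t (Suc j)) * strKL s t u j - (strKL s t u (j + 1) + strKL s t u (j - 1)) \<in> TL_ideal"
    by (simp add: algebra_simps)
qed

lemma string_member:
  assumes b: "is_base s t u" and z: "z \<in> fully_commutative" and p: "p \<in> {s, t}" "p \<in> left_descents z"
  obtains s' t' u' i where "is_base s' t' u'" "{s', t'} = {s, t}" "m s' t' = m s t" "1 \<le> i" "enat i < m s t" "z = str s' t' u' i"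
    "\<And>l. 1 \<le> l \<Longrightarrow> enat l < m s t \<Longrightarrow> str s' t' u' l \<in> fully_commutative"
proof -
  have zc: "z \<in> carrier W" "\<not> is_complex z" using z by (auto simp: mem_fully_commutative)
  have st: "noncommuting s t" "s \<in> S" "t \<in> S" using b noncommutingD[of s t] by (auto simp: is_base_def)
  define q where "q = (if p = s then t else s)"
  have pq: "noncommuting p q" "{p, q} = {s, t}" using st noncommutingD[of s t] p by (auto simp: q_def)
  have "q \<notin> left_descents z" using two_descents_complex[OF pq(1) p(2)] zc by blast
  then obtain s' t' u' i where z': "is_base s' t' u'" "{s', t'} = {p, q}" "1 \<le> i" "enat i < m s' t'" "z = str s' t' u' i"
    using descent_string[OF pq(1) zc(1) p(2)] by metis
  have mm: "m s' t' = m s t" using z'(2) pq(2) m_sym[OF st(2,3)] by (auto simp: doubleton_eq_iff)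
  have "str s' t' u' l \<in> fully_commutative" if "1 \<le> l" "enat l < m s t" for l
    using string_fully_commutative[OF z'(1,3,4), of l] that mm zc z' str_closed[OF z'(1)] by (simp add: mem_fully_commutative)
  then show thesis using that z' mm pq(2) by auto
qed

text \<open>With \<open>y\<close> fixed, the coefficients of the products along the string of the
  left factor, read along the string of \<open>z\<close>, form the matrix. Left multiplication by a
  generator moves along the former by \<open>strKL_mult\<close> and along the latter by
  \<open>coef_gen_string\<close>.\<close>

lemma left_star_positive:
  assumes b: "is_base s t u" and j: "1 \<le> j" "enat j < m s t"
    and col: "positive (KL (str s t u 1) * KL y)"
  shows "positive (KL (str s t u j) * KL y)"
  unfolding positive_def
proof
  fix z assume z: "z \<in> fully_commutative"
  have zc: "z \<in> carrier W" using z by (auto simp: mem_fully_commutative)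
  have eig: "C (letter s t k) * (strKL s t u k * KL y) = laurent_delta *s (strKL s t u k * KL y)"
    if "1 \<le> k" "enat k < m s t" for k
    using strKL_mult(2)[OF b that] by (simp add: mult.assoc[symmetric] scale_mult_left)
  have lS: "letter s t k \<in> S" for k using letter_bond(1)[OF b] .
  show "KL.coef (KL (str s t u j) * KL y) z \<in> nonneg_delta"
  proof (cases "letter s t j \<in> left_descents z")
    case False
    then show ?thesis using coef_eigen[OF eig[OF j] lS zc] j by (simp add: strKL_def nonneg_delta_0)
  next
    case True
    have "letter s t j \<in> {s, t}" by (simp add: letter_def)
    then obtain s' t' u' i where z': "is_base s' t' u'" "{s', t'} = {s, t}" "m s' t' = m s t" "1 \<le> i" "enat i < m s t" "z = str s' t' u' i"
      "\<And>l. 1 \<le> l \<Longrightarrow> enat l < m s t \<Longrightarrow> str s' t' u' l \<in> fully_commutative"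
      using string_member[OF b z _ True] by metis
    define Z where "Z = str s' t' u'"
    have Zc: "Z l \<in> carrier W" for l using str_closed[OF z'(1)] by (simp add: Z_def)
    define a where "a = (\<lambda>i k. if 1 \<le> i \<and> enat i < m s t then KL.coef (strKL s t u k * KL y) (Z i) else 0)"
    have rel: "a (i - 1) k + a (i + 1) k = a i (k - 1) + a i (k + 1)"
      if i: "1 \<le> i" "enat i < m s t" and k: "1 \<le> k" "enat k < m s t" for i k
    proof -
      let ?h = "strKL s t u k * KL y" and ?c = "letter s t k" and ?r = "letter s t (Suc k)"
      have cr: "noncommuting ?c ?r" using letter_bond(4)[OF b] .
      have Zi: "Z i \<in> fully_commutative" using z'(7) i by (simp add: Z_def)
      have "(C ?r * strKL s t u k - (strKL s t u (k + 1) + strKL s t u (k - 1))) * KL y \<in> TL_ideal"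
        using strKL_mult(1)[OF b k] ideal_mult_right by blast
      then have "C ?r * ?h - (strKL s t u (k + 1) * KL y + strKL s t u (k - 1) * KL y) \<in> TL_ideal"
        by (simp add: left_diff_distrib distrib_right mult.assoc)
      from coef_ideal[OF this Zi] have R: "KL.coef (C ?r * ?h) (Z i) = a i (k - 1) + a i (k + 1)"
        using i by (simp add: a_def KL.coef_add)
      have d: "letter s' t' i \<in> left_descents (Z i)" "letter s' t' (Suc i) \<notin> left_descents (Z i)"
        using str_descent[OF z'(1) i(1)] str_not_descent[OF z'(1), of i] i z'(3) by (auto simp: Z_def)
      have out: "a l k = 0" if "letter s' t' (Suc l) = ?c" "l = 0 \<or> enat l < m s t" for l
      proof (cases "1 \<le> l \<and> enat l < m s t")
        case True
        then have "?c \<notin> left_descents (Z l)" using str_not_descent[OF z'(1), of l] z'(3) that by (simp add: Z_def)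
        then show ?thesis using coef_eigen[OF eig[OF k] lS Zc] by (simp add: a_def)
      qed (auto simp: a_def)
      show ?thesis
      proof (cases "letter s' t' i = ?c")
        case True
        \<comment> \<open>For equal first letters both sides of the relation are 0: the neighbours
          in the string lack the descent \<open>?c\<close>, and \<open>Z i\<close> itself lacks
          \<open>?r\<close>.\<close>
        have "?r \<notin> left_descents (Z i)"
          using two_descents_complex[OF cr _ _ Zc] d True Zi by (auto simp: mem_fully_commutative)
        moreover have "KL.coef (C ?r * ?h) (Z i) = 0"
          by (rule coef_eigen[OF _ lS Zc \<open>?r \<notin> left_descents (Z i)\<close>])
            (simp add: mult.assoc[symmetric] C_square[OF lS] scale_mult_left)
        moreover have "a (i - 1) k = 0" using out[of "i - 1"] i True order.strict_trans1[of "enat (i - 1)" "enat i" "m s t"] by auto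
        moreover have "a (i + 1) k = 0"
        proof (cases "enat (i + 1) < m s t")
          case t: True
          then show ?thesis using out[of "i + 1"] letter_bond(6)[OF z'(1), of i] True by simp
        qed (simp add: a_def)
        ultimately show ?thesis using R by simp
      next
        case False
        then have ir: "letter s' t' i = ?r" "letter s' t' (Suc i) = ?c"
          using letter_other[OF b z'(2), of i k] letter_other[OF b z'(2), of "Suc i" k] letter_bond(2)[OF z'(1), of i] by auto
        have nb: "?r \<otimes> Z i = Z (i - 1)" "?c \<otimes> Z i = Z (i + 1)"
          using str_down[OF z'(1), of "i - 1"] str_Suc[OF z'(1), of i] i ir by (auto simp: Z_def)
        have L: "KL.coef (C ?r * ?h) (Z i) = fc ?h (Z (i - 1)) + fc ?h (Z (i + 1))"
          using coef_gen_string[OF eig[OF k] cr Zi] d ir unfolding nb by simp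
        have "fc ?h (Z (i - 1)) = a (i - 1) k"
        proof (cases "i = 1")
          case True
          have "?c \<notin> left_descents u'" "u' \<in> carrier W" using letter_bond(5)[OF z'(1), of i] ir z'(1) by (auto simp: is_base_def)
          then have "KL.coef ?h u' = 0" using coef_eigen[OF eig[OF k] lS] by blast
          then show ?thesis using True str_0[OF z'(1)] by (simp add: a_def fc_def Z_def)
        next
          case False
          then have "1 \<le> i - 1" "enat (i - 1) < m s t" using i order.strict_trans1[of "enat (i - 1)" "enat i" "m s t"] by auto
          then show ?thesis using z'(7) by (simp add: a_def fc_def Z_def)
        qed
        moreover have "fc ?h (Z (i + 1)) = a (i + 1) k"
        proof (cases "enat (i + 1) < m s t")
          case True
          then show ?thesis using z'(7)[of "i + 1"] by (simp add: a_def fc_def Z_def)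
        next
          case False
          then have top: "enat (Suc i) = m s' t'" using i z'(3) by (cases "m s t") auto
          have "is_complex (Z (Suc i))"
            using two_descents_complex[OF letter_bond(4)[OF z'(1), of "Suc i"]] str_top[OF z'(1) top] Zc by (auto simp: Z_def)
          then show ?thesis using False by (simp add: a_def fc_def mem_fully_commutative)
        qed
        ultimately show ?thesis using L R by simp
      qed
    qed
    have "a i j \<in> nonneg_delta"
    proof (rule path_matrix_mem[where M = "m s t"])
      have one: "enat 1 < m s t" using j order.strict_trans1[of "enat 1" "enat j" "m s t"] by simp
      show "a l 1 \<in> nonneg_delta" if "1 \<le> l" "enat l < m s t" for l
        using col z'(7)[OF that] that one by (simp add: a_def positive_def strKL_def Z_def)
      show "a l k = 0" if "enat l = m s t" for l k using that by (simp add: a_def)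
    qed (use rel z' j nonneg_delta_0 nonneg_delta_add in \<open>auto simp: a_def strKL_def\<close>)
    then show ?thesis using z' j by (simp add: a_def Z_def strKL_def)
  qed
qed

section \<open>Star reductions on the right of the left factor\<close>

lemma iota_ideal_iff: "iota h \<in> TL_ideal \<longleftrightarrow> h \<in> TL_ideal"
  using ideal_iota[of h] ideal_iota[of "iota h"] by auto

text \<open>The relation compares two ways of absorbing a generator placed between
  \<open>X k\<close> and \<open>Y l\<close>. If the generators moving the two factors agree, it is
  associativity; if they differ, each acts on the other factor by \<open>laurent_delta\<close>, and
  both sides equal \<open>laurent_delta\<close> times the middle entry.\<close>

lemma right_star_positive_string:
  assumes b: "is_base s t u" and j: "1 \<le> j" "enat j < m s t"
    and y: "y \<in> fully_commutative" "p \<in> {s, t}" "p \<in> left_descents y"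
    and col: "\<And>y. y \<in> fully_commutative \<Longrightarrow> positive (iota (KL (str s t u 1)) * KL y)"
  shows "positive (iota (KL (str s t u j)) * KL y)"
  unfolding positive_def
proof
  fix z assume z: "z \<in> fully_commutative"
  have lS: "letter s t k \<in> S" for k using letter_bond(1)[OF b] .
  obtain s' t' u' i where y': "is_base s' t' u'" "{s', t'} = {s, t}" "m s' t' = m s t" "1 \<le> i" "enat i < m s t" "y = str s' t' u' i"
    "\<And>l. 1 \<le> l \<Longrightarrow> enat l < m s t \<Longrightarrow> str s' t' u' l \<in> fully_commutative"
    using string_member[OF b y] by metis
  define X where "X = (\<lambda>k. iota (strKL s t u k))"
  define Y where "Y = strKL s' t' u'"
  have X1: "X k * C (letter s t (Suc k)) - (X (k + 1) + X (k - 1)) \<in> TL_ideal"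
    "X k * C (letter s t k) = laurent_delta *s X k" if "1 \<le> k" "enat k < m s t" for k
  proof -
    have "iota (C (letter s t (Suc k)) * strKL s t u k - (strKL s t u (k + 1) + strKL s t u (k - 1))) \<in> TL_ideal"
      using strKL_mult(1)[OF b that] iota_ideal_iff by blast
    then show "X k * C (letter s t (Suc k)) - (X (k + 1) + X (k - 1)) \<in> TL_ideal"
      using lS by (simp add: X_def iota_diff iota_add iota_mult)
    have "iota (C (letter s t k) * strKL s t u k) = iota (laurent_delta *s strKL s t u k)"
      using strKL_mult(2)[OF b that] by simp
    then show "X k * C (letter s t k) = laurent_delta *s X k" using lS by (simp add: X_def iota_mult iota_scale)
  qed
  note Y1 = strKL_mult[OF y'(1), folded Y_def, unfolded y'(3)]
  have right: "KL.coef (X k * C (letter s t (Suc k)) * h) z = KL.coef (X (k + 1) * h) z + KL.coef (X (k - 1) * h) z"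
    if "1 \<le> k" "enat k < m s t" for k h
  proof -
    have "(X k * C (letter s t (Suc k)) - (X (k + 1) + X (k - 1))) * h \<in> TL_ideal"
      using X1(1)[OF that] ideal_mult_right by blast
    then have "X k * C (letter s t (Suc k)) * h - (X (k + 1) * h + X (k - 1) * h) \<in> TL_ideal"
      by (simp add: left_diff_distrib distrib_right mult.assoc)
    from coef_ideal[OF this z] show ?thesis by (simp add: KL.coef_add)
  qed
  have left: "KL.coef (h * (C (letter s' t' (Suc l)) * Y l)) z = KL.coef (h * Y (l + 1)) z + KL.coef (h * Y (l - 1)) z"
    if "1 \<le> l" "enat l < m s t" for l h
  proof -
    have "h * (C (letter s' t' (Suc l)) * Y l - (Y (l + 1) + Y (l - 1))) \<in> TL_ideal"
      using Y1(1)[OF that] ideal_mult_left by blast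
    then have "h * (C (letter s' t' (Suc l)) * Y l) - (h * Y (l + 1) + h * Y (l - 1)) \<in> TL_ideal"
      by (simp add: right_diff_distrib distrib_left)
    from coef_ideal[OF this z] show ?thesis by (simp add: KL.coef_add)
  qed
  define a where "a = (\<lambda>l k. KL.coef (X k * Y l) z)"
  have rel: "a (l - 1) k + a (l + 1) k = a l (k - 1) + a l (k + 1)"
    if l: "1 \<le> l" "enat l < m s t" and k: "1 \<le> k" "enat k < m s t" for l k
  proof (cases "letter s' t' (Suc l) = letter s t (Suc k)")
    case True
    have "a (l + 1) k + a (l - 1) k = KL.coef (X k * C (letter s t (Suc k)) * Y l) z"
      using left[OF l, of "X k"] True by (simp add: a_def mult.assoc)
    then show ?thesis using right[OF k, of "Y l"] by (simp add: a_def add.commute)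
  next
    case False
    then have e: "letter s' t' (Suc l) = letter s t k" "letter s' t' l = letter s t (Suc k)"
      using letter_other[OF b y'(2), of "Suc l" k] letter_other[OF b y'(2), of l k] letter_bond(2)[OF y'(1), of l] by auto
    have "a (l + 1) k + a (l - 1) k = KL.coef (X k * C (letter s t k) * Y l) z"
      using left[OF l, of "X k"] e by (simp add: a_def mult.assoc)
    also have "\<dots> = laurent_delta * KL.coef (X k * Y l) z"
      unfolding X1(2)[OF k] by (simp add: scale_mult_left KL.coef_scale)
    also have "\<dots> = KL.coef (X k * C (letter s t (Suc k)) * Y l) z"
      using Y1(2)[OF l] e by (simp add: mult.assoc scale_mult_right KL.coef_scale)
    finally show ?thesis using right[OF k, of "Y l"] by (simp add: a_def add.commute)
  qed
  have "a i j \<in> nonneg_delta"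
  proof (rule path_matrix_mem[where M = "m s t"])
    have one: "enat 1 < m s t" using j order.strict_trans1[of "enat 1" "enat j" "m s t"] by simp
    show "a l 1 \<in> nonneg_delta" if "1 \<le> l" "enat l < m s t" for l
      using col[OF y'(7)[OF that]] that one z y'(3) by (simp add: a_def positive_def strKL_def X_def Y_def)
    show "a l k = 0" if "enat l = m s t" for l k using that y'(3) by (simp add: a_def Y_def strKL_def)
  qed (use rel y' j nonneg_delta_0 nonneg_delta_add in \<open>auto simp: a_def strKL_def X_def Y_def\<close>)
  then show "KL.coef (iota (KL (str s t u j)) * KL y) z \<in> nonneg_delta"
    using y' j by (simp add: a_def X_def Y_def strKL_def)
qed

text \<open>\<open>C p * KL y\<close> involves only elements with descent \<open>p\<close>, which
  lie on strings as required, even if \<open>y\<close> does not. Inserting \<open>C p\<close>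
  between the factors multiplies the product by \<open>laurent_delta\<close>, which
  \<open>nonneg_delta_divide\<close> removes.\<close>

lemma right_star_positive:
  assumes b: "is_base s t u" and j: "1 \<le> j" "enat j < m s t" and y: "y \<in> fully_commutative"
    and col: "\<And>y. y \<in> fully_commutative \<Longrightarrow> positive (iota (KL (str s t u 1)) * KL y)"
  shows "positive (iota (KL (str s t u j)) * KL y)"
proof -
  let ?p = "letter s t j" and ?X = "iota (KL (str s t u j))"
  have p: "?p \<in> S" "?p \<in> {s, t}" using letter_bond(1)[OF b] by (auto simp: letter_def)
  have "?p \<in> left_descents (str s t u j)" using str_descent[OF b j(1)] j by simp
  from KL_down[OF str_closed[OF b] this] have "iota (C ?p * KL (str s t u j)) = iota (laurent_delta *s KL (str s t u j))" by simp
  then have e: "?X * C ?p = laurent_delta *s ?X" using p by (simp add: iota_mult iota_scale)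
  have "positive (?X * (C ?p * KL y))"
  proof (rule positive_mult[OF positive_gen[OF p(1) y]])
    fix x assume x: "x \<in> fully_commutative" "KL.coef (C ?p * KL y) x \<noteq> 0"
    have "C ?p * (C ?p * KL y) = laurent_delta *s (C ?p * KL y)"
      by (simp add: mult.assoc[symmetric] C_square[OF p(1)] scale_mult_left)
    from coef_eigen[OF this p(1), of x] have "?p \<in> left_descents x" using x by (auto simp: mem_fully_commutative)
    then show "positive (?X * KL x)" using right_star_positive_string[OF b j x(1) p(2) _ col] by blast
  qed
  then have "laurent_delta * KL.coef (?X * KL y) z \<in> nonneg_delta" if "z \<in> fully_commutative" for z
    using that e by (simp add: positive_def mult.assoc[symmetric] scale_mult_left KL.coef_scale)
  then show ?thesis unfolding positive_def using nonneg_delta_divide by blast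
qed

text \<open>Only the left factor is reduced, with \<open>y\<close> arbitrary throughout. A left star
  reduction leads to the bottom element of the string of \<open>x\<close>, which is shorter; a right
  one is a left one for \<open>inv x\<close>.\<close>

theorem positive_product: "x \<in> fully_commutative \<Longrightarrow> y \<in> fully_commutative \<Longrightarrow> positive (KL x * KL y)"
proof (induction "len x" arbitrary: x y rule: less_induct)
  case less
  have x: "x \<in> carrier W" "\<not> is_complex x" using less.prems by (auto simp: mem_fully_commutative)
  have bottom: "str s t u 1 \<in> fully_commutative \<and> len (str s t u 1) < len (str s t u (Suc j)) \<and> enat 1 < m s t"
    if h: "is_base s t u" "1 \<le> j" "enat (Suc j) < m s t" "\<not> is_complex (str s t u (Suc j))" for s t u j
  proof -
    have one: "enat 1 < m s t" using h(3) order.strict_trans1[of "enat 1" "enat (Suc j)" "m s t"] by simp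
    then have "\<not> is_complex (str s t u 1)" using string_fully_commutative[OF h(1), of "Suc j" 1] h by simp
    then show ?thesis using str_closed[OF h(1)] str_len[OF h(1), of 1] str_len[OF h(1), of "Suc j"] h one
      by (simp add: mem_fully_commutative)
  qed
  from property_F_cases[OF F less.prems(1)] show ?case
  proof cases
    case (1 ws)
    then show ?thesis using KL_commuting_product positive_commuting_product less.prems(2) by simp
  next
    case (2 v)
    obtain s t u j where h: "is_base s t u" "1 \<le> j" "enat (Suc j) < m s t" "x = str s t u (Suc j)"
      using left_star_reducible_string[OF 2] by metis
    then show ?thesis
      using left_star_positive[OF h(1), of "Suc j" y] less.hyps[of "str s t u 1" y] bottom[OF h(1-3)] less.prems x by simp
  next
    case (3 v)
    obtain s t u j where h: "is_base s t u" "1 \<le> j" "enat (Suc j) < m s t" "inv x = str s t u (Suc j)"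
      using left_star_reducible_string[OF 3] by metis
    have fc1: "\<not> is_complex (str s t u (Suc j))" using h(4) complex_inv_iff x by metis
    note b = bottom[OF h(1-3) fc1]
    have l: "len (inv (str s t u 1)) < len x" using b h(4) x str_closed[OF h(1)] by (metis len_inv)
    have col: "positive (iota (KL (str s t u 1)) * KL y)" if "y \<in> fully_commutative" for y
      using less.hyps[OF l fully_commutative_inv that] b iota_KL[OF str_closed[OF h(1)]] by simp
    have "KL x = iota (KL (str s t u (Suc j)))" 
      unfolding h(4)[symmetric] using iota_KL[of "inv x"] x by simp
    then show ?thesis using right_star_positive[OF h(1) _ h(3) less.prems(2) col] by simp
  qed
qed

lemma coef_product:
  assumes "x \<in> carrier W" "y \<in> carrier W" "z \<in> fully_commutative"
  shows "KL.coef (KL x * KL y) z \<in> nonneg_delta"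
proof (cases "is_complex x \<or> is_complex y")
  case True
  then have "KL x * KL y \<in> TL_ideal"
    using complex_ideal assms ideal_mult_left ideal_mult_right by blast
  then show ?thesis using ideal_iff[OF S] assms nonneg_delta_0 by simp
next
  case False
  then show ?thesis using positive_product assms by (simp add: positive_def mem_fully_commutative)
qed

end

theorem theorem6p16:
  fixes W :: "('w, 'b) monoid_scheme"
    and S :: "'w set"
    and m :: "'w \<Rightarrow> 'w \<Rightarrow> enat"
    and scale :: "laurent \<Rightarrow> 'h::ring_1 \<Rightarrow> 'h"
    and T :: "'w \<Rightarrow> 'h"
    and g :: "'w \<Rightarrow> 'w \<Rightarrow> 'w \<Rightarrow> laurent"
    and x y z :: 'w
  assumes hecke: "hecke_algebra W S m scale T"
    and F: "coxeter_system.property_F W S m"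
    and S: "coxeter_system.property_S W S m"
    and xy: "x \<in> carrier W" "y \<in> carrier W"
    and finite_support: "finite {z \<in> carrier W. g x y z \<noteq> 0}"
    and expansion: "hecke_algebra.KL W S scale T x * hecke_algebra.KL W S scale T y
      = (\<Sum>z | z \<in> carrier W \<and> g x y z \<noteq> 0. scale (g x y z) (hecke_algebra.KL W S scale T z))"
    and z: "z \<in> coxeter_system.fully_commutative W S"
  shows "g x y z \<in> nonneg_delta \<and> nonneg_delta \<subset> nonneg_laurent"
proof -
  interpret hecke_algebra W S m scale T by (rule hecke)
  interpret star_reducible_hecke W S m scale T by unfold_locales (use F S in auto)
  have zc: "z \<in> carrier W" using z by (simp add: mem_fully_commutative)
  \<comment> \<open>The given expansion is a finite sum over basis elements, so its coefficient at
    \<open>z\<close> can be read off.\<close>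
  have "KL.coef (KL x * KL y) z = (\<Sum>w | w \<in> carrier W \<and> g x y w \<noteq> 0. if w = z then g x y z else 0)"
    unfolding expansion KL.coef_sum KL.coef_scale
    by (rule sum.cong) (use zc in \<open>auto simp: KL.coef_basis\<close>)
  also have "\<dots> = g x y z" using finite_support zc by auto
  finally show ?thesis using coef_product[OF xy z] nonneg_delta_subset by simp
qed

end
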